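(* Let $0<d<n-1$ ($d$ not necessarily an integer), let $\Gamma\subset\mathbb R^n$ be a closed $d$-dimensional Ahlfors regular set, $\Omega=\mathbb R^n\setminus\Gamma$, and let $q\in(1,\infty)$. Let $L=-\operatorname{div}A\nabla$ be a $q$-elliptic operator on $\Omega$ (with weight $\delta^{d+1-n}$, see context). For any energy solution $u\in W$ to $Lu=0$, we have: (i) if $q\ge2$, $\displaystyle\int_\Omega|\nabla u|^2|u|^{q-2}\,dm<+\infty$; (ii) if $q\in(1,2)$, there exists a ball $B\subset\mathbb R^n$ such that $\displaystyle\int_{\Omega\setminus B}|\nabla u|^2|u|^{q-2}\,dm<+\infty$.
   Context: A closed set $\Gamma$ is $d$-Ahlfors regular if there are $C>0$ and a measure $\sigma$ on $\Gamma$ with $C^{-1}r^d\le\sigma(B(X,r))\le Cr^d$ for all $X\in\Gamma$, $r>0$. $\delta(X)=\operatorname{dist}(X,\Gamma)$, $dm=\delta^{d+1-n}dX$. $L=-\operatorname{div}A\nabla$ is elliptic (with weight $\delta^{d+1-n}$) if the measurable complex matrix $A$ satisfies, for some $C>0$, $\operatorname{Re}(A(X)\xi\cdot\bar\xi)\ge C^{-1}\delta(X)^{d+1-n}|\xi|^2$ and $|A(X)\xi\cdot\bar\zeta|\le C\delta(X)^{d+1-n}|\xi||\zeta|$ for $X\in\Omega$, $\xi,\zeta\in\mathbb C^n$. Put $\mathcal A=\delta^{n-d-1}A$. $L$ is $q$-elliptic if it is elliptic and there is $\lambda_q>0$ with $\operatorname{Re}(\mathcal A(X)\xi\cdot\overline{\mathcal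 J_q\xi})\ge\lambda_q|\xi|^2$ for a.e. $X\in\Omega$ and all $\xi\in\mathbb C^n$, where $\mathcal J_q(\alpha+i\beta)=\frac1q\alpha+\frac i{q'}\beta$ ($\alpha,\beta\in\mathbb R^n$, $\frac1q+\frac1{q'}=1$). $W=\{u\in L^1_{loc}(\Omega):\|u\|_W=(\int_\Omega|\nabla u|^2dm)^{1/2}<\infty\}$. The trace of $u\in W$ is $\operatorname{Tr}u(x)=\lim_{\epsilon\to0}\frac1{|B(x,\epsilon)|}\int_{B(x,\epsilon)}u\,dY$, which exists for $\sigma$-a.e. $x\in\Gamma$. $u$ is a weak solution to $Lu=0$ if $\int_\Omega\mathcal A\nabla u\cdot\nabla\bar\Psi\,dm=0$ for all $\Psi\in C_0^\infty(\Omega)$. An energy solution to $Lu=0$ is a weak solution $u\in W$ whose trace is smooth and compactly supported, i.e. there is $g\in C_0^\infty(\mathbb R^n)$ with $\operatorname{Tr}u=g$ $\sigma$-a.e. on $\Gamma$. $|\nabla u|^2|u|^{q-2}$ is understood to be $0$ where $u=0$. *)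

theory Defs
  imports "HOL-Analysis.Analysis"
begin

text \<open>Throughout, \<open>\<Gamma>\<close> is a subset of \<open>real ^ 'n\<close>, the domain is its complement \<open>- \<Gamma>\<close>, and
  \<open>d\<close> is a real number. Functions on the domain are total functions; their values on
  \<open>\<Gamma>\<close> are irrelevant.\<close>

text \<open>Nonemptiness has to be required: otherwise the empty set would qualify, and there
  \<open>infdist _ {} = 0\<close>. The measure lives on the space \<open>\<Gamma>\<close>.\<close>

definition ahlfors_regular_measure ::
    "real \<Rightarrow> (real ^ 'n::finite) set \<Rightarrow> (real ^ 'n) measure \<Rightarrow> bool" where
  "ahlfors_regular_measure d \<Gamma> \<sigma> \<longleftrightarrow>
     closed \<Gamma> \<and> \<Gamma> \<noteq> {} \<and> sets \<sigma> = sets (restrict_space borel \<Gamma>) \<and>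
     (\<exists>C>0. \<forall>X\<in>\<Gamma>. \<forall>r>0.
        ennreal (r powr d / C) \<le> emeasure \<sigma> (\<Gamma> \<inter> ball X r) \<and>
        emeasure \<sigma> (\<Gamma> \<inter> ball X r) \<le> ennreal (C * r powr d))"

definition weight :: "real \<Rightarrow> (real ^ 'n::finite) set \<Rightarrow> real ^ 'n \<Rightarrow> real" where
  "weight d \<Gamma> X = infdist X \<Gamma> powr (d + 1 - real CARD('n))"

definition weighted_measure :: "real \<Rightarrow> (real ^ 'n::finite) set \<Rightarrow> (real ^ 'n) measure" where
  "weighted_measure d \<Gamma> = density (lebesgue_on (- \<Gamma>)) (\<lambda>X. ennreal (weight d \<Gamma> X))"

text \<open>The dot product on \<open>complex ^ 'n\<close> is bilinear; conjugates are always written out.\<close>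

definition cdot :: "complex ^ 'n::finite \<Rightarrow> complex ^ 'n \<Rightarrow> complex" where
  "cdot \<xi> \<zeta> = (\<Sum>i\<in>UNIV. \<xi> $ i * \<zeta> $ i)"

definition vec_cnj :: "complex ^ 'n::finite \<Rightarrow> complex ^ 'n" where
  "vec_cnj \<xi> = (\<chi> i. cnj (\<xi> $ i))"

definition elliptic ::
    "real \<Rightarrow> (real ^ 'n::finite) set \<Rightarrow> (real ^ 'n \<Rightarrow> complex ^ 'n ^ 'n) \<Rightarrow> bool" where
  "elliptic d \<Gamma> A \<longleftrightarrow>
     A \<in> borel_measurable (lebesgue_on (- \<Gamma>)) \<and>
     (\<exists>C>0. \<forall>X\<in>- \<Gamma>. \<forall>\<xi> \<zeta>.
        Re (cdot (A X *v \<xi>) (vec_cnj \<xi>)) \<ge> weight d \<Gamma> X * (norm \<xi>)\<^sup>2 / C \<and>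
        cmod (cdot (A X *v \<xi>) (vec_cnj \<zeta>)) \<le> C * weight d \<Gamma> X * norm \<xi> * norm \<zeta>)"

definition normalized_matrix ::
    "real \<Rightarrow> (real ^ 'n::finite) set \<Rightarrow> (real ^ 'n \<Rightarrow> complex ^ 'n ^ 'n) \<Rightarrow>
     real ^ 'n \<Rightarrow> complex ^ 'n ^ 'n" where
  "normalized_matrix d \<Gamma> A X = (infdist X \<Gamma> powr (real CARD('n) - d - 1)) *\<^sub>R A X"

text \<open>The factor \<open>1 - 1 / q\<close> is the reciprocal of the exponent conjugate to \<open>q\<close>.\<close>

definition J_map :: "real \<Rightarrow> complex ^ 'n::finite \<Rightarrow> complex ^ 'n" where
  "J_map q \<xi> = (\<chi> i. Complex ((1 / q) * Re (\<xi> $ i)) ((1 - 1 / q) * Im (\<xi> $ i)))"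

definition q_elliptic ::
    "real \<Rightarrow> real \<Rightarrow> (real ^ 'n::finite) set \<Rightarrow> (real ^ 'n \<Rightarrow> complex ^ 'n ^ 'n) \<Rightarrow> bool" where
  "q_elliptic q d \<Gamma> A \<longleftrightarrow>
     elliptic d \<Gamma> A \<and>
     (\<exists>c>0. AE X in lebesgue_on (- \<Gamma>). \<forall>\<xi>.
        Re (cdot (normalized_matrix d \<Gamma> A X *v \<xi>) (vec_cnj (J_map q \<xi>))) \<ge> c * (norm \<xi>)\<^sup>2)"

primrec k_times_cont_diff ::
    "nat \<Rightarrow> ('a::real_normed_vector \<Rightarrow> 'b::real_normed_vector) \<Rightarrow> bool" where
  "k_times_cont_diff 0 f \<longleftrightarrow> continuous_on UNIV f"
| "k_times_cont_diff (Suc k) f \<longleftrightarrow>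
     (\<forall>x. f differentiable (at x)) \<and>
     (\<forall>v. k_times_cont_diff k (\<lambda>x. frechet_derivative f (at x) v))"

definition smooth_fun :: "('a::real_normed_vector \<Rightarrow> 'b::real_normed_vector) \<Rightarrow> bool" where
  "smooth_fun f \<longleftrightarrow> (\<forall>k. k_times_cont_diff k f)"

definition test_functions :: "(real ^ 'n::finite) set \<Rightarrow> (real ^ 'n \<Rightarrow> complex) set" where
  "test_functions U =
     {\<phi>. smooth_fun \<phi> \<and> compact (closure {X. \<phi> X \<noteq> 0}) \<and> closure {X. \<phi> X \<noteq> 0} \<subseteq> U}"

definition classical_grad :: "(real ^ 'n::finite \<Rightarrow> complex) \<Rightarrow> real ^ 'n \<Rightarrow> complex ^ 'n" where
  "classical_grad \<phi> X = (\<chi> i. frechet_derivative \<phi> (at X) (axis i 1))"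

definition locally_integrable ::
    "(real ^ 'n::finite) set \<Rightarrow> (real ^ 'n \<Rightarrow> 'b::{banach, second_countable_topology}) \<Rightarrow> bool" where
  "locally_integrable U f \<longleftrightarrow> (\<forall>K. compact K \<and> K \<subseteq> U \<longrightarrow> set_integrable lebesgue K f)"

definition has_weak_grad ::
    "(real ^ 'n::finite) set \<Rightarrow> (real ^ 'n \<Rightarrow> complex) \<Rightarrow> (real ^ 'n \<Rightarrow> complex ^ 'n) \<Rightarrow> bool" where
  "has_weak_grad U u G \<longleftrightarrow>
     locally_integrable U G \<and>
     (\<forall>\<phi>\<in>test_functions U. \<forall>i.
        (LINT X:U|lebesgue. u X * classical_grad \<phi> X $ i) =
        - (LINT X:U|lebesgue. G X $ i * \<phi> X))"

text \<open>Weak gradients are unique only up to null sets; a representative is chosen.\<close>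

definition weak_grad ::
    "(real ^ 'n::finite) set \<Rightarrow> (real ^ 'n \<Rightarrow> complex) \<Rightarrow> real ^ 'n \<Rightarrow> complex ^ 'n" where
  "weak_grad U u = (SOME G. has_weak_grad U u G)"

definition W_space :: "real \<Rightarrow> (real ^ 'n::finite) set \<Rightarrow> (real ^ 'n \<Rightarrow> complex) set" where
  "W_space d \<Gamma> =
     {u. locally_integrable (- \<Gamma>) u \<and> (\<exists>G. has_weak_grad (- \<Gamma>) u G) \<and>
         (\<integral>\<^sup>+X. ennreal ((norm (weak_grad (- \<Gamma>) u X))\<^sup>2) \<partial>weighted_measure d \<Gamma>) < \<infinity>}"

text \<open>The average is over the full ball; since \<open>u\<close> is only given on \<open>- \<Gamma>\<close> and the sets \<open>\<Gamma>\<close>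
  considered are Lebesgue null, \<open>\<Gamma>\<close> is removed from the domain of integration.\<close>

definition has_trace ::
    "(real ^ 'n::finite) set \<Rightarrow> (real ^ 'n \<Rightarrow> complex) \<Rightarrow> real ^ 'n \<Rightarrow> complex \<Rightarrow> bool" where
  "has_trace \<Gamma> u x t \<longleftrightarrow>
     ((\<lambda>\<epsilon>. (1 / measure lebesgue (ball x \<epsilon>)) *\<^sub>R (LINT Y:ball x \<epsilon> - \<Gamma>|lebesgue. u Y))
        \<longlongrightarrow> t) (at_right 0)"

definition weak_solution ::
    "real \<Rightarrow> (real ^ 'n::finite) set \<Rightarrow> (real ^ 'n \<Rightarrow> complex ^ 'n ^ 'n) \<Rightarrow>
     (real ^ 'n \<Rightarrow> complex) \<Rightarrow> bool" where
  "weak_solution d \<Gamma> A u \<longleftrightarrow>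
     (\<forall>\<Psi>\<in>test_functions (- \<Gamma>).
        (LINT X|weighted_measure d \<Gamma>.
           cdot (normalized_matrix d \<Gamma> A X *v weak_grad (- \<Gamma>) u X)
                (classical_grad (\<lambda>Y. cnj (\<Psi> Y)) X)) = 0)"

definition energy_solution ::
    "real \<Rightarrow> (real ^ 'n::finite) set \<Rightarrow> (real ^ 'n) measure \<Rightarrow>
     (real ^ 'n \<Rightarrow> complex ^ 'n ^ 'n) \<Rightarrow> (real ^ 'n \<Rightarrow> complex) \<Rightarrow> bool" where
  "energy_solution d \<Gamma> \<sigma> A u \<longleftrightarrow>
     u \<in> W_space d \<Gamma> \<and> weak_solution d \<Gamma> A u \<and>
     (\<exists>g\<in>test_functions UNIV. AE x in \<sigma>. has_trace \<Gamma> u x (g x))"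

definition q_energy_density ::
    "real \<Rightarrow> (real ^ 'n::finite) set \<Rightarrow> (real ^ 'n \<Rightarrow> complex) \<Rightarrow> real ^ 'n \<Rightarrow> real" where
  "q_energy_density q \<Gamma> u X =
     (if u X = 0 then 0 else (norm (weak_grad (- \<Gamma>) u X))\<^sup>2 * cmod (u X) powr (q - 2))"

end

theory Submission
  imports Defs
begin

text \<open>The equation is tested with \<open>\<eta> \<chi> (P u - P g)\<close>, where \<open>g\<close> is the boundary datum and
  \<open>P z = ((k + |z|\<^sup>2) / (1 + k |z|\<^sup>2)) powr ((q - 2) / 2) cnj z\<close> with \<open>0 < k \<le> 1\<close> is a Lipschitz
  regularisation of \<open>|z|\<^bsup>q - 2\<^esup> cnj z\<close>. Interpolating between ellipticity and \<open>q\<close>-ellipticity, the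
  real part of \<open>\<A> \<nabla>u \<cdot> \<nabla>(P u)\<close> dominates \<open>|\<nabla>u|\<^sup>2\<close> times the regularised weight, uniformly in \<open>k\<close>.
  The cutoff \<open>\<chi>\<close> vanishes near \<open>\<Gamma>\<close> and near infinity. Its contribution tends to zero by the Hardy
  inequality \<open>\<integral>\<^bsub>\<delta> < R\<^esub> |u - g|\<^sup>2 dm \<le> K R\<^sup>2\<close>, which holds because \<open>u - g\<close> has zero trace: averages over
  balls centred on \<open>\<Gamma>\<close> are telescoped over geometrically decreasing radii, and each difference is
  controlled by the Poincare inequality. For \<open>q \<ge> 2\<close> take \<open>\<eta> = 1\<close>; for \<open>q < 2\<close> the derivative of \<open>P\<close>
  at \<open>g\<close> is not bounded uniformly in \<open>k\<close>, so \<open>\<eta>\<close> vanishes near the support of \<open>g\<close>, which is why a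
  ball has to be removed. Finally \<open>k \<rightarrow> 0\<close> by Fatou's lemma.\<close>


section \<open>Smooth functions and mollifiers\<close>

text \<open>Two obstacles shape the proof. First, \<open>u\<close> need not be bounded or bounded
  away from 0, so \<open>|u| powr (q - 2) * cnj u\<close> is not an admissible test function. For
  fixed \<open>k\<close> the regularised weight lies between two positive constants, which makes
  \<open>P\<close> globally Lipschitz; and \<open>s\<close> times its logarithmic derivative is
  \<open>(q - 2) / 2\<close> times a number in \<open>{0..1}\<close>. After rotation by the phase of
  \<open>u\<close> this number is the interpolation parameter between ellipticity and q-ellipticity,
  so coercivity does not degrade as \<open>k\<close> tends to 0. Second, elements of
  \<open>W_space\<close> live off \<Gamma>, while the Poincare inequality is wanted on balls centred
  on \<Gamma>. Because \<open>d < n - 1\<close>, the \<epsilon>-neighbourhood of \<Gamma> has volume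
  o(\<epsilon>) locally, so bounded functions extend across \<Gamma> with their gradient; arctangent
  truncations carry this over to unbounded ones. The Hardy bound is used at two scales, near
  \<Gamma> and near infinity: with cutoffs centred at a point of \<Gamma>, distances to \<Gamma> in
  the outer annulus are again of the order of its radius. The factors \<open>1 / \<epsilon>\<close>
  and \<open>1 / R\<close> cancel, and what remains is the energy of the flux on sets shrinking to
  nothing.\<close>

lemma k_times_cont_diff_SucI:
  assumes "\<And>x. (f has_derivative f' x) (at x)"
    and "\<And>v. k_times_cont_diff k (\<lambda>x. f' x v)"
  shows "k_times_cont_diff (Suc k) f"
proof -
  have "frechet_derivative f (at x) = f' x" for x
    using frechet_derivative_at[OF assms(1)] by simp
  then show ?thesis
    using assms by (auto simp: differentiable_def)
qed

lemma k_times_cont_diff_SucD: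
  assumes "k_times_cont_diff (Suc k) f"
  shows "(f has_derivative frechet_derivative f (at x)) (at x)"
    and "k_times_cont_diff k (\<lambda>x. frechet_derivative f (at x) v)"
  using assms by (auto simp: frechet_derivative_works)

lemma k_times_cont_diff_Suc_imp: "k_times_cont_diff (Suc k) f \<Longrightarrow> k_times_cont_diff k f"
proof (induction k arbitrary: f)
  case 0
  then show ?case
    by (auto intro!: continuous_at_imp_continuous_on differentiable_imp_continuous_within)
next
  case (Suc k)
  show ?case
    by (rule k_times_cont_diff_SucI[OF k_times_cont_diff_SucD(1)[OF Suc.prems]
          Suc.IH[OF k_times_cont_diff_SucD(2)[OF Suc.prems]]])
qed

lemma k_times_cont_diff_const: "k_times_cont_diff k (\<lambda>x. c)"
proof (induction k arbitrary: c)
  case (Suc k)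
  show ?case
    by (rule k_times_cont_diff_SucI[where f' = "\<lambda>x v. 0"]) (auto intro: Suc)
qed simp

lemma k_times_cont_diff_bounded_linear:
  assumes "bounded_linear f"
  shows "k_times_cont_diff k f"
proof (cases k)
  case 0
  then show ?thesis
    using assms by (simp add: linear_continuous_on)
next
  case (Suc j)
  then show ?thesis
    using k_times_cont_diff_SucI[where f' = "\<lambda>x v. f v"] k_times_cont_diff_const
      bounded_linear.has_derivative[OF assms has_derivative_ident] by blast
qed

lemma k_times_cont_diff_compose_linear:
  assumes "bounded_linear T" "k_times_cont_diff k f"
  shows "k_times_cont_diff k (\<lambda>x. T (f x))"
  using assms(2)
proof (induction k arbitrary: f)
  case 0
  then show ?case
    using bounded_linear.continuous_on[OF assms(1)] by auto
next
  case (Suc k)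
  show ?case
  proof (rule k_times_cont_diff_SucI)
    show "((\<lambda>x. T (f x)) has_derivative (\<lambda>v. T (frechet_derivative f (at x) v))) (at x)" for x
      by (rule bounded_linear.has_derivative[OF assms(1) k_times_cont_diff_SucD(1)[OF Suc.prems]])
    show "k_times_cont_diff k (\<lambda>x. T (frechet_derivative f (at x) v))" for v
      by (rule Suc.IH[OF k_times_cont_diff_SucD(2)[OF Suc.prems]])
  qed
qed

lemma k_times_cont_diff_add:
  assumes "k_times_cont_diff k f" "k_times_cont_diff k g"
  shows "k_times_cont_diff k (\<lambda>x. f x + g x)"
  using assms
proof (induction k arbitrary: f g)
  case 0
  then show ?case
    by (auto intro: continuous_intros)
next
  case (Suc k)
  show ?case
  proof (rule k_times_cont_diff_SucI)
    show "((\<lambda>x. f x + g x) has_derivative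
        (\<lambda>v. frechet_derivative f (at x) v + frechet_derivative g (at x) v)) (at x)" for x
      by (rule has_derivative_add[OF Suc.prems[THEN k_times_cont_diff_SucD(1)]])
    show "k_times_cont_diff k (\<lambda>x. frechet_derivative f (at x) v + frechet_derivative g (at x) v)" for v
      by (rule Suc.IH[OF Suc.prems[THEN k_times_cont_diff_SucD(2)]])
  qed
qed

text \<open>The product rule gives two bilinear terms, each pairing a derivative with an
  undifferentiated factor; lowering the latter from order \<open>Suc k\<close> to \<open>k\<close>
  makes the induction hypothesis apply to both.\<close>

lemma k_times_cont_diff_bilinear:
  assumes B: "bounded_bilinear B" and "k_times_cont_diff k f" "k_times_cont_diff k g"
  shows "k_times_cont_diff k (\<lambda>x. B (f x) (g x))"
  using assms(2,3)
proof (induction k arbitrary: f g)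
  case 0
  then show ?case
    using bounded_bilinear.continuous_on[OF B] by auto
next
  case (Suc k)
  show ?case
  proof (rule k_times_cont_diff_SucI)
    show "((\<lambda>x. B (f x) (g x)) has_derivative
        (\<lambda>v. B (f x) (frechet_derivative g (at x) v) + B (frechet_derivative f (at x) v) (g x))) (at x)" for x
      by (rule bounded_bilinear.FDERIV[OF B Suc.prems[THEN k_times_cont_diff_SucD(1)]])
    have f': "k_times_cont_diff k (\<lambda>x. frechet_derivative f (at x) v)"
      and g': "k_times_cont_diff k (\<lambda>x. frechet_derivative g (at x) v)" for v
      by (rule Suc.prems[THEN k_times_cont_diff_SucD(2)])+
    show "k_times_cont_diff k
        (\<lambda>x. B (f x) (frechet_derivative g (at x) v) + B (frechet_derivative f (at x) v) (g x))" for v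
      by (rule k_times_cont_diff_add[OF
            Suc.IH[OF Suc.prems(1)[THEN k_times_cont_diff_Suc_imp] g']
            Suc.IH[OF f' Suc.prems(2)[THEN k_times_cont_diff_Suc_imp]]])
  qed
qed

lemma k_times_cont_diff_shift:
  assumes "k_times_cont_diff k f"
  shows "k_times_cont_diff k (\<lambda>y. f (y - x))"
  using assms
proof (induction k arbitrary: f)
  case 0
  then show ?case
    by (auto intro!: continuous_on_compose2[of UNIV f] continuous_intros)
next
  case (Suc k)
  have "((\<lambda>y. f (y - x)) has_derivative frechet_derivative f (at (y - x))) (at y)" for y
  proof -
    have "((\<lambda>y. y - x) has_derivative (\<lambda>v. v)) (at y)"
      by (auto intro!: derivative_eq_intros)
    from has_derivative_compose[OF this k_times_cont_diff_SucD(1)[OF Suc.prems]]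
    show ?thesis by simp
  qed
  then show ?case
    by (rule k_times_cont_diff_SucI) (rule Suc.IH[OF k_times_cont_diff_SucD(2)[OF Suc.prems]])
qed

lemma smooth_fun_has_derivative:
  "smooth_fun f \<Longrightarrow> (f has_derivative frechet_derivative f (at x)) (at x)"
  unfolding smooth_fun_def using k_times_cont_diff_SucD(1) by blast

lemma smooth_fun_continuous_derivative:
  "smooth_fun f \<Longrightarrow> continuous_on UNIV (\<lambda>x. frechet_derivative f (at x) v)"
  unfolding smooth_fun_def by (metis k_times_cont_diff.simps)

lemma smooth_fun_continuous: "smooth_fun f \<Longrightarrow> continuous_on UNIV f"
  unfolding smooth_fun_def by (metis k_times_cont_diff.simps(1))

lemma smooth_fun_mult:
  fixes f g :: "'a::real_normed_vector \<Rightarrow> 'b::real_normed_algebra"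
  shows "smooth_fun f \<Longrightarrow> smooth_fun g \<Longrightarrow> smooth_fun (\<lambda>x. f x * g x)"
  unfolding smooth_fun_def using k_times_cont_diff_bilinear[OF bounded_bilinear_mult] by blast

lemma smooth_fun_add: "smooth_fun f \<Longrightarrow> smooth_fun g \<Longrightarrow> smooth_fun (\<lambda>x. f x + g x)"
  unfolding smooth_fun_def using k_times_cont_diff_add by blast

lemma smooth_fun_compose_linear:
  "bounded_linear T \<Longrightarrow> smooth_fun f \<Longrightarrow> smooth_fun (\<lambda>x. T (f x))"
  unfolding smooth_fun_def using k_times_cont_diff_compose_linear by blast

lemma smooth_fun_of_real:
  "smooth_fun f \<Longrightarrow> smooth_fun (\<lambda>x. complex_of_real (f x))"
  by (rule smooth_fun_compose_linear[OF bounded_linear_of_real])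

lemma smooth_fun_const: "smooth_fun (\<lambda>x. c)"
  unfolding smooth_fun_def using k_times_cont_diff_const by blast

section \<open>The flat function, the bump function and mollifiers\<close>

definition flat :: "nat \<Rightarrow> real \<Rightarrow> real" where
  "flat m t = (if t > 0 then (1 / t) ^ m * exp (- (1 / t)) else 0)"

lemma flat_nonneg: "0 \<le> flat m t"
  by (auto simp: flat_def)

lemma flat_0_mono: "0 < a \<Longrightarrow> a \<le> b \<Longrightarrow> flat 0 a \<le> flat 0 b"
  by (simp add: flat_def frac_le)

lemma tendsto_flat_0: "(flat m \<longlongrightarrow> 0) (at 0)"
proof -
  have "((\<lambda>t::real. (1 / t) ^ m / exp (1 / t)) \<longlongrightarrow> 0) (at_right 0)"
    using filterlim_compose[OF tendsto_power_div_exp_0[of m] filterlim_inverse_at_top_right]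
    by (simp add: inverse_eq_divide)
  then have "(flat m \<longlongrightarrow> 0) (at_right 0)"
    by (rule Lim_transform_eventually)
      (auto simp: flat_def eventually_at_right_field exp_minus field_simps intro!: exI[of _ 1])
  moreover have "(flat m \<longlongrightarrow> 0) (at_left 0)"
    by (rule tendsto_eventually) (auto simp: flat_def eventually_at_left_field intro!: exI[of _ "-1"])
  ultimately show ?thesis
    by (simp add: filterlim_split_at_real)
qed

text \<open>The power of \<open>1 / t\<close> in \<open>flat\<close> is carried along because it
  closes the family under differentiation.\<close>

lemma DERIV_flat:
  "(flat m has_real_derivative (flat (m + 2) t - of_nat m * flat (m + 1) t)) (at t)"
proof -
  consider "t > 0" | "t < 0" | "t = 0" by linarith
  then show ?thesis
  proof cases
    case 1
    have "((\<lambda>t. (1 / t) ^ m * exp (- (1 / t))) has_real_derivative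
        ((1 / t) ^ (m + 2) * exp (- (1 / t)) - of_nat m * ((1 / t) ^ (m + 1) * exp (- (1 / t))))) (at t)"
    proof -
      have "((\<lambda>s. s ^ m * exp (- s)) has_real_derivative
          of_nat m * s ^ (m - 1) * exp (- s) - s ^ m * exp (- s)) (at s)" for s :: real
        by (auto intro!: derivative_eq_intros)
      moreover have "((\<lambda>t. 1 / t) has_real_derivative - ((1 / t)\<^sup>2)) (at t)"
        using 1 by (auto intro!: derivative_eq_intros simp: power2_eq_square)
      ultimately show ?thesis
        by (rule DERIV_cong[OF DERIV_chain2]) (cases m; simp add: power2_eq_square algebra_simps add_divide_distrib)
    qed
    then show ?thesis
      using 1 by (subst DERIV_cong_ev[OF refl _ refl, where g = "\<lambda>t. (1 / t) ^ m * exp (- (1 / t))"])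
        (auto simp: flat_def eventually_nhds intro!: exI[of _ "{0<..}"])
  next
    case 2
    then show ?thesis
      by (subst DERIV_cong_ev[OF refl _ refl, where g = "\<lambda>t. 0"])
        (auto simp: flat_def eventually_nhds intro!: exI[of _ "{..<0}"])
  next
    case 3
    \<comment> \<open>Division by \<open>h\<close> is absorbed by one more power of
      \<open>1 / h\<close>, so the difference quotient at 0 is itself a member of the family and
      tends to 0.\<close>
    have "(flat m (0 + h) - flat m 0) / h = flat (m + 1) h" for h
      by (auto simp: flat_def)
    then show ?thesis
      using tendsto_flat_0[of "m + 1"] by (simp add: DERIV_def 3 flat_def[of _ 0])
  qed
qed

text \<open>From \<open>exp x \<ge> x^2 / 2\<close>. The derivative of \<open>bump\<close> contains
  \<open>flat 2\<close>, so this bounds its gradient.\<close>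

lemma flat_2_le: "flat 2 t \<le> 2"
proof (cases "t > 0")
  case True
  have "(1 / t)\<^sup>2 / 2 \<le> exp (1 / t)"
    using exp_lower_Taylor_quadratic[of "1 / t"] True
    by (smt (verit) divide_pos_pos zero_less_one)
  then show ?thesis
    using True by (simp add: flat_def exp_minus field_simps)
qed (simp add: flat_def)

definition bump :: "'a::euclidean_space \<Rightarrow> real" where
  "bump x = flat 0 (1 - x \<bullet> x)"

text \<open>Proved for all \<open>m\<close> at once: differentiating \<open>flat m\<close> yields
  \<open>flat (m + 1)\<close> and \<open>flat (m + 2)\<close>, so the induction on \<open>k\<close>
  must range over the whole family. The polynomial \<open>x \<bullet> x\<close> is used instead of
  the norm, which is not smooth at 0.\<close>

lemma smooth_flat_ball:
  "k_times_cont_diff k (\<lambda>x::'a::euclidean_space. flat m (1 - x \<bullet> x))"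
proof (induction k arbitrary: m)
  case 0
  have "continuous_on UNIV (flat m)"
    using DERIV_flat by (blast intro: continuous_at_imp_continuous_on DERIV_isCont)
  then show ?case
    by (auto intro!: continuous_on_compose2[of UNIV "flat m"] continuous_intros)
next
  case (Suc k)
  let ?f' = "\<lambda>(x::'a) v. (flat (m + 2) (1 - x \<bullet> x) + (- of_nat m) *\<^sub>R flat (m + 1) (1 - x \<bullet> x)) *\<^sub>R (- 2 * (x \<bullet> v))"
  show ?case
  proof (rule k_times_cont_diff_SucI[where f' = ?f'])
    fix x :: 'a
    have "((\<lambda>x. 1 - x \<bullet> x) has_derivative (\<lambda>v. - 2 * (x \<bullet> v))) (at x)"
      by (auto intro!: derivative_eq_intros simp: inner_commute)
    from has_derivative_compose[OF this DERIV_flat[unfolded has_field_derivative_def]]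
    show "((\<lambda>x. flat m (1 - x \<bullet> x)) has_derivative ?f' x) (at x)"
      by (simp add: algebra_simps)
  next
    fix v :: 'a
    show "k_times_cont_diff k (\<lambda>x. ?f' x v)"
    proof (rule k_times_cont_diff_bilinear[OF bounded_bilinear_scaleR])
      show "k_times_cont_diff k (\<lambda>x::'a. flat (m + 2) (1 - x \<bullet> x) + (- of_nat m) *\<^sub>R flat (m + 1) (1 - x \<bullet> x))"
        by (rule k_times_cont_diff_add[OF Suc k_times_cont_diff_compose_linear[OF bounded_linear_scaleR_right Suc]])
      have "bounded_linear (\<lambda>x::'a. - 2 * (x \<bullet> v))"
        by (rule bounded_linear_const_mult[OF bounded_linear_inner_left])
      then show "k_times_cont_diff k (\<lambda>x::'a. - 2 * (x \<bullet> v))"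
        by (rule k_times_cont_diff_bounded_linear)
    qed
  qed
qed

lemma bump_has_derivative:
  "(bump has_derivative (\<lambda>v. - 2 * flat 2 (1 - x \<bullet> x) * (x \<bullet> v))) (at (x::'a::euclidean_space))"
proof -
  have "((\<lambda>x. 1 - x \<bullet> x) has_derivative (\<lambda>v. - 2 * (x \<bullet> v))) (at x)"
    by (auto intro!: derivative_eq_intros simp: inner_commute)
  from has_derivative_compose[OF this DERIV_flat[of 0, unfolded has_field_derivative_def]]
  show ?thesis
    by (simp add: bump_def[abs_def] algebra_simps numeral_2_eq_2)
qed

lemma bump_eq_0: "1 \<le> norm x \<Longrightarrow> bump x = 0"
  using one_le_power[of "norm x" 2] by (simp add: bump_def flat_def dot_square_norm del: one_le_power)

text \<open>The type argument fixes the dimension, which \<open>r\<close> alone does not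
  determine.\<close>

definition moll_mass :: "'a::euclidean_space itself \<Rightarrow> real \<Rightarrow> real" where
  "moll_mass _ r = (LINT y|lborel. bump ((1 / r) *\<^sub>R (y::'a)))"

definition moll :: "real \<Rightarrow> 'a::euclidean_space \<Rightarrow> real" where
  "moll r x = bump ((1 / r) *\<^sub>R x) / moll_mass TYPE('a) r"

lemma continuous_bump: "continuous_on S (bump :: 'a::euclidean_space \<Rightarrow> real)"
proof (rule continuous_at_imp_continuous_on, rule ballI)
  show "isCont bump x" for x :: 'a
    by (rule has_derivative_continuous[OF bump_has_derivative])
qed

lemma integrable_continuous_cball:
  fixes f :: "'a::euclidean_space \<Rightarrow> 'b::{banach, second_countable_topology}"
  assumes "continuous_on UNIV f" and "\<And>x. norm x > R \<Longrightarrow> f x = 0"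
  shows "integrable lborel f"
proof -
  have "integrable lborel (\<lambda>x. indicator (cball 0 R) x *\<^sub>R f x)"
    by (rule borel_integrable_compact) (auto intro: continuous_on_subset[OF assms(1)])
  also have "(\<lambda>x. indicator (cball 0 R) x *\<^sub>R f x) = f"
    using assms(2) by (fastforce simp: indicator_def)
  finally show ?thesis .
qed

lemma bump_scaled:
  assumes "r > 0"
  shows "integrable lborel (\<lambda>x::'a::euclidean_space. bump ((1 / r) *\<^sub>R x))"
    and "continuous_on UNIV (\<lambda>x::'a::euclidean_space. bump ((1 / r) *\<^sub>R x))"
    and "norm (x::'a) \<ge> r \<Longrightarrow> bump ((1 / r) *\<^sub>R x) = 0"
proof -
  show c: "continuous_on UNIV (\<lambda>x::'a. bump ((1 / r) *\<^sub>R x))"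
    by (rule continuous_on_compose2[OF continuous_bump]) (auto intro!: continuous_intros)
  show z: "norm (x::'a) \<ge> r \<Longrightarrow> bump ((1 / r) *\<^sub>R x) = 0" for x
    using assms by (intro bump_eq_0) (simp add: field_simps)
  show "integrable lborel (\<lambda>x::'a::euclidean_space. bump ((1 / r) *\<^sub>R x))"
    by (rule integrable_continuous_cball[OF c, of r]) (use z in auto)
qed

lemma emeasure_bounded_less_top: "bounded A \<Longrightarrow> emeasure lborel A < top"
  using emeasure_bounded_finite by simp

text \<open>On the ball of radius \<open>r / 2\<close> the argument of \<open>flat 0\<close> is at
  least \<open>3 / 4\<close>. The exact order \<open>r ^ DIM('a)\<close> matters: it cancels the
  volume of the support in the L1 bound for the derivative of the mollifier.\<close>

lemma moll_mass_ge:
  "\<exists>c>0. \<forall>r>0. c * r ^ DIM('a) \<le> moll_mass TYPE('a::euclidean_space) r"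
proof -
  define c where "c = flat 0 (3/4) * unit_ball_vol (DIM('a)) * (1/2) ^ DIM('a)"
  have "c > 0"
    by (auto simp: c_def flat_def)
  moreover have "c * r ^ DIM('a) \<le> moll_mass TYPE('a) r" if r: "r > 0" for r
  proof -
    have bd: "flat 0 (3/4) \<le> bump ((1 / r) *\<^sub>R x)" if "x \<in> ball 0 (r/2)" for x :: 'a
    proof -
      have "norm ((1 / r) *\<^sub>R x) \<le> 1/2"
        using that r by (simp add: field_simps)
      then have "norm ((1 / r) *\<^sub>R x) ^ 2 \<le> (1/2)\<^sup>2"
        by (intro power_mono) auto
      then have "3/4 \<le> 1 - ((1 / r) *\<^sub>R x) \<bullet> ((1 / r) *\<^sub>R x)"
        by (simp only: dot_square_norm) (simp add: power2_eq_square)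
      then show ?thesis
        unfolding bump_def by (intro flat_0_mono) auto
    qed
    have "c * r ^ DIM('a) = (LINT x|lborel. indicat_real (ball 0 (r/2)) (x::'a) * flat 0 (3/4))"
      using r by (simp add: c_def content_ball power_divide)
    also have "\<dots> \<le> moll_mass TYPE('a) r"
      unfolding moll_mass_def
    proof (rule integral_mono)
      show "integrable lborel (\<lambda>x::'a. indicat_real (ball 0 (r/2)) x * flat 0 (3/4))"
        by (intro integrable_mult_left integrable_real_indicator) (auto simp: emeasure_bounded_less_top)
    qed (use bd bump_scaled(1)[OF r] in \<open>auto simp: indicator_def flat_nonneg bump_def\<close>)
    finally show ?thesis .
  qed
  ultimately show ?thesis by blast
qed

lemma moll_mass_pos: "r > 0 \<Longrightarrow> moll_mass TYPE('a::euclidean_space) r > 0"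
  using moll_mass_ge[where ?'a = 'a] by (meson less_le_trans mult_pos_pos zero_less_power)

lemma moll_nonneg: "r > 0 \<Longrightarrow> 0 \<le> moll r (x::'a::euclidean_space)"
  using moll_mass_pos[of r, where ?'a = 'a] by (simp add: moll_def bump_def flat_nonneg less_imp_le)

lemma moll_eq_0: "r > 0 \<Longrightarrow> r \<le> norm x \<Longrightarrow> moll r x = 0"
  by (simp add: moll_def bump_scaled(3))

lemma moll_minus: "moll r (- x) = moll r x"
  by (simp add: moll_def bump_def)

lemma integrable_moll: "r > 0 \<Longrightarrow> integrable lborel (moll r :: 'a::euclidean_space \<Rightarrow> real)"
  unfolding moll_def[abs_def] by (intro integrable_divide bump_scaled(1))

lemma integral_moll: "r > 0 \<Longrightarrow> (LINT x|lborel. moll r (x::'a::euclidean_space)) = 1"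
  using moll_mass_pos[of r, where ?'a = 'a] by (simp add: moll_def[abs_def] moll_mass_def)

lemma smooth_moll: "r > 0 \<Longrightarrow> smooth_fun (moll r :: 'a::euclidean_space \<Rightarrow> real)"
proof -
  have scaled: "k_times_cont_diff k (\<lambda>x::'a. f (c *\<^sub>R x))"
    if "k_times_cont_diff k f" for k f and c :: real
    using that
  proof (induction k arbitrary: f)
    case 0
    then show ?case
      by (auto intro!: continuous_on_compose2[of UNIV f] continuous_intros)
  next
    case (Suc k)
    show ?case
    proof (rule k_times_cont_diff_SucI[where f' = "\<lambda>x v. frechet_derivative f (at (c *\<^sub>R x)) (c *\<^sub>R v)"])
      fix x
      show "((\<lambda>x. f (c *\<^sub>R x)) has_derivative (\<lambda>v. frechet_derivative f (at (c *\<^sub>R x)) (c *\<^sub>R v))) (at x)"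
        using k_times_cont_diff_SucD(1)[OF Suc.prems]
        by (intro has_derivative_compose[of "\<lambda>x. c *\<^sub>R x" "\<lambda>v. c *\<^sub>R v" x UNIV f]) (auto intro!: derivative_eq_intros)
    qed (use Suc.IH[OF k_times_cont_diff_SucD(2)[OF Suc.prems]] in blast)
  qed
  show ?thesis
    unfolding smooth_fun_def
  proof
    fix k
    have "k_times_cont_diff k (bump :: 'a \<Rightarrow> real)"
      using smooth_flat_ball[of k 0] by (simp add: bump_def[abs_def])
    then have "k_times_cont_diff k (\<lambda>x::'a. (1 / moll_mass TYPE('a) r) *\<^sub>R bump ((1 / r) *\<^sub>R x))"
      by (intro k_times_cont_diff_compose_linear[OF bounded_linear_scaleR_right] scaled)
    then show "k_times_cont_diff k (moll r :: 'a \<Rightarrow> real)"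
      by (simp add: moll_def[abs_def])
  qed
qed

text \<open>Pointwise the derivative is at most \<open>4 * norm v / r\<close> divided by the mass,
  where one factor 2 comes from differentiating \<open>x \<bullet> x\<close> and the other from
  \<open>flat_2_le\<close>. The support has volume of order \<open>r ^ DIM('a)\<close>, and the mass
  is at least of the same order.\<close>

lemma moll_derivative_bound:
  "\<exists>C>0. \<forall>r>0. \<forall>v. (LINT x|lborel. \<bar>frechet_derivative (moll r) (at x) v\<bar>)
     \<le> C / r * norm (v::'a::euclidean_space)"
proof -
  obtain c where c: "c > 0" "\<And>r. r > 0 \<Longrightarrow> c * r ^ DIM('a) \<le> moll_mass TYPE('a) r"
    using moll_mass_ge[where ?'a = 'a] by blast
  define C where "C = 4 * unit_ball_vol (DIM('a)) / c"
  have "C > 0" using c by (simp add: C_def)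
  moreover have "(LINT x|lborel. \<bar>frechet_derivative (moll r) (at x) v\<bar>) \<le> C / r * norm v"
    if r: "r > 0" for r and v :: 'a
  proof -
    define M where "M = moll_mass TYPE('a) r"
    have M: "M > 0" "c * r ^ DIM('a) \<le> M"
      using moll_mass_pos[OF r] c(2)[OF r] by (auto simp: M_def)
    have D: "frechet_derivative (moll r) (at x) v
        = - 2 * flat 2 (1 - (x \<bullet> x) / r\<^sup>2) * (x \<bullet> v) / r\<^sup>2 / M" for x
    proof -
      have "((\<lambda>x. bump ((1 / r) *\<^sub>R x) / M) has_derivative
         (\<lambda>v. (- 2 * flat 2 (1 - ((1 / r) *\<^sub>R x) \<bullet> ((1 / r) *\<^sub>R x)) * (((1 / r) *\<^sub>R x) \<bullet> ((1 / r) *\<^sub>R v))) / M)) (at x)"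
        by (intro bounded_linear.has_derivative[OF bounded_linear_divide]
            has_derivative_compose[of "\<lambda>x. (1 / r) *\<^sub>R x" "\<lambda>v. (1 / r) *\<^sub>R v" x UNIV bump] bump_has_derivative)
          (auto intro!: derivative_eq_intros)
      from frechet_derivative_at[OF this] show ?thesis
        by (simp add: moll_def[abs_def] M_def power2_eq_square fun_eq_iff)
    qed
    have bd: "\<bar>frechet_derivative (moll r) (at x) v\<bar> \<le> indicat_real (ball 0 r) x * (4 * norm v / r / M)" for x
    proof (cases "norm x < r")
      case True
      have "\<bar>x \<bullet> v\<bar> \<le> r * norm v"
        using True by (smt (verit) Cauchy_Schwarz_ineq2 mult_right_mono norm_ge_zero)
      then have "flat 2 (1 - (x \<bullet> x) / r\<^sup>2) * \<bar>x \<bullet> v\<bar> \<le> 2 * (r * norm v)"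
        by (intro mult_mono flat_2_le) auto
      then have "2 * (flat 2 (1 - (x \<bullet> x) / r\<^sup>2) * \<bar>x \<bullet> v\<bar>) / r\<^sup>2 / M \<le> 2 * (2 * (r * norm v)) / r\<^sup>2 / M"
        using M r by (intro divide_right_mono mult_left_mono) auto
      then show ?thesis
        using True r M by (simp add: D abs_mult flat_nonneg power2_eq_square field_simps)
    next
      case False
      then have "r\<^sup>2 \<le> x \<bullet> x"
        using r by (simp add: power2_norm_eq_inner[symmetric] power_mono)
      then have "1 - (x \<bullet> x) / r\<^sup>2 \<le> 0"
        using r by (simp add: field_simps)
      then show ?thesis
        using False by (simp add: D flat_def)
    qed
    have "(LINT x|lborel. \<bar>frechet_derivative (moll r) (at x) v\<bar>)
        \<le> (LINT x|lborel. indicat_real (ball 0 r) (x::'a) * (4 * norm v / r / M))"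
    proof (rule integral_mono')
      show "integrable lborel (\<lambda>x::'a. indicat_real (ball 0 r) x * (4 * norm v / r / M))"
        by (intro integrable_mult_left integrable_real_indicator) (auto simp: emeasure_bounded_less_top)
    qed (use bd r M in auto)
    also have "\<dots> = unit_ball_vol (DIM('a)) * r ^ DIM('a) * (4 * norm v / r / M)"
      using r by (simp add: content_ball)
    also have "\<dots> \<le> unit_ball_vol (DIM('a)) * r ^ DIM('a) * (4 * norm v / r / (c * r ^ DIM('a)))"
      using M r c by (intro mult_left_mono divide_left_mono) auto
    also have "\<dots> = C / r * norm v"
      using r c by (simp add: C_def mult_ac)
    finally show ?thesis .
  qed
  ultimately show ?thesis by blast
qed

section \<open>Convolution, cutoff functions and convergence of mollifications\<close>

lemma lborel_shift: "distr lborel borel (\<lambda>x. x - h) = (lborel :: 'a::euclidean_space measure)"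
proof -
  have "(+) (- h) = (\<lambda>x. x - h)"
    by auto
  then show ?thesis
    using lborel_distr_plus[of "- h"] by simp
qed

lemma nn_integral_shift:
  fixes f :: "'a::euclidean_space \<Rightarrow> ennreal"
  assumes [measurable]: "f \<in> borel_measurable borel"
  shows "(\<integral>\<^sup>+x. f (x - h) \<partial>lborel) = (\<integral>\<^sup>+x. f x \<partial>lborel)"
  using nn_integral_distr[of "\<lambda>x. x - h" lborel borel f] by (simp add: lborel_shift)

lemma integrable_shift:
  fixes f :: "'a::euclidean_space \<Rightarrow> 'b::{banach, second_countable_topology}"
  assumes "integrable lborel f"
  shows "integrable lborel (\<lambda>x. f (x - h))" "(LINT x|lborel. f (x - h)) = (LINT x|lborel. f x)"
  using integrable_distr[of "\<lambda>x. x - h" lborel borel f] integral_distr[of "\<lambda>x. x - h" lborel borel f] assms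
  by (auto simp: lborel_shift)

lemma integrable_reflect:
  fixes f :: "'a::euclidean_space \<Rightarrow> 'b::{banach, second_countable_topology}"
  assumes "integrable lborel f"
  shows "integrable lborel (\<lambda>x. f (h - x))" "(LINT x|lborel. f (h - x)) = (LINT x|lborel. f x)"
proof -
  have *: "distr lborel borel (\<lambda>x. h - x) = (lborel :: 'a measure)"
    using lborel_affine[of "-1" h] by (simp add: density_1 cong: distr_cong)
  show "integrable lborel (\<lambda>x. f (h - x))" "(LINT x|lborel. f (h - x)) = (LINT x|lborel. f x)"
    using integrable_distr[of "\<lambda>x. h - x" lborel borel f] integral_distr[of "\<lambda>x. h - x" lborel borel f] assms
    by (auto simp: *)
qed

lemma bounded_continuous_cball:
  fixes f :: "'a::euclidean_space \<Rightarrow> 'b::real_normed_vector"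
  assumes "continuous_on UNIV f" "\<And>x. norm x > R \<Longrightarrow> f x = 0"
  obtains M where "M > 0" "\<And>x. norm (f x) \<le> M"
proof -
  have "bounded (f ` cball 0 R)"
    using assms(1) by (intro compact_imp_bounded compact_continuous_image)
      (auto intro: continuous_on_subset)
  then obtain M where "M > 0" "\<And>x. x \<in> cball 0 R \<Longrightarrow> norm (f x) \<le> M"
    unfolding bounded_pos by auto
  then show ?thesis
    using assms(2) by (intro that[of M]) (metis less_imp_le mem_cball_0 norm_zero not_le)+
qed

lemma uniformly_continuous_cball:
  fixes f :: "'a::euclidean_space \<Rightarrow> 'b::real_normed_vector"
  assumes "continuous_on UNIV f" "\<And>x. norm x > R \<Longrightarrow> f x = 0"
  shows "uniformly_continuous_on UNIV f"
  unfolding uniformly_continuous_on_def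
proof (intro allI impI)
  fix e :: real
  assume e: "e > 0"
  have "uniformly_continuous_on (cball 0 (R + 1)) f"
    using assms(1) by (intro compact_uniformly_continuous) (auto intro: continuous_on_subset)
  then obtain d where d: "d > 0"
    "\<And>x y. \<lbrakk>x \<in> cball 0 (R + 1); y \<in> cball 0 (R + 1); dist y x < d\<rbrakk> \<Longrightarrow> dist (f y) (f x) < e"
    unfolding uniformly_continuous_on_def using e by meson
  \<comment> \<open>The margin 1 in the radius pays off here: if one of two points at distance less
    than 1 leaves the larger ball, both lie outside \<open>cball 0 R\<close>, where \<open>f\<close>
    vanishes.\<close>
  have "dist (f y) (f x) < e" if "dist y x < min d 1" for x y
  proof (cases "x \<in> cball 0 (R + 1) \<and> y \<in> cball 0 (R + 1)")
    case True
    then show ?thesis using d that by auto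
  next
    case False
    moreover have "\<bar>norm x - norm y\<bar> < 1"
      using that norm_triangle_ineq3[of x y] by (simp add: dist_norm norm_minus_commute)
    ultimately have "norm x > R \<and> norm y > R"
      by (auto simp: not_le)
    then show ?thesis using assms(2) e by simp
  qed
  then show "\<exists>d>0. \<forall>x\<in>UNIV. \<forall>y\<in>UNIV. dist y x < d \<longrightarrow> dist (f y) (f x) < e"
    using d(1) by (intro exI[of _ "min d 1"]) auto
qed

lemma derivative_eq_0_outside:
  assumes "(f has_derivative f') (at x)" "\<And>x. norm x > R \<Longrightarrow> f x = 0" "norm x > R"
  shows "f' = (\<lambda>v. 0)"
proof (rule has_derivative_unique[OF assms(1)])
  have "open {x. norm x > R}"
    by (intro open_Collect_less continuous_intros)
  then show "(f has_derivative (\<lambda>v. 0)) (at x)"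
    by (rule has_derivative_transform_within_open[OF has_derivative_const]) (use assms(2,3) in auto)
qed

text \<open>The partial derivatives are continuous with compact support, hence uniformly continuous,
  and the mean value inequality turns this into a linearization error uniform in the base point. The
  uniformity allows integrating the error, for convolutions and for integrals of
  derivatives.\<close>

lemma uniform_linearization:
  fixes \<psi> :: "'a::euclidean_space \<Rightarrow> 'b::real_normed_vector"
  assumes D: "\<And>x. (\<psi> has_derivative \<psi>' x) (at x)"
    and c: "\<And>v. continuous_on UNIV (\<lambda>x. \<psi>' x v)"
    and R: "\<And>x. norm x > R \<Longrightarrow> \<psi> x = 0"
    and e: "e > 0"
  obtains d where "d > 0"
    "\<And>z h. norm h < d \<Longrightarrow> norm (\<psi> (z + h) - \<psi> z - \<psi>' z h) \<le> e * norm h"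
proof -
  \<comment> \<open>The operator norm is estimated direction by direction, so each basis vector
    receives the share \<open>e / N\<close>.\<close>
  define N where "N = real (card (Basis :: 'a set)) + 1"
  have N: "N > 0" by (simp add: N_def)
  have bl: "bounded_linear (\<psi>' x)" for x
    using D has_derivative_bounded_linear by blast
  have "\<exists>d>0. \<forall>x y. dist y x < d \<longrightarrow> dist (\<psi>' y b) (\<psi>' x b) < e / N" for b
  proof -
    have "uniformly_continuous_on UNIV (\<lambda>x. \<psi>' x b)"
    proof (rule uniformly_continuous_cball[OF c])
      show "\<psi>' x b = 0" if "norm x > R" for x
        using derivative_eq_0_outside[OF D R that] by simp
    qed
    then show ?thesis
      unfolding uniformly_continuous_on_def using e N by (auto dest: spec[of _ "e / N"])
  qed
  then obtain d where d: "\<And>b. d b > 0"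
    "\<And>b x y. dist y x < d b \<Longrightarrow> dist (\<psi>' y b) (\<psi>' x b) < e / N"
    by metis
  define d0 where "d0 = Min (d ` Basis)"
  have d0: "d0 > 0" "\<And>b. b \<in> Basis \<Longrightarrow> d0 \<le> d b"
    using d(1) by (auto simp: d0_def)
  have "norm (\<psi> (z + h) - \<psi> z - \<psi>' z h) \<le> e * norm h" if h: "norm h < d0" for z h
  proof -
    have on: "onorm (\<psi>' x - \<psi>' z) \<le> e" if x: "x \<in> ball z d0" for x
    proof (rule onorm_le)
      fix v :: 'a
      have lin: "linear (\<lambda>v. \<psi>' x v - \<psi>' z v)"
        using bl by (intro bounded_linear.linear bounded_linear_sub)
      have "\<psi>' x v - \<psi>' z v = (\<Sum>b\<in>Basis. (v \<bullet> b) *\<^sub>R (\<psi>' x b - \<psi>' z b))"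
        using linear_sum[OF lin, of "\<lambda>b. (v \<bullet> b) *\<^sub>R b" Basis] linear_cmul[OF lin]
        by (simp add: euclidean_representation)
      also have "norm \<dots> \<le> (\<Sum>b\<in>(Basis::'a set). norm v * (e / N))"
      proof (intro sum_norm_le)
        fix b :: 'a assume b: "b \<in> Basis"
        have "dist x z < d b"
          using x d0(2)[OF b] by (simp add: dist_commute)
        from d(2)[OF this] show "norm ((v \<bullet> b) *\<^sub>R (\<psi>' x b - \<psi>' z b)) \<le> norm v * (e / N)"
          using Basis_le_norm[OF b, of v] mult_mono[of "\<bar>v \<bullet> b\<bar>" "norm v" "norm (\<psi>' x b - \<psi>' z b)" "e / N"]
          by (simp add: dist_norm)
      qed
      also have "\<dots> \<le> e * norm v"
        using e N by (simp add: N_def field_simps)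
      finally show "norm ((\<psi>' x - \<psi>' z) v) \<le> e * norm v" by simp
    qed
    have "norm (\<psi> (z + h) - \<psi> z - \<psi>' z (z + h - z)) \<le> norm (z + h - z) * e"
    proof (rule differentiable_bound_linearization[where S = "ball z d0"])
      show "z + t *\<^sub>R (z + h - z) \<in> ball z d0" if "t \<in> {0..1}" for t
        using that h by (auto simp: dist_norm intro: le_less_trans[OF mult_left_le_one_le])
      show "(\<psi> has_derivative \<psi>' x) (at x within ball z d0)" for x
        by (rule has_derivative_at_withinI[OF D])
    qed (use on d0 in auto)
    then show ?thesis by (simp add: mult.commute)
  qed
  then show ?thesis using that d0 by blast
qed

section \<open>Convolution with smooth compactly supported kernels\<close>

definition conv :: "('a::euclidean_space \<Rightarrow> real) \<Rightarrow> ('a \<Rightarrow> 'b::{banach, second_countable_topology}) \<Rightarrow> 'a \<Rightarrow> 'b" where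
  "conv \<psi> f x = (LINT y|lborel. \<psi> (x - y) *\<^sub>R f y)"

lemma integrable_bounded_scaleR:
  fixes f :: "'a::euclidean_space \<Rightarrow> 'b::{banach, second_countable_topology}"
  assumes "integrable lborel f" "\<psi> \<in> borel_measurable borel" "\<And>x. \<bar>\<psi> x\<bar> \<le> M"
  shows "integrable lborel (\<lambda>y. \<psi> y *\<^sub>R f y)"
proof (rule Bochner_Integration.integrable_bound)
  show "integrable lborel (\<lambda>y. M *\<^sub>R f y)"
    using assms(1) by simp
  show "AE y in lborel. norm (\<psi> y *\<^sub>R f y) \<le> norm (M *\<^sub>R f y)"
    using assms(3) by (intro AE_I2) (auto intro!: mult_right_mono order_trans[OF assms(3) abs_ge_self])
  show "(\<lambda>y. \<psi> y *\<^sub>R f y) \<in> borel_measurable lborel"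
    using assms(1,2) borel_measurable_integrable[OF assms(1)] by measurable
qed

lemma integrable_conv:
  fixes f :: "'a::euclidean_space \<Rightarrow> 'b::{banach, second_countable_topology}"
  assumes f: "integrable lborel f" and c: "continuous_on UNIV \<psi>" and R: "\<And>x. norm x > R \<Longrightarrow> \<psi> x = 0"
  shows "integrable lborel (\<lambda>y. \<psi> (x - y) *\<^sub>R f y)"
proof -
  obtain M where M: "\<And>x. norm (\<psi> x) \<le> M"
    using bounded_continuous_cball[OF c R] by blast
  have "continuous_on UNIV (\<lambda>y. \<psi> (x - y))"
    by (rule continuous_on_compose2[OF c]) (auto intro!: continuous_intros)
  then show ?thesis
    using M by (intro integrable_bounded_scaleR[OF f, of _ M] borel_measurable_continuous_onI) auto
qed

lemma LINT_norm_bound: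
  fixes f :: "'a \<Rightarrow> 'b::{banach, second_countable_topology}"
  assumes "integrable M f" "integrable M g" "\<And>x. norm (f x) \<le> g x"
  shows "norm (LINT x|M. f x) \<le> (LINT x|M. g x)"
  using integral_norm_bound[of M f] integral_mono[OF integrable_norm[OF assms(1)] assms(2,3)] by linarith

lemma continuous_conv:
  fixes f :: "'a::euclidean_space \<Rightarrow> 'b::{banach, second_countable_topology}"
  assumes f: "integrable lborel f" and c: "continuous_on UNIV \<psi>" and R: "\<And>x. norm x > R \<Longrightarrow> \<psi> x = 0"
  shows "continuous_on UNIV (conv \<psi> f)"
  unfolding continuous_on_iff
proof (intro ballI allI impI)
  fix x e assume e: "(0::real) < e"
  define N where "N = (LINT y|lborel. norm (f y)) + 1"
  have N: "N > 0" unfolding N_def by (simp add: add_nonneg_pos)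
  obtain d where d: "d > 0" "\<And>x y. dist y x < d \<Longrightarrow> dist (\<psi> y) (\<psi> x) < e / N"
    using uniformly_continuous_cball[OF c R] e N unfolding uniformly_continuous_on_def
    by (metis UNIV_I divide_pos_pos)
  have "dist (conv \<psi> f y) (conv \<psi> f x) < e" if "dist y x < d" for y
  proof -
    have "norm (conv \<psi> f y - conv \<psi> f x) = norm (LINT z|lborel. \<psi> (y - z) *\<^sub>R f z - \<psi> (x - z) *\<^sub>R f z)"
      unfolding conv_def by (subst Bochner_Integration.integral_diff) (auto intro: integrable_conv[OF f c R])
    also have "\<dots> \<le> (LINT z|lborel. (e / N) * norm (f z))"
    proof (rule LINT_norm_bound)
      show "norm (\<psi> (y - z) *\<^sub>R f z - \<psi> (x - z) *\<^sub>R f z) \<le> (e / N) * norm (f z)" for z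
        using mult_right_mono[OF less_imp_le[OF d(2)[of "y - z" "x - z"]] norm_ge_zero[of "f z"]] that
        by (simp add: dist_norm scaleR_diff_left[symmetric])
      show "integrable lborel (\<lambda>z. e / N * norm (f z))"
          by (intro integrable_mult_right integrable_norm f)
      qed (intro integrable_conv[OF f c R] Bochner_Integration.integrable_diff)
    also have "\<dots> < e"
      using e N by (simp add: N_def field_simps)
    finally show ?thesis by (simp add: dist_norm)
  qed
  then show "\<exists>d>0. \<forall>x'\<in>UNIV. dist x' x < d \<longrightarrow> dist (conv \<psi> f x') (conv \<psi> f x) < e"
    using d(1) by blast
qed

text \<open>The kernel is linearized uniformly, with error at most a small multiple of
  \<open>norm (y - x)\<close>; integrating this error against \<open>f\<close> costs only the L1
  norm of \<open>f\<close>.\<close>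

lemma conv_has_derivative:
  fixes f :: "'a::euclidean_space \<Rightarrow> 'b::{banach, second_countable_topology}"
  assumes f: "integrable lborel f"
    and D: "\<And>x. (\<psi> has_derivative \<psi>' x) (at x)"
    and c: "\<And>v. continuous_on UNIV (\<lambda>x. \<psi>' x v)"
    and R: "\<And>x. norm x > R \<Longrightarrow> \<psi> x = 0"
  shows "(conv \<psi> f has_derivative (\<lambda>v. conv (\<lambda>z. \<psi>' z v) f x)) (at x)"
proof -
  have bl: "bounded_linear (\<psi>' x)" for x
    using D has_derivative_bounded_linear by blast
  have R': "\<psi>' x v = 0" if "norm x > R" for x v
    using derivative_eq_0_outside[OF D R that] by simp
  have c0: "continuous_on UNIV \<psi>"
    using D by (blast intro: continuous_at_imp_continuous_on has_derivative_continuous)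
  have I: "integrable lborel (\<lambda>y. \<psi> (x - y) *\<^sub>R f y)" for x
    by (rule integrable_conv[OF f c0 R])
  have I': "integrable lborel (\<lambda>y. \<psi>' (x - y) v *\<^sub>R f y)" for x v
    by (rule integrable_conv[OF f c R'])
  define N where "N = (LINT y|lborel. norm (f y)) + 1"
  have N: "N > 0" unfolding N_def by (simp add: add_nonneg_pos)
  show ?thesis
    unfolding has_derivative_at_alt
  proof (intro conjI allI impI)
    have "linear (\<lambda>v. conv (\<lambda>z. \<psi>' z v) f x)"
    proof (rule linearI)
      show "conv (\<lambda>z. \<psi>' z (v + w)) f x = conv (\<lambda>z. \<psi>' z v) f x + conv (\<lambda>z. \<psi>' z w) f x" for v w
        unfolding conv_def using bl
        by (subst Bochner_Integration.integral_add[OF I' I', symmetric])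
          (simp add: linear_add[OF bounded_linear.linear] scaleR_add_left)
      show "conv (\<lambda>z. \<psi>' z (r *\<^sub>R v)) f x = r *\<^sub>R conv (\<lambda>z. \<psi>' z v) f x" for r v
        unfolding conv_def using bl
        by (subst integral_scaleR_right[symmetric]) (simp add: linear_cmul[OF bounded_linear.linear])
    qed
    then show "bounded_linear (\<lambda>v. conv (\<lambda>z. \<psi>' z v) f x)"
      by (simp add: linear_conv_bounded_linear)
  next
    fix e :: real assume e: "e > 0"
    obtain d where d: "d > 0"
      "\<And>z h. norm h < d \<Longrightarrow> norm (\<psi> (z + h) - \<psi> z - \<psi>' z h) \<le> (e / N) * norm h"
      using uniform_linearization[of \<psi> \<psi>' R "e / N", OF D c R] e N by auto
    have "norm (conv \<psi> f y - conv \<psi> f x - conv (\<lambda>z. \<psi>' z (y - x)) f x) \<le> e * norm (y - x)"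
      if "norm (y - x) < d" for y
    proof -
      have "conv \<psi> f y - conv \<psi> f x - conv (\<lambda>z. \<psi>' z (y - x)) f x
        = (LINT z|lborel. (\<psi> (y - z) *\<^sub>R f z - \<psi> (x - z) *\<^sub>R f z) - \<psi>' (x - z) (y - x) *\<^sub>R f z)"
        unfolding conv_def
        by (subst Bochner_Integration.integral_diff, intro Bochner_Integration.integrable_diff I, rule I')
          (subst Bochner_Integration.integral_diff[OF I I], rule refl)
      also have "norm \<dots> \<le> (LINT z|lborel. ((e / N) * norm (y - x)) * norm (f z))"
      proof (rule LINT_norm_bound)
        show "norm ((\<psi> (y - z) *\<^sub>R f z - \<psi> (x - z) *\<^sub>R f z) - \<psi>' (x - z) (y - x) *\<^sub>R f z)
            \<le> ((e / N) * norm (y - x)) * norm (f z)" for z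
          using mult_right_mono[OF d(2)[OF that, of "x - z"] norm_ge_zero[of "f z"]]
          by (simp add: scaleR_diff_left[symmetric])
      qed (intro I I' f Bochner_Integration.integrable_diff integrable_mult_right integrable_norm)+
      also have "\<dots> = (e * norm (y - x)) * ((LINT y|lborel. norm (f y)) / N)"
        by simp
      also have "\<dots> \<le> (e * norm (y - x)) * 1"
        using e N by (intro mult_left_mono) (auto simp: N_def)
      finally show ?thesis by simp
    qed
    then show "\<exists>d>0. \<forall>y. norm (y - x) < d \<longrightarrow>
        norm (conv \<psi> f y - conv \<psi> f x - conv (\<lambda>z. \<psi>' z (y - x)) f x) \<le> e * norm (y - x)"
      using d(1) by blast
  qed
qed

lemma k_times_cont_diff_conv:
  fixes f :: "'a::euclidean_space \<Rightarrow> 'b::{banach, second_countable_topology}"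
  assumes f: "integrable lborel f"
    and "k_times_cont_diff k \<psi>" and "\<And>x. norm x > R \<Longrightarrow> \<psi> x = 0"
  shows "k_times_cont_diff k (conv \<psi> f)"
  using assms(2,3)
proof (induction k arbitrary: \<psi>)
  case 0
  then show ?case
    using continuous_conv[OF f, of \<psi> R] by simp
next
  case (Suc k)
  note D = k_times_cont_diff_SucD[OF Suc.prems(1)]
  have c: "continuous_on UNIV (\<lambda>x. frechet_derivative \<psi> (at x) v)" for v
    using D(2)[of v]
  proof (induction k)
    case (Suc j)
    then show ?case by (blast dest: k_times_cont_diff_Suc_imp)
  qed simp
  show ?case
  proof (rule k_times_cont_diff_SucI[OF conv_has_derivative[OF f D(1) c Suc.prems(2)]])
    show "k_times_cont_diff k (\<lambda>x. conv (\<lambda>z. frechet_derivative \<psi> (at z) v) f x)" for v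
    proof (rule Suc.IH[OF D(2)])
      show "frechet_derivative \<psi> (at x) v = 0" if "norm x > R" for x
        using derivative_eq_0_outside[OF D(1) Suc.prems(2) that] by simp
    qed
  qed
qed

lemma smooth_conv_moll:
  fixes f :: "'a::euclidean_space \<Rightarrow> 'b::{banach, second_countable_topology}"
  assumes "integrable lborel f" "r > 0"
  shows "smooth_fun (conv (moll r) f)"
  unfolding smooth_fun_def
  using smooth_moll[OF assms(2), where ?'a = 'a] moll_eq_0[OF assms(2), where ?'a = 'a]
  by (auto simp: smooth_fun_def less_imp_le intro!: k_times_cont_diff_conv[OF assms(1), of _ _ r])

lemma conv_moll_has_derivative:
  fixes f :: "'a::euclidean_space \<Rightarrow> 'b::{banach, second_countable_topology}"
  assumes "integrable lborel f" "r > 0"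
  shows "(conv (moll r) f has_derivative (\<lambda>v. conv (\<lambda>z. frechet_derivative (moll r) (at z) v) f x)) (at x)"
  using smooth_moll[OF assms(2), where ?'a = 'a] moll_eq_0[OF assms(2), where ?'a = 'a]
  by (intro conv_has_derivative[OF assms(1), of _ _ r] smooth_fun_has_derivative smooth_fun_continuous_derivative)
    (auto simp: less_imp_le)

lemma integrable_conv_moll:
  fixes f :: "'a::euclidean_space \<Rightarrow> 'b::{banach, second_countable_topology}"
  assumes "integrable lborel f" "r > 0"
  shows "integrable lborel (\<lambda>y. moll r (x - y) *\<^sub>R f y)"
  by (rule integrable_conv[OF assms(1) smooth_fun_continuous[OF smooth_moll[OF assms(2)]], of r])
    (simp add: moll_eq_0 assms)

section \<open>Cutoff functions at a prescribed scale\<close>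

definition cutoff_fun :: "real \<Rightarrow> 'a::euclidean_space set \<Rightarrow> real \<Rightarrow> ('a \<Rightarrow> real) \<Rightarrow> bool" where
  "cutoff_fun C S r \<theta> \<longleftrightarrow> smooth_fun \<theta> \<and>
      (\<forall>x. 0 \<le> \<theta> x \<and> \<theta> x \<le> 1) \<and>
      (\<forall>x. ball x r \<subseteq> S \<longrightarrow> \<theta> x = 1 \<and> frechet_derivative \<theta> (at x) = (\<lambda>v. 0)) \<and>
      (\<forall>x. ball x r \<inter> S = {} \<longrightarrow> \<theta> x = 0 \<and> frechet_derivative \<theta> (at x) = (\<lambda>v. 0)) \<and>
      (\<forall>x v. \<bar>frechet_derivative \<theta> (at x) v\<bar> \<le> C / r * norm v)"

lemma cutoff_funD:
  assumes "cutoff_fun C S r \<theta>"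
  shows "smooth_fun \<theta>" "0 \<le> \<theta> x" "\<theta> x \<le> 1"
    "ball x r \<subseteq> S \<Longrightarrow> \<theta> x = 1" "ball x r \<subseteq> S \<Longrightarrow> frechet_derivative \<theta> (at x) = (\<lambda>v. 0)"
    "ball x r \<inter> S = {} \<Longrightarrow> \<theta> x = 0" "ball x r \<inter> S = {} \<Longrightarrow> frechet_derivative \<theta> (at x) = (\<lambda>v. 0)"
    "\<bar>frechet_derivative \<theta> (at x) v\<bar> \<le> C / r * norm v"
  using assms unfolding cutoff_fun_def by blast+

text \<open>Mollify the indicator of \<open>S\<close> at scale \<open>r\<close>. The gradient is
  bounded by the L1 norm of the derivative of the kernel, which is of order \<open>1 / r\<close>
  with a constant depending on neither \<open>S\<close> nor \<open>r\<close>.\<close>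

lemma cutoff_exists:
  "\<exists>C>0. \<forall>(S::'a::euclidean_space set) r. S \<in> sets borel \<longrightarrow> bounded S \<longrightarrow> r > 0 \<longrightarrow> (\<exists>\<theta>. cutoff_fun C S r \<theta>)"
proof -
  obtain C where C: "C > 0" "\<And>r v. r > 0 \<Longrightarrow> (LINT x|lborel. \<bar>frechet_derivative (moll r) (at x) v\<bar>) \<le> C / r * norm (v::'a)"
    using moll_derivative_bound[where ?'a = 'a] by blast
  have "\<exists>\<theta>. cutoff_fun C S r \<theta>"
    if S: "S \<in> sets borel" "bounded S" and r: "r > 0" for S :: "'a set" and r
  proof -
    define \<theta> where "\<theta> = conv (moll r) (indicat_real S)"
    have f: "integrable lborel (indicat_real S)"
      using S by (intro integrable_real_indicator) (auto simp: emeasure_bounded_less_top)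
    have I: "integrable lborel (\<lambda>y. moll r (x - y) *\<^sub>R indicat_real S y)" for x
      by (rule integrable_conv_moll[OF f r])
    have J: "integrable lborel (\<lambda>y. moll r (x - y))" "(LINT y|lborel. moll r (x - y)) = 1" for x :: 'a
      using integrable_reflect[OF integrable_moll[OF r], of x] integral_moll[OF r] by auto
    have sm: "smooth_fun \<theta>"
      unfolding \<theta>_def by (rule smooth_conv_moll[OF f r])
    have ge: "0 \<le> \<theta> x" for x
      unfolding \<theta>_def conv_def using moll_nonneg[OF r, where ?'a = 'a] by (intro integral_nonneg_AE AE_I2) simp
    have le: "\<theta> x \<le> 1" for x
      unfolding \<theta>_def conv_def J(2)[of x, symmetric]
      using moll_nonneg[OF r] by (intro integral_mono I J) (auto simp: indicator_def)
    have one: "\<theta> x = 1" if "ball x r \<subseteq> S" for x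
    proof -
      have "moll r (x - y) *\<^sub>R indicat_real S y = moll r (x - y)" for y
        using that moll_eq_0[OF r, of "x - y"] by (auto simp: indicator_def dist_norm subset_eq not_less[symmetric])
      then show ?thesis unfolding \<theta>_def conv_def by (simp only: J(2))
    qed
    have zero: "\<theta> x = 0" if "ball x r \<inter> S = {}" for x
    proof -
      have "moll r (x - y) *\<^sub>R indicat_real S y = 0" for y
        using that moll_eq_0[OF r, of "x - y"] by (auto simp: indicator_def dist_norm disjoint_iff not_less[symmetric])
      then show ?thesis unfolding \<theta>_def conv_def by (simp only: Bochner_Integration.integral_zero)
    qed
    have D: "(\<theta> has_derivative frechet_derivative \<theta> (at x)) (at x)" for x
      by (rule smooth_fun_has_derivative[OF sm])
    \<comment> \<open>The values 0 and 1 are global extrema of \<theta>, so the derivative vanishes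
      wherever they are attained. This locates the support of the gradient.\<close>
    have d1: "frechet_derivative \<theta> (at x) = (\<lambda>v. 0)" if "\<theta> x = 1" for x
      by (rule differential_zero_maxmin[OF _ open_UNIV D]) (use that le in auto)
    have d0: "frechet_derivative \<theta> (at x) = (\<lambda>v. 0)" if "\<theta> x = 0" for x
      by (rule differential_zero_maxmin[OF _ open_UNIV D]) (use that ge in auto)
    have bd: "\<bar>frechet_derivative \<theta> (at x) v\<bar> \<le> C / r * norm v" for x v
    proof -
      let ?m = "\<lambda>z. frechet_derivative (moll r) (at z) v"
      have cm: "continuous_on UNIV ?m"
        by (rule smooth_fun_continuous_derivative[OF smooth_moll[OF r]])
      have Rm: "?m x = 0" if "norm x > r" for x
      proof -
        have "moll r y = 0" if "norm y > r" for y :: 'a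
          using moll_eq_0[OF r, of y] that by simp
        from derivative_eq_0_outside[OF smooth_fun_has_derivative[OF smooth_moll[OF r]] this that]
        show ?thesis by simp
      qed
      have Im: "integrable lborel (\<lambda>y. \<bar>?m (x - y)\<bar>)"
        by (intro integrable_abs integrable_reflect(1) integrable_continuous_cball[OF cm Rm])
      have "frechet_derivative \<theta> (at x) v = conv ?m (indicat_real S) x"
        unfolding \<theta>_def using frechet_derivative_at[OF conv_moll_has_derivative[OF f r]]
        by (metis (no_types))
      also have "\<bar>\<dots>\<bar> \<le> (LINT y|lborel. \<bar>?m (x - y)\<bar>)"
        unfolding conv_def
        proof (rule LINT_norm_bound[OF integrable_conv[OF f cm Rm] Im, unfolded real_norm_def])
          show "\<bar>?m (x - y) *\<^sub>R indicat_real S y\<bar> \<le> \<bar>?m (x - y)\<bar>" for y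
            by (simp add: indicator_def)
        qed
      also have "\<dots> = (LINT y|lborel. \<bar>?m y\<bar>)"
        by (rule integrable_reflect(2)[OF integrable_abs[OF integrable_continuous_cball[OF cm Rm]]])
      also have "\<dots> \<le> C / r * norm v"
        by (rule C(2)[OF r])
      finally show ?thesis .
    qed
    show ?thesis
      unfolding cutoff_fun_def
      using sm ge le one zero d0 d1 bd by (intro exI[of _ \<theta>] conjI allI impI) blast+
  qed
  with C(1) show ?thesis by (intro exI[of _ C]) simp
qed

text \<open>Squeeze \<open>A\<close> between a compact \<open>K\<close> and an open
  \<open>U\<close>. If \<open>h\<close> is shorter than the distance from \<open>K\<close> to the
  complement of \<open>U\<close>, then membership in \<open>A\<close> changes between
  \<open>x\<close> and \<open>x - h\<close> only if one of the two points lies in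
  \<open>U - A\<close> or in \<open>A - K\<close>.\<close>

lemma indicator_translation_continuous:
  fixes A :: "'a::euclidean_space set"
  assumes A: "A \<in> sets lborel" "emeasure lborel A < \<infinity>" and e: "(0::real) < e"
  obtains d where "d > 0" "\<And>h. norm h < d \<Longrightarrow>
    (\<integral>\<^sup>+x. ennreal \<bar>indicat_real A (x - h) - indicat_real A x\<bar> \<partial>lborel) \<le> ennreal e"
proof -
  have lm: "A \<in> sets lebesgue"
    using A by auto
  \<comment> \<open>Budget: \<open>e / 4\<close> for \<open>U - A\<close> and for
    \<open>A - K\<close>, each counted at \<open>x\<close> and at \<open>x - h\<close>. The share of
    \<open>A - K\<close> is halved once more: inner regularity gives a closed \<open>T\<close>, and
    cutting \<open>T\<close> at a large radius to make it compact costs another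
    \<open>e / 8\<close>.\<close>
  have e': "e / 4 > 0" "e / 8 > 0" using e by auto
  obtain U where U: "open U" "A \<subseteq> U" "emeasure lebesgue (U - A) < ennreal (e / 4)"
    using sets_lebesgue_outer_open[OF lm e'(1)] by metis
  obtain T where T: "closed T" "T \<subseteq> A" "emeasure lebesgue (A - T) < ennreal (e / 8)"
    using sets_lebesgue_inner_closed[OF lm e'(2)] by metis
  have [measurable]: "T \<in> sets borel"
    using T(1) by auto
  have "(\<lambda>n. emeasure lborel (T - cball 0 (real n))) \<longlonglongrightarrow> emeasure lborel (\<Inter>n. T - cball 0 (real n))"
  proof (rule Lim_emeasure_decseq)
    show "decseq (\<lambda>n. T - cball 0 (real n))"
      unfolding decseq_def by (auto intro: order_trans)
    have "emeasure lborel (T - cball 0 (real n)) \<le> emeasure lborel A" for n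
      using A T(2) by (intro emeasure_mono) auto
    from le_less_trans[OF this A(2)] show "emeasure lborel (T - cball 0 (real n)) \<noteq> \<infinity>" for n
      by (metis less_irrefl)
  qed auto
  also have "(\<Inter>n. T - cball 0 (real n)) = {}"
    using real_arch_simple by (auto simp: not_le)
  finally have "eventually (\<lambda>n. emeasure lborel (T - cball 0 (real n)) < ennreal (e / 8)) sequentially"
    using e' by (intro order_tendstoD(2)) auto
  then obtain N where N: "emeasure lborel (T - cball 0 (real N)) < ennreal (e / 8)"
    by (auto simp: eventually_sequentially)
  define K where "K = T \<inter> cball 0 (real N)"
  have K: "compact K" "K \<subseteq> A"
    using T by (auto simp: K_def closed_Int_compact)
  have KU: "K \<subseteq> U" using K(2) U(2) by auto
  obtain d where d0: "d > 0" "(\<Union>x\<in>K. ball x d) \<subseteq> U"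
    using compact_subset_open_imp_ball_epsilon_subset[OF K(1) U(1) KU] by metis
  have d: "d > 0" "\<And>x. x \<in> K \<Longrightarrow> ball x d \<subseteq> U"
    using d0 by auto
  have [measurable]: "A \<in> sets borel" "K \<in> sets borel" "U \<in> sets borel"
    using A K(1) U(1) by (auto intro: borel_compact)
  have mU: "emeasure lborel (U - A) \<le> ennreal (e / 4)"
    using U(3) by simp
  have "emeasure lborel (A - K) \<le> emeasure lborel ((A - T) \<union> (T - cball 0 (real N)))"
    by (intro emeasure_mono) (auto simp: K_def)
  also have "\<dots> \<le> emeasure lborel (A - T) + emeasure lborel (T - cball 0 (real N))"
    by (intro emeasure_subadditive) auto
  also have "\<dots> \<le> ennreal (e / 8) + ennreal (e / 8)"
    using T(3) N by (intro add_mono) auto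
  finally have mK: "emeasure lborel (A - K) \<le> ennreal (e / 4)"
    using e by (simp add: ennreal_plus[symmetric] del: ennreal_plus)
  have "(\<integral>\<^sup>+x. ennreal \<bar>indicat_real A (x - h) - indicat_real A x\<bar> \<partial>lborel) \<le> ennreal e"
    if h: "norm h < d" for h
  proof -
    let ?g = "\<lambda>x::'a. indicator (U - A) x + indicator (A - K) x :: ennreal"
    have "ennreal \<bar>indicat_real A (x - h) - indicat_real A x\<bar> \<le> ?g (x - h) + ?g x" for x
    proof -
      have "x \<in> U" if "x - h \<in> K"
        using d(2)[OF that] h by (auto simp: subset_eq dist_norm)
      moreover have "x - h \<in> U" if "x \<in> K"
        using d(2)[OF that] h by (auto simp: subset_eq dist_norm)
      ultimately show ?thesis
        by (auto simp: indicator_def)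
    qed
    then have "(\<integral>\<^sup>+x. ennreal \<bar>indicat_real A (x - h) - indicat_real A x\<bar> \<partial>lborel)
        \<le> (\<integral>\<^sup>+x. ?g (x - h) + ?g x \<partial>lborel)"
      by (intro nn_integral_mono)
    also have "\<dots> = (\<integral>\<^sup>+x. ?g (x - h) \<partial>lborel) + (\<integral>\<^sup>+x. ?g x \<partial>lborel)"
      by (rule nn_integral_add) measurable
    also have "\<dots> = 2 * (emeasure lborel (U - A) + emeasure lborel (A - K))"
      by (subst nn_integral_shift) (simp_all add: nn_integral_add mult_2)
    also have "\<dots> \<le> 2 * (ennreal (e / 4) + ennreal (e / 4))"
      using mU mK by (intro mult_left_mono add_mono) auto
    also have "\<dots> = ennreal e"
      using e by (simp add: ennreal_plus[symmetric] ennreal_numeral[symmetric] ennreal_mult[symmetric] del: ennreal_plus ennreal_numeral)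
    finally show ?thesis .
  qed
  then show ?thesis using that d(1) by blast
qed

lemma L1_translation_continuous:
  fixes f :: "'a::euclidean_space \<Rightarrow> 'b::{banach, second_countable_topology}"
  assumes "integrable lborel f"
  shows "\<forall>e>0. \<exists>d>0. \<forall>h. norm h < d \<longrightarrow>
    (\<integral>\<^sup>+x. ennreal (norm (f (x - h) - f x)) \<partial>lborel) \<le> ennreal e"
  using assms
proof (induction rule: integrable_induct)
  case (base A c)
  show ?case
  proof (intro allI impI)
    fix e :: real assume e: "e > 0"
    define N where "N = norm c + 1"
    have N: "N > 0" by (simp add: N_def add_nonneg_pos)
    obtain d where d: "d > 0" "\<And>h. norm h < d \<Longrightarrow>
        (\<integral>\<^sup>+x. ennreal \<bar>indicat_real A (x - h) - indicat_real A x\<bar> \<partial>lborel) \<le> ennreal (e / N)"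
      using indicator_translation_continuous[OF base, of "e / N"] e N by auto
    have [measurable]: "A \<in> sets borel" using base by simp
    have "(\<integral>\<^sup>+x. ennreal (norm (indicat_real A (x - h) *\<^sub>R c - indicat_real A x *\<^sub>R c)) \<partial>lborel) \<le> ennreal e"
      if "norm h < d" for h
    proof -
      have "(\<integral>\<^sup>+x. ennreal (norm (indicat_real A (x - h) *\<^sub>R c - indicat_real A x *\<^sub>R c)) \<partial>lborel)
        \<le> (\<integral>\<^sup>+x. ennreal N * ennreal \<bar>indicat_real A (x - h) - indicat_real A x\<bar> \<partial>lborel)"
        using N by (intro nn_integral_mono)
          (auto simp: ennreal_mult[symmetric] scaleR_diff_left[symmetric] N_def mult.commute
            simp del: ennreal_plus intro!: mult_right_mono ennreal_leI)
      also have "\<dots> = ennreal N * (\<integral>\<^sup>+x. ennreal \<bar>indicat_real A (x - h) - indicat_real A x\<bar> \<partial>lborel)"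
        by (rule nn_integral_cmult) measurable
      also have "\<dots> \<le> ennreal N * ennreal (e / N)"
        using d(2)[OF that] by (intro mult_left_mono) auto
      also have "\<dots> = ennreal e"
        using e N by (simp add: ennreal_mult[symmetric])
      finally show ?thesis .
    qed
    then show "\<exists>d>0. \<forall>h. norm h < d \<longrightarrow>
      (\<integral>\<^sup>+x. ennreal (norm (indicat_real A (x - h) *\<^sub>R c - indicat_real A x *\<^sub>R c)) \<partial>lborel) \<le> ennreal e"
      using d(1) by blast
  qed
next
  case (add f g)
  have [measurable]: "f \<in> borel_measurable borel" "g \<in> borel_measurable borel"
    using add.hyps by auto
  show ?case
  proof (intro allI impI)
    fix e :: real assume e: "e > 0"
    then have e2: "e / 2 > 0" by simp
    obtain d1 where d1: "d1 > 0" "\<And>h. norm h < d1 \<Longrightarrow> (\<integral>\<^sup>+x. ennreal (norm (f (x - h) - f x)) \<partial>lborel) \<le> ennreal (e / 2)"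
      using add.IH(1) e2 by meson
    obtain d2 where d2: "d2 > 0" "\<And>h. norm h < d2 \<Longrightarrow> (\<integral>\<^sup>+x. ennreal (norm (g (x - h) - g x)) \<partial>lborel) \<le> ennreal (e / 2)"
      using add.IH(2) e2 by meson
    have "(\<integral>\<^sup>+x. ennreal (norm (f (x - h) + g (x - h) - (f x + g x))) \<partial>lborel) \<le> ennreal e"
      if "norm h < min d1 d2" for h
    proof -
      have "(\<integral>\<^sup>+x. ennreal (norm (f (x - h) + g (x - h) - (f x + g x))) \<partial>lborel)
        \<le> (\<integral>\<^sup>+x. ennreal (norm (f (x - h) - f x)) + ennreal (norm (g (x - h) - g x)) \<partial>lborel)"
        by (intro nn_integral_mono) (simp add: ennreal_plus[symmetric] norm_diff_triangle_ineq del: ennreal_plus)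
      also have "\<dots> = (\<integral>\<^sup>+x. ennreal (norm (f (x - h) - f x)) \<partial>lborel) + (\<integral>\<^sup>+x. ennreal (norm (g (x - h) - g x)) \<partial>lborel)"
        by (rule nn_integral_add) measurable
      also have "\<dots> \<le> ennreal (e / 2) + ennreal (e / 2)"
        using that by (intro add_mono d1 d2) auto
      also have "\<dots> = ennreal e"
        using e by (simp add: ennreal_plus[symmetric] del: ennreal_plus)
      finally show ?thesis .
    qed
    then show "\<exists>d>0. \<forall>h. norm h < d \<longrightarrow> (\<integral>\<^sup>+x. ennreal (norm (f (x - h) + g (x - h) - (f x + g x))) \<partial>lborel) \<le> ennreal e"
      using d1(1) d2(1) by (intro exI[of _ "min d1 d2"]) auto
  qed
next
  case (lim f s)
  have [measurable]: "f \<in> borel_measurable borel" "\<And>i. s i \<in> borel_measurable borel"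
    using lim.hyps borel_measurable_integrable by auto
  show ?case
  proof (intro allI impI)
    fix e :: real assume e: "e > 0"
    then have e3: "e / 3 > 0" by simp
    have fin: "(\<integral>\<^sup>+x. ennreal (2 * norm (f x)) \<partial>lborel) < \<infinity>"
      using lim.hyps integrable_iff_bounded[of lborel "\<lambda>x. 2 * norm (f x)"] by auto
    have "(\<lambda>i. \<integral>\<^sup>+x. ennreal (norm (f x - s i x)) \<partial>lborel) \<longlonglongrightarrow> 0"
      by (rule nn_integral_dominated_convergence_norm[where w = "\<lambda>x. 2 * norm (f x)"])
        (use lim.hyps fin in auto)
    then have "eventually (\<lambda>i. (\<integral>\<^sup>+x. ennreal (norm (f x - s i x)) \<partial>lborel) < ennreal (e / 3)) sequentially"
      by (rule order_tendstoD(2)) (use e3 in simp)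
    then obtain i where i: "(\<integral>\<^sup>+x. ennreal (norm (s i x - f x)) \<partial>lborel) < ennreal (e / 3)"
      by (auto simp: eventually_sequentially norm_minus_commute)
    obtain d where d: "d > 0" "\<And>h. norm h < d \<Longrightarrow> (\<integral>\<^sup>+x. ennreal (norm (s i (x - h) - s i x)) \<partial>lborel) \<le> ennreal (e / 3)"
      using lim.IH[of i] e3 by meson
    have "(\<integral>\<^sup>+x. ennreal (norm (f (x - h) - f x)) \<partial>lborel) \<le> ennreal e" if "norm h < d" for h
    proof -
      have "(\<integral>\<^sup>+x. ennreal (norm (f (x - h) - f x)) \<partial>lborel)
        \<le> (\<integral>\<^sup>+x. (ennreal (norm (s i (x - h) - f (x - h))) + ennreal (norm (s i (x - h) - s i x))) + ennreal (norm (s i x - f x)) \<partial>lborel)"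
      proof (intro nn_integral_mono)
        fix x
        have "norm (f (x - h) - f x) \<le> norm (s i (x - h) - f (x - h)) + norm (s i (x - h) - s i x) + norm (s i x - f x)"
          by (smt (verit) norm_minus_commute norm_triangle_ineq4 diff_add_cancel norm_triangle_sub norm_diff_triangle_le order_refl)
        then show "ennreal (norm (f (x - h) - f x)) \<le> (ennreal (norm (s i (x - h) - f (x - h))) + ennreal (norm (s i (x - h) - s i x))) + ennreal (norm (s i x - f x))"
          by (simp add: ennreal_plus[symmetric] del: ennreal_plus)
      qed
      also have "\<dots> = ((\<integral>\<^sup>+x. ennreal (norm (s i (x - h) - f (x - h))) \<partial>lborel) + (\<integral>\<^sup>+x. ennreal (norm (s i (x - h) - s i x)) \<partial>lborel))
          + (\<integral>\<^sup>+x. ennreal (norm (s i x - f x)) \<partial>lborel)"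
        by (subst nn_integral_add, measurable)+
      also have "(\<integral>\<^sup>+x. ennreal (norm (s i (x - h) - f (x - h))) \<partial>lborel) = (\<integral>\<^sup>+x. ennreal (norm (s i x - f x)) \<partial>lborel)"
        by (rule nn_integral_shift[of "\<lambda>x. ennreal (norm (s i x - f x))"]) measurable
      also have "((\<integral>\<^sup>+x. ennreal (norm (s i x - f x)) \<partial>lborel) + (\<integral>\<^sup>+x. ennreal (norm (s i (x - h) - s i x)) \<partial>lborel))
          + (\<integral>\<^sup>+x. ennreal (norm (s i x - f x)) \<partial>lborel) \<le> (ennreal (e / 3) + ennreal (e / 3)) + ennreal (e / 3)"
        using i that by (intro add_mono d) auto
      also have "\<dots> = ennreal e"
        using e by (simp add: ennreal_plus[symmetric] del: ennreal_plus)
      finally show ?thesis .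
    qed
    then show "\<exists>d>0. \<forall>h. norm h < d \<longrightarrow> (\<integral>\<^sup>+x. ennreal (norm (f (x - h) - f x)) \<partial>lborel) \<le> ennreal e"
      using d(1) by blast
  qed
qed

text \<open>The map \<open>a \<mapsto> |a| a\<close> carries \<open>L\<^sup>2\<close> into \<open>L\<^sup>1\<close>, which reduces \<open>L\<^sup>2\<close> continuity of
  translations to the \<open>L\<^sup>1\<close> case.\<close>

lemma norm_diff_square_le:
  fixes a b :: "'b::real_inner"
  shows "(norm (a - b))\<^sup>2 \<le> 2 * norm (norm a *\<^sub>R a - norm b *\<^sub>R b)"
proof (cases "a = b")
  case False
  define s t where "s = norm a" and "t = norm b"
  have st: "s \<ge> 0" "t \<ge> 0" by (auto simp: s_def t_def)
  \<comment> \<open>The last summand equals \<open>(s - t)^2 * (s + t) / 2\<close> and is dropped;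
    then \<open>s + t \<ge> norm (a - b)\<close> lets one factor \<open>norm (a - b)\<close>
    cancel.\<close>
  have "(s *\<^sub>R a - t *\<^sub>R b) \<bullet> (a - b) = (s + t) / 2 * (norm (a - b))\<^sup>2 + (s - t) / 2 * (s\<^sup>2 - t\<^sup>2)"
    by (simp add: s_def t_def power2_norm_eq_inner inner_diff algebra_simps inner_commute add_divide_distrib)
      (simp add: field_simps inner_commute)
  moreover have "(s - t) / 2 * (s\<^sup>2 - t\<^sup>2) = (s - t)\<^sup>2 / 2 * (s + t)"
    by (simp add: power2_eq_square field_simps)
  ultimately have "(s + t) / 2 * (norm (a - b))\<^sup>2 \<le> (s *\<^sub>R a - t *\<^sub>R b) \<bullet> (a - b)"
    using st by simp
  also have "\<dots> \<le> norm (s *\<^sub>R a - t *\<^sub>R b) * norm (a - b)"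
    by (rule norm_cauchy_schwarz)
  finally have 1: "(s + t) / 2 * (norm (a - b))\<^sup>2 \<le> norm (s *\<^sub>R a - t *\<^sub>R b) * norm (a - b)" .
  have "norm (a - b) / 2 * (norm (a - b))\<^sup>2 \<le> (s + t) / 2 * (norm (a - b))\<^sup>2"
    using norm_triangle_ineq4[of a b] by (intro mult_right_mono) (auto simp: s_def t_def)
  with 1 have "norm (a - b) * (norm (a - b))\<^sup>2 \<le> norm (a - b) * (2 * norm (s *\<^sub>R a - t *\<^sub>R b))"
    by (simp add: mult.commute)
  then show ?thesis
    using False by (simp add: s_def t_def)
qed simp

lemma L2_translation_continuous:
  fixes f :: "'a::euclidean_space \<Rightarrow> 'b::euclidean_space"
  assumes [measurable]: "f \<in> borel_measurable borel" and f2: "integrable lborel (\<lambda>x. (norm (f x))\<^sup>2)" and e: "e > 0"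
  obtains d where "d > 0" "\<And>h. norm h < d \<Longrightarrow>
    (\<integral>\<^sup>+x. ennreal ((norm (f (x - h) - f x))\<^sup>2) \<partial>lborel) \<le> ennreal e"
proof -
  let ?g = "\<lambda>x. norm (f x) *\<^sub>R f x"
  have "integrable lborel ?g"
    by (rule Bochner_Integration.integrable_bound[OF f2]) (auto simp: power2_eq_square)
  from L1_translation_continuous[OF this] obtain d where d: "d > 0"
    "\<And>h. norm h < d \<Longrightarrow> (\<integral>\<^sup>+x. ennreal (norm (?g (x - h) - ?g x)) \<partial>lborel) \<le> ennreal (e / 2)"
    using half_gt_zero[OF e] by meson
  have "(\<integral>\<^sup>+x. ennreal ((norm (f (x - h) - f x))\<^sup>2) \<partial>lborel) \<le> ennreal e" if "norm h < d" for h
  proof -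
    have "(\<integral>\<^sup>+x. ennreal ((norm (f (x - h) - f x))\<^sup>2) \<partial>lborel) \<le> (\<integral>\<^sup>+x. 2 * ennreal (norm (?g (x - h) - ?g x)) \<partial>lborel)"
      using norm_diff_square_le
      by (intro nn_integral_mono) (simp add: ennreal_mult[symmetric] ennreal_numeral[symmetric] del: ennreal_numeral)
    also have "\<dots> = 2 * (\<integral>\<^sup>+x. ennreal (norm (?g (x - h) - ?g x)) \<partial>lborel)"
      by (rule nn_integral_cmult) measurable
    also have "\<dots> \<le> 2 * ennreal (e / 2)"
      using d(2)[OF that] by (intro mult_left_mono) auto
    also have "\<dots> = ennreal e"
      using e by (simp add: ennreal_mult[symmetric] ennreal_numeral[symmetric] del: ennreal_numeral)
    finally show ?thesis .
  qed
  then show ?thesis using that d(1) by blast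
qed

text \<open>The mollifier has integral 1, so \<open>f x\<close> can be moved under the integral; the
  mollification error becomes an average of translation errors.\<close>

lemma conv_moll_diff:
  fixes f :: "'a::euclidean_space \<Rightarrow> 'b::{banach, second_countable_topology}"
  assumes f: "integrable lborel f" and r: "r > 0"
  shows "integrable lborel (\<lambda>h. moll r h *\<^sub>R (f (x - h) - f x))"
    and "conv (moll r) f x - f x = (LINT h|lborel. moll r h *\<^sub>R (f (x - h) - f x))"
proof -
  have I: "integrable lborel (\<lambda>y. moll r (x - y) *\<^sub>R f y)"
    by (rule integrable_conv_moll[OF f r])
  have I1: "integrable lborel (\<lambda>h. moll r h *\<^sub>R f (x - h))"
    and e1: "(LINT h|lborel. moll r h *\<^sub>R f (x - h)) = conv (moll r) f x"
    using integrable_reflect[OF I, of x] by (simp_all add: conv_def)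
  have I2: "integrable lborel (\<lambda>h. moll r (h::'a) *\<^sub>R f x)"
    by (rule integrable_scaleR_left[OF integrable_moll[OF r]])
  have e2: "(LINT h|lborel. moll r (h::'a) *\<^sub>R f x) = f x"
    using integral_scaleR_left[OF integrable_moll[OF r, where ?'a = 'a], of "f x"] integral_moll[OF r, where ?'a = 'a] by simp
  show "integrable lborel (\<lambda>h. moll r h *\<^sub>R (f (x - h) - f x))"
    using Bochner_Integration.integrable_diff[OF I1 I2] by (simp add: scaleR_diff_right)
  show "conv (moll r) f x - f x = (LINT h|lborel. moll r h *\<^sub>R (f (x - h) - f x))"
    using Bochner_Integration.integral_diff[OF I1 I2] by (simp add: scaleR_diff_right e1 e2)
qed

lemma borel_measurable_conv_moll:
  fixes f :: "'a::euclidean_space \<Rightarrow> 'b::{banach, second_countable_topology}"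
  assumes "integrable lborel f" "r > 0"
  shows "conv (moll r) f \<in> borel_measurable borel"
  by (rule borel_measurable_continuous_onI[OF smooth_fun_continuous[OF smooth_conv_moll[OF assms]]])

lemma borel_measurable_moll: "r > 0 \<Longrightarrow> moll r \<in> borel_measurable borel"
  by (rule borel_measurable_continuous_onI[OF smooth_fun_continuous[OF smooth_moll]])

lemma nn_integral_moll:
  assumes "r > 0"
  shows "(\<integral>\<^sup>+h. ennreal (moll r (h::'a::euclidean_space)) \<partial>lborel) = 1"
  using integral_moll[OF assms, where ?'a = 'a] integrable_moll[OF assms, where ?'a = 'a] moll_nonneg[OF assms, where ?'a = 'a]
  by (simp add: nn_integral_eq_integral)

text \<open>By Fubini the average over \<open>h\<close> may be taken last, and only \<open>h\<close>
  with \<open>norm h < r\<close> carry mass.\<close>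

lemma nn_integral_moll_average_le:
  fixes g :: "'a::euclidean_space \<Rightarrow> 'a \<Rightarrow> ennreal"
  assumes r: "r > 0" and [measurable]: "(\<lambda>(x, h). g x h) \<in> borel_measurable (borel \<Otimes>\<^sub>M borel)"
    and le: "\<And>h. norm h < r \<Longrightarrow> (\<integral>\<^sup>+x. g x h \<partial>lborel) \<le> c"
  shows "(\<integral>\<^sup>+x. (\<integral>\<^sup>+h. ennreal (moll r h) * g x h \<partial>lborel) \<partial>lborel) \<le> c"
proof -
  note [measurable] = borel_measurable_moll[OF r]
  have "(\<integral>\<^sup>+x. (\<integral>\<^sup>+h. ennreal (moll r h) * g x h \<partial>lborel) \<partial>lborel)
      = (\<integral>\<^sup>+h. (\<integral>\<^sup>+x. ennreal (moll r h) * g x h \<partial>lborel) \<partial>lborel)"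
    by (rule lborel_pair.Fubini'[symmetric]) measurable
  also have "\<dots> = (\<integral>\<^sup>+h. ennreal (moll r h) * (\<integral>\<^sup>+x. g x h \<partial>lborel) \<partial>lborel)"
    by (intro nn_integral_cong nn_integral_cmult) measurable
  also have "\<dots> \<le> (\<integral>\<^sup>+h. ennreal (moll r (h::'a)) * c \<partial>lborel)"
  proof (intro nn_integral_mono)
    show "ennreal (moll r h) * (\<integral>\<^sup>+x. g x h \<partial>lborel) \<le> ennreal (moll r h) * c" for h
      using le[of h] moll_eq_0[OF r, of h] by (cases "norm h < r") (auto intro: mult_left_mono)
  qed
  also have "\<dots> = c"
    by (simp add: nn_integral_multc nn_integral_moll[OF r])
  finally show ?thesis .
qed

lemma conv_moll_L1:
  fixes f :: "'a::euclidean_space \<Rightarrow> 'b::{banach, second_countable_topology}"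
  assumes f: "integrable lborel f" and e: "e > 0"
  obtains d where "d > 0" "\<And>r. 0 < r \<Longrightarrow> r < d \<Longrightarrow>
    (\<integral>\<^sup>+x. ennreal (norm (conv (moll r) f x - f x)) \<partial>lborel) \<le> ennreal e"
proof -
  have [measurable]: "f \<in> borel_measurable borel" using f by auto
  obtain d where d: "d > 0" "\<And>h. norm h < d \<Longrightarrow> (\<integral>\<^sup>+x. ennreal (norm (f (x - h) - f x)) \<partial>lborel) \<le> ennreal e"
    using L1_translation_continuous[OF f] e by meson
  have "(\<integral>\<^sup>+x. ennreal (norm (conv (moll r) f x - f x)) \<partial>lborel) \<le> ennreal e" if r: "0 < r" "r < d" for r
  proof -
    have "(\<integral>\<^sup>+x. ennreal (norm (conv (moll r) f x - f x)) \<partial>lborel)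
        \<le> (\<integral>\<^sup>+x. (\<integral>\<^sup>+h. ennreal (moll r h) * ennreal (norm (f (x - h) - f x)) \<partial>lborel) \<partial>lborel)"
    proof (intro nn_integral_mono)
      fix x
      have "ennreal (norm (conv (moll r) f x - f x)) \<le> (\<integral>\<^sup>+h. ennreal (norm (moll r h *\<^sub>R (f (x - h) - f x))) \<partial>lborel)"
        unfolding conv_moll_diff(2)[OF f r(1)] by (rule integral_norm_bound_ennreal[OF conv_moll_diff(1)[OF f r(1)]])
      then show "ennreal (norm (conv (moll r) f x - f x)) \<le> (\<integral>\<^sup>+h. ennreal (moll r h) * ennreal (norm (f (x - h) - f x)) \<partial>lborel)"
        using moll_nonneg[OF r(1), where ?'a = 'a] by (simp add: ennreal_mult)
    qed
    also have "\<dots> \<le> ennreal e"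
      using d(2) r by (intro nn_integral_moll_average_le) auto
    finally show ?thesis .
  qed
  then show ?thesis using that d(1) by blast
qed

text \<open>Jensen's inequality for the square, obtained from Cauchy-Schwarz against the constant 1
  with respect to the probability density \<open>m\<close>.\<close>

lemma nn_integral_prob_square:
  assumes [measurable]: "m \<in> borel_measurable M" "g \<in> borel_measurable M" and "(\<integral>\<^sup>+h. m h \<partial>M) = 1"
  shows "(\<integral>\<^sup>+h. m h * g h \<partial>M)\<^sup>2 \<le> (\<integral>\<^sup>+h. m h * (g h)\<^sup>2 \<partial>M)"
proof -
  have "(\<integral>\<^sup>+h. g h * 1 \<partial>density M m)\<^sup>2 \<le> (\<integral>\<^sup>+h. (g h)\<^sup>2 \<partial>density M m) * (\<integral>\<^sup>+h. 1\<^sup>2 \<partial>density M m)"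
    by (rule Cauchy_Schwarz_nn_integral) auto
  then show ?thesis
    using assms(3) by (simp add: nn_integral_density emeasure_density)
qed

lemma conv_moll_L2:
  fixes f :: "'a::euclidean_space \<Rightarrow> 'b::euclidean_space"
  assumes f: "integrable lborel f" and f2: "integrable lborel (\<lambda>x. (norm (f x))\<^sup>2)" and e: "e > 0"
  obtains d where "d > 0" "\<And>r. 0 < r \<Longrightarrow> r < d \<Longrightarrow>
    (\<integral>\<^sup>+x. ennreal ((norm (conv (moll r) f x - f x))\<^sup>2) \<partial>lborel) \<le> ennreal e"
proof -
  have [measurable]: "f \<in> borel_measurable borel" using f by auto
  obtain d where d: "d > 0" "\<And>h. norm h < d \<Longrightarrow> (\<integral>\<^sup>+x. ennreal ((norm (f (x - h) - f x))\<^sup>2) \<partial>lborel) \<le> ennreal e"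
    using L2_translation_continuous[OF _ f2 e] by auto
  have "(\<integral>\<^sup>+x. ennreal ((norm (conv (moll r) f x - f x))\<^sup>2) \<partial>lborel) \<le> ennreal e" if r: "0 < r" "r < d" for r
  proof -
    note [measurable] = borel_measurable_moll[OF r(1)]
    have "(\<integral>\<^sup>+x. ennreal ((norm (conv (moll r) f x - f x))\<^sup>2) \<partial>lborel)
        \<le> (\<integral>\<^sup>+x. (\<integral>\<^sup>+h. ennreal (moll r h) * ennreal ((norm (f (x - h) - f x))\<^sup>2) \<partial>lborel) \<partial>lborel)"
    proof (intro nn_integral_mono)
      fix x
      have "ennreal (norm (conv (moll r) f x - f x)) \<le> (\<integral>\<^sup>+h. ennreal (norm (moll r h *\<^sub>R (f (x - h) - f x))) \<partial>lborel)"
        unfolding conv_moll_diff(2)[OF f r(1)] by (rule integral_norm_bound_ennreal[OF conv_moll_diff(1)[OF f r(1)]])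
      then have "ennreal (norm (conv (moll r) f x - f x)) \<le> (\<integral>\<^sup>+h. ennreal (moll r h) * ennreal (norm (f (x - h) - f x)) \<partial>lborel)"
        using moll_nonneg[OF r(1), where ?'a = 'a] by (simp add: ennreal_mult)
      then have "(ennreal (norm (conv (moll r) f x - f x)))\<^sup>2 \<le> (\<integral>\<^sup>+h. ennreal (moll r h) * ennreal (norm (f (x - h) - f x)) \<partial>lborel)\<^sup>2"
        by (rule power_mono) simp
      also have "\<dots> \<le> (\<integral>\<^sup>+h. ennreal (moll r h) * (ennreal (norm (f (x - h) - f x)))\<^sup>2 \<partial>lborel)"
        by (rule nn_integral_prob_square) (auto simp: nn_integral_moll[OF r(1)])
      finally show "ennreal ((norm (conv (moll r) f x - f x))\<^sup>2) \<le> (\<integral>\<^sup>+h. ennreal (moll r h) * ennreal ((norm (f (x - h) - f x))\<^sup>2) \<partial>lborel)"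
        by (simp add: ennreal_power)
    qed
    also have "\<dots> \<le> ennreal e"
      using d(2) r by (intro nn_integral_moll_average_le) auto
    finally show ?thesis .
  qed
  then show ?thesis using that d(1) by blast
qed

section \<open>Weak gradients\<close>

text \<open>Weak gradients for Borel representatives, tested with respect to \<open>lborel\<close>, where Fubini's
  theorem is available.\<close>

definition wgrad :: "(real ^ 'n::finite) set \<Rightarrow> (real ^ 'n \<Rightarrow> complex) \<Rightarrow> (real ^ 'n \<Rightarrow> complex ^ 'n) \<Rightarrow> bool" where
  "wgrad U u G \<longleftrightarrow> u \<in> borel_measurable borel \<and> G \<in> borel_measurable borel \<and>
     (\<forall>K. compact K \<and> K \<subseteq> U \<longrightarrow> set_integrable lborel K u \<and> set_integrable lborel K G) \<and>
     (\<forall>\<phi>\<in>test_functions U. \<forall>i.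
        (LINT X|lborel. u X * classical_grad \<phi> X $ i) = - (LINT X|lborel. G X $ i * \<phi> X))"

lemma wgradD:
  assumes "wgrad U u G"
  shows "u \<in> borel_measurable borel" "G \<in> borel_measurable borel"
    and "compact K \<Longrightarrow> K \<subseteq> U \<Longrightarrow> set_integrable lborel K u"
    and "compact K \<Longrightarrow> K \<subseteq> U \<Longrightarrow> set_integrable lborel K G"
    and "\<phi> \<in> test_functions U \<Longrightarrow>
      (LINT X|lborel. u X * classical_grad \<phi> X $ i) = - (LINT X|lborel. G X $ i * \<phi> X)"
  using assms unfolding wgrad_def by blast+

lemma norm_cdot_le: "cmod (cdot a b) \<le> norm a * norm b"
proof -
  have "cmod (cdot a b) \<le> (\<Sum>i\<in>UNIV. \<bar>cmod (a $ i)\<bar> * \<bar>cmod (b $ i)\<bar>)"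
    unfolding cdot_def by (rule order_trans[OF norm_sum]) (simp add: norm_mult)
  also have "\<dots> \<le> norm a * norm b"
    unfolding norm_vec_def by (rule L2_set_mult_ineq)
  finally show ?thesis .
qed

lemma borel_measurable_vec_iff:
  fixes f :: "'a \<Rightarrow> complex ^ 'n::finite"
  shows "f \<in> borel_measurable M \<longleftrightarrow> (\<forall>i. (\<lambda>x. f x $ i) \<in> borel_measurable M)"
proof
  assume f: "f \<in> borel_measurable M"
  have "(\<lambda>v::complex^'n. v $ i) \<in> borel_measurable borel" for i
    by (intro borel_measurable_continuous_onI continuous_intros)
  from measurable_compose[OF f this] show "\<forall>i. (\<lambda>x. f x $ i) \<in> borel_measurable M"
    by auto
next
  assume *: "\<forall>i. (\<lambda>x. f x $ i) \<in> borel_measurable M"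
  have "(\<lambda>x. \<Sum>i\<in>UNIV. axis i (f x $ i)) \<in> borel_measurable M"
  proof (intro borel_measurable_sum)
    fix i :: 'n
    have ax: "(\<lambda>c::complex. axis i c :: complex^'n) \<in> borel_measurable borel"
      by (intro borel_measurable_continuous_onI linear_continuous_on)
        (auto intro!: linear_conv_bounded_linear[THEN iffD1] linearI simp: axis_def vec_eq_iff)
    show "(\<lambda>x. axis i (f x $ i)) \<in> borel_measurable M"
      by (rule measurable_compose[OF spec[OF *] ax])
  qed
  moreover have "(\<Sum>i\<in>UNIV. axis i (f x $ i)) = f x" for x
    by (simp add: vec_eq_iff axis_def sum.delta)
  ultimately show "f \<in> borel_measurable M" by simp
qed

lemma borel_measurable_vec_nth [measurable (raw)]:
  fixes f :: "'a \<Rightarrow> complex ^ 'n::finite"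
  shows "f \<in> borel_measurable M \<Longrightarrow> (\<lambda>x. f x $ i) \<in> borel_measurable M"
  by (simp add: borel_measurable_vec_iff)

lemma borel_measurable_vec_lambda [measurable (raw)]:
  fixes f :: "'a \<Rightarrow> 'n::finite \<Rightarrow> complex"
  shows "(\<And>i. (\<lambda>x. f x i) \<in> borel_measurable M) \<Longrightarrow> (\<lambda>x. \<chi> i. f x i) \<in> borel_measurable M"
  by (simp add: borel_measurable_vec_iff)

lemma borel_measurable_cdot [measurable (raw)]:
  fixes f g :: "'a \<Rightarrow> complex ^ 'n::finite"
  shows "f \<in> borel_measurable M \<Longrightarrow> g \<in> borel_measurable M \<Longrightarrow> (\<lambda>x. cdot (f x) (g x)) \<in> borel_measurable M"
  unfolding cdot_def by (intro borel_measurable_sum borel_measurable_times borel_measurable_vec_nth)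

lemma test_functionsD:
  assumes "\<phi> \<in> test_functions U"
  shows "smooth_fun \<phi>" "compact (closure {X. \<phi> X \<noteq> 0})" "closure {X. \<phi> X \<noteq> 0} \<subseteq> U"
    "X \<notin> closure {X. \<phi> X \<noteq> 0} \<Longrightarrow> \<phi> X = 0"
  using assms closure_subset[of "{X. \<phi> X \<noteq> 0}"] unfolding test_functions_def by auto

lemma test_functionsI:
  assumes "smooth_fun \<phi>" "compact K" "K \<subseteq> U" "\<And>X. X \<notin> K \<Longrightarrow> \<phi> X = 0"
  shows "\<phi> \<in> test_functions U"
proof -
  have "closure {X. \<phi> X \<noteq> 0} \<subseteq> K"
    using assms(2,4) by (intro closure_minimal) (auto intro: compact_imp_closed)
  moreover from this have "compact (closure {X. \<phi> X \<noteq> 0})"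
    using assms(2) by (metis closed_closure compact_Int_closed inf.absorb_iff2)
  ultimately show ?thesis
    using assms(1,3) by (auto simp: test_functions_def)
qed

lemma frechet_derivative_eq_0_off_support:
  assumes "smooth_fun \<phi>" "X \<notin> closure {X. \<phi> X \<noteq> 0}"
  shows "frechet_derivative \<phi> (at X) = (\<lambda>v. 0)"
proof (rule has_derivative_unique[OF smooth_fun_has_derivative[OF assms(1)]])
  have "\<phi> y = 0" if "y \<in> - closure {X. \<phi> X \<noteq> 0}" for y
    using that closure_subset[of "{X. \<phi> X \<noteq> 0}"] by auto
  note z = this
  show "(\<phi> has_derivative (\<lambda>v. 0)) (at X)"
  proof (rule has_derivative_transform_within_open)
    show "((\<lambda>_. 0) has_derivative (\<lambda>v. 0)) (at X)" by simp
    show "open (- closure {X. \<phi> X \<noteq> 0})" "X \<in> - closure {X. \<phi> X \<noteq> 0}"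
      using assms(2) by auto
    show "0 = \<phi> y" if "y \<in> - closure {X. \<phi> X \<noteq> 0}" for y
      using z[OF that] by simp
  qed
qed

lemma continuous_classical_grad: "smooth_fun \<phi> \<Longrightarrow> continuous_on UNIV (\<lambda>X. classical_grad \<phi> X $ i)"
  unfolding classical_grad_def by (simp add: smooth_fun_continuous_derivative)

lemma continuous_on_classical_grad: "smooth_fun \<phi> \<Longrightarrow> continuous_on UNIV (classical_grad \<phi>)"
  unfolding classical_grad_def by (intro continuous_on_vec_lambda smooth_fun_continuous_derivative)

lemma classical_grad_eq_0_outside:
  assumes "smooth_fun \<phi>" "\<And>X. norm X > R \<Longrightarrow> \<phi> X = 0" "norm X > R"
  shows "classical_grad \<phi> X = 0"
  using derivative_eq_0_outside[OF smooth_fun_has_derivative[OF assms(1)] assms(2,3)]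
  by (simp add: classical_grad_def vec_eq_iff)

lemma borel_measurable_classical_grad: "smooth_fun \<phi> \<Longrightarrow> classical_grad \<phi> \<in> borel_measurable borel"
  by (auto simp: borel_measurable_vec_iff intro!: borel_measurable_continuous_onI continuous_classical_grad)

lemma integrable_mult_continuous:
  fixes f h :: "real ^ 'n::finite \<Rightarrow> complex"
  assumes f: "set_integrable lborel K f" and K: "compact K" and h: "continuous_on UNIV h"
    and z: "\<And>X. X \<notin> K \<Longrightarrow> h X = 0"
  shows "integrable lborel (\<lambda>X. f X * h X)"
proof -
  have "bounded (h ` K)"
    using K h by (intro compact_imp_bounded compact_continuous_image) (auto intro: continuous_on_subset)
  then obtain M where M: "\<And>X. X \<in> K \<Longrightarrow> norm (h X) \<le> M"
    by (auto simp: bounded_iff)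
  have "integrable lborel (\<lambda>X. (indicator K X *\<^sub>R f X) * h X)"
  proof (rule Bochner_Integration.integrable_bound)
    show "integrable lborel (\<lambda>X. M *\<^sub>R (indicator K X *\<^sub>R f X))"
      using f unfolding set_integrable_def by (rule integrable_scaleR_right)
    show "(\<lambda>X. indicat_real K X *\<^sub>R f X * h X) \<in> borel_measurable lborel"
      using f borel_measurable_continuous_onI[OF h] unfolding set_integrable_def
      by (intro borel_measurable_times) auto
    show "AE X in lborel. norm (indicat_real K X *\<^sub>R f X * h X) \<le> norm (M *\<^sub>R indicat_real K X *\<^sub>R f X)"
    proof (intro AE_I2)
      fix X
      show "norm (indicat_real K X *\<^sub>R f X * h X) \<le> norm (M *\<^sub>R indicat_real K X *\<^sub>R f X)"
      proof (cases "X \<in> K")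
        case True
        then have "norm (h X) \<le> \<bar>M\<bar>" using M by fastforce
        then show ?thesis
          using True by (simp add: norm_mult mult.commute[of "cmod (f X)"] mult_right_mono)
      qed simp
    qed
  qed
  also have "(\<lambda>X. (indicator K X *\<^sub>R f X) * h X) = (\<lambda>X. f X * h X)"
    using z by (fastforce simp: indicator_def)
  finally show ?thesis .
qed

text \<open>The integral is translation invariant, so the difference quotient in direction
  \<open>v\<close> has integral 0; the uniform linearization replaces it by the derivative up to an
  arbitrarily small error.\<close>

lemma integral_derivative_eq_0:
  fixes f :: "'a::euclidean_space \<Rightarrow> 'b::{banach, second_countable_topology}"
  assumes D: "\<And>x. (f has_derivative f' x) (at x)"
    and c: "\<And>v. continuous_on UNIV (\<lambda>x. f' x v)"
    and R: "\<And>x. norm x > R \<Longrightarrow> f x = 0"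
  shows "(LINT x|lborel. f' x v) = 0"
proof -
  have c0: "continuous_on UNIV f"
    using D by (blast intro: continuous_at_imp_continuous_on has_derivative_continuous)
  have R': "f' x v = 0" if "norm x > R" for x v
    using derivative_eq_0_outside[OF D R that] by simp
  have If: "integrable lborel f" by (rule integrable_continuous_cball[OF c0 R])
  have If': "integrable lborel (\<lambda>x. f' x v)" for v by (rule integrable_continuous_cball[OF c R'])
  \<comment> \<open>This ball contains the supports of \<open>f\<close> and of all its translates by
    \<open>t *\<^sub>R v\<close> with \<open>0 \<le> t \<le> 1\<close>.\<close>
  let ?B = "cball (0::'a) (R + norm v)"
  define m where "m = norm v * measure lborel ?B + 1"
  have m: "m > 0" by (simp add: m_def add_nonneg_pos)
  have "norm (LINT x|lborel. f' x v) \<le> e" if e: "e > 0" for e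
  proof -
    obtain d where d: "d > 0" "\<And>z h. norm h < d \<Longrightarrow> norm (f (z + h) - f z - f' z h) \<le> (e / m) * norm h"
      using uniform_linearization[of f f' R "e / m", OF D c R] e m by auto
    define t where "t = min 1 (d / (2 * (norm v + 1)))"
    have "norm v + 1 > 0" by (simp add: add_nonneg_pos)
    then have "t > 0" "t \<le> 1" "t \<le> d / (2 * (norm v + 1))"
      using d(1) by (auto simp: t_def)
    moreover have "t * norm v < d"
    proof -
      have "t * norm v \<le> d / (2 * (norm v + 1)) * (norm v + 1)"
        using \<open>t \<le> d / _\<close> \<open>t > 0\<close> by (intro mult_mono) auto
      also have "\<dots> = d / 2" using \<open>norm v + 1 > 0\<close> by (simp add: field_simps)
      also have "\<dots> < d" using d(1) by simp
      finally show ?thesis .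
    qed
    ultimately have t: "t > 0" "t \<le> 1" "norm (t *\<^sub>R v) < d"
      by auto
    have lin: "f' x (t *\<^sub>R v) = t *\<^sub>R f' x v" for x
      using has_derivative_bounded_linear[OF D[of x]] by (simp add: bounded_linear.linear linear_cmul)
    have shift: "integrable lborel (\<lambda>x. f (x + t *\<^sub>R v))" "(LINT x|lborel. f (x + t *\<^sub>R v)) = (LINT x|lborel. f x)"
      using integrable_shift[OF If, of "- (t *\<^sub>R v)"] by simp_all
    have "t * norm (LINT x|lborel. f' x v) = norm (LINT x|lborel. f (x + t *\<^sub>R v) - f x - f' x (t *\<^sub>R v))"
      using t shift If If' by (simp add: lin)
    also have "\<dots> \<le> (LINT x|lborel. indicat_real ?B x * ((e / m) * (t * norm v)))"
    proof (rule LINT_norm_bound)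
      show "integrable lborel (\<lambda>x. f (x + t *\<^sub>R v) - f x - f' x (t *\<^sub>R v))"
        by (intro Bochner_Integration.integrable_diff shift If If')
      show "integrable lborel (\<lambda>x. indicat_real ?B x * ((e / m) * (t * norm v)))"
        by (intro integrable_mult_left integrable_real_indicator) (auto simp: emeasure_bounded_less_top)
      fix x
      show "norm (f (x + t *\<^sub>R v) - f x - f' x (t *\<^sub>R v)) \<le> indicat_real ?B x * ((e / m) * (t * norm v))"
      proof (cases "x \<in> ?B")
        case True
        then show ?thesis using d(2)[OF t(3), of x] t by simp
      next
        case False
        then have "norm x > R + norm v" by simp
        moreover have "norm (t *\<^sub>R v) \<le> norm v"
          using t by (simp add: mult_left_le_one_le)
        moreover have "norm x \<le> norm (x + t *\<^sub>R v) + norm (t *\<^sub>R v)"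
          using norm_triangle_ineq4[of "x + t *\<^sub>R v" "t *\<^sub>R v"] by simp
        ultimately have "norm (x + t *\<^sub>R v) > R" "norm x > R"
          using norm_ge_zero[of v] by linarith+
        then show ?thesis using R R' False by simp
      qed
    qed
    also have "\<dots> = t * (e * ((norm v * measure lborel ?B) / m))"
      by simp
    also have "\<dots> \<le> t * (e * 1)"
      using t e m by (intro mult_left_mono) (auto simp: m_def)
    finally show ?thesis using t by simp
  qed
  then have "norm (LINT x|lborel. f' x v) \<le> 0"
    by (rule field_le_epsilon[of _ 0, simplified])
  then show ?thesis by simp
qed

lemma test_function_cball:
  assumes "\<phi> \<in> test_functions U"
  obtains R where "\<And>X. norm X > R \<Longrightarrow> \<phi> X = 0" "closure {X. \<phi> X \<noteq> 0} \<subseteq> cball 0 R"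
proof -
  obtain R where R: "closure {X. \<phi> X \<noteq> 0} \<subseteq> cball 0 R"
    using bounded_subset_ballD[OF compact_imp_bounded[OF test_functionsD(2)[OF assms]], of 0]
    by (meson ball_subset_cball order_trans)
  moreover have "\<phi> X = 0" if "norm X > R" for X
    using R that test_functionsD(4)[OF assms, of X] by (metis mem_cball_0 not_le subset_eq)
  ultimately show ?thesis using that by blast
qed

lemma integral_by_parts_test:
  fixes f :: "real ^ 'n::finite \<Rightarrow> complex"
  assumes D: "\<And>x. (f has_derivative f' x) (at x)"
    and c: "\<And>v. continuous_on UNIV (\<lambda>x. f' x v)"
    and \<phi>: "\<phi> \<in> test_functions U"
  shows "(LINT X|lborel. f X * classical_grad \<phi> X $ i) = - (LINT X|lborel. f' X (axis i 1) * \<phi> X)"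
proof -
  note sm = test_functionsD(1)[OF \<phi>]
  let ?D = "\<lambda>X. frechet_derivative \<phi> (at X)"
  obtain R where R: "\<And>X. norm X > R \<Longrightarrow> \<phi> X = 0"
    using test_function_cball[OF \<phi>] by metis
  have c0: "continuous_on UNIV f"
    using D by (blast intro: continuous_at_imp_continuous_on has_derivative_continuous)
  have R': "?D x v = 0" if "norm x > R" for x v
    using derivative_eq_0_outside[OF smooth_fun_has_derivative[OF sm] R that] by simp
  have I1: "integrable lborel (\<lambda>X. f X * ?D X v)" for v
    by (rule integrable_continuous_cball[of _ R])
      (auto intro!: continuous_intros c0 smooth_fun_continuous_derivative[OF sm] simp: R')
  have I2: "integrable lborel (\<lambda>X. f' X v * \<phi> X)" for v
    by (rule integrable_continuous_cball[of _ R])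
      (auto intro!: continuous_intros c smooth_fun_continuous[OF sm] simp: R)
  have "(LINT X|lborel. f X * ?D X (axis i 1) + f' X (axis i 1) * \<phi> X) = 0"
  proof (rule integral_derivative_eq_0[where R = R and f = "\<lambda>X. f X * \<phi> X" and f' = "\<lambda>X v. f X * ?D X v + f' X v * \<phi> X"])
    show "((\<lambda>X. f X * \<phi> X) has_derivative (\<lambda>v. f X * ?D X v + f' X v * \<phi> X)) (at X)" for X
      by (rule has_derivative_mult[OF D smooth_fun_has_derivative[OF sm]])
    show "continuous_on UNIV (\<lambda>X. f X * ?D X v + f' X v * \<phi> X)" for v
      by (intro continuous_intros c c0 smooth_fun_continuous[OF sm] smooth_fun_continuous_derivative[OF sm])
  qed (simp add: R)
  then show ?thesis
    by (simp add: Bochner_Integration.integral_add[OF I1 I2] classical_grad_def eq_neg_iff_add_eq_0)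
qed

lemma compact_set_integrable_continuous:
  fixes f :: "'a::euclidean_space \<Rightarrow> 'b::{banach, second_countable_topology}"
  assumes "continuous_on UNIV f" "compact K"
  shows "set_integrable lborel K f"
  unfolding set_integrable_def
  by (rule borel_integrable_compact) (use assms in \<open>auto intro: continuous_on_subset\<close>)

lemma wgrad_smooth:
  assumes "smooth_fun g"
  shows "wgrad U g (classical_grad g)"
  unfolding wgrad_def
proof (intro conjI allI ballI impI)
  show "g \<in> borel_measurable borel" "classical_grad g \<in> borel_measurable borel"
    using assms by (auto intro: borel_measurable_continuous_onI smooth_fun_continuous borel_measurable_classical_grad)
  fix K assume K: "compact K \<and> K \<subseteq> U"
  have "continuous_on UNIV (classical_grad g)"
    by (rule continuous_on_classical_grad[OF assms])
  then show "set_integrable lborel K g" "set_integrable lborel K (classical_grad g)"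
    using K by (auto intro: compact_set_integrable_continuous smooth_fun_continuous[OF assms])
next
  fix \<phi> i assume "\<phi> \<in> test_functions U"
  from integral_by_parts_test[OF smooth_fun_has_derivative[OF assms] smooth_fun_continuous_derivative[OF assms] this]
  show "(LINT X|lborel. g X * classical_grad \<phi> X $ i) = - (LINT X|lborel. classical_grad g X $ i * \<phi> X)"
    by (simp add: classical_grad_def)
qed

lemma integrable_test:
  assumes \<phi>: "\<phi> \<in> test_functions U" and f: "\<And>K. compact K \<Longrightarrow> K \<subseteq> U \<Longrightarrow> set_integrable lborel K f"
  shows "integrable lborel (\<lambda>X. f X * \<phi> X)" "integrable lborel (\<lambda>X. f X * classical_grad \<phi> X $ i)"
proof -
  note \<phi>' = test_functionsD[OF \<phi>]
  show "integrable lborel (\<lambda>X. f X * \<phi> X)"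
    by (rule integrable_mult_continuous[OF f[OF \<phi>'(2,3)] \<phi>'(2) smooth_fun_continuous[OF \<phi>'(1)] \<phi>'(4)])
  show "integrable lborel (\<lambda>X. f X * classical_grad \<phi> X $ i)"
    by (rule integrable_mult_continuous[OF f[OF \<phi>'(2,3)] \<phi>'(2) continuous_classical_grad[OF \<phi>'(1)]])
      (simp add: classical_grad_def frechet_derivative_eq_0_off_support[OF \<phi>'(1)])
qed

lemma set_integrable_vec_nth:
  fixes G :: "real ^ 'm::finite \<Rightarrow> complex ^ 'n::finite"
  assumes "set_integrable lborel K G"
  shows "set_integrable lborel K (\<lambda>X. G X $ i)"
proof -
  have "integrable lborel (\<lambda>X. (indicator K X *\<^sub>R G X) $ i)"
    using assms unfolding set_integrable_def by (rule integrable_bounded_linear[OF bounded_linear_vec_nth])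
  then show ?thesis by (simp add: set_integrable_def)
qed

lemma wgrad_diff:
  assumes "wgrad U u G" "wgrad U v H"
  shows "wgrad U (\<lambda>X. u X - v X) (\<lambda>X. G X - H X)"
  unfolding wgrad_def
proof (intro conjI allI ballI impI)
  note u = wgradD[OF assms(1)] and v = wgradD[OF assms(2)]
  note [measurable] = u(1,2) v(1,2)
  show "(\<lambda>X. u X - v X) \<in> borel_measurable borel" "(\<lambda>X. G X - H X) \<in> borel_measurable borel"
    by measurable
  fix K assume "compact K \<and> K \<subseteq> U"
  then show "set_integrable lborel K (\<lambda>X. u X - v X)" "set_integrable lborel K (\<lambda>X. G X - H X)"
    by (auto intro!: set_integral_diff(1) u v)
next
  note u = wgradD[OF assms(1)] and v = wgradD[OF assms(2)]
  fix \<phi> i assume \<phi>: "\<phi> \<in> test_functions U"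
  have nth: "set_integrable lborel K (\<lambda>X. G X $ i)" "set_integrable lborel K (\<lambda>X. H X $ i)"
    if "compact K" "K \<subseteq> U" for K
    using that by (auto intro: set_integrable_vec_nth u v)
  show "(LINT X|lborel. (u X - v X) * classical_grad \<phi> X $ i) = - (LINT X|lborel. (G X - H X) $ i * \<phi> X)"
    using u(5)[OF \<phi>, of i] v(5)[OF \<phi>, of i]
      integrable_test(2)[OF \<phi> u(3), of i] integrable_test(2)[OF \<phi> v(3), of i]
      integrable_test(1)[OF \<phi> nth(1)] integrable_test(1)[OF \<phi> nth(2)]
    by (simp add: left_diff_distrib)
qed

lemma set_integrable_continuous_mult:
  fixes f :: "real ^ 'm::finite \<Rightarrow> complex"
  assumes "set_integrable lborel K f" "continuous_on UNIV h" "compact K"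
  shows "set_integrable lborel K (\<lambda>X. h X * f X)"
proof -
  have "bounded (h ` K)"
    using assms by (intro compact_imp_bounded compact_continuous_image) (auto intro: continuous_on_subset)
  then obtain M where M: "\<And>X. X \<in> K \<Longrightarrow> norm (h X) \<le> M"
    by (auto simp: bounded_iff)
  have "integrable lborel (\<lambda>X. h X * (indicator K X *\<^sub>R f X))"
  proof (rule Bochner_Integration.integrable_bound)
    show "integrable lborel (\<lambda>X. M *\<^sub>R (indicator K X *\<^sub>R f X))"
      using assms(1) unfolding set_integrable_def by (rule integrable_scaleR_right)
    show "(\<lambda>X. h X * (indicat_real K X *\<^sub>R f X)) \<in> borel_measurable lborel"
      using assms(1) borel_measurable_continuous_onI[OF assms(2)] unfolding set_integrable_def
      by (intro borel_measurable_times) auto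
    show "AE X in lborel. norm (h X * (indicat_real K X *\<^sub>R f X)) \<le> norm (M *\<^sub>R indicat_real K X *\<^sub>R f X)"
    proof (intro AE_I2)
      fix X
      show "norm (h X * (indicat_real K X *\<^sub>R f X)) \<le> norm (M *\<^sub>R indicat_real K X *\<^sub>R f X)"
      proof (cases "X \<in> K")
        case True
        then have "norm (h X) \<le> \<bar>M\<bar>" using M by fastforce
        then show ?thesis
          using True by (simp add: norm_mult mult_right_mono)
      qed simp
    qed
  qed
  then show ?thesis by (simp add: set_integrable_def)
qed

lemma classical_grad_mult:
  assumes "smooth_fun f" "smooth_fun g"
  shows "classical_grad (\<lambda>X. f X * g X) X $ i = f X * classical_grad g X $ i + classical_grad f X $ i * g X"
  using frechet_derivative_at[OF has_derivative_mult[OF smooth_fun_has_derivative[OF assms(1)] smooth_fun_has_derivative[OF assms(2)]]]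
  by (metis (no_types, lifting) classical_grad_def vec_lambda_beta)

lemma set_integrable_vec_lambda:
  fixes G :: "real ^ 'm::finite \<Rightarrow> complex ^ 'n::finite"
  assumes "\<And>i. set_integrable lborel K (\<lambda>X. G X $ i)"
  shows "set_integrable lborel K G"
proof -
  have "integrable lborel (\<lambda>X. \<Sum>i\<in>UNIV. axis i ((indicator K X *\<^sub>R G X) $ i))"
  proof (intro Bochner_Integration.integrable_sum)
    fix i :: 'n
    have "bounded_linear (\<lambda>c::complex. axis i c :: complex^'n)"
      by (auto intro!: linear_conv_bounded_linear[THEN iffD1] linearI simp: axis_def vec_eq_iff)
    from integrable_bounded_linear[OF this assms[of i, unfolded set_integrable_def]]
    show "integrable lborel (\<lambda>X. axis i ((indicator K X *\<^sub>R G X) $ i))"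
      by simp
  qed
  moreover have "(\<Sum>i\<in>UNIV. axis i ((indicator K X *\<^sub>R G X) $ i)) = indicator K X *\<^sub>R G X" for X
    by (simp add: vec_eq_iff axis_def sum.delta)
  ultimately show ?thesis by (simp add: set_integrable_def)
qed

text \<open>With \<phi> also \<open>\<theta> \<phi>\<close> is a test function; testing
  \<open>u\<close> with it and expanding its gradient by the classical product rule moves \<theta>
  over to \<open>u\<close>.\<close>

lemma wgrad_mult_smooth:
  assumes u: "wgrad U u G" and \<theta>: "smooth_fun \<theta>"
  shows "wgrad U (\<lambda>X. \<theta> X * u X) (\<lambda>X. \<chi> i. \<theta> X * G X $ i + classical_grad \<theta> X $ i * u X)"
  unfolding wgrad_def
proof (intro conjI allI ballI impI)
  note u' = wgradD[OF u]
  note [measurable] = u'(1,2)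
  have [measurable]: "\<theta> \<in> borel_measurable borel" "classical_grad \<theta> \<in> borel_measurable borel"
    using \<theta> by (auto intro: borel_measurable_continuous_onI smooth_fun_continuous borel_measurable_classical_grad)
  show "(\<lambda>X. \<theta> X * u X) \<in> borel_measurable borel"
    "(\<lambda>X. \<chi> i. \<theta> X * G X $ i + classical_grad \<theta> X $ i * u X) \<in> borel_measurable borel"
    by measurable
  fix K assume K: "compact K \<and> K \<subseteq> U"
  show "set_integrable lborel K (\<lambda>X. \<theta> X * u X)"
    using K by (intro set_integrable_continuous_mult u' smooth_fun_continuous[OF \<theta>]) auto
  show "set_integrable lborel K (\<lambda>X. \<chi> i. \<theta> X * G X $ i + classical_grad \<theta> X $ i * u X)"
  proof (rule set_integrable_vec_lambda)
    fix i
    have "set_integrable lborel K (\<lambda>X. \<theta> X * G X $ i)"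
      using K by (intro set_integrable_continuous_mult[OF set_integrable_vec_nth[OF u'(4)] smooth_fun_continuous[OF \<theta>]]) auto
    moreover have "set_integrable lborel K (\<lambda>X. classical_grad \<theta> X $ i * u X)"
      using K by (intro set_integrable_continuous_mult[OF u'(3) continuous_classical_grad[OF \<theta>]]) auto
    ultimately show "set_integrable lborel K (\<lambda>X. (\<chi> i. \<theta> X * G X $ i + classical_grad \<theta> X $ i * u X) $ i)"
      by (simp add: set_integral_add(1))
  qed
next
  note u' = wgradD[OF u]
  fix \<phi> i assume \<phi>: "\<phi> \<in> test_functions U"
  note \<phi>' = test_functionsD[OF \<phi>]
  have \<theta>\<phi>: "(\<lambda>X. \<theta> X * \<phi> X) \<in> test_functions U"
  proof (rule test_functionsI[OF smooth_fun_mult[OF \<theta> \<phi>'(1)] \<phi>'(2,3)])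
    show "\<theta> X * \<phi> X = 0" if "X \<notin> closure {X. \<phi> X \<noteq> 0}" for X
      using \<phi>'(4)[OF that] by simp
  qed
  have lu: "set_integrable lborel K (\<lambda>X. \<theta> X * u X)" "set_integrable lborel K (\<lambda>X. classical_grad \<theta> X $ i * u X)"
    "set_integrable lborel K (\<lambda>X. \<theta> X * G X $ i)"
    if "compact K" "K \<subseteq> U" for K
    using that set_integrable_continuous_mult[OF u'(3) smooth_fun_continuous[OF \<theta>], of K]
      set_integrable_continuous_mult[OF u'(3) continuous_classical_grad[OF \<theta>], of K i]
      set_integrable_continuous_mult[OF set_integrable_vec_nth[OF u'(4)] smooth_fun_continuous[OF \<theta>], of K i] by simp_all
  have I1: "integrable lborel (\<lambda>X. \<theta> X * u X * classical_grad \<phi> X $ i)"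
    by (rule integrable_test(2)[OF \<phi> lu(1)])
  have I2: "integrable lborel (\<lambda>X. classical_grad \<theta> X $ i * u X * \<phi> X)"
    by (rule integrable_test(1)[OF \<phi> lu(2)])
  have I3: "integrable lborel (\<lambda>X. \<theta> X * G X $ i * \<phi> X)"
    by (rule integrable_test(1)[OF \<phi> lu(3)])
  have "(LINT X|lborel. \<theta> X * u X * classical_grad \<phi> X $ i) + (LINT X|lborel. classical_grad \<theta> X $ i * u X * \<phi> X)
      = (LINT X|lborel. u X * classical_grad (\<lambda>X. \<theta> X * \<phi> X) X $ i)"
    unfolding Bochner_Integration.integral_add[OF I1 I2, symmetric]
    by (intro Bochner_Integration.integral_cong refl) (simp only: classical_grad_mult[OF \<theta> \<phi>'(1)], simp add: algebra_simps)
  also have "\<dots> = - (LINT X|lborel. \<theta> X * G X $ i * \<phi> X)"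
    unfolding u'(5)[OF \<theta>\<phi>] by (simp add: mult.assoc mult.left_commute)
  finally show "(LINT X|lborel. \<theta> X * u X * classical_grad \<phi> X $ i)
      = - (LINT X|lborel. (\<chi> i. \<theta> X * G X $ i + classical_grad \<theta> X $ i * u X) $ i * \<phi> X)"
    using Bochner_Integration.integral_add[OF I3 I2] by (simp add: distrib_right add_eq_0_iff algebra_simps)
qed

section \<open>Mollification commutes with the weak gradient\<close>

lemma compact_nbhd:
  fixes K U :: "'a::euclidean_space set"
  assumes K: "compact K" and U: "open U" "K \<subseteq> U"
  obtains r K' where "r > 0" "compact K'" "K' \<subseteq> U" "\<And>x. x \<in> K \<Longrightarrow> cball x r \<subseteq> K'"
proof -
  obtain e where e: "e > 0" "(\<Union>x\<in>K. ball x e) \<subseteq> U"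
    using compact_subset_open_imp_ball_epsilon_subset[OF K U] by metis
  define K' where "K' = (\<Union>x\<in>K. \<Union>y\<in>cball 0 (e/2). {x + y})"
  have "compact K'"
    unfolding K'_def by (rule compact_sums'[OF K]) simp
  moreover have "K' \<subseteq> U"
    using e by (force simp: K'_def dist_norm)
  moreover have "cball x (e/2) \<subseteq> K'" if "x \<in> K" for x
  proof
    fix z assume "z \<in> cball x (e/2)"
    then have "z - x \<in> cball 0 (e/2)" by (simp add: dist_norm norm_minus_commute)
    then show "z \<in> K'" unfolding K'_def using that by (intro UN_I[of x] UN_I[of "z - x"]) auto
  qed
  ultimately show ?thesis using e(1) that[of "e/2" K'] by simp
qed

text \<open>The kernel is even, hence its derivative is odd. The sign is what turns differentiation
  in \<open>x\<close> of \<open>moll r (x - y)\<close> into the minus sign of the weak gradient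
  identity.\<close>

lemma frechet_moll_minus:
  assumes "r > 0"
  shows "frechet_derivative (moll r) (at (- z)) v = - frechet_derivative (moll r) (at (z::'a::euclidean_space)) v"
proof -
  have "(moll r \<circ> uminus has_derivative frechet_derivative (moll r) (at (- z)) \<circ> uminus) (at z)"
    by (intro diff_chain_at smooth_fun_has_derivative[OF smooth_moll[OF assms]]) (auto intro!: derivative_eq_intros)
  moreover have "moll r \<circ> uminus = (moll r :: 'a \<Rightarrow> real)"
    by (simp add: fun_eq_iff moll_minus)
  ultimately have "frechet_derivative (moll r) (at z) = frechet_derivative (moll r) (at (- z)) \<circ> uminus"
    using frechet_derivative_at by metis
  then have "frechet_derivative (moll r) (at z) v = frechet_derivative (moll r) (at (- z)) (- v)"
    by simp
  also have "\<dots> = - frechet_derivative (moll r) (at (- z)) v"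
    using has_derivative_bounded_linear[OF smooth_fun_has_derivative[OF smooth_moll[OF assms], of "- z"]]
    by (simp add: bounded_linear.linear linear_neg)
  finally show ?thesis by simp
qed

text \<open>A zero of the nonnegative mollifier is a minimum.\<close>

lemma frechet_moll_eq_0:
  assumes "r > 0" "norm x \<ge> r"
  shows "frechet_derivative (moll r) (at (x::'a::euclidean_space)) = (\<lambda>v. 0)"
proof (rule differential_zero_maxmin[OF _ open_UNIV])
  show "(moll r has_derivative frechet_derivative (moll r) (at x)) (at x)"
    by (rule smooth_fun_has_derivative[OF smooth_moll[OF assms(1)]])
qed (use moll_nonneg[OF assms(1)] moll_eq_0[OF assms] in auto)

text \<open>As a function of \<open>y\<close> the kernel \<open>moll r (y - x)\<close> is a test
  function on \<open>U\<close>, since \<open>cball x r\<close> lies in \<open>U\<close>; the weak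
  gradient identity for this test function is the claim. Restriction to \<open>K'\<close> makes the
  convolutions globally integrable and does not affect the values at \<open>x\<close>.\<close>

lemma classical_grad_conv_moll:
  fixes u :: "real ^ 'n::finite \<Rightarrow> complex"
  assumes u: "wgrad U u G" and K': "compact K'" "K' \<subseteq> U" and r: "r > 0" and x: "cball x r \<subseteq> K'"
  shows "classical_grad (conv (moll r) (\<lambda>y. indicator K' y *\<^sub>R u y)) x
    = conv (moll r) (\<lambda>y. indicator K' y *\<^sub>R G y) x"
proof -
  note u' = wgradD[OF u]
  have f: "integrable lborel (\<lambda>y. indicator K' y *\<^sub>R u y)" and g: "integrable lborel (\<lambda>y. indicator K' y *\<^sub>R G y)"
    using u'(3,4)[OF K'] by (auto simp: set_integrable_def)
  let ?\<phi> = "\<lambda>y. complex_of_real (moll r (y - x))"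
  have sm: "smooth_fun (\<lambda>y. moll r (y - x))"
    using smooth_moll[OF r, where ?'a = "real^'n"] unfolding smooth_fun_def by (blast intro: k_times_cont_diff_shift)
  have \<phi>: "?\<phi> \<in> test_functions U"
  proof (rule test_functionsI[OF smooth_fun_of_real[OF sm] compact_cball])
    show "cball x r \<subseteq> U" using x K' by blast
    show "?\<phi> y = 0" if "y \<notin> cball x r" for y
      using that moll_eq_0[OF r, of "y - x"] by (simp add: dist_norm norm_minus_commute)
  qed
  have D\<phi>: "classical_grad ?\<phi> y $ i = complex_of_real (frechet_derivative (moll r) (at (y - x)) (axis i 1))" for y i
  proof -
    have "((\<lambda>y. y - x) has_derivative (\<lambda>v. v)) (at y)"
      by (auto intro!: derivative_eq_intros)
    from has_derivative_of_real[OF has_derivative_compose[OF this smooth_fun_has_derivative[OF smooth_moll[OF r]]]]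
    have "(?\<phi> has_derivative (\<lambda>v. complex_of_real (frechet_derivative (moll r) (at (y - x)) v))) (at y)" .
    from frechet_derivative_at[OF this, symmetric] show ?thesis
      by (simp add: classical_grad_def)
  qed
  have "classical_grad (conv (moll r) (\<lambda>y. indicator K' y *\<^sub>R u y)) x $ i
      = conv (moll r) (\<lambda>y. indicator K' y *\<^sub>R G y) x $ i" for i
  proof -
    have "classical_grad (conv (moll r) (\<lambda>y. indicator K' y *\<^sub>R u y)) x $ i
      = conv (\<lambda>z. frechet_derivative (moll r) (at z) (axis i 1)) (\<lambda>y. indicator K' y *\<^sub>R u y) x"
      unfolding classical_grad_def by (simp add: frechet_derivative_at[OF conv_moll_has_derivative[OF f r], symmetric])
    also have "\<dots> = (LINT y|lborel. - (u y * classical_grad ?\<phi> y $ i))"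
      unfolding conv_def
    proof (rule Bochner_Integration.integral_cong[OF refl])
      fix y
      show "frechet_derivative (moll r) (at (x - y)) (axis i 1) *\<^sub>R indicat_real K' y *\<^sub>R u y = - (u y * classical_grad ?\<phi> y $ i)"
      proof (cases "y \<in> K'")
        case True
        then show ?thesis
          using frechet_moll_minus[OF r, of "y - x"] by (simp add: D\<phi> scaleR_conv_of_real mult.commute)
      next
        case False
        then have "r \<le> norm (y - x)"
          using x by (force simp: dist_norm norm_minus_commute not_le)
        then show ?thesis using False by (simp add: D\<phi> frechet_moll_eq_0[OF r])
      qed
    qed
    also have "\<dots> = (LINT y|lborel. G y $ i * ?\<phi> y)"
      using u'(5)[OF \<phi>, of i] by simp
    also have "\<dots> = (LINT y|lborel. (moll r (x - y) *\<^sub>R (indicator K' y *\<^sub>R G y)) $ i)"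
    proof (rule Bochner_Integration.integral_cong[OF refl])
      fix y
      have e: "moll r (x - y) = moll r (y - x)"
        using moll_minus[of r "y - x"] by simp
      show "G y $ i * ?\<phi> y = (moll r (x - y) *\<^sub>R (indicator K' y *\<^sub>R G y)) $ i"
      proof (cases "y \<in> K'")
        case True
        then show ?thesis by (simp add: e) (simp add: scaleR_conv_of_real mult.commute)
      next
        case False
        then have "r \<le> norm (y - x)"
          using x by (force simp: dist_norm norm_minus_commute not_le)
        then show ?thesis using False by (simp add: e moll_eq_0[OF r])
      qed
    qed
    also have "\<dots> = conv (moll r) (\<lambda>y. indicator K' y *\<^sub>R G y) x $ i"
      unfolding conv_def
      by (rule integral_bounded_linear[OF bounded_linear_vec_nth integrable_conv_moll[OF g r]])
    finally show ?thesis .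
  qed
  then show ?thesis by (simp add: vec_eq_iff)
qed

lemma integrable_conv_moll_fun:
  fixes f :: "'a::euclidean_space \<Rightarrow> 'b::{banach, second_countable_topology}"
  assumes f: "integrable lborel f" and r: "r > 0"
  shows "integrable lborel (conv (moll r) f)"
proof -
  have [measurable]: "f \<in> borel_measurable borel" using f by auto
  have "(\<integral>\<^sup>+x. ennreal (norm (conv (moll r) f x)) \<partial>lborel)
      \<le> (\<integral>\<^sup>+x. (\<integral>\<^sup>+h. ennreal (moll r h) * ennreal (norm (f (x - h))) \<partial>lborel) \<partial>lborel)"
  proof (intro nn_integral_mono)
    fix x
    have I: "integrable lborel (\<lambda>y. moll r (x - y) *\<^sub>R f y)"
      by (rule integrable_conv_moll[OF f r])
    have "conv (moll r) f x = (LINT h|lborel. moll r h *\<^sub>R f (x - h))"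
      using integrable_reflect(2)[OF I, of x] by (simp add: conv_def)
    moreover have "integrable lborel (\<lambda>h. moll r h *\<^sub>R f (x - h))"
      using integrable_reflect(1)[OF I, of x] by simp
    ultimately have "ennreal (norm (conv (moll r) f x)) \<le> (\<integral>\<^sup>+h. ennreal (norm (moll r h *\<^sub>R f (x - h))) \<partial>lborel)"
      using integral_norm_bound_ennreal by metis
    then show "ennreal (norm (conv (moll r) f x)) \<le> (\<integral>\<^sup>+h. ennreal (moll r h) * ennreal (norm (f (x - h))) \<partial>lborel)"
      using moll_nonneg[OF r, where ?'a = 'a] by (simp add: ennreal_mult)
  qed
  also have "\<dots> \<le> (\<integral>\<^sup>+x. ennreal (norm (f x)) \<partial>lborel)"
    using nn_integral_shift[of "\<lambda>x. ennreal (norm (f x))"] by (intro nn_integral_moll_average_le[OF r]) auto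
  also have "\<dots> < \<infinity>"
    using f by (simp add: integrable_iff_bounded)
  finally show ?thesis
    using borel_measurable_conv_moll[OF f r] by (simp add: integrable_iff_bounded)
qed

lemma ennreal_tendsto_0I:
  assumes "\<And>e::real. e > 0 \<Longrightarrow> eventually (\<lambda>j. F j \<le> ennreal e) net"
  shows "(F \<longlongrightarrow> 0) net"
proof (rule order_tendstoI)
  fix a :: ennreal assume "0 < a"
  then obtain b where b: "0 < b" "b < a" using dense by blast
  from b(2) have "b < top" by (rule less_le_trans) simp
  with b(1) have "enn2real b > 0" "ennreal (enn2real b) = b"
    by (simp_all add: enn2real_positive_iff)
  with assms[of "enn2real b"] have "eventually (\<lambda>j. F j \<le> b) net" by simp
  then show "eventually (\<lambda>j. F j < a) net"
    by eventually_elim (use b(2) in order)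
qed simp

lemma conv_moll_L1_tendsto:
  fixes f :: "'a::euclidean_space \<Rightarrow> 'b::{banach, second_countable_topology}"
  assumes f: "integrable lborel f" and \<rho>: "\<And>j. \<rho> j > 0" "\<rho> \<longlonglongrightarrow> 0"
  shows "(\<lambda>j. \<integral>\<^sup>+x. ennreal (norm (conv (moll (\<rho> j)) f x - f x)) \<partial>lborel) \<longlonglongrightarrow> 0"
proof (rule ennreal_tendsto_0I)
  fix e :: real assume "e > 0"
  then obtain d where d: "d > 0" "\<And>r. 0 < r \<Longrightarrow> r < d \<Longrightarrow>
    (\<integral>\<^sup>+x. ennreal (norm (conv (moll r) f x - f x)) \<partial>lborel) \<le> ennreal e"
    using conv_moll_L1[OF f] by metis
  have "eventually (\<lambda>j. \<rho> j < d) sequentially"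
    using \<rho>(2) d(1) by (rule order_tendstoD)
  then show "eventually (\<lambda>j. (\<integral>\<^sup>+x. ennreal (norm (conv (moll (\<rho> j)) f x - f x)) \<partial>lborel) \<le> ennreal e) sequentially"
    by eventually_elim (use d(2) \<rho>(1) in auto)
qed

lemma AE_subseq_of_L1_tendsto:
  fixes v :: "nat \<Rightarrow> 'a \<Rightarrow> 'b::{banach, second_countable_topology}"
  assumes v: "\<And>j. integrable M (v j)" and f: "integrable M f"
    and lim: "(\<lambda>j. \<integral>\<^sup>+x. ennreal (norm (v j x - f x)) \<partial>M) \<longlonglongrightarrow> 0"
  obtains s :: "nat \<Rightarrow> nat" where "strict_mono s" "AE x in M. (\<lambda>j. v (s j) x) \<longlonglongrightarrow> f x"
proof -
  have I: "integrable M (\<lambda>x. v j x - f x)" for j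
    using v f by (rule Bochner_Integration.integrable_diff)
  have "ennreal (LINT x|M. norm (v j x - f x)) = (\<integral>\<^sup>+x. ennreal (norm (v j x - f x)) \<partial>M)" for j
    using I by (intro nn_integral_eq_integral[symmetric]) auto
  then have "(\<lambda>j. ennreal (LINT x|M. norm (v j x - f x))) \<longlonglongrightarrow> ennreal 0"
    using lim by simp
  then have "(\<lambda>j. LINT x|M. norm (v j x - f x)) \<longlonglongrightarrow> 0"
    by (subst (asm) tendsto_ennreal_iff) auto
  from tendsto_L1_AE_subseq[OF I this] obtain s :: "nat \<Rightarrow> nat" where
    "strict_mono s" "AE x in M. (\<lambda>n. v (s n) x - f x) \<longlonglongrightarrow> 0" by blast
  then show ?thesis using that by (simp add: LIM_zero_iff)
qed

section \<open>Chain rule for Lipschitz C1 functions of weakly differentiable functions\<close>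

locale C1_lipschitz =
  fixes P :: "complex \<Rightarrow> complex" and D :: "complex \<Rightarrow> complex \<Rightarrow> complex" and L :: real
  assumes deriv: "(P has_derivative D z) (at z)"
    and cont: "continuous_on UNIV (\<lambda>z. D z v)"
    and bound: "cmod (D z v) \<le> L * cmod v"
begin

lemma L_nonneg: "0 \<le> L"
  using order_trans[OF norm_ge_zero bound[of 0 1]] by simp

lemma lipschitz: "cmod (P a - P b) \<le> L * cmod (a - b)"
  by (rule differentiable_bound[OF convex_UNIV has_derivative_at_withinI[OF deriv]])
    (auto intro: onorm_le bound)

lemma linear_D: "linear (D z)"
  using deriv has_derivative_bounded_linear bounded_linear.linear by blast

text \<open>\<open>P\<close> is differentiable in the real sense only, so \<open>D z\<close> is
  determined by its values at 1 and \<open>\<i>\<close>. This reduces joint continuity and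
  measurability to the fixed directions of assumption \<open>cont\<close>.\<close>

lemma expand: "D z w = Re w *\<^sub>R D z 1 + Im w *\<^sub>R D z \<i>"
proof -
  have "D z w = D z (Re w *\<^sub>R 1 + Im w *\<^sub>R \<i>)"
    by (rule arg_cong[of _ _ "D z"]) (simp add: complex_eq_iff)
  then show ?thesis
    by (simp add: linear_add[OF linear_D] linear_cmul[OF linear_D])
qed

lemma continuous_P: "continuous_on S P"
  using deriv by (meson continuous_at_imp_continuous_on has_derivative_continuous)

lemma borel_measurable_P: "u \<in> borel_measurable M \<Longrightarrow> (\<lambda>x. P (u x)) \<in> borel_measurable M"
  using measurable_compose borel_measurable_continuous_onI[OF continuous_P] by blast

lemma continuous_D:
  assumes "continuous_on S u" "continuous_on S w"
  shows "continuous_on S (\<lambda>x. D (u x) (w x))"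
  by (subst expand, intro continuous_intros assms continuous_on_compose2[OF cont assms(1)]) auto

lemma borel_measurable_D:
  assumes [measurable]: "u \<in> borel_measurable M" "w \<in> borel_measurable M"
  shows "(\<lambda>x. D (u x) (w x)) \<in> borel_measurable M"
proof -
  have [measurable]: "(\<lambda>z. D z v) \<in> borel_measurable borel" for v
    by (rule borel_measurable_continuous_onI[OF cont])
  show ?thesis by (subst expand) measurable
qed

lemma set_integrable_P:
  fixes u :: "real ^ 'n::finite \<Rightarrow> complex"
  assumes u: "set_integrable lborel K u" "u \<in> borel_measurable borel" and K: "compact K"
  shows "set_integrable lborel K (\<lambda>X. P (u X))"
  unfolding set_integrable_def
proof (rule Bochner_Integration.integrable_bound)
  have [measurable]: "K \<in> sets borel" using K by (rule borel_compact)
  note [measurable] = borel_measurable_P[OF u(2)]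
  show "integrable lborel (\<lambda>X. indicat_real K X * cmod (P 0) + L * norm (indicat_real K X *\<^sub>R u X))"
    using u(1) K unfolding set_integrable_def
    by (intro Bochner_Integration.integrable_add integrable_mult_left integrable_mult_right integrable_norm
        integrable_real_indicator) (auto simp: emeasure_bounded_less_top compact_imp_bounded)
  show "(\<lambda>X. indicat_real K X *\<^sub>R P (u X)) \<in> borel_measurable lborel"
    by measurable
  show "AE X in lborel. norm (indicat_real K X *\<^sub>R P (u X)) \<le> norm (indicat_real K X * cmod (P 0) + L * norm (indicat_real K X *\<^sub>R u X))"
  proof (intro AE_I2)
    fix X
    have "cmod (P (u X)) \<le> cmod (P 0) + L * cmod (u X)"
      using lipschitz[of "u X" 0] norm_triangle_sub[of "P (u X)" "P 0"] by simp
    then show "norm (indicat_real K X *\<^sub>R P (u X)) \<le> norm (indicat_real K X * cmod (P 0) + L * norm (indicat_real K X *\<^sub>R u X))"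
      using L_nonneg by (auto simp: indicator_def)
  qed
qed

lemma set_integrable_D:
  fixes u w :: "real ^ 'n::finite \<Rightarrow> complex"
  assumes u: "u \<in> borel_measurable borel" and w: "set_integrable lborel K w" "w \<in> borel_measurable borel" and K: "compact K"
  shows "set_integrable lborel K (\<lambda>X. D (u X) (w X))"
  unfolding set_integrable_def
proof (rule Bochner_Integration.integrable_bound)
  have [measurable]: "K \<in> sets borel" using K by (rule borel_compact)
  note [measurable] = borel_measurable_D[OF u w(2)]
  show "integrable lborel (\<lambda>X. L *\<^sub>R (indicat_real K X *\<^sub>R w X))"
    using w(1) unfolding set_integrable_def by (rule integrable_scaleR_right)
  show "(\<lambda>X. indicat_real K X *\<^sub>R D (u X) (w X)) \<in> borel_measurable lborel"
    by measurable
  show "AE X in lborel. norm (indicat_real K X *\<^sub>R D (u X) (w X)) \<le> norm (L *\<^sub>R (indicat_real K X *\<^sub>R w X))"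
    using bound L_nonneg by (intro AE_I2) (auto simp: indicator_def)
qed

text \<open>Near the support of the test function \<open>u\<close> is mollified, the classical chain
  rule is applied, and the limit is taken on both sides. The left side converges in L1 since
  \<open>P\<close> is Lipschitz. On the right the gradient is replaced by its limit first and the
  argument of \<open>D\<close> afterwards, because the two replacements converge for different
  reasons.\<close>

lemma wgrad_chain:
  fixes u :: "real ^ 'n::finite \<Rightarrow> complex"
  assumes U: "open U" and u: "wgrad U u G"
  shows "wgrad U (\<lambda>X. P (u X)) (\<lambda>X. \<chi> i. D (u X) (G X $ i))"
  unfolding wgrad_def
proof (intro conjI allI ballI impI)
  note u' = wgradD[OF u]
  note [measurable] = u'(1,2)
  show "(\<lambda>X. P (u X)) \<in> borel_measurable borel"
    by (rule borel_measurable_P) measurable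
  show "(\<lambda>X. \<chi> i. D (u X) (G X $ i)) \<in> borel_measurable borel"
    by (rule borel_measurable_vec_lambda, rule borel_measurable_D) measurable
  fix K assume K: "compact K \<and> K \<subseteq> U"
  show "set_integrable lborel K (\<lambda>X. P (u X))"
    using K u' by (intro set_integrable_P) auto
  have "set_integrable lborel K (\<lambda>X. D (u X) (G X $ i))" for i
    using K by (intro set_integrable_D set_integrable_vec_nth u' borel_measurable_vec_nth) auto
  then show "set_integrable lborel K (\<lambda>X. \<chi> i. D (u X) (G X $ i))"
    by (intro set_integrable_vec_lambda) simp
next
  note u' = wgradD[OF u]
  fix \<phi> i assume \<phi>: "\<phi> \<in> test_functions U"
  note \<phi>' = test_functionsD[OF \<phi>]
  define K where "K = closure {X. \<phi> X \<noteq> 0}"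
  have K: "compact K" "K \<subseteq> U" using \<phi>'(2,3) by (auto simp: K_def)
  obtain r K' where r: "r > 0" and K': "compact K'" "K' \<subseteq> U" and nb: "\<And>x. x \<in> K \<Longrightarrow> cball x r \<subseteq> K'"
    using compact_nbhd[OF K(1) U K(2)] by blast
  have KK': "K \<subseteq> K'" using nb r by fastforce
  define f where "f = (\<lambda>y. indicator K' y *\<^sub>R u y)"
  define g where "g = (\<lambda>y. indicator K' y *\<^sub>R G y)"
  have [measurable]: "K' \<in> sets borel" using K' by (auto intro: borel_compact)
  note [measurable] = u'(1,2)
  have f: "integrable lborel f" and g: "integrable lborel g"
    using u'(3,4)[OF K'] by (auto simp: f_def g_def set_integrable_def)
  define \<rho> where "\<rho> = (\<lambda>j. r / real (Suc j))"
  have \<rho>: "\<rho> j > 0" "\<rho> j \<le> r" for j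
    using r by (auto simp: \<rho>_def field_simps)
  have \<rho>0: "\<rho> \<longlonglongrightarrow> 0"
    unfolding \<rho>_def by (rule LIMSEQ_Suc[OF lim_const_over_n])
  define v where "v j = conv (moll (\<rho> j)) f" for j
  define h where "h j = conv (moll (\<rho> j)) g" for j
  have v: "integrable lborel (v j)" "smooth_fun (v j)" and h: "integrable lborel (h j)" for j
    using f g \<rho> by (auto simp: v_def h_def intro: integrable_conv_moll_fun smooth_conv_moll)
  have [measurable]: "v j \<in> borel_measurable borel" "h j \<in> borel_measurable borel" "f \<in> borel_measurable borel" "g \<in> borel_measurable borel" for j
    using v h f g by auto
  have lv: "(\<lambda>j. \<integral>\<^sup>+x. ennreal (norm (v j x - f x)) \<partial>lborel) \<longlonglongrightarrow> 0"
    and lh: "(\<lambda>j. \<integral>\<^sup>+x. ennreal (norm (h j x - g x)) \<partial>lborel) \<longlonglongrightarrow> 0"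
    unfolding v_def h_def using f g \<rho>(1) \<rho>0 by (auto intro: conv_moll_L1_tendsto)
  have vh: "classical_grad (v j) x = h j x" if "x \<in> K" for x j
    unfolding v_def h_def f_def g_def
    using nb[OF that] \<rho>(2)[of j] by (intro classical_grad_conv_moll[OF u K' \<rho>(1)]) force
  have [measurable]: "\<phi> \<in> borel_measurable borel" "(\<lambda>X. classical_grad \<phi> X $ i) \<in> borel_measurable borel"
    using \<phi>'(1) by (auto intro: borel_measurable_continuous_onI smooth_fun_continuous continuous_classical_grad)
  have z: "\<phi> X = 0" "classical_grad \<phi> X $ i = 0" if "X \<notin> K" for X
    using that \<phi>'(4)[of X] frechet_derivative_eq_0_off_support[OF \<phi>'(1), of X] by (auto simp: K_def classical_grad_def)
  obtain R where R: "\<And>X. norm X > R \<Longrightarrow> \<phi> X = 0" "K \<subseteq> cball 0 R"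
    using test_function_cball[OF \<phi>] unfolding K_def by metis
  obtain M1 where M1: "M1 > 0" "\<And>X. cmod (\<phi> X) \<le> M1"
    using bounded_continuous_cball[OF smooth_fun_continuous[OF \<phi>'(1)] R(1)] by metis
  have "classical_grad \<phi> X $ i = 0" if "norm X > R" for X
    using z(2)[of X] R(2) that by (meson mem_cball_0 not_le subsetD)
  from bounded_continuous_cball[OF continuous_classical_grad[OF \<phi>'(1)] this]
  obtain M2 where M2: "M2 > 0" "\<And>X. cmod (classical_grad \<phi> X $ i) \<le> M2" by blast
  have ibp: "(LINT X|lborel. P (v j X) * classical_grad \<phi> X $ i) = - (LINT X|lborel. D (v j X) (h j X $ i) * \<phi> X)" for j
  proof -
    have "(LINT X|lborel. P (v j X) * classical_grad \<phi> X $ i)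
        = - (LINT X|lborel. D (v j X) (frechet_derivative (v j) (at X) (axis i 1)) * \<phi> X)"
    proof (rule integral_by_parts_test[OF _ _ \<phi>, where f' = "\<lambda>X w. D (v j X) (frechet_derivative (v j) (at X) w)"])
      show "((\<lambda>X. P (v j X)) has_derivative (\<lambda>w. D (v j X) (frechet_derivative (v j) (at X) w))) (at X)" for X
        by (rule has_derivative_compose[OF smooth_fun_has_derivative[OF v(2)] deriv])
      show "continuous_on UNIV (\<lambda>X. D (v j X) (frechet_derivative (v j) (at X) w))" for w
        by (intro continuous_D smooth_fun_continuous v smooth_fun_continuous_derivative)
    qed
    also have "(LINT X|lborel. D (v j X) (frechet_derivative (v j) (at X) (axis i 1)) * \<phi> X) = (LINT X|lborel. D (v j X) (h j X $ i) * \<phi> X)"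
    proof (rule Bochner_Integration.integral_cong[OF refl])
      fix X
      show "D (v j X) (frechet_derivative (v j) (at X) (axis i 1)) * \<phi> X = D (v j X) (h j X $ i) * \<phi> X"
        using vh[of X j, symmetric] z(1)[of X] by (cases "X \<in> K") (auto simp: classical_grad_def)
    qed
    finally show ?thesis .
  qed
  have lim1: "(\<lambda>j. LINT X|lborel. P (v j X) * classical_grad \<phi> X $ i) \<longlonglongrightarrow> (LINT X|lborel. P (u X) * classical_grad \<phi> X $ i)"
  proof (rule tendsto_L1_int)
    have vK: "set_integrable lborel K (v j)" for j
      by (rule compact_set_integrable_continuous[OF smooth_fun_continuous[OF v(2)] K(1)])
    show "integrable lborel (\<lambda>X. P (v j X) * classical_grad \<phi> X $ i)" for j
      by (rule integrable_mult_continuous[OF set_integrable_P[OF vK _ K(1)] K(1) continuous_classical_grad[OF \<phi>'(1)] z(2)]) auto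
    show "integrable lborel (\<lambda>X. P (u X) * classical_grad \<phi> X $ i)"
      by (rule integrable_mult_continuous[OF set_integrable_P[OF u'(3)[OF K] u'(1) K(1)] K(1) continuous_classical_grad[OF \<phi>'(1)] z(2)])
    show "(\<lambda>j. \<integral>\<^sup>+X. ennreal (norm (P (v j X) * classical_grad \<phi> X $ i - P (u X) * classical_grad \<phi> X $ i)) \<partial>lborel) \<longlonglongrightarrow> 0"
    proof (rule tendsto_sandwich[OF _ _ tendsto_const])
      show "(\<lambda>j. ennreal (L * M2) * (\<integral>\<^sup>+x. ennreal (norm (v j x - f x)) \<partial>lborel)) \<longlonglongrightarrow> 0"
        using ennreal_tendsto_cmult[OF _ lv, of "ennreal (L * M2)"] by simp
      show "\<forall>\<^sub>F j in sequentially. (\<integral>\<^sup>+X. ennreal (norm (P (v j X) * classical_grad \<phi> X $ i - P (u X) * classical_grad \<phi> X $ i)) \<partial>lborel)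
          \<le> ennreal (L * M2) * (\<integral>\<^sup>+x. ennreal (norm (v j x - f x)) \<partial>lborel)"
      proof (intro always_eventually allI)
        fix j
        have "cmod (P (v j X) * classical_grad \<phi> X $ i - P (u X) * classical_grad \<phi> X $ i) \<le> L * M2 * cmod (v j X - f X)" for X
        proof (cases "X \<in> K")
          case True
          then have "u X = f X" using KK' by (auto simp: f_def)
          moreover have "cmod (P (v j X) - P (f X)) * cmod (classical_grad \<phi> X $ i) \<le> (L * cmod (v j X - f X)) * M2"
            using L_nonneg by (intro mult_mono lipschitz M2) auto
          ultimately show ?thesis by (simp add: left_diff_distrib[symmetric] norm_mult mult_ac)
        next
          case False
          then show ?thesis using L_nonneg M2(1) by (simp add: z(2))
        qed
        then have "(\<integral>\<^sup>+X. ennreal (norm (P (v j X) * classical_grad \<phi> X $ i - P (u X) * classical_grad \<phi> X $ i)) \<partial>lborel)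
          \<le> (\<integral>\<^sup>+X. ennreal (L * M2) * ennreal (norm (v j X - f X)) \<partial>lborel)"
          using L_nonneg M2(1) by (intro nn_integral_mono) (simp add: ennreal_mult[symmetric] ennreal_leI)
        also have "\<dots> = ennreal (L * M2) * (\<integral>\<^sup>+x. ennreal (norm (v j x - f x)) \<partial>lborel)"
          by (rule nn_integral_cmult) measurable
        finally show "(\<integral>\<^sup>+X. ennreal (norm (P (v j X) * classical_grad \<phi> X $ i - P (u X) * classical_grad \<phi> X $ i)) \<partial>lborel)
          \<le> ennreal (L * M2) * (\<integral>\<^sup>+x. ennreal (norm (v j x - f x)) \<partial>lborel)" .
      qed
    qed auto
  qed
  have int_D: "integrable lborel (\<lambda>X. D (w X) (b X $ i) * \<phi> X)"
    if "w \<in> borel_measurable borel" "integrable lborel b" for w :: "real^'n \<Rightarrow> complex" and b :: "real^'n \<Rightarrow> complex^'n"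
  proof (rule integrable_mult_continuous[OF set_integrable_D[OF that(1) set_integrable_vec_nth _ K(1)] K(1) smooth_fun_continuous[OF \<phi>'(1)] z(1)])
    have "K \<in> sets lborel" using K by (auto intro: borel_compact)
    then show "set_integrable lborel K b"
      using integrable_mult_indicator[of K lborel b] that(2) by (simp add: set_integrable_def)
    show "(\<lambda>X. b X $ i) \<in> borel_measurable borel"
      using that(2) by (intro borel_measurable_vec_nth) auto
  qed
  \<comment> \<open>\<open>D\<close> is linear in the direction and bounded by \<open>L\<close>
    uniformly in the base point, so L1 convergence of the mollified gradients suffices here.\<close>
  have lim2: "(\<lambda>j. LINT X|lborel. D (v j X) (h j X $ i) * \<phi> X - D (v j X) (g X $ i) * \<phi> X) \<longlonglongrightarrow> (LINT X|(lborel::(real^'n) measure). 0)"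
  proof (rule tendsto_L1_int)
    show "integrable lborel (\<lambda>X. D (v j X) (h j X $ i) * \<phi> X - D (v j X) (g X $ i) * \<phi> X)" for j
      by (intro Bochner_Integration.integrable_diff int_D h g) measurable
    show "(\<lambda>j. \<integral>\<^sup>+X. ennreal (norm (D (v j X) (h j X $ i) * \<phi> X - D (v j X) (g X $ i) * \<phi> X - 0)) \<partial>lborel) \<longlonglongrightarrow> 0"
    proof (rule tendsto_sandwich[OF _ _ tendsto_const])
      show "(\<lambda>j. ennreal (L * M1) * (\<integral>\<^sup>+x. ennreal (norm (h j x - g x)) \<partial>lborel)) \<longlonglongrightarrow> 0"
        using ennreal_tendsto_cmult[OF _ lh, of "ennreal (L * M1)"] by simp
      show "\<forall>\<^sub>F j in sequentially. (\<integral>\<^sup>+X. ennreal (norm (D (v j X) (h j X $ i) * \<phi> X - D (v j X) (g X $ i) * \<phi> X - 0)) \<partial>lborel)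
          \<le> ennreal (L * M1) * (\<integral>\<^sup>+x. ennreal (norm (h j x - g x)) \<partial>lborel)"
      proof (intro always_eventually allI)
        fix j
        have "cmod (D (v j X) (h j X $ i) * \<phi> X - D (v j X) (g X $ i) * \<phi> X) \<le> L * M1 * norm (h j X - g X)" for X
        proof -
          have "cmod (D (v j X) (h j X $ i) * \<phi> X - D (v j X) (g X $ i) * \<phi> X) = cmod (D (v j X) ((h j X - g X) $ i)) * cmod (\<phi> X)"
            by (simp add: left_diff_distrib[symmetric] norm_mult linear_diff[OF linear_D])
          also have "\<dots> \<le> (L * norm (h j X - g X)) * M1"
            using L_nonneg by (intro mult_mono M1 order_trans[OF bound] mult_left_mono Finite_Cartesian_Product.norm_nth_le) auto
          finally show ?thesis by (simp add: mult_ac)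
        qed
        then have "(\<integral>\<^sup>+X. ennreal (norm (D (v j X) (h j X $ i) * \<phi> X - D (v j X) (g X $ i) * \<phi> X - 0)) \<partial>lborel)
          \<le> (\<integral>\<^sup>+X. ennreal (L * M1) * ennreal (norm (h j X - g X)) \<partial>lborel)"
          using L_nonneg M1(1) by (intro nn_integral_mono) (simp add: ennreal_mult[symmetric] ennreal_leI)
        also have "\<dots> = ennreal (L * M1) * (\<integral>\<^sup>+x. ennreal (norm (h j x - g x)) \<partial>lborel)"
          by (rule nn_integral_cmult) measurable
        finally show "(\<integral>\<^sup>+X. ennreal (norm (D (v j X) (h j X $ i) * \<phi> X - D (v j X) (g X $ i) * \<phi> X - 0)) \<partial>lborel)
          \<le> ennreal (L * M1) * (\<integral>\<^sup>+x. ennreal (norm (h j x - g x)) \<partial>lborel)" .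
      qed
    qed auto
  qed simp
  obtain s where s: "strict_mono s" "AE x in lborel. (\<lambda>j. v (s j) x) \<longlonglongrightarrow> f x"
    using AE_subseq_of_L1_tendsto[OF v(1) f lv] by blast
  \<comment> \<open>In the base point \<open>D\<close> is merely continuous; hence almost everywhere
    convergence along a subsequence, with a majorant that involves the fixed gradient
    \<open>g\<close>.\<close>
  have lim3: "(\<lambda>j. LINT X|lborel. D (v (s j) X) (g X $ i) * \<phi> X) \<longlonglongrightarrow> (LINT X|lborel. D (f X) (g X $ i) * \<phi> X)"
  proof (rule integral_dominated_convergence[where w = "\<lambda>X. L * norm (g X) * M1"])
    have [measurable]: "(\<lambda>X. D (v j X) (g X $ i)) \<in> borel_measurable borel" "(\<lambda>X. D (f X) (g X $ i)) \<in> borel_measurable borel" for j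
      by (rule borel_measurable_D; measurable)+
    show "(\<lambda>X. D (f X) (g X $ i) * \<phi> X) \<in> borel_measurable lborel" "(\<lambda>X. D (v (s j) X) (g X $ i) * \<phi> X) \<in> borel_measurable lborel" for j
      by measurable
    show "integrable lborel (\<lambda>X. L * norm (g X) * M1)"
      using g by simp
    show "AE X in lborel. (\<lambda>j. D (v (s j) X) (g X $ i) * \<phi> X) \<longlonglongrightarrow> D (f X) (g X $ i) * \<phi> X"
      using s(2)
    proof eventually_elim
      case (elim X)
      have "isCont (\<lambda>z. D z (g X $ i)) (f X)"
        using cont by (simp add: continuous_on_eq_continuous_at)
      then show ?case
        by (intro tendsto_mult_right isCont_tendsto_compose[OF _ elim])
    qed
    show "AE X in lborel. norm (D (v (s j) X) (g X $ i) * \<phi> X) \<le> L * norm (g X) * M1" for j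
    proof (intro AE_I2)
      fix X
      have "cmod (D (v (s j) X) (g X $ i)) * cmod (\<phi> X) \<le> (L * norm (g X)) * M1"
        using L_nonneg by (intro mult_mono M1 order_trans[OF bound] mult_left_mono Finite_Cartesian_Product.norm_nth_le) auto
      then show "norm (D (v (s j) X) (g X $ i) * \<phi> X) \<le> L * norm (g X) * M1"
        by (simp add: norm_mult)
    qed
  qed
  have "(\<lambda>j. - ((LINT X|lborel. D (v (s j) X) (h (s j) X $ i) * \<phi> X - D (v (s j) X) (g X $ i) * \<phi> X)
       + (LINT X|lborel. D (v (s j) X) (g X $ i) * \<phi> X))) \<longlonglongrightarrow> - ((LINT X|(lborel::(real^'n) measure). 0) + (LINT X|lborel. D (f X) (g X $ i) * \<phi> X))"
    by (intro tendsto_minus tendsto_add lim3 LIMSEQ_subseq_LIMSEQ[OF lim2 s(1), unfolded comp_def])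
  also have "(\<lambda>j. - ((LINT X|lborel. D (v (s j) X) (h (s j) X $ i) * \<phi> X - D (v (s j) X) (g X $ i) * \<phi> X)
       + (LINT X|lborel. D (v (s j) X) (g X $ i) * \<phi> X))) = (\<lambda>j. LINT X|lborel. P (v (s j) X) * classical_grad \<phi> X $ i)"
    unfolding ibp using int_D[of "v _", OF _ h] int_D[of "v _", OF _ g]
    by (simp add: Bochner_Integration.integral_diff)
  finally have "(LINT X|lborel. P (u X) * classical_grad \<phi> X $ i) = - (LINT X|lborel. D (f X) (g X $ i) * \<phi> X)"
    using LIMSEQ_unique[OF LIMSEQ_subseq_LIMSEQ[OF lim1 s(1), unfolded comp_def]] by simp
  also have "(LINT X|lborel. D (f X) (g X $ i) * \<phi> X) = (LINT X|lborel. (\<chi> i. D (u X) (G X $ i)) $ i * \<phi> X)"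
  proof (rule Bochner_Integration.integral_cong[OF refl])
    fix X
    show "D (f X) (g X $ i) * \<phi> X = (\<chi> i. D (u X) (G X $ i)) $ i * \<phi> X"
      using z(1)[of X] KK' by (cases "X \<in> K") (auto simp: f_def g_def)
  qed
  finally show "(LINT X|lborel. P (u X) * classical_grad \<phi> X $ i) = - (LINT X|lborel. (\<chi> i. D (u X) (G X $ i)) $ i * \<phi> X)" .
qed

end

section \<open>Extending the weak formulation to nonsmooth test functions\<close>

lemma integrable_cdot:
  fixes V H :: "real ^ 'n::finite \<Rightarrow> complex ^ 'n"
  assumes [measurable]: "V \<in> borel_measurable borel" "H \<in> borel_measurable borel"
    and V: "set_integrable lborel K (\<lambda>X. (norm (V X))\<^sup>2)" and H: "integrable lborel (\<lambda>X. (norm (H X))\<^sup>2)"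
    and z: "\<And>X. X \<notin> K \<Longrightarrow> H X = 0"
  shows "integrable lborel (\<lambda>X. cdot (V X) (H X))"
proof (rule Bochner_Integration.integrable_bound)
  show "integrable lborel (\<lambda>X. indicat_real K X *\<^sub>R (norm (V X))\<^sup>2 + (norm (H X))\<^sup>2)"
    using V H by (auto simp: set_integrable_def)
  show "AE X in lborel. norm (cdot (V X) (H X)) \<le> norm (indicat_real K X *\<^sub>R (norm (V X))\<^sup>2 + (norm (H X))\<^sup>2)"
  proof (intro AE_I2)
    fix X
    have "norm (cdot (V X) (H X)) \<le> norm (V X) * norm (H X)" by (rule norm_cdot_le)
    also have "\<dots> \<le> indicat_real K X *\<^sub>R (norm (V X))\<^sup>2 + (norm (H X))\<^sup>2"
    proof (cases "X \<in> K")
      case True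
      have "2 * (norm (V X) * norm (H X)) \<le> (norm (V X))\<^sup>2 + (norm (H X))\<^sup>2"
        using sum_squares_bound[of "norm (V X)" "norm (H X)"] by simp
      moreover have "0 \<le> norm (V X) * norm (H X)" by simp
      ultimately have "norm (V X) * norm (H X) \<le> (norm (V X))\<^sup>2 + (norm (H X))\<^sup>2"
        by linarith
      then show ?thesis using True by simp
    qed (simp add: z)
    finally show "norm (cdot (V X) (H X)) \<le> norm (indicat_real K X *\<^sub>R (norm (V X))\<^sup>2 + (norm (H X))\<^sup>2)"
      by simp
  qed
qed measurable

text \<open>A mollification of \<open>F\<close> is an admissible test function whose gradient is the
  mollification of \<open>H\<close>, and the latter tends to \<open>H\<close> in L2. Since
  everything stays inside the compact set \<open>K'\<close>, on which \<open>V\<close> is square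
  integrable, Cauchy-Schwarz passes to the limit.\<close>

lemma weak_form_extension:
  fixes V H :: "real ^ 'n::finite \<Rightarrow> complex ^ 'n"
  assumes U: "open U" and [measurable]: "V \<in> borel_measurable borel"
    and V2: "\<And>K. compact K \<Longrightarrow> K \<subseteq> U \<Longrightarrow> set_integrable lborel K (\<lambda>X. (norm (V X))\<^sup>2)"
    and weak: "\<And>\<phi>. \<phi> \<in> test_functions U \<Longrightarrow> (LINT X|lborel. cdot (V X) (classical_grad \<phi> X)) = 0"
    and F: "wgrad U F H" and K: "compact K" "K \<subseteq> U"
    and z: "\<And>X. X \<notin> K \<Longrightarrow> F X = 0" "\<And>X. X \<notin> K \<Longrightarrow> H X = 0"
    and H2: "integrable lborel (\<lambda>X. (norm (H X))\<^sup>2)"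
  shows "(LINT X|lborel. cdot (V X) (H X)) = 0"
proof -
  note F' = wgradD[OF F]
  note [measurable] = F'(1,2)
  obtain r K' where r: "r > 0" and K': "compact K'" "K' \<subseteq> U" and nb: "\<And>x. x \<in> K \<Longrightarrow> cball x r \<subseteq> K'"
    using compact_nbhd[OF K(1) U K(2)] by blast
  have KK': "K \<subseteq> K'" using nb r by fastforce
  have eF: "(\<lambda>y. indicat_real K' y *\<^sub>R F y) = F" and eH: "(\<lambda>y. indicat_real K' y *\<^sub>R H y) = H"
    using z KK' by (fastforce simp: indicator_def)+
  have IF: "integrable lborel F" and IH: "integrable lborel H"
    using F'(3,4)[OF K'] by (simp_all only: set_integrable_def eF eH)
  have [measurable]: "K' \<in> sets borel" using K' by (auto intro: borel_compact)
  define A where "A = (LINT X|lborel. indicat_real K' X *\<^sub>R (norm (V X))\<^sup>2)"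
  have IA: "integrable lborel (\<lambda>X. indicat_real K' X *\<^sub>R (norm (V X))\<^sup>2)"
    using V2[OF K'] by (simp add: set_integrable_def)
  have A: "A \<ge> 0" unfolding A_def by (intro integral_nonneg_AE AE_I2) simp
  let ?I = "LINT X|lborel. cdot (V X) (H X)"
  have key: "(norm ?I)\<^sup>2 \<le> A * e" if e: "e > 0" for e
  proof -
    obtain d where d: "d > 0" "\<And>r. 0 < r \<Longrightarrow> r < d \<Longrightarrow>
      (\<integral>\<^sup>+x. ennreal ((norm (conv (moll r) H x - H x))\<^sup>2) \<partial>lborel) \<le> ennreal e"
      using conv_moll_L2[OF IH H2 e] by blast
    \<comment> \<open>With \<open>\<rho> \<le> r / 2\<close>, a point within \<rho> of
      \<open>K\<close> has its whole \<rho>-ball inside the r-neighbourhood of \<open>K\<close>, and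
      so inside \<open>K'\<close>.\<close>
    define \<rho> where "\<rho> = min (r / 2) (d / 2)"
    have \<rho>: "\<rho> > 0" "\<rho> < d" "\<rho> \<le> r / 2" using r d(1) by (auto simp: \<rho>_def min_def)
    let ?F = "conv (moll \<rho>) F" and ?H = "conv (moll \<rho>) H"
    have far: "?F x = 0 \<and> ?H x = 0 \<and> classical_grad ?F x = 0" if "\<And>y. y \<in> K \<Longrightarrow> \<rho> < norm (x - y)" for x
    proof -
      have m: "moll \<rho> (x - y) *\<^sub>R F y = 0" "moll \<rho> (x - y) *\<^sub>R H y = 0"
        "frechet_derivative (moll \<rho>) (at (x - y)) v *\<^sub>R F y = 0" for y v
        using moll_eq_0[OF \<rho>(1), of "x - y"] frechet_moll_eq_0[OF \<rho>(1), of "x - y"] that[of y] z[of y]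
        by (cases "y \<in> K"; simp)+
      have "frechet_derivative ?F (at x) = (\<lambda>v. 0)"
        by (subst frechet_derivative_at[OF conv_moll_has_derivative[OF IF \<rho>(1)], symmetric]) (simp add: conv_def m)
      then show ?thesis
        by (simp add: conv_def m classical_grad_def vec_eq_iff)
    qed
    have out: "\<rho> < norm (x - y)" if "x \<notin> K'" "y \<in> K" for x y
      using nb[OF that(2)] that(1) \<rho> r by (force simp: dist_norm norm_minus_commute not_le)
    \<comment> \<open>Close to \<open>K\<close> this is the commutation of mollification and
      gradient; at distance more than \<rho> from \<open>K\<close> both sides vanish.\<close>
    have grad: "classical_grad ?F x = ?H x" for x
    proof (cases "\<forall>y\<in>K. \<rho> < norm (x - y)")
      case True
      then show ?thesis using far[of x] by simp
    next
      case False
      then obtain y where y: "y \<in> K" "norm (x - y) \<le> \<rho>" by (auto simp: not_less)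
      have "cball x \<rho> \<subseteq> cball y r"
      proof
        fix w assume "w \<in> cball x \<rho>"
        then have "dist y w \<le> \<rho> + \<rho>"
          using y(2) dist_triangle[of y w x] by (simp add: dist_norm norm_minus_commute)
        then show "w \<in> cball y r" using \<rho>(3) by simp
      qed
      then have "cball x \<rho> \<subseteq> K'" using nb[OF y(1)] by blast
      from classical_grad_conv_moll[OF F K' \<rho>(1) this] show ?thesis
        by (simp only: eF eH)
    qed
    have test: "?F \<in> test_functions U"
      by (rule test_functionsI[OF smooth_conv_moll[OF IF \<rho>(1)] K']) (use far out in blast)
    have zH: "?H x = 0" if "x \<notin> K'" for x
      using far[of x] out[OF that] by blast
    have [measurable]: "?H \<in> borel_measurable borel"
      by (rule borel_measurable_conv_moll[OF IH \<rho>(1)])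
    have H\<rho>: "integrable lborel (\<lambda>X. (norm (?H X))\<^sup>2)"
    proof -
      have "continuous_on UNIV ?H"
        by (rule smooth_fun_continuous[OF smooth_conv_moll[OF IH \<rho>(1)]])
      then have "set_integrable lborel K' (\<lambda>X. (norm (?H X))\<^sup>2)"
        by (intro compact_set_integrable_continuous K' continuous_intros)
      moreover have "(\<lambda>X. indicat_real K' X *\<^sub>R (norm (?H X))\<^sup>2) = (\<lambda>X. (norm (?H X))\<^sup>2)"
        using zH by (fastforce simp: indicator_def)
      ultimately show ?thesis by (simp add: set_integrable_def)
    qed
    have I1: "integrable lborel (\<lambda>X. cdot (V X) (?H X))"
      by (rule integrable_cdot[OF _ _ V2[OF K'] H\<rho> zH]) measurable
    have I2: "integrable lborel (\<lambda>X. cdot (V X) (H X))"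
      by (rule integrable_cdot[OF _ _ V2[OF K'] H2]) (use z KK' in auto)
    have "ennreal (norm ?I) = ennreal (norm (LINT X|lborel. cdot (V X) (?H X) - cdot (V X) (H X)))"
      using weak[OF test] by (simp add: grad Bochner_Integration.integral_diff[OF I1 I2])
    also have "\<dots> \<le> (\<integral>\<^sup>+X. ennreal (norm (cdot (V X) (?H X) - cdot (V X) (H X))) \<partial>lborel)"
      by (rule integral_norm_bound_ennreal) (intro Bochner_Integration.integrable_diff I1 I2)
    also have "\<dots> \<le> (\<integral>\<^sup>+X. ennreal (indicat_real K' X * norm (V X)) * ennreal (norm (?H X - H X)) \<partial>lborel)"
    proof (intro nn_integral_mono)
      fix X
      have "cdot (V X) (?H X) - cdot (V X) (H X) = cdot (V X) (?H X - H X)"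
        by (simp add: cdot_def sum_subtractf[symmetric] right_diff_distrib)
      moreover have "norm (cdot (V X) (?H X - H X)) \<le> indicat_real K' X * norm (V X) * norm (?H X - H X)"
      proof (cases "X \<in> K'")
        case True
        then show ?thesis using norm_cdot_le[of "V X" "?H X - H X"] by simp
      next
        case False
        then have "?H X = 0" "H X = 0" using zH z(2) KK' by auto
        then show ?thesis by (simp add: cdot_def)
      qed
      ultimately show "ennreal (norm (cdot (V X) (?H X) - cdot (V X) (H X)))
          \<le> ennreal (indicat_real K' X * norm (V X)) * ennreal (norm (?H X - H X))"
        by (simp add: ennreal_mult[symmetric] ennreal_leI)
    qed
    finally have "(ennreal (norm ?I))\<^sup>2 \<le> (\<integral>\<^sup>+X. ennreal (indicat_real K' X * norm (V X)) * ennreal (norm (?H X - H X)) \<partial>lborel)\<^sup>2"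
      by (rule power_mono) simp
    also have "\<dots> \<le> (\<integral>\<^sup>+X. (ennreal (indicat_real K' X * norm (V X)))\<^sup>2 \<partial>lborel) * (\<integral>\<^sup>+X. (ennreal (norm (?H X - H X)))\<^sup>2 \<partial>lborel)"
      by (rule Cauchy_Schwarz_nn_integral) measurable
    also have "(\<integral>\<^sup>+X. (ennreal (indicat_real K' X * norm (V X)))\<^sup>2 \<partial>lborel) = (\<integral>\<^sup>+X. ennreal (indicat_real K' X *\<^sub>R (norm (V X))\<^sup>2) \<partial>lborel)"
      by (intro nn_integral_cong) (auto simp: ennreal_power indicator_def)
    also have "\<dots> = ennreal A"
      unfolding A_def by (rule nn_integral_eq_integral[OF IA]) simp
    also have "(\<integral>\<^sup>+X. (ennreal (norm (?H X - H X)))\<^sup>2 \<partial>lborel) \<le> ennreal e"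
      using d(2)[OF \<rho>(1,2)] by (simp add: ennreal_power)
    finally have "(ennreal (norm ?I))\<^sup>2 \<le> ennreal A * ennreal e"
      by (meson dual_order.trans mult_left_mono zero_le)
    then have "ennreal ((norm ?I)\<^sup>2) \<le> ennreal (A * e)"
      using A e by (simp add: ennreal_power ennreal_mult)
    then show ?thesis
      using A e by simp
  qed
  show ?thesis
  proof (rule ccontr)
    assume "?I \<noteq> 0"
    then have p: "(norm ?I)\<^sup>2 > 0" by simp
    \<comment> \<open>With this \<open>e\<close> the bound \<open>key\<close> reads
      \<open>(norm ?I)^2 \<le> c * (norm ?I)^2\<close> with a factor \<open>c < 1\<close>.\<close>
    define e where "e = (norm ?I)\<^sup>2 / (2 * (A + 1))"
    have "e > 0" using p A by (simp add: e_def)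
    from key[OF this] have "(norm ?I)\<^sup>2 \<le> (norm ?I)\<^sup>2 * (A / (2 * (A + 1)))"
      by (simp add: e_def mult.commute)
    moreover have "A / (2 * (A + 1)) < 1" using A by (simp add: field_simps)
    ultimately show False using p
      by (smt (verit) mult_less_cancel_left2)
  qed
qed

section \<open>Poincare inequalities\<close>

lemma nn_integral_affine:
  fixes g :: "'a::euclidean_space \<Rightarrow> ennreal"
  assumes [measurable]: "g \<in> borel_measurable borel" and t: "t \<noteq> 0"
  shows "(\<integral>\<^sup>+x. g x \<partial>lborel) = ennreal (\<bar>t\<bar> ^ DIM('a)) * (\<integral>\<^sup>+x. g (a + t *\<^sub>R x) \<partial>lborel)"
proof -
  have "(\<integral>\<^sup>+x. g x \<partial>lborel) = (\<integral>\<^sup>+x. g x \<partial>density (distr lborel borel (\<lambda>x. a + t *\<^sub>R x)) (\<lambda>_. ennreal (\<bar>t\<bar> ^ DIM('a))))"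
    by (subst lborel_affine[OF t, of a]) simp
  also have "\<dots> = ennreal (\<bar>t\<bar> ^ DIM('a)) * (\<integral>\<^sup>+x. g (a + t *\<^sub>R x) \<partial>lborel)"
    by (subst nn_integral_density) (auto simp: nn_integral_cmult nn_integral_distr)
  finally show ?thesis .
qed

text \<open>Substitute \<open>Z = (1 - t) *\<^sub>R X + t *\<^sub>R Y\<close>: the Jacobian factor
  \<open>t ^ (- n)\<close> is at most \<open>2 ^ n\<close> for \<open>t \<ge> 1/2\<close>, and
  convexity keeps \<open>Z\<close> in the ball.\<close>

lemma nn_integral_affine_ball_le:
  fixes f :: "'a::euclidean_space \<Rightarrow> ennreal"
  assumes [measurable]: "f \<in> borel_measurable borel" and t: "1/2 \<le> t" "t \<le> 1" and X: "X \<in> ball c r"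
  shows "(\<integral>\<^sup>+Y. indicator (ball c r) Y * f ((1 - t) *\<^sub>R X + t *\<^sub>R Y) \<partial>lborel)
    \<le> 2 ^ DIM('a) * (\<integral>\<^sup>+Z. indicator (ball c r) Z * f Z \<partial>lborel)"
proof -
  have [measurable]: "ball c r \<in> sets borel" by simp
  let ?g = "\<lambda>Z. indicator (ball c r) Z * f Z"
  let ?I = "\<integral>\<^sup>+Y. ?g ((1 - t) *\<^sub>R X + t *\<^sub>R Y) \<partial>lborel"
  have "(\<integral>\<^sup>+Y. indicator (ball c r) Y * f ((1 - t) *\<^sub>R X + t *\<^sub>R Y) \<partial>lborel) \<le> ?I"
  proof (intro nn_integral_mono)
    fix Y
    show "indicator (ball c r) Y * f ((1 - t) *\<^sub>R X + t *\<^sub>R Y) \<le> ?g ((1 - t) *\<^sub>R X + t *\<^sub>R Y)"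
    proof (cases "Y \<in> ball c r")
      case True
      then have "(1 - t) *\<^sub>R X + t *\<^sub>R Y \<in> ball c r"
        using X t by (intro convexD[OF convex_ball]) auto
      then show ?thesis using True by simp
    qed simp
  qed
  also have "?I = 2 ^ DIM('a) * (ennreal ((1/2) ^ DIM('a)) * ?I)"
  proof -
    have "2 ^ DIM('a) * ennreal ((1/2) ^ DIM('a)) = ennreal (2 ^ DIM('a) * (1/2) ^ DIM('a))"
      by (simp add: ennreal_mult ennreal_power[symmetric])
    also have "\<dots> = 1"
      by (simp add: power_mult_distrib[symmetric])
    finally show ?thesis
      by (simp add: mult.assoc[symmetric])
  qed
  also have "\<dots> \<le> 2 ^ DIM('a) * (ennreal (\<bar>t\<bar> ^ DIM('a)) * ?I)"
    using t by (intro mult_left_mono mult_right_mono ennreal_leI power_mono) auto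
  also have "\<dots> = 2 ^ DIM('a) * (\<integral>\<^sup>+Z. ?g Z \<partial>lborel)"
    using t by (subst nn_integral_affine[of ?g t "(1 - t) *\<^sub>R X"]) auto
  finally show ?thesis .
qed

text \<open>The substitution is made in \<open>Y\<close> for \<open>t \<ge> 1/2\<close> and in
  \<open>X\<close> for \<open>t \<le> 1/2\<close>, so the Jacobian factor never exceeds
  \<open>2 ^ DIM('a)\<close>. Choosing a single variable would let it blow up at one end of the
  segment.\<close>

lemma segment_average_le:
  fixes f :: "'a::euclidean_space \<Rightarrow> ennreal"
  assumes [measurable]: "f \<in> borel_measurable borel"
  shows "(\<integral>\<^sup>+X. \<integral>\<^sup>+Y. indicator (ball c r) X * indicator (ball c r) Y *
      (\<integral>\<^sup>+t. indicator {0..1::real} t * f ((1 - t) *\<^sub>R X + t *\<^sub>R Y) \<partial>lborel) \<partial>lborel \<partial>lborel)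
    \<le> 2 ^ DIM('a) * emeasure lborel (ball c r) * (\<integral>\<^sup>+Z. indicator (ball c r) Z * f Z \<partial>lborel)"
proof -
  let ?B = "ball c r" and ?N = "\<integral>\<^sup>+Z. indicator (ball c r) Z * f Z \<partial>lborel"
  have [measurable]: "?B \<in> sets borel" by simp
  let ?h = "\<lambda>X Y t. indicator ?B X * indicator ?B Y * (indicator {0..1::real} t * f ((1 - t) *\<^sub>R X + t *\<^sub>R Y))"
  have "(\<integral>\<^sup>+X. \<integral>\<^sup>+Y. indicator ?B X * indicator ?B Y *
      (\<integral>\<^sup>+t. indicator {0..1::real} t * f ((1 - t) *\<^sub>R X + t *\<^sub>R Y) \<partial>lborel) \<partial>lborel \<partial>lborel)
    = (\<integral>\<^sup>+X. \<integral>\<^sup>+Y. \<integral>\<^sup>+t. ?h X Y t \<partial>lborel \<partial>lborel \<partial>lborel)"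
    by (intro nn_integral_cong nn_integral_cmult[symmetric]) measurable
  also have "\<dots> = (\<integral>\<^sup>+X. \<integral>\<^sup>+t. \<integral>\<^sup>+Y. ?h X Y t \<partial>lborel \<partial>lborel \<partial>lborel)"
    by (intro nn_integral_cong lborel_pair.Fubini') measurable
  also have "\<dots> = (\<integral>\<^sup>+t. \<integral>\<^sup>+X. \<integral>\<^sup>+Y. ?h X Y t \<partial>lborel \<partial>lborel \<partial>lborel)"
    by (intro lborel_pair.Fubini') measurable
  also have "\<dots> \<le> (\<integral>\<^sup>+t. indicator {0..1::real} t * (2 ^ DIM('a) * emeasure lborel ?B * ?N) \<partial>lborel)"
  proof (intro nn_integral_mono)
    fix t :: real
    have *: "(\<integral>\<^sup>+X. indicator ?B X * (2 ^ DIM('a) * ?N) \<partial>lborel) = 2 ^ DIM('a) * emeasure lborel ?B * ?N"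
      by (simp add: nn_integral_multc mult_ac)
    consider "t \<notin> {0..1}" | "1/2 \<le> t" "t \<le> 1" | "0 \<le> t" "t \<le> 1/2" by fastforce
    then show "(\<integral>\<^sup>+X. \<integral>\<^sup>+Y. ?h X Y t \<partial>lborel \<partial>lborel) \<le> indicator {0..1::real} t * (2 ^ DIM('a) * emeasure lborel ?B * ?N)"
    proof cases
      case 1
      then show ?thesis by simp
    next
      case 2
      have "(\<integral>\<^sup>+X. \<integral>\<^sup>+Y. ?h X Y t \<partial>lborel \<partial>lborel) \<le> (\<integral>\<^sup>+X. indicator ?B X * (2 ^ DIM('a) * ?N) \<partial>lborel)"
      proof (intro nn_integral_mono)
        fix X
        show "(\<integral>\<^sup>+Y. ?h X Y t \<partial>lborel) \<le> indicator ?B X * (2 ^ DIM('a) * ?N)"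
          using nn_integral_affine_ball_le[of f t X c r] 2 by (cases "X \<in> ?B") auto
      qed
      then show ?thesis using 2 * by simp
    next
      case 3
      have "(\<integral>\<^sup>+X. \<integral>\<^sup>+Y. ?h X Y t \<partial>lborel \<partial>lborel) = (\<integral>\<^sup>+Y. \<integral>\<^sup>+X. ?h X Y t \<partial>lborel \<partial>lborel)"
        by (intro lborel_pair.Fubini') measurable
      also have "\<dots> \<le> (\<integral>\<^sup>+X. indicator ?B X * (2 ^ DIM('a) * ?N) \<partial>lborel)"
      proof (intro nn_integral_mono)
        fix Y
        show "(\<integral>\<^sup>+X. ?h X Y t \<partial>lborel) \<le> indicator ?B Y * (2 ^ DIM('a) * ?N)"
          using nn_integral_affine_ball_le[of f "1 - t" Y c r] 3 by (cases "Y \<in> ?B") (auto simp: add.commute)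
      qed
      finally show ?thesis using 3 * by simp
    qed
  qed
  also have "\<dots> = 2 ^ DIM('a) * emeasure lborel ?B * ?N"
    by (simp add: nn_integral_multc)
  finally show ?thesis .
qed

lemma norm_derivative_le_grad:
  assumes "smooth_fun v"
  shows "cmod (frechet_derivative v (at X) w) \<le> norm w * norm (classical_grad v X)"
proof -
  have lin: "linear (frechet_derivative v (at X))"
    using smooth_fun_has_derivative[OF assms, of X] has_derivative_bounded_linear bounded_linear.linear by blast
  have "w = (\<Sum>i\<in>UNIV. (w $ i) *\<^sub>R axis i 1)"
    by (simp add: vec_eq_iff axis_def if_distrib sum.delta cong: if_cong)
  then have "frechet_derivative v (at X) w = (\<Sum>i\<in>UNIV. (w $ i) *\<^sub>R classical_grad v X $ i)"
    using linear_sum[OF lin, of "\<lambda>i. (w $ i) *\<^sub>R axis i 1" UNIV] linear_cmul[OF lin]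
    by (simp add: classical_grad_def)
  also have "cmod \<dots> \<le> (\<Sum>i\<in>UNIV. \<bar>w $ i\<bar> * \<bar>cmod (classical_grad v X $ i)\<bar>)"
    by (rule order_trans[OF norm_sum]) simp
  also have "\<dots> \<le> norm w * norm (classical_grad v X)"
    unfolding norm_vec_def using L2_set_mult_ineq[of "\<lambda>i. w $ i" "\<lambda>i. cmod (classical_grad v X $ i)" UNIV]
    by (simp add: L2_set_def)
  finally show ?thesis .
qed

text \<open>The fundamental theorem of calculus along the segment from \<open>X\<close> to
  \<open>Y\<close>, followed by Jensen's inequality in \<open>t\<close>.\<close>

lemma smooth_difference_square_le:
  fixes v :: "real ^ 'n::finite \<Rightarrow> complex"
  assumes v: "smooth_fun v"
  shows "ennreal ((cmod (v X - v Y))\<^sup>2) \<le> ennreal ((norm (X - Y))\<^sup>2) *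
    (\<integral>\<^sup>+t. indicator {0..1::real} t * ennreal ((norm (classical_grad v ((1 - t) *\<^sub>R X + t *\<^sub>R Y)))\<^sup>2) \<partial>lborel)"
proof -
  let ?p = "\<lambda>t::real. (1 - t) *\<^sub>R X + t *\<^sub>R Y"
  let ?D = "\<lambda>t. frechet_derivative v (at (?p t)) (Y - X)"
  let ?g = "\<lambda>t. norm (classical_grad v (?p t))"
  have cp: "continuous_on S ?p" for S by (intro continuous_intros)
  have cD: "continuous_on S ?D" for S
    by (rule continuous_on_compose2[OF smooth_fun_continuous_derivative[OF v] cp]) simp
  have [measurable]: "?p \<in> borel_measurable borel" by measurable
  note [measurable] = borel_measurable_classical_grad[OF v]
  have "(LINT t|lborel. indicator {0..1} t *\<^sub>R ?D t) = v (?p 1) - v (?p 0)"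
  proof (rule integral_FTC_Icc)
    show "((\<lambda>t. v (?p t)) has_vector_derivative ?D t) (at t within {0..1})" for t
    proof -
      have "(?p has_derivative (\<lambda>s. s *\<^sub>R (Y - X))) (at t within {0..1})"
        by (auto intro!: derivative_eq_intros simp: algebra_simps)
      from has_derivative_compose[OF this smooth_fun_has_derivative[OF v]]
      have "((\<lambda>t. v (?p t)) has_derivative (\<lambda>s. frechet_derivative v (at (?p t)) (s *\<^sub>R (Y - X)))) (at t within {0..1})" .
      moreover have "frechet_derivative v (at (?p t)) (s *\<^sub>R (Y - X)) = s *\<^sub>R ?D t" for s
        using smooth_fun_has_derivative[OF v, of "?p t"] has_derivative_bounded_linear bounded_linear.linear linear_cmul by blast
      ultimately show ?thesis by (simp add: has_vector_derivative_def)
    qed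
  qed (auto intro: cD)
  then have eq: "v Y - v X = (LINT t|lborel. indicator {0..1} t *\<^sub>R ?D t)" by simp
  have "integrable lborel (\<lambda>t. indicator {0..1} t *\<^sub>R ?D t)"
    by (rule borel_integrable_compact) (auto intro: cD)
  from integral_norm_bound_ennreal[OF this]
  have "ennreal (cmod (v X - v Y)) \<le> (\<integral>\<^sup>+t. ennreal (norm (indicator {0..1} t *\<^sub>R ?D t)) \<partial>lborel)"
    by (simp add: eq[symmetric] norm_minus_commute)
  also have "\<dots> \<le> (\<integral>\<^sup>+t. indicator {0..1} t * ennreal (norm (X - Y) * ?g t) \<partial>lborel)"
    using norm_derivative_le_grad[OF v, of _ "Y - X"]
    by (intro nn_integral_mono) (auto simp: indicator_def norm_minus_commute intro!: ennreal_leI)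
  finally have "(ennreal (cmod (v X - v Y)))\<^sup>2 \<le> (\<integral>\<^sup>+t. indicator {0..1} t * ennreal (norm (X - Y) * ?g t) \<partial>lborel)\<^sup>2"
    by (rule power_mono) simp
  also have "\<dots> \<le> (\<integral>\<^sup>+t. indicator {0..1::real} t * (ennreal (norm (X - Y) * ?g t))\<^sup>2 \<partial>lborel)"
    by (rule nn_integral_prob_square) auto
  also have "\<dots> = (\<integral>\<^sup>+t. ennreal ((norm (X - Y))\<^sup>2) * (indicator {0..1::real} t * ennreal ((?g t)\<^sup>2)) \<partial>lborel)"
    by (intro nn_integral_cong) (simp add: ennreal_power ennreal_mult[symmetric] power_mult_distrib indicator_def)
  also have "\<dots> = ennreal ((norm (X - Y))\<^sup>2) * (\<integral>\<^sup>+t. indicator {0..1::real} t * ennreal ((?g t)\<^sup>2) \<partial>lborel)"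
    by (rule nn_integral_cmult) measurable
  finally show ?thesis by (simp add: ennreal_power)
qed

text \<open>The Poincare inequality in terms of pairs of points mentions no mean value, so it makes
  sense before any integrability of the function is known and survives limits by Fatou's lemma. The
  factor \<open>4 * r\<^sup>2\<close> is the square of the diameter.\<close>

lemma poincare_pair_smooth:
  fixes v :: "real ^ 'n::finite \<Rightarrow> complex"
  assumes v: "smooth_fun v" and r: "r > 0"
  shows "(\<integral>\<^sup>+X. \<integral>\<^sup>+Y. indicator (ball c r) X * indicator (ball c r) Y * ennreal ((cmod (v X - v Y))\<^sup>2) \<partial>lborel \<partial>lborel)
    \<le> ennreal (4 * r\<^sup>2 * 2 ^ CARD('n)) * emeasure lborel (ball c r) *
      (\<integral>\<^sup>+Z. indicator (ball c r) Z * ennreal ((norm (classical_grad v Z))\<^sup>2) \<partial>lborel)"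
proof -
  let ?B = "ball c r" and ?G = "\<lambda>Z. ennreal ((norm (classical_grad v Z))\<^sup>2)"
  note [measurable] = borel_measurable_classical_grad[OF v]
  let ?S = "\<lambda>X Y. \<integral>\<^sup>+t. indicator {0..1::real} t * ?G ((1 - t) *\<^sub>R X + t *\<^sub>R Y) \<partial>lborel"
  have "(\<integral>\<^sup>+X. \<integral>\<^sup>+Y. indicator ?B X * indicator ?B Y * ennreal ((cmod (v X - v Y))\<^sup>2) \<partial>lborel \<partial>lborel)
     \<le> (\<integral>\<^sup>+X. \<integral>\<^sup>+Y. ennreal (4 * r\<^sup>2) * (indicator ?B X * indicator ?B Y * ?S X Y) \<partial>lborel \<partial>lborel)"
  proof (intro nn_integral_mono)
    fix X Y
    show "indicator ?B X * indicator ?B Y * ennreal ((cmod (v X - v Y))\<^sup>2) \<le> ennreal (4 * r\<^sup>2) * (indicator ?B X * indicator ?B Y * ?S X Y)"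
    proof (cases "X \<in> ?B \<and> Y \<in> ?B")
      case True
      then have "norm (X - Y) \<le> 2 * r"
        using dist_triangle[of X Y c] by (simp add: dist_norm norm_minus_commute)
      then have "(norm (X - Y))\<^sup>2 \<le> 4 * r\<^sup>2"
        using power_mono[of "norm (X - Y)" "2 * r" 2] by (simp add: power_mult_distrib)
      then show ?thesis
        using True order_trans[OF smooth_difference_square_le[OF v, of X Y] mult_right_mono[OF ennreal_leI]] by simp
    qed auto
  qed
  also have "\<dots> = ennreal (4 * r\<^sup>2) * (\<integral>\<^sup>+X. \<integral>\<^sup>+Y. indicator ?B X * indicator ?B Y * ?S X Y \<partial>lborel \<partial>lborel)"
  proof -
    have [measurable]: "?B \<in> sets borel" by simp
    have "(\<integral>\<^sup>+X. \<integral>\<^sup>+Y. ennreal (4 * r\<^sup>2) * (indicator ?B X * indicator ?B Y * ?S X Y) \<partial>lborel \<partial>lborel)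
        = (\<integral>\<^sup>+X. ennreal (4 * r\<^sup>2) * (\<integral>\<^sup>+Y. indicator ?B X * indicator ?B Y * ?S X Y \<partial>lborel) \<partial>lborel)"
      by (intro nn_integral_cong nn_integral_cmult) measurable
    also have "\<dots> = ennreal (4 * r\<^sup>2) * (\<integral>\<^sup>+X. \<integral>\<^sup>+Y. indicator ?B X * indicator ?B Y * ?S X Y \<partial>lborel \<partial>lborel)"
      by (intro nn_integral_cmult) measurable
    finally show ?thesis .
  qed
  also have "\<dots> \<le> ennreal (4 * r\<^sup>2) * (2 ^ DIM(real^'n) * emeasure lborel ?B * (\<integral>\<^sup>+Z. indicator ?B Z * ?G Z \<partial>lborel))"
    by (intro mult_left_mono segment_average_le) auto
  also have "\<dots> = ennreal (4 * r\<^sup>2 * 2 ^ CARD('n)) * emeasure lborel ?B * (\<integral>\<^sup>+Z. indicator ?B Z * ?G Z \<partial>lborel)"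
    by (simp add: ennreal_mult ennreal_power[symmetric] mult.assoc)
  finally show ?thesis .
qed

text \<open>Fatou's lemma in each of the two variables; almost everywhere convergence in one
  variable yields it for almost every pair.\<close>

lemma nn_integral_pair_liminf_le:
  fixes v :: "nat \<Rightarrow> 'a::euclidean_space \<Rightarrow> 'b::{real_normed_vector, second_countable_topology}"
  assumes [measurable]: "\<And>j. v j \<in> borel_measurable borel" "w \<in> borel_measurable borel" "B \<in> sets borel"
    and lim: "AE X in lborel. X \<in> B \<longrightarrow> (\<lambda>j. v j X) \<longlonglongrightarrow> w X"
    and bd: "\<And>j. (\<integral>\<^sup>+X. \<integral>\<^sup>+Y. indicator B X * indicator B Y * ennreal ((norm (v j X - v j Y))\<^sup>2) \<partial>lborel \<partial>lborel) \<le> F j"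
    and F: "F \<longlonglongrightarrow> c"
  shows "(\<integral>\<^sup>+X. \<integral>\<^sup>+Y. indicator B X * indicator B Y * ennreal ((norm (w X - w Y))\<^sup>2) \<partial>lborel \<partial>lborel) \<le> c"
proof -
  let ?h = "\<lambda>j X Y. indicator B X * indicator B Y * ennreal ((norm (v j X - v j Y))\<^sup>2)"
  have "AE X in lborel. (\<integral>\<^sup>+Y. indicator B X * indicator B Y * ennreal ((norm (w X - w Y))\<^sup>2) \<partial>lborel) \<le> liminf (\<lambda>j. \<integral>\<^sup>+Y. ?h j X Y \<partial>lborel)"
    using lim
  proof eventually_elim
    case X: (elim X)
    have "(\<integral>\<^sup>+Y. indicator B X * indicator B Y * ennreal ((norm (w X - w Y))\<^sup>2) \<partial>lborel) \<le> (\<integral>\<^sup>+Y. liminf (\<lambda>j. ?h j X Y) \<partial>lborel)"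
    proof (rule nn_integral_mono_AE)
      show "AE Y in lborel. indicator B X * indicator B Y * ennreal ((norm (w X - w Y))\<^sup>2) \<le> liminf (\<lambda>j. ?h j X Y)"
        using lim
      proof eventually_elim
        case (elim Y)
        show ?case
        proof (cases "X \<in> B \<and> Y \<in> B")
          case True
          then have "(\<lambda>j. ennreal ((norm (v j X - v j Y))\<^sup>2)) \<longlonglongrightarrow> ennreal ((norm (w X - w Y))\<^sup>2)"
            using X elim by (intro tendsto_ennrealI tendsto_intros) auto
          from lim_imp_Liminf[OF _ this] True show ?thesis by simp
        qed auto
      qed
    qed
    also have "\<dots> \<le> liminf (\<lambda>j. \<integral>\<^sup>+Y. ?h j X Y \<partial>lborel)"
      by (rule nn_integral_liminf) measurable
    finally show ?case .
  qed
  then have "(\<integral>\<^sup>+X. \<integral>\<^sup>+Y. indicator B X * indicator B Y * ennreal ((norm (w X - w Y))\<^sup>2) \<partial>lborel \<partial>lborel)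
     \<le> (\<integral>\<^sup>+X. liminf (\<lambda>j. \<integral>\<^sup>+Y. ?h j X Y \<partial>lborel) \<partial>lborel)"
    by (rule nn_integral_mono_AE)
  also have "\<dots> \<le> liminf (\<lambda>j. \<integral>\<^sup>+X. \<integral>\<^sup>+Y. ?h j X Y \<partial>lborel \<partial>lborel)"
    by (rule nn_integral_liminf) measurable
  also have "\<dots> \<le> liminf F"
    by (rule Liminf_mono) (use bd in auto)
  also have "\<dots> = c"
    by (rule lim_imp_Liminf[OF _ F]) simp
  finally show ?thesis .
qed

text \<open>Mollify and pass to the limit: gradients converge in L2 and functions almost everywhere
  along a subsequence. The extra factor 2 stems from \<open>(a + b)^2 \<le> 2 a^2 + 2 b^2\<close>,
  used to split the mollified gradient into its limit and an error.\<close>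

lemma poincare_pair_UNIV:
  fixes w :: "real ^ 'n::finite \<Rightarrow> complex"
  assumes w: "wgrad UNIV w H" and H2: "\<And>K. compact K \<Longrightarrow> set_integrable lborel K (\<lambda>X. (norm (H X))\<^sup>2)" and r: "r > 0"
  shows "(\<integral>\<^sup>+X. \<integral>\<^sup>+Y. indicator (ball c r) X * indicator (ball c r) Y * ennreal ((cmod (w X - w Y))\<^sup>2) \<partial>lborel \<partial>lborel)
    \<le> ennreal (4 * r\<^sup>2 * 2 ^ CARD('n)) * emeasure lborel (ball c r) *
      (2 * (\<integral>\<^sup>+Z. indicator (ball c r) Z * ennreal ((norm (H Z))\<^sup>2) \<partial>lborel))"
proof -
  note w' = wgradD[OF w]
  note [measurable] = w'(1,2)
  let ?B = "ball c r" and ?N = "\<integral>\<^sup>+Z. indicator (ball c r) Z * ennreal ((norm (H Z))\<^sup>2) \<partial>lborel"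
  have [measurable]: "?B \<in> sets borel" by simp
  \<comment> \<open>The margin 1 matches the bound \<open>\<rho> j \<le> 1\<close> on the
    mollification radii, so mollifying inside the ball never sees the edge of
    \<open>K\<close>.\<close>
  define K where "K = cball c (r + 1)"
  have K: "compact K" by (simp add: K_def)
  have [measurable]: "K \<in> sets borel" by (simp add: K_def)
  define f where "f = (\<lambda>y. indicator K y *\<^sub>R w y)"
  define g where "g = (\<lambda>y. indicator K y *\<^sub>R H y)"
  have f: "integrable lborel f" and g: "integrable lborel g"
    using w'(3,4)[OF K] by (simp_all add: f_def g_def set_integrable_def)
  have g2: "integrable lborel (\<lambda>x. (norm (g x))\<^sup>2)"
  proof -
    have "(\<lambda>x. (norm (g x))\<^sup>2) = (\<lambda>x. indicat_real K x *\<^sub>R (norm (H x))\<^sup>2)"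
      by (auto simp: g_def indicator_def)
    then show ?thesis using H2[OF K] by (simp add: set_integrable_def)
  qed
  have [measurable]: "f \<in> borel_measurable borel" "g \<in> borel_measurable borel" using f g by auto
  have "\<exists>d. 0 < d \<and> d \<le> 1 \<and> d < 1 / real (Suc j) \<and>
      (\<integral>\<^sup>+x. ennreal ((norm (conv (moll d) g x - g x))\<^sup>2) \<partial>lborel) \<le> ennreal (1 / real (Suc j))" for j
  proof -
    have e: "1 / real (Suc j) > 0" by simp
    obtain d where d: "d > 0" "\<And>r. 0 < r \<Longrightarrow> r < d \<Longrightarrow>
      (\<integral>\<^sup>+x. ennreal ((norm (conv (moll r) g x - g x))\<^sup>2) \<partial>lborel) \<le> ennreal (1 / real (Suc j))"
      using conv_moll_L2[OF g g2 e] by blast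
    define d' where "d' = min (d / 2) (1 / real (Suc j) / 2)"
    have "d' \<le> 1 / real (Suc j) / 2" by (simp add: d'_def)
    also have "\<dots> \<le> 1" by simp
    finally have "d' \<le> 1" .
    moreover have "0 < d'" "d' < d" using d(1) by (auto simp: d'_def)
    moreover have "d' < 1 / real (Suc j)"
      using e unfolding d'_def by (intro min.strict_coboundedI2) (simp add: field_simps)
    ultimately show ?thesis using d(2)[of d'] by blast
  qed
  then have "\<forall>j. \<exists>d. 0 < d \<and> d \<le> 1 \<and> d < 1 / real (Suc j) \<and>
      (\<integral>\<^sup>+x. ennreal ((norm (conv (moll d) g x - g x))\<^sup>2) \<partial>lborel) \<le> ennreal (1 / real (Suc j))"
    by blast
  from choice[OF this] obtain \<rho> where "\<forall>j. 0 < \<rho> j \<and> \<rho> j \<le> 1 \<and> \<rho> j < 1 / real (Suc j) \<and>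
      (\<integral>\<^sup>+x. ennreal ((norm (conv (moll (\<rho> j)) g x - g x))\<^sup>2) \<partial>lborel) \<le> ennreal (1 / real (Suc j))" ..
  then have \<rho>: "\<And>j. 0 < \<rho> j" "\<And>j. \<rho> j \<le> 1" "\<And>j. \<rho> j < 1 / real (Suc j)"
    "\<And>j. (\<integral>\<^sup>+x. ennreal ((norm (conv (moll (\<rho> j)) g x - g x))\<^sup>2) \<partial>lborel) \<le> ennreal (1 / real (Suc j))"
    by blast+
  have \<rho>0: "\<rho> \<longlonglongrightarrow> 0"
    by (rule tendsto_sandwich[OF _ _ tendsto_const LIMSEQ_Suc[OF lim_1_over_n]])
      (use \<rho>(1,3) in \<open>auto intro!: always_eventually less_imp_le simp del: of_nat_Suc\<close>)
  define v where "v j = conv (moll (\<rho> j)) f" for j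
  define h where "h j = conv (moll (\<rho> j)) g" for j
  have v: "integrable lborel (v j)" "smooth_fun (v j)" and h: "integrable lborel (h j)" for j
    using f g \<rho> by (auto simp: v_def h_def intro: integrable_conv_moll_fun smooth_conv_moll)
  have [measurable]: "v j \<in> borel_measurable borel" "h j \<in> borel_measurable borel" for j
    using v h by auto
  have vh: "classical_grad (v j) x = h j x" if "x \<in> ?B" for x j
    unfolding v_def h_def f_def g_def
  proof (rule classical_grad_conv_moll[OF w K subset_UNIV \<rho>(1)])
    show "cball x (\<rho> j) \<subseteq> K"
    proof
      fix y assume "y \<in> cball x (\<rho> j)"
      then have "dist c y < r + 1"
        using that \<rho>(2)[of j] dist_triangle[of c y x] by simp
      then show "y \<in> K" by (simp add: K_def)
    qed
  qed
  have "(\<lambda>j. \<integral>\<^sup>+x. ennreal (norm (v j x - f x)) \<partial>lborel) \<longlonglongrightarrow> 0"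
    unfolding v_def by (rule conv_moll_L1_tendsto[OF f \<rho>(1) \<rho>0])
  from AE_subseq_of_L1_tendsto[OF v(1) f this]
  obtain s where s: "strict_mono s" "AE x in lborel. (\<lambda>j. v (s j) x) \<longlonglongrightarrow> f x" by blast
  have Nh: "(\<integral>\<^sup>+Z. indicator ?B Z * ennreal ((norm (classical_grad (v j) Z))\<^sup>2) \<partial>lborel) \<le> 2 * ?N + 2 * ennreal (1 / real (Suc j))" for j
  proof -
    have "(\<integral>\<^sup>+Z. indicator ?B Z * ennreal ((norm (classical_grad (v j) Z))\<^sup>2) \<partial>lborel)
       \<le> (\<integral>\<^sup>+Z. 2 * (indicator ?B Z * ennreal ((norm (H Z))\<^sup>2)) + 2 * ennreal ((norm (h j Z - g Z))\<^sup>2) \<partial>lborel)"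
    proof (intro nn_integral_mono)
      fix Z
      show "indicator ?B Z * ennreal ((norm (classical_grad (v j) Z))\<^sup>2)
          \<le> 2 * (indicator ?B Z * ennreal ((norm (H Z))\<^sup>2)) + 2 * ennreal ((norm (h j Z - g Z))\<^sup>2)"
      proof (cases "Z \<in> ?B")
        case True
        then have g: "g Z = H Z" by (auto simp: g_def K_def indicator_def)
        have "(norm (h j Z))\<^sup>2 \<le> (norm (H Z) + norm (h j Z - g Z))\<^sup>2"
          using norm_triangle_sub[of "h j Z" "H Z"] by (intro power_mono) (auto simp: g)
        also have "\<dots> \<le> 2 * (norm (H Z))\<^sup>2 + 2 * (norm (h j Z - g Z))\<^sup>2"
          using sum_squares_bound[of "norm (H Z)" "norm (h j Z - g Z)"] by (simp add: power2_sum)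
        finally show ?thesis
          using True by (simp add: vh ennreal_plus[symmetric] ennreal_mult[symmetric] ennreal_numeral[symmetric] ennreal_leI
              del: ennreal_plus ennreal_numeral)
      qed simp
    qed
    also have "\<dots> = 2 * ?N + 2 * (\<integral>\<^sup>+Z. ennreal ((norm (h j Z - g Z))\<^sup>2) \<partial>lborel)"
      by (subst nn_integral_add) (auto simp: nn_integral_cmult)
    also have "\<dots> \<le> 2 * ?N + 2 * ennreal (1 / real (Suc j))"
      using \<rho>(4)[of j] by (intro add_left_mono mult_left_mono) (auto simp: h_def)
    finally show ?thesis .
  qed
  let ?C = "ennreal (4 * r\<^sup>2 * 2 ^ CARD('n)) * emeasure lborel ?B"
  have Cfin: "?C < top"
    using emeasure_bounded_less_top[of ?B] by (simp add: ennreal_mult_less_top)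
  show ?thesis
  proof (rule nn_integral_pair_liminf_le[where v = "\<lambda>j. v (s j)" and F = "\<lambda>j. ?C * (2 * ?N + 2 * ennreal (1 / real (Suc (s j))))"])
    show "AE X in lborel. X \<in> ?B \<longrightarrow> (\<lambda>j. v (s j) X) \<longlonglongrightarrow> w X"
      using s(2) by eventually_elim (auto simp: f_def K_def indicator_def)
    show "(\<integral>\<^sup>+X. \<integral>\<^sup>+Y. indicator ?B X * indicator ?B Y * ennreal ((norm (v (s j) X - v (s j) Y))\<^sup>2) \<partial>lborel \<partial>lborel)
        \<le> ?C * (2 * ?N + 2 * ennreal (1 / real (Suc (s j))))" for j
      by (rule order_trans[OF poincare_pair_smooth[OF v(2) r] mult_left_mono[OF Nh]]) simp
    have "(\<lambda>j. ennreal (1 / real (Suc j))) \<longlonglongrightarrow> ennreal 0"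
      by (intro tendsto_ennrealI LIMSEQ_Suc[OF lim_1_over_n])
    from LIMSEQ_subseq_LIMSEQ[OF this s(1)]
    have "(\<lambda>j. ennreal (1 / real (Suc (s j)))) \<longlonglongrightarrow> 0" by (simp add: comp_def)
    then have "(\<lambda>j. ?C * (2 * ?N + 2 * ennreal (1 / real (Suc (s j))))) \<longlonglongrightarrow> ?C * (2 * ?N + 2 * 0)"
      using Cfin by (intro ennreal_tendsto_cmult tendsto_add tendsto_const) auto
    then show "(\<lambda>j. ?C * (2 * ?N + 2 * ennreal (1 / real (Suc (s j))))) \<longlonglongrightarrow> ?C * (2 * ?N)"
      by simp
  qed measurable
qed

text \<open>Locally vanishing Minkowski content of codimension one: the volume of the
  \<epsilon>-collar beats the gradient \<open>1 / \<epsilon>\<close> of a cutoff of width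
  \<epsilon>.\<close>

definition thin :: "(real ^ 'n::finite) set \<Rightarrow> bool" where
  "thin \<Gamma> \<longleftrightarrow> (\<forall>R. ((\<lambda>\<epsilon>. measure lborel (cball 0 R \<inter> {X. infdist X \<Gamma> \<le> \<epsilon>}) / \<epsilon>) \<longlongrightarrow> 0) (at_right 0))"

text \<open>A bounded function extends across a thin set: the gradient of a cutoff of width \<open>\<epsilon>\<close> is of
  size \<open>1 / \<epsilon>\<close>, on a set of measure \<open>o(\<epsilon>)\<close>.\<close>

lemma wgrad_extend:
  fixes \<Gamma> :: "(real ^ 'n::finite) set"
  assumes \<Gamma>: "closed \<Gamma>" "\<Gamma> \<noteq> {}" "thin \<Gamma>"
    and w: "wgrad (- \<Gamma>) w H" and M: "\<And>X. cmod (w X) \<le> M" and z: "\<And>X. X \<in> \<Gamma> \<Longrightarrow> H X = 0"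
    and HI: "\<And>K. compact K \<Longrightarrow> set_integrable lborel K H"
  shows "wgrad UNIV w H"
  unfolding wgrad_def
proof (intro conjI allI ballI impI)
  note w' = wgradD[OF w]
  note [measurable] = w'(1,2)
  show "w \<in> borel_measurable borel" "H \<in> borel_measurable borel" by measurable
  have M0: "M \<ge> 0" using order_trans[OF norm_ge_zero M] .
  show wI: "set_integrable lborel K w" if "compact K \<and> K \<subseteq> UNIV" for K
    unfolding set_integrable_def
  proof (rule Bochner_Integration.integrable_bound)
    have [measurable]: "K \<in> sets borel" using that by (auto intro: borel_compact)
    show "integrable lborel (\<lambda>X. indicat_real K X * M)"
      using that by (intro integrable_mult_left integrable_real_indicator) (auto simp: emeasure_bounded_less_top compact_imp_bounded)
    show "(\<lambda>X. indicat_real K X *\<^sub>R w X) \<in> borel_measurable lborel" by measurable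
    show "AE X in lborel. norm (indicat_real K X *\<^sub>R w X) \<le> norm (indicat_real K X * M)"
      using M M0 by (intro AE_I2) (simp add: indicator_def)
  qed
  show "set_integrable lborel K H" if "compact K \<and> K \<subseteq> UNIV" for K
    using HI that by blast
  fix \<phi> :: "real^'n \<Rightarrow> complex" and i
  assume \<phi>: "\<phi> \<in> test_functions UNIV"
  note sm = test_functionsD(1)[OF \<phi>]
  obtain R where R: "\<And>X. norm X > R \<Longrightarrow> \<phi> X = 0"
    using test_function_cball[OF \<phi>] by metis
  have R': "classical_grad \<phi> X $ i = 0" if "norm X > R" for X
    using classical_grad_eq_0_outside[OF sm R that] by simp
  obtain M1 where M1: "M1 > 0" "\<And>X. cmod (\<phi> X) \<le> M1"
    using bounded_continuous_cball[OF smooth_fun_continuous[OF sm] R] by metis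
  obtain M2 where M2: "M2 > 0" "\<And>X. cmod (classical_grad \<phi> X $ i) \<le> M2"
    using bounded_continuous_cball[OF continuous_classical_grad[OF sm] R'] by metis
  obtain C where C: "C > 0" and cut: "\<forall>(S::(real^'n) set) r. S \<in> sets borel \<longrightarrow> bounded S \<longrightarrow> r > 0 \<longrightarrow> (\<exists>\<theta>. cutoff_fun C S r \<theta>)"
    using cutoff_exists by blast
  define \<epsilon> where "\<epsilon> j = 1 / real (Suc j)" for j
  have \<epsilon>: "\<epsilon> j > 0" "\<epsilon> j \<le> 1" for j by (auto simp: \<epsilon>_def)
  have \<epsilon>0: "\<epsilon> \<longlonglongrightarrow> 0" unfolding \<epsilon>_def by (rule LIMSEQ_Suc[OF lim_1_over_n])
  have cont_inf: "continuous_on UNIV (\<lambda>X. infdist X \<Gamma>)" by (intro continuous_intros)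
  have [measurable]: "(\<lambda>X. infdist X \<Gamma>) \<in> borel_measurable borel"
    by (rule borel_measurable_continuous_onI[OF cont_inf])
  define B where "B = cball (0::real^'n) R"
  have [measurable]: "B \<in> sets borel" by (simp add: B_def)
  define a where "a j = B \<inter> {X. infdist X \<Gamma> \<le> 3 * \<epsilon> j}" for j
  have [measurable]: "a j \<in> sets borel" for j by (simp add: a_def)
  have fa: "emeasure lborel (a j) < \<infinity>" for j
    using emeasure_bounded_less_top[of "a j"] bounded_subset[of B "a j"] by (simp add: a_def B_def)
  \<comment> \<open>The defect in the weak gradient identity for \<phi>. A cutoff \<theta> splits
    \<phi>; the part \<open>(1 - \<theta>) \<phi>\<close> is supported off \<Gamma>, where the
    identity is known, so only the part near \<Gamma> contributes.\<close>
  define I where "I = (LINT X|lborel. w X * classical_grad \<phi> X $ i) + (LINT X|lborel. H X $ i * \<phi> X)"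
  have Iw: "integrable lborel (\<lambda>X. w X * classical_grad \<phi> X $ i)"
    by (rule integrable_test(2)[OF \<phi>]) (use wI in auto)
  have IH: "integrable lborel (\<lambda>X. H X $ i * \<phi> X)"
    by (rule integrable_test(1)[OF \<phi>]) (use HI set_integrable_vec_nth in blast)
  have IBH: "integrable lborel (\<lambda>X. indicat_real B X *\<^sub>R norm (H X))"
    using integrable_norm[OF HI[of B, unfolded set_integrable_def]] by (simp add: B_def)
  define T where "T j = M * M2 * measure lborel (a j) + M * C * M1 * (measure lborel (a j) / \<epsilon> j)
      + M1 * (LINT X|lborel. indicat_real (a j) X * norm (H X))" for j
  have IaH: "integrable lborel (\<lambda>X. indicat_real (a j) X * norm (H X))" for j
    by (rule Bochner_Integration.integrable_bound[OF IBH]) (auto simp: a_def indicator_def)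
  have bd: "cmod I \<le> T j" for j
  proof -
    \<comment> \<open>A cutoff of the \<open>2 * \<epsilon> j\<close> collar at scale
      \<open>\<epsilon> j\<close> equals 1 up to distance \<open>\<epsilon> j\<close> from \<Gamma>
      and 0 beyond \<open>3 * \<epsilon> j\<close>. The radius \<open>R + 1\<close> leaves room for
      the \<epsilon>-balls around the support of \<phi>, as
      \<open>\<epsilon> j \<le> 1\<close>.\<close>
    define S where "S = cball (0::real^'n) (R + 1) \<inter> {X. infdist X \<Gamma> \<le> 2 * \<epsilon> j}"
    have S: "S \<in> sets borel" "bounded S"
      unfolding S_def by (simp, rule bounded_subset[of "cball 0 (R + 1)"]) auto
    obtain \<theta> where \<theta>: "cutoff_fun C S (\<epsilon> j) \<theta>"
      using cut S \<epsilon>(1)[of j] by blast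
    note \<theta>' = cutoff_funD[OF \<theta>]
    let ?\<theta> = "\<lambda>X. complex_of_real (\<theta> X)"
    have near: "infdist y \<Gamma> \<le> infdist x \<Gamma> + \<epsilon> j" "infdist x \<Gamma> \<le> infdist y \<Gamma> + \<epsilon> j" if "y \<in> ball x (\<epsilon> j)" for x y
      using infdist_triangle[of y \<Gamma> x] infdist_triangle[of x \<Gamma> y] that by (auto simp: dist_commute)
    have \<theta>1: "\<theta> x = 1" if "norm x \<le> R" "infdist x \<Gamma> \<le> \<epsilon> j" for x
    proof (rule \<theta>'(4), rule subsetI)
      fix y assume y: "y \<in> ball x (\<epsilon> j)"
      then have "norm y \<le> R + 1"
        using that(1) \<epsilon>(2)[of j] norm_triangle_sub[of y x] by (simp add: dist_norm norm_minus_commute)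
      then show "y \<in> S" using near[OF y] that by (simp add: S_def)
    qed
    have \<theta>0: "\<theta> x = 0 \<and> frechet_derivative \<theta> (at x) = (\<lambda>v. 0)" if "infdist x \<Gamma> > 3 * \<epsilon> j" for x
      using near(2) that by (intro conjI \<theta>'(6) \<theta>'(7)) (force simp: S_def)+
    have sm\<theta>: "smooth_fun ?\<theta>" by (rule smooth_fun_of_real[OF \<theta>'(1)])
    have sm1: "smooth_fun (\<lambda>X. 1 + (-1) * ?\<theta> X)"
      by (intro smooth_fun_add smooth_fun_const smooth_fun_mult sm\<theta>)
    have D\<theta>: "frechet_derivative ?\<theta> (at X) = (\<lambda>v. complex_of_real (frechet_derivative \<theta> (at X) v))" for X
      by (rule frechet_derivative_at[symmetric]) (rule has_derivative_of_real[OF smooth_fun_has_derivative[OF \<theta>'(1)]])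
    have g\<theta>: "cmod (classical_grad ?\<theta> X $ i) \<le> C / \<epsilon> j" for X
      using \<theta>'(8)[of X "axis i 1"] by (simp add: classical_grad_def D\<theta>)
    have g\<theta>0: "classical_grad ?\<theta> X $ i = 0" if "infdist X \<Gamma> > 3 * \<epsilon> j" for X
      using \<theta>0[OF that] by (simp add: classical_grad_def D\<theta>)
    have test: "(\<lambda>X. (1 + (-1) * ?\<theta> X) * \<phi> X) \<in> test_functions (- \<Gamma>)"
    proof (rule test_functionsI[OF smooth_fun_mult[OF sm1 sm], where K = "B \<inter> {X. infdist X \<Gamma> \<ge> \<epsilon> j}"])
      show "compact (B \<inter> {X. infdist X \<Gamma> \<ge> \<epsilon> j})"
        unfolding B_def by (intro compact_Int_closed compact_cball closed_Collect_le continuous_intros)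
      show "B \<inter> {X. infdist X \<Gamma> \<ge> \<epsilon> j} \<subseteq> - \<Gamma>"
        using \<epsilon>(1)[of j] by (auto simp: not_le[symmetric])
      fix X assume "X \<notin> B \<inter> {X. infdist X \<Gamma> \<ge> \<epsilon> j}"
      then show "(1 + (-1) * ?\<theta> X) * \<phi> X = 0"
        using R[of X] \<theta>1[of X] by (cases "norm X \<le> R") (auto simp: B_def)
    qed
    let ?g = "\<lambda>X. (1 + (-1) * ?\<theta> X) * classical_grad \<phi> X $ i - classical_grad ?\<theta> X $ i * \<phi> X"
    have grad: "classical_grad (\<lambda>X. (1 + (-1) * ?\<theta> X) * \<phi> X) X $ i = ?g X" for X
    proof -
      have "classical_grad (\<lambda>X. 1 + (-1) * ?\<theta> X) X $ i = - (classical_grad ?\<theta> X $ i)"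
      proof -
        have "((\<lambda>X. 1 + (-1) * ?\<theta> X) has_derivative (\<lambda>v. 0 + (-1) * frechet_derivative ?\<theta> (at X) v)) (at X)"
          by (intro has_derivative_add has_derivative_const has_derivative_mult_right smooth_fun_has_derivative[OF sm\<theta>])
        from frechet_derivative_at[OF this, symmetric] show ?thesis by (simp add: classical_grad_def)
      qed
      then show ?thesis
        unfolding classical_grad_mult[OF sm1 sm] by simp
    qed
    \<comment> \<open>The integrand of the defect with \<open>\<theta> \<phi>\<close> in place of
      \<phi>; it vanishes outside the collar \<open>a j\<close>.\<close>
    let ?E = "\<lambda>X. w X * (?\<theta> X * classical_grad \<phi> X $ i) + w X * (classical_grad ?\<theta> X $ i * \<phi> X) + H X $ i * (?\<theta> X * \<phi> X)"
    have weq: "(LINT X|lborel. w X * ?g X) + (LINT X|lborel. H X $ i * ((1 + (-1) * ?\<theta> X) * \<phi> X)) = 0"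
      using w'(5)[OF test, of i] by (simp only: grad add.left_inverse)
    have B: "compact B" "\<And>X. X \<notin> B \<Longrightarrow> \<phi> X = 0" "\<And>X. X \<notin> B \<Longrightarrow> classical_grad \<phi> X $ i = 0"
      using R R' by (auto simp: B_def)
    note cs = smooth_fun_continuous[OF sm] smooth_fun_continuous[OF sm\<theta>] continuous_classical_grad[OF sm] continuous_classical_grad[OF sm\<theta>]
    have J: "integrable lborel (\<lambda>X. w X * ?g X)" "integrable lborel (\<lambda>X. H X $ i * ((1 + (-1) * ?\<theta> X) * \<phi> X))"
      by (rule integrable_mult_continuous[OF _ B(1)];
          (use wI HI B in \<open>auto intro!: continuous_intros cs set_integrable_vec_nth\<close>))+
    have "I = (LINT X|lborel. ?E X)"
    proof -
      have "(LINT X|lborel. ?E X) = (LINT X|lborel. (w X * classical_grad \<phi> X $ i + H X $ i * \<phi> X) - (w X * ?g X + H X $ i * ((1 + (-1) * ?\<theta> X) * \<phi> X)))"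
        by (intro Bochner_Integration.integral_cong refl) (simp add: algebra_simps)
      also have "\<dots> = I - 0"
        unfolding I_def weq[symmetric] using Iw IH J by simp
      finally show ?thesis by simp
    qed
    also have "cmod (LINT X|lborel. ?E X) \<le> (LINT X|lborel. indicat_real (a j) X * (M * M2) + indicat_real (a j) X * (M * (C / \<epsilon> j) * M1) + indicat_real (a j) X * norm (H X) * M1)"
    proof (rule LINT_norm_bound)
      have "integrable lborel (\<lambda>X. (w X * classical_grad \<phi> X $ i + H X $ i * \<phi> X) - (w X * ?g X + H X $ i * ((1 + (-1) * ?\<theta> X) * \<phi> X)))"
        by (intro Bochner_Integration.integrable_diff Bochner_Integration.integrable_add Iw IH J)
      also have "?this \<longleftrightarrow> integrable lborel ?E"
        by (intro Bochner_Integration.integrable_cong refl) (simp add: algebra_simps)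
      finally show "integrable lborel ?E" .
      show "integrable lborel (\<lambda>X. indicat_real (a j) X * (M * M2) + indicat_real (a j) X * (M * (C / \<epsilon> j) * M1) + indicat_real (a j) X * norm (H X) * M1)"
        using fa[of j] by (intro Bochner_Integration.integrable_add integrable_mult_left IaH integrable_real_indicator) auto
      fix X
      show "cmod (?E X) \<le> indicat_real (a j) X * (M * M2) + indicat_real (a j) X * (M * (C / \<epsilon> j) * M1) + indicat_real (a j) X * norm (H X) * M1"
      proof (cases "X \<in> a j")
        case False
        then have "norm X > R \<or> infdist X \<Gamma> > 3 * \<epsilon> j" by (auto simp: a_def B_def)
        then show ?thesis using False R[of X] R'[of X] \<theta>0[of X] g\<theta>0[of X] by auto
      next
        case True
        have t: "cmod (?\<theta> X) \<le> 1" using \<theta>'(2,3)[of X] by simp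
        have "cmod (?E X) \<le> cmod (w X) * (cmod (?\<theta> X) * cmod (classical_grad \<phi> X $ i)) + cmod (w X) * (cmod (classical_grad ?\<theta> X $ i) * cmod (\<phi> X)) + cmod (H X $ i) * (cmod (?\<theta> X) * cmod (\<phi> X))"
          by (simp only: norm_mult[symmetric]) (intro norm_triangle_mono norm_triangle_ineq order_refl)
        also have "\<dots> \<le> M * (1 * M2) + M * ((C / \<epsilon> j) * M1) + norm (H X) * (1 * M1)"
          using M0 C \<epsilon>(1)[of j]
          by (intro add_mono mult_mono M M1 M2 t g\<theta> Finite_Cartesian_Product.norm_nth_le) auto
        finally show ?thesis using True by simp
      qed
    qed
    also have "\<dots> = T j"
      using fa[of j] IaH by (simp add: T_def mult_ac)
    finally show ?thesis .
  qed
  have thinj: "(\<lambda>j. measure lborel (a j) / (3 * \<epsilon> j)) \<longlonglongrightarrow> 0"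
  proof -
    have "\<epsilon> j \<noteq> 0" for j using \<epsilon>(1)[of j] by simp
    then have "filterlim (\<lambda>j. 3 * \<epsilon> j) (at_right 0) sequentially"
      using tendsto_mult_right[OF \<epsilon>0, of 3] \<epsilon>(1) by (auto simp: filterlim_at intro!: always_eventually)
    from filterlim_compose[OF \<Gamma>(3)[unfolded thin_def, rule_format, of R] this]
    show ?thesis by (simp add: a_def B_def)
  qed
  have l2: "(\<lambda>j. measure lborel (a j) / \<epsilon> j) \<longlonglongrightarrow> 0"
    using tendsto_mult_right[OF thinj, of 3] by simp
  have l1: "(\<lambda>j. measure lborel (a j)) \<longlonglongrightarrow> 0"
  proof -
    have "(\<lambda>j. (measure lborel (a j) / \<epsilon> j) * \<epsilon> j) \<longlonglongrightarrow> 0 * 0" by (intro tendsto_mult l2 \<epsilon>0)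
    moreover have "(measure lborel (a j) / \<epsilon> j) * \<epsilon> j = measure lborel (a j)" for j using \<epsilon>(1)[of j] by simp
    ultimately show ?thesis by simp
  qed
  \<comment> \<open>Each point off \<Gamma> eventually leaves the collars, and on \<Gamma> the field
    \<open>H\<close> is 0 by assumption; dominated convergence applies.\<close>
  have l3: "(\<lambda>j. LINT X|lborel. indicat_real (a j) X * norm (H X)) \<longlonglongrightarrow> (LINT X|(lborel::(real^'n) measure). 0)"
  proof (rule integral_dominated_convergence[OF _ _ IBH])
    show "AE X in lborel. (\<lambda>j. indicat_real (a j) X * norm (H X)) \<longlonglongrightarrow> 0"
    proof (intro AE_I2)
      fix X
      show "(\<lambda>j. indicat_real (a j) X * norm (H X)) \<longlonglongrightarrow> 0"
      proof (cases "X \<in> \<Gamma>")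
        case False
        then have p: "infdist X \<Gamma> > 0"
          using \<Gamma>(1,2) by (metis in_closed_iff_infdist_zero infdist_nonneg less_eq_real_def)
        have "eventually (\<lambda>j. 3 * \<epsilon> j < infdist X \<Gamma>) sequentially"
          using tendsto_mult_right[OF \<epsilon>0, of 3] p by (intro order_tendstoD(2)) auto
        then have "eventually (\<lambda>j. indicat_real (a j) X * norm (H X) = 0) sequentially"
          by eventually_elim (auto simp: a_def)
        then show ?thesis
          by (rule tendsto_eventually)
      qed (simp add: z)
    qed
    show "AE X in lborel. norm (indicat_real (a j) X * norm (H X)) \<le> indicat_real B X *\<^sub>R norm (H X)" for j
      by (intro AE_I2) (auto simp: a_def indicator_def)
  qed auto
  have "T \<longlonglongrightarrow> M * M2 * 0 + M * C * M1 * 0 + M1 * (LINT X|(lborel::(real^'n) measure). 0)"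
    unfolding T_def by (intro tendsto_add tendsto_mult tendsto_const l1 l2 l3)
  then have "cmod I \<le> 0"
    using bd by (intro LIMSEQ_le_const[of T]) auto
  then show "(LINT X|lborel. w X * classical_grad \<phi> X $ i) = - (LINT X|lborel. H X $ i * \<phi> X)"
    by (simp add: I_def eq_neg_iff_add_eq_0)
qed

section \<open>Truncation and the Poincare inequality across \<Gamma>\<close>

definition trunc :: "real \<Rightarrow> complex \<Rightarrow> complex" where
  "trunc M z = Complex (M * arctan (Re z / M)) (M * arctan (Im z / M))"

definition trunc_deriv :: "real \<Rightarrow> complex \<Rightarrow> complex \<Rightarrow> complex" where
  "trunc_deriv M z v = Complex (Re v / (1 + (Re z / M)\<^sup>2)) (Im v / (1 + (Im z / M)\<^sup>2))"

text \<open>The arctangent takes the place of a hard truncation because the chain rule is available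
  for C1 functions. The Lipschitz constant 1, independent of \<open>M\<close>, keeps truncated
  gradients below the original one.\<close>

lemma C1_lipschitz_trunc:
  assumes M: "M > 0"
  shows "C1_lipschitz (trunc M) (trunc_deriv M) 1"
proof
  fix z v
  have Complex_eq': "Complex a b = of_real a + \<i> * of_real b" for a b by (simp add: complex_eq_iff)
  have at: "((\<lambda>x. M * arctan (x / M)) has_derivative (\<lambda>h. h / (1 + (x / M)\<^sup>2))) (at x)" for x :: real
    using M by (auto intro!: derivative_eq_intros simp: fun_eq_iff power_divide divide_inverse)
  have R: "((\<lambda>z. M * arctan (Re z / M)) has_derivative (\<lambda>v. Re v / (1 + (Re z / M)\<^sup>2))) (at z)"
    by (rule has_derivative_compose[OF bounded_linear_imp_has_derivative[OF bounded_linear_Re] at])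
  have I: "((\<lambda>z. M * arctan (Im z / M)) has_derivative (\<lambda>v. Im v / (1 + (Im z / M)\<^sup>2))) (at z)"
    by (rule has_derivative_compose[OF bounded_linear_imp_has_derivative[OF bounded_linear_Im] at])
  show "(trunc M has_derivative trunc_deriv M z) (at z)"
    unfolding trunc_def[abs_def] trunc_deriv_def[abs_def] Complex_eq'
    by (intro has_derivative_add has_derivative_mult_right has_derivative_of_real R I)
  have p: "1 + (x / M)\<^sup>2 \<noteq> 0" for x by (smt (verit) zero_le_power2)
  show "continuous_on UNIV (\<lambda>z. trunc_deriv M z v)"
    unfolding trunc_deriv_def Complex_eq' using M p by (intro continuous_intros) auto
  have le: "\<bar>a / (1 + (x / M)\<^sup>2)\<bar> \<le> \<bar>a\<bar>" for a x
    using p[of x] by (simp add: abs_divide divide_le_eq) (smt (verit) mult_left_mono abs_ge_zero zero_le_power2 mult_cancel_left2 mult_left_le)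
  show "cmod (trunc_deriv M z v) \<le> 1 * cmod v"
    unfolding cmod_def trunc_deriv_def mult_1 complex.sel
    by (intro real_sqrt_le_mono add_mono abs_le_square_iff[THEN iffD1] le)
qed

lemma norm_trunc_le: "M > 0 \<Longrightarrow> cmod (trunc M z) \<le> M * pi"
proof -
  assume M: "M > 0"
  have b: "\<bar>arctan x\<bar> \<le> pi / 2" for x
    using arctan_bounded[of x] by (auto simp: abs_le_iff)
  have "cmod (trunc M z) \<le> \<bar>M * arctan (Re z / M)\<bar> + \<bar>M * arctan (Im z / M)\<bar>"
    using cmod_le[of "trunc M z"] by (simp add: trunc_def)
  also have "\<dots> \<le> M * (pi / 2) + M * (pi / 2)"
    using M b by (intro add_mono) (auto simp: abs_mult intro!: mult_left_mono)
  finally show ?thesis by simp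
qed

lemma trunc_tendsto: "(\<lambda>j. trunc (real (Suc j)) z) \<longlonglongrightarrow> z"
proof -
  have "(\<lambda>j. real (Suc j) * arctan (x / real (Suc j))) \<longlonglongrightarrow> x" for x
  proof -
    \<comment> \<open>With \<open>h = 1 / real (Suc j)\<close> the truncated coordinate is the
      difference quotient of this function at 0.\<close>
    have "((\<lambda>h. arctan (x * h)) has_real_derivative x) (at 0)"
      by (auto intro!: derivative_eq_intros)
    then have "((\<lambda>h. arctan (x * h) / h) \<longlongrightarrow> x) (at 0)"
      by (simp add: DERIV_def)
    moreover have "filterlim (\<lambda>j. 1 / real (Suc j)) (at 0) sequentially"
      using LIMSEQ_Suc[OF lim_1_over_n] by (auto simp: filterlim_at intro!: always_eventually)
    ultimately have "(\<lambda>j. arctan (x * (1 / real (Suc j))) / (1 / real (Suc j))) \<longlonglongrightarrow> x"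
      by (rule filterlim_compose)
    then show ?thesis by (simp add: mult.commute)
  qed
  from tendsto_Complex[OF this[of "Re z"] this[of "Im z"]] show ?thesis
    unfolding trunc_def by (simp only: complex.collapse)
qed

text \<open>Truncations of \<open>w\<close> are bounded and hence extend across \<Gamma>, so the
  inequality on the whole space applies to them; their gradients are dominated by \<open>H\<close>,
  and Fatou's lemma removes the truncation.\<close>

lemma poincare_pair:
  fixes \<Gamma> :: "(real ^ 'n::finite) set"
  assumes \<Gamma>: "closed \<Gamma>" "\<Gamma> \<noteq> {}" "thin \<Gamma>"
    and w: "wgrad (- \<Gamma>) w H" and z: "\<And>X. X \<in> \<Gamma> \<Longrightarrow> H X = 0"
    and H2: "\<And>K. compact K \<Longrightarrow> set_integrable lborel K (\<lambda>X. (norm (H X))\<^sup>2)" and r: "r > 0"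
  shows "(\<integral>\<^sup>+X. \<integral>\<^sup>+Y. indicator (ball c r) X * indicator (ball c r) Y * ennreal ((cmod (w X - w Y))\<^sup>2) \<partial>lborel \<partial>lborel)
    \<le> ennreal (4 * r\<^sup>2 * 2 ^ CARD('n)) * emeasure lborel (ball c r) *
      (2 * (\<integral>\<^sup>+Z. indicator (ball c r) Z * ennreal ((norm (H Z))\<^sup>2) \<partial>lborel))"
proof -
  note w' = wgradD[OF w]
  note [measurable] = w'(1,2)
  define v where "v j X = trunc (real (Suc j)) (w X)" for j X
  define G where "G j X = (\<chi> i. trunc_deriv (real (Suc j)) (w X) (H X $ i))" for j X
  have C: "C1_lipschitz (trunc (real (Suc j))) (trunc_deriv (real (Suc j))) 1" for j
    by (rule C1_lipschitz_trunc) simp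
  have vG: "wgrad (- \<Gamma>) (v j) (G j)" for j
    unfolding v_def G_def using C1_lipschitz.wgrad_chain[OF C _ w] \<Gamma>(1) by (simp add: open_Compl)
  have [measurable]: "v j \<in> borel_measurable borel" "G j \<in> borel_measurable borel" for j
    using wgradD(1,2)[OF vG] by auto
  have Gle: "norm (G j X) \<le> norm (H X)" for j X
    unfolding norm_vec_def using C1_lipschitz.bound[OF C, of j "w X"]
    by (intro L2_set_mono) (auto simp: G_def)
  have G2: "set_integrable lborel K (\<lambda>X. (norm (G j X))\<^sup>2)" if "compact K" for K j
    unfolding set_integrable_def
  proof (rule Bochner_Integration.integrable_bound)
    have [measurable]: "K \<in> sets borel" using that by (rule borel_compact)
    show "integrable lborel (\<lambda>X. indicat_real K X *\<^sub>R (norm (H X))\<^sup>2)"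
      using H2[OF that] by (simp add: set_integrable_def)
    show "AE X in lborel. norm (indicat_real K X *\<^sub>R (norm (G j X))\<^sup>2) \<le> norm (indicat_real K X *\<^sub>R (norm (H X))\<^sup>2)"
      using Gle by (intro AE_I2) (auto intro!: mult_left_mono power_mono)
    show "(\<lambda>X. indicat_real K X *\<^sub>R (norm (G j X))\<^sup>2) \<in> borel_measurable lborel" by measurable
  qed
  have G1: "set_integrable lborel K (G j)" if "compact K" for K j
    unfolding set_integrable_def
  proof (rule Bochner_Integration.integrable_bound)
    have [measurable]: "K \<in> sets borel" using that by (rule borel_compact)
    show "integrable lborel (\<lambda>X. indicat_real K X + indicat_real K X *\<^sub>R (norm (G j X))\<^sup>2)"
      using G2[OF that] that unfolding set_integrable_def
      by (intro Bochner_Integration.integrable_add integrable_real_indicator) (auto simp: emeasure_bounded_less_top compact_imp_bounded)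
    show "AE X in lborel. norm (indicat_real K X *\<^sub>R G j X) \<le> norm (indicat_real K X + indicat_real K X *\<^sub>R (norm (G j X))\<^sup>2)"
    proof (intro AE_I2)
      fix X
      have "norm (G j X) \<le> 1 + (norm (G j X))\<^sup>2"
        using sum_squares_bound[of "norm (G j X)" 1] norm_ge_zero[of "G j X"] unfolding one_power2 by linarith
      then show "norm (indicat_real K X *\<^sub>R G j X) \<le> norm (indicat_real K X + indicat_real K X *\<^sub>R (norm (G j X))\<^sup>2)"
        by (auto simp: indicator_def)
    qed
    show "(\<lambda>X. indicat_real K X *\<^sub>R G j X) \<in> borel_measurable lborel" by measurable
  qed
  have vU: "wgrad UNIV (v j) (G j)" for j
  proof (rule wgrad_extend[OF \<Gamma> vG])
    show "cmod (v j X) \<le> real (Suc j) * pi" for X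
      unfolding v_def by (rule norm_trunc_le) simp
    show "G j X = 0" if "X \<in> \<Gamma>" for X
      using Gle[of j X] z[OF that] by simp
  qed (use G1 in auto)
  let ?F = "\<lambda>H. ennreal (4 * r\<^sup>2 * 2 ^ CARD('n)) * emeasure lborel (ball c r) *
      (2 * (\<integral>\<^sup>+Z. indicator (ball c r) Z * ennreal ((norm (H Z))\<^sup>2) \<partial>lborel))"
  show ?thesis
  proof (rule nn_integral_pair_liminf_le[where v = v and F = "\<lambda>j. ?F H"])
    show "AE X in lborel. X \<in> ball c r \<longrightarrow> (\<lambda>j. v j X) \<longlonglongrightarrow> w X"
      unfolding v_def using trunc_tendsto by auto
    fix j
    have "?F (G j) \<le> ?F H"
      using Gle by (intro mult_left_mono nn_integral_mono ennreal_leI power_mono) auto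
    with poincare_pair_UNIV[OF vU G2 r] 
    show "(\<integral>\<^sup>+X. \<integral>\<^sup>+Y. indicator (ball c r) X * indicator (ball c r) Y * ennreal ((cmod (v j X - v j Y))\<^sup>2) \<partial>lborel \<partial>lborel) \<le> ?F H"
      by (rule order_trans)
  qed auto
qed

section \<open>Ahlfors regular sets and a Hardy inequality\<close>

text \<open>\<tau> is the regular measure transported to the whole space, so that balls with
  arbitrary centres may be used: \<open>far\<close> says that \<tau> is carried by \<Gamma>, and the
  radius in \<open>lower\<close> is doubled because the centre may lie at distance up to
  \<open>r\<close> from \<Gamma>.\<close>

locale ahlfors =
  fixes \<Gamma> :: "(real ^ 'n::finite) set" and \<tau> :: "(real ^ 'n) measure" and d C N :: real
  assumes closed: "closed \<Gamma>" and ne: "\<Gamma> \<noteq> {}"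
    and sets_\<tau>[measurable_cong]: "sets \<tau> = sets borel"
    and upper: "0 < r \<Longrightarrow> emeasure \<tau> (ball X r) \<le> ennreal (C * r powr d)"
    and far: "r \<le> infdist X \<Gamma> \<Longrightarrow> emeasure \<tau> (ball X r) = 0"
    and lower: "infdist X \<Gamma> < r \<Longrightarrow> ennreal (r powr d / C) \<le> emeasure \<tau> (ball X (2 * r))"
    and C: "0 < C" and N: "N = real CARD('n)" and d: "0 < d" "d < N - 1"
begin

abbreviation \<delta> :: "real ^ 'n \<Rightarrow> real" where "\<delta> X \<equiv> infdist X \<Gamma>"

lemma borel_measurable_\<delta> [measurable]: "\<delta> \<in> borel_measurable borel"
  by (intro borel_measurable_continuous_onI continuous_intros)

lemma \<delta>_pos_iff: "0 < \<delta> X \<longleftrightarrow> X \<notin> \<Gamma>"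
  using in_closed_iff_infdist_zero[OF closed ne, of X] infdist_nonneg[of X \<Gamma>] by linarith

lemma weight_eq: "weight d \<Gamma> X = \<delta> X powr (d + 1 - N)"
  by (simp add: weight_def N)

lemma borel_measurable_weight [measurable]: "weight d \<Gamma> \<in> borel_measurable borel"
  unfolding weight_def[abs_def] by measurable

lemma sets_\<Gamma> [measurable]: "\<Gamma> \<in> sets borel"
  using closed by simp

lemma space_\<tau>: "space \<tau> = UNIV"
  using sets_eq_imp_space_eq[OF sets_\<tau>] by simp

sublocale \<tau>: sigma_finite_measure \<tau>
proof
  show "\<exists>A::(real^'n) set set. countable A \<and> A \<subseteq> sets \<tau> \<and> \<Union> A = space \<tau> \<and> (\<forall>a\<in>A. emeasure \<tau> a \<noteq> \<infinity>)"
  proof (intro exI[of _ "range (\<lambda>k::nat. ball 0 (real (Suc k)))"] conjI ballI)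
    show "\<Union> (range (\<lambda>k::nat. ball (0::real^'n) (real (Suc k)))) = space \<tau>"
    proof -
      have "\<exists>k::nat. norm x < real (Suc k)" for x :: "real^'n"
        using reals_Archimedean2[of "norm x"] by (metis less_trans lessI of_nat_less_iff)
      then show ?thesis by (auto simp: space_\<tau>)
    qed
    fix a assume "a \<in> range (\<lambda>k::nat. ball (0::real^'n) (real (Suc k)))"
    then obtain k where a: "a = ball 0 (real (Suc k))" by blast
    have "emeasure \<tau> a < \<infinity>"
      unfolding a using upper[of "real (Suc k)" 0] by (rule le_less_trans) auto
    then show "emeasure \<tau> a \<noteq> \<infinity>" by simp
  qed (auto simp: sets_\<tau>)
qed

sublocale lt: pair_sigma_finite \<tau> lborel ..

lemma emeasure_ball: "0 \<le> r \<Longrightarrow> emeasure lborel (ball (X::real^'n) r) = ennreal (unit_ball_vol N * r powr N)"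
  by (simp add: Ball_Volume.emeasure_ball powr_realpow' N)

text \<open>Fubini for the symmetric relation \<open>dist y X < s\<close>. It exchanges integration
  over balls centred on \<Gamma> with integration over a collar.\<close>

lemma nn_integral_\<tau>_ball:
  assumes [measurable]: "f \<in> borel_measurable borel"
  shows "(\<integral>\<^sup>+y. (\<integral>\<^sup>+X. indicator (ball y s) X * f X \<partial>lborel) \<partial>\<tau>) = (\<integral>\<^sup>+X. f X * emeasure \<tau> (ball X s) \<partial>lborel)"
proof -
  \<comment> \<open>Stated through \<open>dist\<close>, the indicator is visibly measurable jointly
    in \<open>y\<close> and \<open>X\<close>.\<close>
  have ind: "indicator (ball y s) X = (if dist y X < s then 1 else 0 :: ennreal)" for y X :: "real^'n"
    by (simp add: indicator_def)
  have "(\<integral>\<^sup>+y. (\<integral>\<^sup>+X. (if dist y X < s then 1 else 0) * f X \<partial>lborel) \<partial>\<tau>)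
      = (\<integral>\<^sup>+X. (\<integral>\<^sup>+y. (if dist y X < s then 1 else 0) * f X \<partial>\<tau>) \<partial>lborel)"
    by (rule lt.Fubini'[symmetric]) measurable
  also have "\<dots> = (\<integral>\<^sup>+X. f X * emeasure \<tau> (ball X s) \<partial>lborel)"
  proof (intro nn_integral_cong)
    fix X
    have "(\<integral>\<^sup>+y. (if dist y X < s then 1 else 0) * f X \<partial>\<tau>) = (\<integral>\<^sup>+y. indicator (ball X s) y * f X \<partial>\<tau>)"
      by (intro nn_integral_cong) (simp add: indicator_def dist_commute)
    also have "\<dots> = emeasure \<tau> (ball X s) * f X"
      by (subst nn_integral_multc) (auto simp: sets_\<tau> intro!: borel_measurable_indicator)
    finally show "(\<integral>\<^sup>+y. (if dist y X < s then 1 else 0) * f X \<partial>\<tau>) = f X * emeasure \<tau> (ball X s)"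
      by (simp add: mult.commute)
  qed
  finally show ?thesis by (simp add: ind)
qed

lemma nn_integral_\<tau>_ball_le:
  assumes [measurable]: "f \<in> borel_measurable borel" and s: "s > 0"
  shows "(\<integral>\<^sup>+y. (\<integral>\<^sup>+X. indicator (ball y s) X * f X \<partial>lborel) \<partial>\<tau>)
    \<le> ennreal (C * s powr d) * (\<integral>\<^sup>+X. indicator {X. \<delta> X < s} X * f X \<partial>lborel)"
proof -
  have "(\<integral>\<^sup>+X. f X * emeasure \<tau> (ball X s) \<partial>lborel) \<le> (\<integral>\<^sup>+X. ennreal (C * s powr d) * (indicator {X. \<delta> X < s} X * f X) \<partial>lborel)"
  proof (intro nn_integral_mono)
    fix X
    show "f X * emeasure \<tau> (ball X s) \<le> ennreal (C * s powr d) * (indicator {X. \<delta> X < s} X * f X)"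
      using upper[OF s, of X] far[of s X] by (cases "\<delta> X < s") (auto simp: mult.commute intro: mult_left_mono)
  qed
  also have "\<dots> = ennreal (C * s powr d) * (\<integral>\<^sup>+X. indicator {X. \<delta> X < s} X * f X \<partial>lborel)"
    by (rule nn_integral_cmult) measurable
  finally show ?thesis by (simp add: nn_integral_\<tau>_ball)
qed

text \<open>Each point of the collar sees \<tau>-mass at least \<open>\<epsilon> powr d / C\<close>
  within distance \<open>2 * \<epsilon>\<close>. A collar integral is thereby reduced to integrals
  over balls centred on \<Gamma>, averaged by \<tau>, in place of a covering argument.\<close>

lemma nn_integral_collar_le:
  assumes [measurable]: "f \<in> borel_measurable borel" and e: "\<epsilon> > 0"
  shows "(\<integral>\<^sup>+X. indicator {X. \<delta> X < \<epsilon>} X * f X \<partial>lborel)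
    \<le> ennreal (C / \<epsilon> powr d) * (\<integral>\<^sup>+y. (\<integral>\<^sup>+X. indicator (ball y (2 * \<epsilon>)) X * (indicator {X. \<delta> X < \<epsilon>} X * f X) \<partial>lborel) \<partial>\<tau>)"
proof -
  let ?g = "\<lambda>X. indicator {X. \<delta> X < \<epsilon>} X * f X"
  have p: "\<epsilon> powr d > 0" using e by simp
  have "(\<integral>\<^sup>+X. ?g X \<partial>lborel) \<le> (\<integral>\<^sup>+X. ennreal (C / \<epsilon> powr d) * (?g X * emeasure \<tau> (ball X (2 * \<epsilon>))) \<partial>lborel)"
  proof (intro nn_integral_mono)
    fix X
    show "?g X \<le> ennreal (C / \<epsilon> powr d) * (?g X * emeasure \<tau> (ball X (2 * \<epsilon>)))"
    proof (cases "\<delta> X < \<epsilon>")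
      case True
      have "1 = ennreal (C / \<epsilon> powr d) * ennreal (\<epsilon> powr d / C)"
        using C p by (simp add: ennreal_mult[symmetric])
      also have "\<dots> \<le> ennreal (C / \<epsilon> powr d) * emeasure \<tau> (ball X (2 * \<epsilon>))"
        by (rule mult_left_mono[OF lower[OF True]]) simp
      finally have "?g X * 1 \<le> ?g X * (ennreal (C / \<epsilon> powr d) * emeasure \<tau> (ball X (2 * \<epsilon>)))"
        by (rule mult_left_mono) simp
      then show ?thesis by (simp add: mult.left_commute)
    qed simp
  qed
  also have "\<dots> = ennreal (C / \<epsilon> powr d) * (\<integral>\<^sup>+X. ?g X * emeasure \<tau> (ball X (2 * \<epsilon>)) \<partial>lborel)"
  proof (rule nn_integral_cmult)
    have "(\<lambda>X. emeasure \<tau> (ball X (2 * \<epsilon>))) = (\<lambda>X. \<integral>\<^sup>+y. (if dist X y < 2 * \<epsilon> then 1 else 0) \<partial>\<tau>)"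
    proof
      fix X
      have "emeasure \<tau> (ball X (2 * \<epsilon>)) = (\<integral>\<^sup>+y. indicator (ball X (2 * \<epsilon>)) y \<partial>\<tau>)"
        by (simp add: sets_\<tau>)
      then show "emeasure \<tau> (ball X (2 * \<epsilon>)) = (\<integral>\<^sup>+y. (if dist X y < 2 * \<epsilon> then 1 else 0) \<partial>\<tau>)"
        by (simp add: indicator_def of_bool_def)
    qed
    then have [measurable]: "(\<lambda>X. emeasure \<tau> (ball X (2 * \<epsilon>))) \<in> borel_measurable lborel"
      by (simp only:) measurable
    show "(\<lambda>X. ?g X * emeasure \<tau> (ball X (2 * \<epsilon>))) \<in> borel_measurable lborel"
      by measurable
  qed
  finally show ?thesis
    by (subst nn_integral_\<tau>_ball) auto
qed

text \<open>Balls of radius \<open>2 * \<epsilon>\<close> have volume of order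
  \<open>\<epsilon> powr N\<close>, and averaging over centres with density
  \<open>1 / \<epsilon> powr d\<close> leaves \<open>\<epsilon> powr (N - d)\<close>.\<close>

lemma collar_volume:
  assumes "R > 0"
  obtains K where "K \<ge> 0" "\<And>\<epsilon>. 0 < \<epsilon> \<Longrightarrow> \<epsilon> \<le> 1 \<Longrightarrow>
    (\<integral>\<^sup>+X. indicator {X. \<delta> X < \<epsilon>} X * indicator (ball 0 R) X \<partial>lborel) \<le> ennreal (K * \<epsilon> powr (N - d))"
proof -
  \<comment> \<open>The radius \<open>R + 2\<close> collects the centres: a ball of radius
    \<open>2 * \<epsilon> \<le> 2\<close> meets \<open>ball 0 R\<close> only if its centre lies in
    \<open>ball 0 (R + 2)\<close>.\<close>
  define K where "K = C * (unit_ball_vol N * 2 powr N * (C * (R + 2) powr d))"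
  have K: "K \<ge> 0" using C N by (simp add: K_def)
  have "(\<integral>\<^sup>+X. indicator {X. \<delta> X < \<epsilon>} X * indicator (ball 0 R) X \<partial>lborel) \<le> ennreal (K * \<epsilon> powr (N - d))"
    if e: "0 < \<epsilon>" "\<epsilon> \<le> 1" for \<epsilon>
  proof -
    have [measurable]: "ball (0::real^'n) R \<in> sets borel" "ball (0::real^'n) (R + 2) \<in> sets borel" by auto
    let ?b = "\<lambda>y. \<integral>\<^sup>+X. indicator (ball y (2 * \<epsilon>)) X * (indicator {X. \<delta> X < \<epsilon>} X * indicator (ball 0 R) X) \<partial>lborel"
    have "?b y \<le> ennreal (unit_ball_vol N * (2 * \<epsilon>) powr N) * indicator (ball 0 (R + 2)) y" for y :: "real^'n"
    proof (cases "y \<in> ball 0 (R + 2)")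
      case True
      have "?b y \<le> (\<integral>\<^sup>+X. indicator (ball y (2 * \<epsilon>)) X \<partial>lborel)"
        by (intro nn_integral_mono) (auto simp: indicator_def)
      also have "\<dots> = ennreal (unit_ball_vol N * (2 * \<epsilon>) powr N)"
        using e by (simp add: emeasure_ball)
      finally show ?thesis using True by simp
    next
      case False
      have "X \<notin> ball 0 R" if "X \<in> ball y (2 * \<epsilon>)" for X
        using that False e norm_triangle_sub[of y X] by (auto simp: dist_norm)
      then have "?b y = (\<integral>\<^sup>+X. 0 \<partial>(lborel::(real^'n) measure))"
        by (intro nn_integral_cong) (auto simp: indicator_def)
      then show ?thesis by simp
    qed
    then have "(\<integral>\<^sup>+y. ?b y \<partial>\<tau>) \<le> (\<integral>\<^sup>+y. ennreal (unit_ball_vol N * (2 * \<epsilon>) powr N) * indicator (ball 0 (R + 2)) y \<partial>\<tau>)"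
      by (intro nn_integral_mono)
    also have "\<dots> = ennreal (unit_ball_vol N * (2 * \<epsilon>) powr N) * emeasure \<tau> (ball 0 (R + 2))"
      by (simp add: nn_integral_cmult_indicator sets_\<tau>)
    also have "\<dots> \<le> ennreal (unit_ball_vol N * (2 * \<epsilon>) powr N) * ennreal (C * (R + 2) powr d)"
      using assms by (intro mult_left_mono upper) auto
    finally have "ennreal (C / \<epsilon> powr d) * (\<integral>\<^sup>+y. ?b y \<partial>\<tau>)
        \<le> ennreal (C / \<epsilon> powr d) * (ennreal (unit_ball_vol N * (2 * \<epsilon>) powr N) * ennreal (C * (R + 2) powr d))"
      by (rule mult_left_mono) simp
    also have "\<dots> = ennreal (C / \<epsilon> powr d * (unit_ball_vol N * (2 * \<epsilon>) powr N * (C * (R + 2) powr d)))"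
      using C e N by (simp add: ennreal_mult[symmetric])
    also have "C / \<epsilon> powr d * (unit_ball_vol N * (2 * \<epsilon>) powr N * (C * (R + 2) powr d)) = K * \<epsilon> powr (N - d)"
      using e by (simp add: K_def powr_mult powr_diff)
    finally show ?thesis
      by (intro order_trans[OF nn_integral_collar_le[of "indicator (ball 0 R)", OF _ e(1)]]) auto
  qed
  then show ?thesis using that K by blast
qed

text \<open>The collar volume is of order \<open>\<epsilon> powr (N - d)\<close> and
  \<open>N - d > 1\<close> by assumption \<open>d\<close>. Doubling \<epsilon> passes from the
  closed collar of \<open>thin\<close> to an open one.\<close>

lemma thin_\<Gamma>: "thin \<Gamma>"
  unfolding thin_def
proof
  fix R :: real
  define R' where "R' = \<bar>R\<bar> + 1"
  have "R' > 0" by (simp add: R'_def)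
  then obtain K where K: "K \<ge> 0" "\<And>\<epsilon>. 0 < \<epsilon> \<Longrightarrow> \<epsilon> \<le> 1 \<Longrightarrow>
    (\<integral>\<^sup>+X. indicator {X. \<delta> X < \<epsilon>} X * indicator (ball 0 R') X \<partial>lborel) \<le> ennreal (K * \<epsilon> powr (N - d))"
    using collar_volume by blast
  have le: "measure lborel (cball 0 R \<inter> {X. \<delta> X \<le> \<epsilon>}) / \<epsilon> \<le> K * 2 powr (N - d) * \<epsilon> powr (N - d - 1)"
    if e: "0 < \<epsilon>" "\<epsilon> \<le> 1/2" for \<epsilon>
  proof -
    have "emeasure lborel (cball 0 R \<inter> {X. \<delta> X \<le> \<epsilon>}) = (\<integral>\<^sup>+X. indicator (cball 0 R \<inter> {X. \<delta> X \<le> \<epsilon>}) X \<partial>lborel)"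
      by (rule nn_integral_indicator[symmetric]) measurable
    also have "\<dots> \<le> (\<integral>\<^sup>+X. indicator {X. \<delta> X < 2 * \<epsilon>} X * indicator (ball 0 R') X \<partial>lborel)"
      using e by (intro nn_integral_mono) (auto simp: indicator_def R'_def)
    also have "\<dots> \<le> ennreal (K * (2 * \<epsilon>) powr (N - d))"
      using e by (intro K(2)) auto
    finally have "measure lborel (cball 0 R \<inter> {X. \<delta> X \<le> \<epsilon>}) \<le> K * (2 * \<epsilon>) powr (N - d)"
      using K(1) by (simp add: measure_def enn2real_leI)
    also have "\<dots> = K * 2 powr (N - d) * \<epsilon> powr (N - d - 1) * \<epsilon>"
      using e by (simp add: powr_mult powr_diff)
    finally show ?thesis using e by (simp add: divide_le_eq)
  qed
  have "((\<lambda>\<epsilon>. \<epsilon> powr (N - d - 1)) \<longlongrightarrow> 0) (at_right (0::real))"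
  proof (rule tendsto_zero_powrI[OF tendsto_ident_at tendsto_const])
    show "\<forall>\<^sub>F x in at_right (0::real). 0 \<le> x"
      by (auto simp: eventually_at_right_field intro!: exI[of _ 1])
    show "0 < N - d - 1" using d by simp
  qed
  from tendsto_mult_left[OF this, of "K * 2 powr (N - d)"]
  have lim: "((\<lambda>\<epsilon>. K * 2 powr (N - d) * \<epsilon> powr (N - d - 1)) \<longlongrightarrow> 0) (at_right 0)"
    by simp
  show "((\<lambda>\<epsilon>. measure lborel (cball 0 R \<inter> {X. \<delta> X \<le> \<epsilon>}) / \<epsilon>) \<longlongrightarrow> 0) (at_right 0)"
  proof (rule tendsto_sandwich[OF _ _ tendsto_const lim])
    show "\<forall>\<^sub>F \<epsilon> in at_right 0. 0 \<le> measure lborel (cball 0 R \<inter> {X. \<delta> X \<le> \<epsilon>}) / \<epsilon>"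
      by (auto simp: eventually_at_right_field intro!: exI[of _ 1])
    show "\<forall>\<^sub>F \<epsilon> in at_right 0. measure lborel (cball 0 R \<inter> {X. \<delta> X \<le> \<epsilon>}) / \<epsilon> \<le> K * 2 powr (N - d) * \<epsilon> powr (N - d - 1)"
      using le by (auto simp: eventually_at_right_field intro!: exI[of _ "1/2"])
  qed
qed

text \<open>The exponent \<open>d + 1 - N\<close> is negative, so on the shell
  \<open>R / 2 ^ Suc j \<le> \<delta> X < R / 2 ^ j\<close> the weight is largest at the inner edge.
  Multiplied by the assumed bound at that scale, the power of the radius is exactly 1, and the
  shells sum as a geometric series.\<close>

lemma dyadic_weight_le:
  assumes [measurable]: "f \<in> borel_measurable borel" and R: "R > 0" and K: "K \<ge> 0"
    and le: "\<And>\<epsilon>. 0 < \<epsilon> \<Longrightarrow> \<epsilon> \<le> R \<Longrightarrow> (\<integral>\<^sup>+X. indicator {X. \<delta> X < \<epsilon>} X * f X \<partial>lborel) \<le> ennreal (K * \<epsilon> powr (N - d))"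
  shows "(\<integral>\<^sup>+X. indicator {X. 0 < \<delta> X \<and> \<delta> X < R} X * (ennreal (weight d \<Gamma> X) * f X) \<partial>lborel) \<le> ennreal (K * 2 powr (N - d) * R)"
proof -
  let ?e = "\<lambda>j::nat. R / 2 ^ j"
  let ?T = "\<lambda>j X. ennreal ((?e j / 2) powr (d + 1 - N)) * (indicator {X. \<delta> X < ?e j} X * f X)"
  have "indicator {X. 0 < \<delta> X \<and> \<delta> X < R} X * (ennreal (weight d \<Gamma> X) * f X) \<le> (\<Sum>j. ?T j X)" for X
  proof (cases "0 < \<delta> X \<and> \<delta> X < R")
    case True
    have "\<exists>j. ?e (Suc j) \<le> \<delta> X"
    proof -
      obtain j where "(1/2) ^ j < \<delta> X / R"
        using real_arch_pow_inv[of "\<delta> X / R" "1/2"] True R by auto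
      moreover have "(1/2::real) ^ Suc j \<le> (1/2) ^ j" by simp
      ultimately have "(1/2) ^ Suc j * R \<le> \<delta> X" using R by (simp add: field_simps)
      then show ?thesis by (intro exI[of _ j]) (simp add: power_divide)
    qed
    then obtain j where j: "?e (Suc j) \<le> \<delta> X" "\<And>i. i < j \<Longrightarrow> \<not> ?e (Suc i) \<le> \<delta> X"
      using exists_least_iff[of "\<lambda>j. ?e (Suc j) \<le> \<delta> X"] by blast
    have lt: "\<delta> X < ?e j"
      using j(2)[of "j - 1"] True by (cases j) (auto simp: not_le)
    have "weight d \<Gamma> X \<le> (?e j / 2) powr (d + 1 - N)"
      unfolding weight_eq using j(1) d R by (intro powr_mono2') auto
    then have "ennreal (weight d \<Gamma> X) * f X \<le> ?T j X"
      using lt by (auto intro!: mult_right_mono ennreal_leI)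
    also have "?T j X \<le> (\<Sum>j. ?T j X)"
      using sum_le_suminf[of "\<lambda>j. ?T j X" "{j}"] by auto
    finally show ?thesis using True by simp
  qed simp
  then have "(\<integral>\<^sup>+X. indicator {X. 0 < \<delta> X \<and> \<delta> X < R} X * (ennreal (weight d \<Gamma> X) * f X) \<partial>lborel) \<le> (\<integral>\<^sup>+X. (\<Sum>j. ?T j X) \<partial>lborel)"
    by (intro nn_integral_mono)
  also have "\<dots> = (\<Sum>j. \<integral>\<^sup>+X. ?T j X \<partial>lborel)"
    by (rule nn_integral_suminf) measurable
  also have "\<dots> \<le> (\<Sum>j. ennreal (K * 2 powr (N - d - 1) * R * (1/2) ^ j))"
  proof (rule suminf_le)
    fix j
    have p: "?e j > 0" using R by simp
    have "(\<integral>\<^sup>+X. ?T j X \<partial>lborel) = ennreal ((?e j / 2) powr (d + 1 - N)) * (\<integral>\<^sup>+X. indicator {X. \<delta> X < ?e j} X * f X \<partial>lborel)"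
      by (rule nn_integral_cmult) measurable
    also have "\<dots> \<le> ennreal ((?e j / 2) powr (d + 1 - N)) * ennreal (K * ?e j powr (N - d))"
      using R p by (intro mult_left_mono le) (auto simp: divide_le_eq mult_le_cancel_left1)
    also have "\<dots> = ennreal ((?e j / 2) powr (d + 1 - N) * (K * ?e j powr (N - d)))"
      using K by (simp add: ennreal_mult[symmetric])
    also have "(?e j / 2) powr (d + 1 - N) * (K * ?e j powr (N - d)) = K * 2 powr (N - d - 1) * R * (1/2) ^ j"
    proof -
      have "(?e j / 2) powr (d + 1 - N) = ?e j powr (d + 1 - N) * 2 powr (N - d - 1)"
      proof -
        have "2 powr (N - d - 1) = 1 / 2 powr (d + 1 - N)"
          using powr_minus_divide[of 2 "d + 1 - N"] by (simp add: algebra_simps)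
        then show ?thesis
          using powr_divide[of "?e j" 2 "d + 1 - N"] p R by simp
      qed
      moreover have "?e j powr (d + 1 - N) * ?e j powr (N - d) = ?e j"
        using p R by (simp add: powr_add[symmetric])
      ultimately have "(?e j / 2) powr (d + 1 - N) * (K * ?e j powr (N - d)) = K * 2 powr (N - d - 1) * ?e j"
        by (simp only: mult_ac)
      then show ?thesis by (simp add: power_divide)
    qed
    finally show "(\<integral>\<^sup>+X. ?T j X \<partial>lborel) \<le> ennreal (K * 2 powr (N - d - 1) * R * (1/2) ^ j)" .
  qed auto
  also have "\<dots> = ennreal (\<Sum>j. K * 2 powr (N - d - 1) * R * (1/2) ^ j)"
    using K R by (intro suminf_ennreal2 summable_mult summable_geometric) auto
  also have "(\<Sum>j. K * 2 powr (N - d - 1) * R * (1/2) ^ j) = K * 2 powr (N - d) * R"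
  proof -
    have "(\<lambda>j. K * 2 powr (N - d - 1) * R * (1/2) ^ j) sums (K * 2 powr (N - d - 1) * R * (1 / (1 - 1/2)))"
      by (intro sums_mult geometric_sums) simp
    from sums_unique[OF this] show ?thesis by (simp add: powr_diff)
  qed
  finally show ?thesis .
qed

text \<open>The weight is singular on \<Gamma> but locally integrable: near \<Gamma> the dyadic
  estimate is fed with the collar volume, and where \<open>\<delta> X \<ge> 1\<close> the weight is
  at most 1.\<close>

lemma nn_integral_weight_ball: "(\<integral>\<^sup>+X. indicator (- \<Gamma>) X * (ennreal (weight d \<Gamma> X) * indicator (ball 0 R) X) \<partial>lborel) < \<infinity>"
proof -
  define R' where "R' = \<bar>R\<bar> + 1"
  have [measurable]: "ball (0::real^'n) R' \<in> sets borel" by simp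
  have R': "R' > 0" by (simp add: R'_def)
  then obtain K where K: "K \<ge> 0" "\<And>\<epsilon>. 0 < \<epsilon> \<Longrightarrow> \<epsilon> \<le> 1 \<Longrightarrow>
    (\<integral>\<^sup>+X. indicator {X. \<delta> X < \<epsilon>} X * indicator (ball 0 R') X \<partial>lborel) \<le> ennreal (K * \<epsilon> powr (N - d))"
    using collar_volume by blast
  have "(\<integral>\<^sup>+X. indicator (- \<Gamma>) X * (ennreal (weight d \<Gamma> X) * indicator (ball 0 R) X) \<partial>lborel)
    \<le> (\<integral>\<^sup>+X. indicator {X. 0 < \<delta> X \<and> \<delta> X < 1} X * (ennreal (weight d \<Gamma> X) * indicator (ball 0 R') X) + indicator (ball 0 R') X \<partial>lborel)"
  proof (intro nn_integral_mono)
    fix X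
    have "weight d \<Gamma> X \<le> 1" if "\<delta> X \<ge> 1"
      using powr_mono2'[of "d + 1 - N" 1 "\<delta> X"] that d by (simp add: weight_eq)
    then have "ennreal (weight d \<Gamma> X) \<le> 1" if "\<delta> X \<ge> 1"
      using that ennreal_leI by fastforce
    then show "indicator (- \<Gamma>) X * (ennreal (weight d \<Gamma> X) * indicator (ball 0 R) X)
      \<le> indicator {X. 0 < \<delta> X \<and> \<delta> X < 1} X * (ennreal (weight d \<Gamma> X) * indicator (ball 0 R') X) + indicator (ball 0 R') X"
      using \<delta>_pos_iff[of X] by (cases "\<delta> X < 1") (auto simp: indicator_def R'_def)
  qed
  also have "\<dots> = (\<integral>\<^sup>+X. indicator {X. 0 < \<delta> X \<and> \<delta> X < 1} X * (ennreal (weight d \<Gamma> X) * indicator (ball 0 R') X) \<partial>lborel) + emeasure lborel (ball (0::real^'n) R')"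
    by (subst nn_integral_add) auto
  also have "\<dots> \<le> ennreal (K * 2 powr (N - d) * 1) + emeasure lborel (ball (0::real^'n) R')"
    by (intro add_right_mono dyadic_weight_le K) auto
  also have "\<dots> < \<infinity>"
    using emeasure_bounded_less_top[of "ball (0::real^'n) R'"] by (simp add: ennreal_add_less_top)
  finally show ?thesis .
qed

end

lemma ennreal_mult_assoc: "0 \<le> a \<Longrightarrow> 0 \<le> b \<Longrightarrow> ennreal a * (ennreal b * x) = ennreal (a * b) * x"
  by (simp add: ennreal_mult mult.assoc)

section \<open>Averages over balls and energy in collars\<close>

context ahlfors
begin

definition avg :: "(real ^ 'n \<Rightarrow> complex) \<Rightarrow> real ^ 'n \<Rightarrow> real \<Rightarrow> complex" where
  "avg w x r = (1 / measure lborel (ball x r)) *\<^sub>R (LINT Y|lborel. indicator (ball x r) Y *\<^sub>R w Y)"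

lemma measure_ball: "0 \<le> r \<Longrightarrow> measure lborel (ball (X::real^'n) r) = unit_ball_vol N * r powr N"
  using emeasure_ball[of r X] N by (simp add: measure_def)

lemma vol_pos: "unit_ball_vol N > 0"
  using N by simp

lemma borel_measurable_avg:
  assumes [measurable]: "w \<in> borel_measurable borel" and r: "r \<ge> 0"
  shows "(\<lambda>x. avg w x r) \<in> borel_measurable borel"
proof -
  have "(\<lambda>x. LINT Y|lborel. (if dist x Y < r then 1 else (0::real)) *\<^sub>R w Y) \<in> borel_measurable borel"
    by measurable
  moreover have "(if dist x Y < r then 1 else 0) = indicat_real (ball x r) Y" for x Y :: "real^'n"
    by (simp add: indicator_def)
  ultimately have "(\<lambda>x. LINT Y|lborel. indicat_real (ball x r) Y *\<^sub>R w Y) \<in> borel_measurable borel"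
    by simp
  then show ?thesis
    unfolding avg_def using r by (simp add: measure_ball)
qed

lemma avg_jensen:
  assumes [measurable]: "w \<in> borel_measurable borel" and I: "set_integrable lborel (ball x r) w" and r: "r > 0"
  shows "ennreal ((cmod (avg w x r - c))\<^sup>2) \<le> ennreal (1 / measure lborel (ball x r)) *
    (\<integral>\<^sup>+Y. indicator (ball x r) Y * ennreal ((cmod (w Y - c))\<^sup>2) \<partial>lborel)"
proof -
  let ?B = "ball x r" and ?m = "measure lborel (ball x r)"
  have [measurable]: "?B \<in> sets borel" by simp
  have m: "?m > 0" "emeasure lborel ?B = ennreal ?m"
    using r vol_pos by (simp_all add: measure_ball emeasure_ball)
  have I1: "integrable lborel (\<lambda>Y. indicat_real ?B Y *\<^sub>R w Y)"
    using I by (simp add: set_integrable_def)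
  have I2: "integrable lborel (\<lambda>Y. indicat_real ?B Y *\<^sub>R c)"
    using m by (intro integrable_scaleR_left integrable_real_indicator) auto
  have I3: "integrable lborel (\<lambda>Y. (indicat_real ?B Y / ?m) *\<^sub>R (w Y - c))"
    using integrable_scaleR_right[OF Bochner_Integration.integrable_diff[OF I1 I2], of "1 / ?m"]
    by (simp add: scaleR_diff_right)
  have "avg w x r - c = (1 / ?m) *\<^sub>R ((LINT Y|lborel. indicat_real ?B Y *\<^sub>R w Y) - (LINT Y|lborel. indicat_real ?B Y *\<^sub>R c))"
    using m by (simp add: avg_def scaleR_diff_right integral_scaleR_left)
  also have "\<dots> = (LINT Y|lborel. (1 / ?m) *\<^sub>R (indicat_real ?B Y *\<^sub>R w Y - indicat_real ?B Y *\<^sub>R c))"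
    by (simp only: integral_scaleR_right Bochner_Integration.integral_diff[OF I1 I2])
  also have "\<dots> = (LINT Y|lborel. (indicat_real ?B Y / ?m) *\<^sub>R (w Y - c))"
    by (intro Bochner_Integration.integral_cong refl) (simp add: scaleR_diff_right)
  finally have eq: "avg w x r - c = (LINT Y|lborel. (indicat_real ?B Y / ?m) *\<^sub>R (w Y - c))" .
  have "ennreal (cmod (avg w x r - c)) \<le> (\<integral>\<^sup>+Y. ennreal (norm ((indicat_real ?B Y / ?m) *\<^sub>R (w Y - c))) \<partial>lborel)"
    unfolding eq by (rule integral_norm_bound_ennreal[OF I3])
  also have "\<dots> = (\<integral>\<^sup>+Y. ennreal (indicat_real ?B Y / ?m) * ennreal (cmod (w Y - c)) \<partial>lborel)"
    using m by (intro nn_integral_cong) (simp add: ennreal_mult[symmetric])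
  finally have "(ennreal (cmod (avg w x r - c)))\<^sup>2 \<le> (\<integral>\<^sup>+Y. ennreal (indicat_real ?B Y / ?m) * ennreal (cmod (w Y - c)) \<partial>lborel)\<^sup>2"
    by (rule power_mono) simp
  also have "\<dots> \<le> (\<integral>\<^sup>+Y. ennreal (indicat_real ?B Y / ?m) * (ennreal (cmod (w Y - c)))\<^sup>2 \<partial>lborel)"
  proof (rule nn_integral_prob_square)
    have "(\<integral>\<^sup>+Y. ennreal (indicat_real ?B Y / ?m) \<partial>lborel) = (\<integral>\<^sup>+Y. ennreal (1 / ?m) * indicator ?B Y \<partial>lborel)"
      by (intro nn_integral_cong) (simp add: indicator_def)
    also have "\<dots> = 1"
      using m by (simp add: nn_integral_cmult_indicator ennreal_mult[symmetric])
    finally show "(\<integral>\<^sup>+Y. ennreal (indicat_real ?B Y / ?m) \<partial>lborel) = 1" .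
  qed measurable
  also have "\<dots> = (\<integral>\<^sup>+Y. ennreal (1 / ?m) * (indicator ?B Y * ennreal ((cmod (w Y - c))\<^sup>2)) \<partial>lborel)"
    by (intro nn_integral_cong) (simp add: indicator_def ennreal_power)
  also have "\<dots> = ennreal (1 / ?m) * (\<integral>\<^sup>+Y. indicator ?B Y * ennreal ((cmod (w Y - c))\<^sup>2) \<partial>lborel)"
    by (rule nn_integral_cmult) measurable
  finally show ?thesis by (simp add: ennreal_power)
qed

text \<open>Off \<Gamma> one has
  \<open>1 = \<delta> X powr (N - 1 - d) * weight d \<Gamma> X\<close>. Inside the collar the first
  factor is at most a positive power of \<epsilon>, so unweighted energy is small there.\<close>

lemma collar_energy_le:
  assumes [measurable]: "h \<in> borel_measurable borel" and h0: "\<And>X. X \<in> \<Gamma> \<Longrightarrow> h X = 0" and E: "0 \<le> E"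
    and energy: "(\<integral>\<^sup>+X. indicator (- \<Gamma>) X * (ennreal (weight d \<Gamma> X) * h X) \<partial>lborel) \<le> ennreal E"
    and e: "\<epsilon> > 0"
  shows "(\<integral>\<^sup>+X. indicator {X. \<delta> X < \<epsilon>} X * h X \<partial>lborel) \<le> ennreal (\<epsilon> powr (N - 1 - d) * E)"
proof -
  have "(\<integral>\<^sup>+X. indicator {X. \<delta> X < \<epsilon>} X * h X \<partial>lborel)
      \<le> (\<integral>\<^sup>+X. ennreal (\<epsilon> powr (N - 1 - d)) * (indicator (- \<Gamma>) X * (ennreal (weight d \<Gamma> X) * h X)) \<partial>lborel)"
  proof (intro nn_integral_mono)
    fix X
    show "indicator {X. \<delta> X < \<epsilon>} X * h X \<le> ennreal (\<epsilon> powr (N - 1 - d)) * (indicator (- \<Gamma>) X * (ennreal (weight d \<Gamma> X) * h X))"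
    proof (cases "X \<in> \<Gamma> \<or> \<delta> X \<ge> \<epsilon>")
      case False
      then have p: "0 < \<delta> X" "\<delta> X < \<epsilon>" using \<delta>_pos_iff by auto
      have "1 = \<delta> X powr (N - 1 - d) * weight d \<Gamma> X"
        using p by (simp add: weight_eq powr_add[symmetric])
      also have "\<dots> \<le> \<epsilon> powr (N - 1 - d) * weight d \<Gamma> X"
        using p d by (intro mult_right_mono powr_mono2) (auto simp: weight_eq)
      finally have "1 \<le> ennreal (\<epsilon> powr (N - 1 - d)) * ennreal (weight d \<Gamma> X)"
        using ennreal_leI by (force simp: ennreal_mult[symmetric] weight_eq)
      then have "1 * h X \<le> ennreal (\<epsilon> powr (N - 1 - d)) * ennreal (weight d \<Gamma> X) * h X"
        by (rule mult_right_mono) simp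
      then show ?thesis using False by (simp add: mult.assoc)
    qed (auto simp: h0)
  qed
  also have "\<dots> = ennreal (\<epsilon> powr (N - 1 - d)) * (\<integral>\<^sup>+X. indicator (- \<Gamma>) X * (ennreal (weight d \<Gamma> X) * h X) \<partial>lborel)"
    by (rule nn_integral_cmult) measurable
  also have "\<dots> \<le> ennreal (\<epsilon> powr (N - 1 - d)) * ennreal E"
    by (rule mult_left_mono[OF energy]) simp
  finally show ?thesis using E by (simp add: ennreal_mult)
qed

end

text \<open>Iterating \<open>(a + b)^2 \<le> 2 a^2 + 2 b^2\<close> costs a factor 2 per step. This
  loss is affordable because the radii will shrink by the factor 4.\<close>

lemma square_telescope_le:
  fixes a :: "nat \<Rightarrow> complex"
  shows "(cmod (a 0 - a m))\<^sup>2 \<le> (\<Sum>k<m. 2 ^ Suc k * (cmod (a k - a (Suc k)))\<^sup>2)"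
proof (induction m arbitrary: a)
  case (Suc m)
  have "(cmod (a 0 - a (Suc m)))\<^sup>2 \<le> (cmod (a 0 - a 1) + cmod (a 1 - a (Suc m)))\<^sup>2"
    by (intro power_mono norm_diff_triangle_le[OF order_refl order_refl]) auto
  also have "\<dots> \<le> 2 * (cmod (a 0 - a 1))\<^sup>2 + 2 * (cmod (a 1 - a (Suc m)))\<^sup>2"
    using sum_squares_bound[of "cmod (a 0 - a 1)" "cmod (a 1 - a (Suc m))"] by (simp add: power2_sum)
  also have "\<dots> \<le> 2 * (cmod (a 0 - a 1))\<^sup>2 + 2 * (\<Sum>k<m. 2 ^ Suc k * (cmod (a (Suc k) - a (Suc (Suc k))))\<^sup>2)"
    using Suc.IH[of "\<lambda>k. a (Suc k)"] by simp
  also have "\<dots> = (\<Sum>k<Suc m. 2 ^ Suc k * (cmod (a k - a (Suc k)))\<^sup>2)"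
    by (simp add: sum.lessThan_Suc_shift sum_distrib_left mult.assoc del: sum.lessThan_Suc)
  finally show ?case .
qed simp

lemma square_telescope_limit_le:
  fixes a :: "nat \<Rightarrow> complex"
  assumes "a \<longlonglongrightarrow> 0"
  shows "ennreal ((cmod (a 0))\<^sup>2) \<le> (\<Sum>k. ennreal (2 ^ Suc k) * ennreal ((cmod (a k - a (Suc k)))\<^sup>2))"
proof (rule LIMSEQ_le_const2)
  have "(\<lambda>m. (cmod (a 0 - a m))\<^sup>2) \<longlonglongrightarrow> (cmod (a 0 - 0))\<^sup>2"
    by (intro tendsto_intros assms)
  then show "(\<lambda>m. ennreal ((cmod (a 0 - a m))\<^sup>2)) \<longlonglongrightarrow> ennreal ((cmod (a 0))\<^sup>2)"
    by (intro tendsto_ennrealI) simp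
  have "ennreal ((cmod (a 0 - a m))\<^sup>2) \<le> (\<Sum>k. ennreal (2 ^ Suc k) * ennreal ((cmod (a k - a (Suc k)))\<^sup>2))" for m
  proof -
    have "ennreal ((cmod (a 0 - a m))\<^sup>2) \<le> ennreal (\<Sum>k<m. 2 ^ Suc k * (cmod (a k - a (Suc k)))\<^sup>2)"
      by (rule ennreal_leI[OF square_telescope_le])
    also have "\<dots> = (\<Sum>k<m. ennreal (2 ^ Suc k) * ennreal ((cmod (a k - a (Suc k)))\<^sup>2))"
      by (subst sum_ennreal[symmetric]) (auto simp: ennreal_mult)
    also have "\<dots> \<le> (\<Sum>k. ennreal (2 ^ Suc k) * ennreal ((cmod (a k - a (Suc k)))\<^sup>2))"
      by (rule sum_le_suminf) auto
    finally show ?thesis .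
  qed
  then show "\<exists>M. \<forall>m\<ge>M. ennreal ((cmod (a 0 - a m))\<^sup>2) \<le> (\<Sum>k. ennreal (2 ^ Suc k) * ennreal ((cmod (a k - a (Suc k)))\<^sup>2))"
    by blast
qed

text \<open>\<open>h\<close> stands for the squared gradient of \<open>w\<close>. Only the pair form
  of the Poincare inequality and a finite weighted energy are kept; integrability of
  \<open>w\<close> on balls is derived from them.\<close>

locale poincare_function = ahlfors \<Gamma> \<tau> d C N
  for \<Gamma> :: "(real ^ 'n::finite) set" and \<tau> d C N +
  fixes w :: "real ^ 'n \<Rightarrow> complex" and h :: "real ^ 'n \<Rightarrow> ennreal" and C0 E :: real
  assumes w[measurable]: "w \<in> borel_measurable borel" and h[measurable]: "h \<in> borel_measurable borel"
    and C0: "0 \<le> C0" and E: "0 \<le> E"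
    and poincare: "0 < r \<Longrightarrow> (\<integral>\<^sup>+X. \<integral>\<^sup>+Y. indicator (ball c r) X * indicator (ball c r) Y *
          ennreal ((cmod (w X - w Y))\<^sup>2) \<partial>lborel \<partial>lborel)
        \<le> ennreal (C0 * r\<^sup>2) * emeasure lborel (ball c r) * (\<integral>\<^sup>+Z. indicator (ball c r) Z * h Z \<partial>lborel)"
    and h0: "X \<in> \<Gamma> \<Longrightarrow> h X = 0"
    and energy: "(\<integral>\<^sup>+X. indicator (- \<Gamma>) X * (ennreal (weight d \<Gamma> X) * h X) \<partial>lborel) \<le> ennreal E"
begin

lemmas collar_energy = collar_energy_le[OF h h0 E energy]

text \<open>The double integral in \<open>poincare\<close> is finite, so for some \<open>X\<close>
  in the ball the inner integral is finite. Then \<open>w - w X\<close>, and with it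
  \<open>w\<close>, is square integrable on the ball.\<close>

lemma square_integrable_ball:
  assumes r: "r > 0"
  shows "(\<integral>\<^sup>+Y. indicator (ball c r) Y * ennreal ((cmod (w Y))\<^sup>2) \<partial>lborel) < \<infinity>"
proof -
  let ?B = "ball c r"
  have [measurable]: "?B \<in> sets borel" by simp
  have "(\<integral>\<^sup>+Z. indicator ?B Z * h Z \<partial>lborel) \<le> (\<integral>\<^sup>+Z. indicator {X. \<delta> X < \<delta> c + r} Z * h Z \<partial>lborel)"
  proof (intro nn_integral_mono)
    fix Z
    show "indicator ?B Z * h Z \<le> indicator {X. \<delta> X < \<delta> c + r} Z * h Z"
      using infdist_triangle[of Z \<Gamma> c] by (auto simp: indicator_def dist_commute)
  qed
  also have "\<dots> < \<infinity>"
    using collar_energy[of "\<delta> c + r"] r infdist_nonneg[of c \<Gamma>] by (intro le_less_trans[OF collar_energy]) auto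
  finally have "(\<integral>\<^sup>+Z. indicator ?B Z * h Z \<partial>lborel) < \<infinity>" .
  then have "ennreal (C0 * r\<^sup>2) * emeasure lborel ?B * (\<integral>\<^sup>+Z. indicator ?B Z * h Z \<partial>lborel) < \<infinity>"
    using emeasure_bounded_less_top[of ?B] by (simp add: ennreal_mult_less_top)
  from le_less_trans[OF poincare[OF r, of c] this]
  have fin: "(\<integral>\<^sup>+X. \<integral>\<^sup>+Y. indicator ?B X * indicator ?B Y * ennreal ((cmod (w X - w Y))\<^sup>2) \<partial>lborel \<partial>lborel) \<noteq> \<infinity>"
    by simp
  have "AE X in lborel. (\<integral>\<^sup>+Y. indicator ?B X * indicator ?B Y * ennreal ((cmod (w X - w Y))\<^sup>2) \<partial>lborel) \<noteq> \<infinity>"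
    by (rule nn_integral_PInf_AE[OF _ fin]) measurable
  \<comment> \<open>The ball is not a null set, so a property valid almost everywhere holds at one
    of its points.\<close>
  moreover have "\<not> (AE X in lborel. X \<notin> ?B)"
  proof
    assume "AE X in lborel. X \<notin> ?B"
    then have "emeasure lborel ?B = 0" by (subst (asm) AE_iff_measurable[OF _ refl]) (auto simp: ball_def)
    then show False using r vol_pos by (simp add: emeasure_ball)
  qed
  ultimately obtain X where X: "X \<in> ?B" "(\<integral>\<^sup>+Y. indicator ?B X * indicator ?B Y * ennreal ((cmod (w X - w Y))\<^sup>2) \<partial>lborel) \<noteq> \<infinity>"
    by (metis (mono_tags, lifting) eventually_mono)
  have "(\<integral>\<^sup>+Y. indicator ?B Y * ennreal ((cmod (w Y))\<^sup>2) \<partial>lborel)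
      \<le> (\<integral>\<^sup>+Y. ennreal (2 * (cmod (w X))\<^sup>2) * indicator ?B Y + 2 * (indicator ?B X * indicator ?B Y * ennreal ((cmod (w X - w Y))\<^sup>2)) \<partial>lborel)"
  proof (intro nn_integral_mono)
    fix Y
    have "(cmod (w Y))\<^sup>2 \<le> (cmod (w X) + cmod (w X - w Y))\<^sup>2"
      using norm_triangle_sub[of "w Y" "w X"] by (intro power_mono) (auto simp: norm_minus_commute)
    also have "\<dots> \<le> 2 * (cmod (w X))\<^sup>2 + 2 * (cmod (w X - w Y))\<^sup>2"
      using sum_squares_bound[of "cmod (w X)" "cmod (w X - w Y)"] by (simp add: power2_sum)
    finally have "ennreal ((cmod (w Y))\<^sup>2) \<le> ennreal (2 * (cmod (w X))\<^sup>2) + 2 * ennreal ((cmod (w X - w Y))\<^sup>2)"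
      by (simp add: ennreal_plus[symmetric] ennreal_mult[symmetric] ennreal_numeral[symmetric] ennreal_leI del: ennreal_plus ennreal_numeral)
    then show "indicator ?B Y * ennreal ((cmod (w Y))\<^sup>2) \<le> ennreal (2 * (cmod (w X))\<^sup>2) * indicator ?B Y + 2 * (indicator ?B X * indicator ?B Y * ennreal ((cmod (w X - w Y))\<^sup>2))"
      using X(1) by (simp add: indicator_def)
  qed
  also have "\<dots> = ennreal (2 * (cmod (w X))\<^sup>2) * emeasure lborel ?B + 2 * (\<integral>\<^sup>+Y. indicator ?B X * indicator ?B Y * ennreal ((cmod (w X - w Y))\<^sup>2) \<partial>lborel)"
    by (subst nn_integral_add) (auto simp: nn_integral_cmult)
  also have "\<dots> < \<infinity>"
    using X(2) emeasure_bounded_less_top[of ?B] by (simp add: ennreal_mult_less_top ennreal_add_less_top less_top)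
  finally show ?thesis .
qed

lemma set_integrable_ball:
  assumes r: "r > 0"
  shows "set_integrable lborel (ball c r) w"
  unfolding set_integrable_def integrable_iff_bounded
proof
  let ?B = "ball c r"
  have [measurable]: "?B \<in> sets borel" by simp
  show "(\<lambda>X. indicat_real ?B X *\<^sub>R w X) \<in> borel_measurable lborel" by measurable
  have "(\<integral>\<^sup>+X. ennreal (norm (indicat_real ?B X *\<^sub>R w X)) \<partial>lborel) \<le> (\<integral>\<^sup>+X. indicator ?B X + indicator ?B X * ennreal ((cmod (w X))\<^sup>2) \<partial>lborel)"
  proof (intro nn_integral_mono)
    fix X
    have "cmod (w X) \<le> 1 + (cmod (w X))\<^sup>2"
      using sum_squares_bound[of "cmod (w X)" 1] norm_ge_zero[of "w X"] unfolding one_power2 by linarith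
    then have "ennreal (cmod (w X)) \<le> 1 + ennreal ((cmod (w X))\<^sup>2)"
      by (simp add: ennreal_1[symmetric] ennreal_plus[symmetric] ennreal_leI del: ennreal_1 ennreal_plus)
    then show "ennreal (norm (indicat_real ?B X *\<^sub>R w X)) \<le> indicator ?B X + indicator ?B X * ennreal ((cmod (w X))\<^sup>2)"
      by (simp add: indicator_def)
  qed
  also have "\<dots> = emeasure lborel ?B + (\<integral>\<^sup>+X. indicator ?B X * ennreal ((cmod (w X))\<^sup>2) \<partial>lborel)"
    by (subst nn_integral_add) auto
  also have "\<dots> < \<infinity>"
    using square_integrable_ball[OF r, of c] emeasure_bounded_less_top[of ?B] by (simp add: ennreal_add_less_top)
  finally show "(\<integral>\<^sup>+X. ennreal (norm (indicat_real ?B X *\<^sub>R w X)) \<partial>lborel) < \<infinity>" .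
qed

text \<open>Jensen's inequality in one variable turns the pair form of the Poincare inequality into
  the form with the mean; the volume of the ball cancels.\<close>

lemma variance_le:
  assumes r: "r > 0"
  shows "(\<integral>\<^sup>+Y. indicator (ball c r) Y * ennreal ((cmod (w Y - avg w c r))\<^sup>2) \<partial>lborel)
    \<le> ennreal (C0 * r\<^sup>2) * (\<integral>\<^sup>+Z. indicator (ball c r) Z * h Z \<partial>lborel)"
proof -
  let ?B = "ball c r" and ?m = "measure lborel (ball c r)"
  have [measurable]: "?B \<in> sets borel" by simp
  have m: "?m > 0" "emeasure lborel ?B = ennreal ?m"
    using r vol_pos by (simp_all add: measure_ball emeasure_ball)
  have "(\<integral>\<^sup>+Y. indicator ?B Y * ennreal ((cmod (w Y - avg w c r))\<^sup>2) \<partial>lborel)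
      \<le> (\<integral>\<^sup>+X. ennreal (1 / ?m) * (\<integral>\<^sup>+Y. indicator ?B X * indicator ?B Y * ennreal ((cmod (w X - w Y))\<^sup>2) \<partial>lborel) \<partial>lborel)"
  proof (intro nn_integral_mono)
    fix X
    show "indicator ?B X * ennreal ((cmod (w X - avg w c r))\<^sup>2)
      \<le> ennreal (1 / ?m) * (\<integral>\<^sup>+Y. indicator ?B X * indicator ?B Y * ennreal ((cmod (w X - w Y))\<^sup>2) \<partial>lborel)"
      using avg_jensen[OF w set_integrable_ball[OF r] r, of c "w X"]
      by (cases "X \<in> ?B") (auto simp: norm_minus_commute)
  qed
  also have "\<dots> = ennreal (1 / ?m) * (\<integral>\<^sup>+X. \<integral>\<^sup>+Y. indicator ?B X * indicator ?B Y * ennreal ((cmod (w X - w Y))\<^sup>2) \<partial>lborel \<partial>lborel)"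
    by (rule nn_integral_cmult) measurable
  also have "\<dots> \<le> ennreal (1 / ?m) * (ennreal (C0 * r\<^sup>2) * emeasure lborel ?B * (\<integral>\<^sup>+Z. indicator ?B Z * h Z \<partial>lborel))"
    by (rule mult_left_mono[OF poincare[OF r]]) simp
  also have "\<dots> = (ennreal (1 / ?m) * ennreal ?m) * (ennreal (C0 * r\<^sup>2) * (\<integral>\<^sup>+Z. indicator ?B Z * h Z \<partial>lborel))"
    by (simp add: m(2) mult_ac)
  also have "ennreal (1 / ?m) * ennreal ?m = 1"
    using m(1) by (simp add: ennreal_mult[symmetric])
  finally show ?thesis by simp
qed

text \<open>Jensen's inequality on the small ball with the mean over the large ball as the constant,
  then enlargement of the domain. The factor \<open>4 powr N\<close> is the ratio of the
  volumes.\<close>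

lemma avg_step_le:
  assumes r: "r > 0"
  shows "ennreal ((cmod (avg w c r - avg w c (r / 4)))\<^sup>2)
    \<le> ennreal (C0 * 4 powr N / unit_ball_vol N * r powr (2 - N)) * (\<integral>\<^sup>+Z. indicator (ball c r) Z * h Z \<partial>lborel)"
proof -
  have r4: "r / 4 > 0" using r by simp
  have m: "measure lborel (ball c (r / 4)) = unit_ball_vol N * (r / 4) powr N"
    using r4 by (simp add: measure_ball)
  have "ennreal ((cmod (avg w c r - avg w c (r / 4)))\<^sup>2) = ennreal ((cmod (avg w c (r / 4) - avg w c r))\<^sup>2)"
    by (simp add: norm_minus_commute)
  also have "\<dots> \<le> ennreal (1 / measure lborel (ball c (r / 4))) *
      (\<integral>\<^sup>+Y. indicator (ball c (r / 4)) Y * ennreal ((cmod (w Y - avg w c r))\<^sup>2) \<partial>lborel)"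
    by (rule avg_jensen[OF w set_integrable_ball[OF r4] r4])
  also have "\<dots> \<le> ennreal (1 / measure lborel (ball c (r / 4))) *
      (\<integral>\<^sup>+Y. indicator (ball c r) Y * ennreal ((cmod (w Y - avg w c r))\<^sup>2) \<partial>lborel)"
    using r by (intro mult_left_mono nn_integral_mono) (auto simp: indicator_def)
  also have "\<dots> \<le> ennreal (1 / measure lborel (ball c (r / 4))) * (ennreal (C0 * r\<^sup>2) * (\<integral>\<^sup>+Z. indicator (ball c r) Z * h Z \<partial>lborel))"
    by (rule mult_left_mono[OF variance_le[OF r]]) simp
  also have "\<dots> = ennreal (1 / measure lborel (ball c (r / 4)) * (C0 * r\<^sup>2)) * (\<integral>\<^sup>+Z. indicator (ball c r) Z * h Z \<partial>lborel)"
    using C0 by (intro ennreal_mult_assoc) auto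
  also have "1 / measure lborel (ball c (r / 4)) * (C0 * r\<^sup>2) = C0 * 4 powr N / unit_ball_vol N * r powr (2 - N)"
  proof -
    have "r powr (2 - N) = r\<^sup>2 / r powr N"
      using r by (simp add: powr_diff powr_realpow[of r 2, symmetric] flip: powr_numeral)
    then show ?thesis
      unfolding m using r by (simp add: powr_divide)
  qed
  finally show ?thesis .
qed

end

locale poincare_function_zero_trace = poincare_function \<Gamma> \<tau> d C N w h C0 E
  for \<Gamma> :: "(real ^ 'n::finite) set" and \<tau> d C N w h C0 E +
  assumes trace: "AE x in \<tau>. ((\<lambda>r. avg w x r) \<longlongrightarrow> 0) (at_right 0)"
begin

text \<open>For \<tau>-almost every centre the averages tend to 0, so the average at radius
  \<open>R\<close> is the sum of its differences along \<open>R / 4 ^ k\<close>. After integration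
  over \<tau> the k-th term is of order \<open>2 ^ k * R / 4 ^ k\<close>, and the series is
  geometric.\<close>

lemma boundary_average_le:
  assumes R: "R > 0"
  shows "(\<integral>\<^sup>+x. ennreal ((cmod (avg w x R))\<^sup>2) \<partial>\<tau>) \<le> ennreal (4 * C0 * 4 powr N / unit_ball_vol N * C * E * R)"
proof -
  let ?r = "\<lambda>k::nat. R / 4 ^ k"
  let ?c = "\<lambda>k. C0 * 4 powr N / unit_ball_vol N * ?r k powr (2 - N)"
  let ?H = "\<lambda>k x. \<integral>\<^sup>+Z. indicator (ball x (?r k)) Z * h Z \<partial>lborel"
  have r: "?r k > 0" for k using R by simp
  have r0: "?r \<longlonglongrightarrow> 0"
  proof -
    have "(\<lambda>k. R * (1/4) ^ k) \<longlonglongrightarrow> R * 0"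
      by (intro tendsto_mult tendsto_const LIMSEQ_realpow_zero) auto
    then show ?thesis by (simp add: power_divide)
  qed
  have mH: "?H k \<in> borel_measurable \<tau>" for k
  proof -
    have "?H k = (\<lambda>x. \<integral>\<^sup>+Z. (if dist x Z < ?r k then 1 else 0) * h Z \<partial>lborel)"
      by (intro ext nn_integral_cong) (simp add: indicator_def)
    also have "\<dots> \<in> borel_measurable \<tau>" by measurable
    finally show ?thesis .
  qed
  have "(\<integral>\<^sup>+x. ennreal ((cmod (avg w x R))\<^sup>2) \<partial>\<tau>) \<le> (\<integral>\<^sup>+x. (\<Sum>k. ennreal (2 ^ Suc k) * (ennreal (?c k) * ?H k x)) \<partial>\<tau>)"
  proof (rule nn_integral_mono_AE)
    show "AE x in \<tau>. ennreal ((cmod (avg w x R))\<^sup>2) \<le> (\<Sum>k. ennreal (2 ^ Suc k) * (ennreal (?c k) * ?H k x))"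
      using trace
    proof eventually_elim
      case (elim x)
      have "filterlim ?r (at_right 0) sequentially"
        using r0 R by (auto simp: filterlim_at intro!: always_eventually)
      from filterlim_compose[OF elim this]
      have "(\<lambda>k. avg w x (?r k)) \<longlonglongrightarrow> 0" .
      from square_telescope_limit_le[OF this]
      have "ennreal ((cmod (avg w x R))\<^sup>2) \<le> (\<Sum>k. ennreal (2 ^ Suc k) * ennreal ((cmod (avg w x (?r k) - avg w x (?r (Suc k))))\<^sup>2))"
        by simp
      also have "\<dots> \<le> (\<Sum>k. ennreal (2 ^ Suc k) * (ennreal (?c k) * ?H k x))"
      proof (rule suminf_le)
        fix k
        show "ennreal (2 ^ Suc k) * ennreal ((cmod (avg w x (?r k) - avg w x (?r (Suc k))))\<^sup>2) \<le> ennreal (2 ^ Suc k) * (ennreal (?c k) * ?H k x)"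
          using avg_step_le[OF r[of k], of x] by (intro mult_left_mono) (simp_all add: mult.commute)
      qed auto
      finally show ?case .
    qed
  qed
  also have "\<dots> = (\<Sum>k. \<integral>\<^sup>+x. ennreal (2 ^ Suc k) * (ennreal (?c k) * ?H k x) \<partial>\<tau>)"
    using mH by (intro nn_integral_suminf) auto
  also have "\<dots> \<le> (\<Sum>k. ennreal (2 * C0 * 4 powr N / unit_ball_vol N * C * E * R * (1/2) ^ k))"
  proof (rule suminf_le)
    fix k
    have "(\<integral>\<^sup>+x. ennreal (2 ^ Suc k) * (ennreal (?c k) * ?H k x) \<partial>\<tau>) = ennreal (2 ^ Suc k) * (ennreal (?c k) * (\<integral>\<^sup>+x. ?H k x \<partial>\<tau>))"
      using mH[of k] by (simp add: nn_integral_cmult)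
    also have "\<dots> \<le> ennreal (2 ^ Suc k) * (ennreal (?c k) * (ennreal (C * ?r k powr d) * ennreal (?r k powr (N - 1 - d) * E)))"
      by (intro mult_left_mono order_trans[OF nn_integral_\<tau>_ball_le[OF h r]] collar_energy r) auto
    also have "\<dots> = ennreal (2 ^ Suc k * (?c k * (C * ?r k powr d * (?r k powr (N - 1 - d) * E))))"
      using C0 C E vol_pos by (simp only: ennreal_mult_assoc ennreal_mult'[symmetric] mult_nonneg_nonneg
          divide_nonneg_pos powr_ge_zero less_imp_le zero_le_power zero_le_numeral mult.assoc)
    also have "2 ^ Suc k * (?c k * (C * ?r k powr d * (?r k powr (N - 1 - d) * E))) = 2 * C0 * 4 powr N / unit_ball_vol N * C * E * R * (1/2) ^ k"
    proof -
      \<comment> \<open>The exponents come from the Poincare step, the \<tau>-mass of a ball and the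
        collar energy. They add up to 1, whatever \<open>N\<close> and \<open>d\<close> are.\<close>
      have "?r k powr (2 - N) * (?r k powr d * ?r k powr (N - 1 - d)) = ?r k powr 1"
        by (simp only: powr_add[symmetric]) (simp add: algebra_simps)
      also have "\<dots> = ?r k" using r[of k] R by simp
      finally have "?r k powr (2 - N) * (?r k powr d * ?r k powr (N - 1 - d)) = ?r k" .
      note e1 = this
      have e2: "2 ^ Suc k * ?r k = 2 * R * (1/2) ^ k"
        by (simp add: power_divide field_simps power_mult_distrib[symmetric])
      have "2 ^ Suc k * (?c k * (C * ?r k powr d * (?r k powr (N - 1 - d) * E)))
         = (C0 * 4 powr N / unit_ball_vol N) * C * E * (2 ^ Suc k * (?r k powr (2 - N) * (?r k powr d * ?r k powr (N - 1 - d))))"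
        by (simp only: mult_ac)
      also have "\<dots> = (C0 * 4 powr N / unit_ball_vol N) * C * E * (2 * R * (1/2) ^ k)"
        by (simp only: e1 e2)
      also have "\<dots> = 2 * C0 * 4 powr N / unit_ball_vol N * C * E * R * (1/2) ^ k"
        by simp
      finally show ?thesis .
    qed
    finally show "(\<integral>\<^sup>+x. ennreal (2 ^ Suc k) * (ennreal (?c k) * ?H k x) \<partial>\<tau>) \<le> ennreal (2 * C0 * 4 powr N / unit_ball_vol N * C * E * R * (1/2) ^ k)" .
  qed auto
  also have "\<dots> = ennreal (\<Sum>k. 2 * C0 * 4 powr N / unit_ball_vol N * C * E * R * (1/2) ^ k)"
    using C0 C E R vol_pos by (intro suminf_ennreal2 summable_mult summable_geometric) auto
  also have "(\<Sum>k. 2 * C0 * 4 powr N / unit_ball_vol N * C * E * R * (1/2) ^ k) = 4 * C0 * 4 powr N / unit_ball_vol N * C * E * R"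
  proof -
    have "(\<lambda>k. 2 * C0 * 4 powr N / unit_ball_vol N * C * E * R * (1/2) ^ k) sums (2 * C0 * 4 powr N / unit_ball_vol N * C * E * R * (1 / (1 - 1/2)))"
      by (intro sums_mult geometric_sums) simp
    from sums_unique[OF this] show ?thesis by simp
  qed
  finally show ?thesis .
qed

text \<open>The first summand comes from the boundary averages and the second from the deviation
  from the mean; \<open>2 powr N\<close> and the trailing 2 come from the doubled radius, and
  \<open>C\<close> from the passage from the collar to balls. The constant is linear in the energy
  \<open>E\<close>.\<close>

definition hardy_const :: real where
  "hardy_const = 2 powr N * (8 * C0 * 4 powr N * C * E + 2 * C0 * C * E) * 2 * C"

lemma hardy_const_nonneg: "hardy_const \<ge> 0"
  using C0 C E by (simp add: hardy_const_def)

text \<open>On balls of radius \<open>2 * \<epsilon>\<close> centred on \<Gamma>, \<open>w\<close>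
  is split into its mean and the deviation from it: zero trace controls the mean through
  \<open>boundary_average_le\<close>, and the Poincare inequality controls the deviation.\<close>

lemma collar_square_le:
  assumes e: "\<epsilon> > 0"
  shows "(\<integral>\<^sup>+X. indicator {X. \<delta> X < \<epsilon>} X * ennreal ((cmod (w X))\<^sup>2) \<partial>lborel) \<le> ennreal (hardy_const * \<epsilon> * \<epsilon> powr (N - d))"
proof -
  let ?s = "2 * \<epsilon>"
  have s: "?s > 0" using e by simp
  let ?K = "4 * C0 * 4 powr N / unit_ball_vol N * C * E * ?s"
  have mball: "(\<integral>\<^sup>+X. indicator (ball y ?s) X * (indicator {X. \<delta> X < \<epsilon>} X * ennreal ((cmod (w X))\<^sup>2)) \<partial>lborel)
     \<le> ennreal (2 * unit_ball_vol N * ?s powr N) * ennreal ((cmod (avg w y ?s))\<^sup>2) + ennreal (2 * C0 * ?s\<^sup>2) * (\<integral>\<^sup>+Z. indicator (ball y ?s) Z * h Z \<partial>lborel)" for y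
  proof -
    have [measurable]: "ball y ?s \<in> sets borel" by simp
    have "(\<integral>\<^sup>+X. indicator (ball y ?s) X * (indicator {X. \<delta> X < \<epsilon>} X * ennreal ((cmod (w X))\<^sup>2)) \<partial>lborel)
      \<le> (\<integral>\<^sup>+X. ennreal (2 * (cmod (avg w y ?s))\<^sup>2) * indicator (ball y ?s) X + 2 * (indicator (ball y ?s) X * ennreal ((cmod (w X - avg w y ?s))\<^sup>2)) \<partial>lborel)"
    proof (intro nn_integral_mono)
      fix X
      have "(cmod (w X))\<^sup>2 \<le> (cmod (avg w y ?s) + cmod (w X - avg w y ?s))\<^sup>2"
        using norm_triangle_sub[of "w X" "avg w y ?s"] by (intro power_mono) auto
      also have "\<dots> \<le> 2 * (cmod (avg w y ?s))\<^sup>2 + 2 * (cmod (w X - avg w y ?s))\<^sup>2"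
        using sum_squares_bound[of "cmod (avg w y ?s)" "cmod (w X - avg w y ?s)"] by (simp add: power2_sum)
      finally have "ennreal ((cmod (w X))\<^sup>2) \<le> ennreal (2 * (cmod (avg w y ?s))\<^sup>2) + 2 * ennreal ((cmod (w X - avg w y ?s))\<^sup>2)"
        by (simp add: ennreal_plus[symmetric] ennreal_mult[symmetric] ennreal_numeral[symmetric] ennreal_leI del: ennreal_plus ennreal_numeral)
      then show "indicator (ball y ?s) X * (indicator {X. \<delta> X < \<epsilon>} X * ennreal ((cmod (w X))\<^sup>2))
        \<le> ennreal (2 * (cmod (avg w y ?s))\<^sup>2) * indicator (ball y ?s) X + 2 * (indicator (ball y ?s) X * ennreal ((cmod (w X - avg w y ?s))\<^sup>2))"
        by (simp add: indicator_def)
    qed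
    also have "\<dots> = ennreal (2 * (cmod (avg w y ?s))\<^sup>2) * emeasure lborel (ball y ?s) + 2 * (\<integral>\<^sup>+X. indicator (ball y ?s) X * ennreal ((cmod (w X - avg w y ?s))\<^sup>2) \<partial>lborel)"
      by (subst nn_integral_add) (auto simp: nn_integral_cmult)
    also have "\<dots> \<le> ennreal (2 * (cmod (avg w y ?s))\<^sup>2) * emeasure lborel (ball y ?s) + 2 * (ennreal (C0 * ?s\<^sup>2) * (\<integral>\<^sup>+Z. indicator (ball y ?s) Z * h Z \<partial>lborel))"
      by (intro add_left_mono mult_left_mono variance_le s) simp
    also have "ennreal (2 * (cmod (avg w y ?s))\<^sup>2) * emeasure lborel (ball y ?s) = ennreal (2 * unit_ball_vol N * ?s powr N) * ennreal ((cmod (avg w y ?s))\<^sup>2)"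
      using s vol_pos by (simp add: emeasure_ball ennreal_mult[symmetric] mult_ac)
    also have "2 * (ennreal (C0 * ?s\<^sup>2) * (\<integral>\<^sup>+Z. indicator (ball y ?s) Z * h Z \<partial>lborel)) = ennreal (2 * C0 * ?s\<^sup>2) * (\<integral>\<^sup>+Z. indicator (ball y ?s) Z * h Z \<partial>lborel)"
      using C0 ennreal_mult_assoc[of 2 "C0 * ?s\<^sup>2" "\<integral>\<^sup>+Z. indicator (ball y ?s) Z * h Z \<partial>lborel"]
      by (simp add: mult.assoc)
    finally show ?thesis .
  qed
  have [measurable]: "(\<lambda>x. avg w x ?s) \<in> borel_measurable borel"
    using s by (intro borel_measurable_avg) auto
  have mH: "(\<lambda>x. \<integral>\<^sup>+Z. indicator (ball x ?s) Z * h Z \<partial>lborel) \<in> borel_measurable \<tau>"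
  proof -
    have "(\<lambda>x. \<integral>\<^sup>+Z. indicator (ball x ?s) Z * h Z \<partial>lborel) = (\<lambda>x. \<integral>\<^sup>+Z. (if dist x Z < ?s then 1 else 0) * h Z \<partial>lborel)"
      by (intro ext nn_integral_cong) (simp add: indicator_def)
    also have "\<dots> \<in> borel_measurable \<tau>" by measurable
    finally show ?thesis .
  qed
  have "(\<integral>\<^sup>+X. indicator {X. \<delta> X < \<epsilon>} X * ennreal ((cmod (w X))\<^sup>2) \<partial>lborel)
    \<le> ennreal (C / \<epsilon> powr d) * (\<integral>\<^sup>+y. (\<integral>\<^sup>+X. indicator (ball y ?s) X * (indicator {X. \<delta> X < \<epsilon>} X * ennreal ((cmod (w X))\<^sup>2)) \<partial>lborel) \<partial>\<tau>)"
    by (rule nn_integral_collar_le[OF _ e]) measurable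
  also have "\<dots> \<le> ennreal (C / \<epsilon> powr d) * (\<integral>\<^sup>+y. ennreal (2 * unit_ball_vol N * ?s powr N) * ennreal ((cmod (avg w y ?s))\<^sup>2)
      + ennreal (2 * C0 * ?s\<^sup>2) * (\<integral>\<^sup>+Z. indicator (ball y ?s) Z * h Z \<partial>lborel) \<partial>\<tau>)"
    by (intro mult_left_mono nn_integral_mono mball) simp
  also have "\<dots> = ennreal (C / \<epsilon> powr d) * (ennreal (2 * unit_ball_vol N * ?s powr N) * (\<integral>\<^sup>+y. ennreal ((cmod (avg w y ?s))\<^sup>2) \<partial>\<tau>)
      + ennreal (2 * C0 * ?s\<^sup>2) * (\<integral>\<^sup>+y. (\<integral>\<^sup>+Z. indicator (ball y ?s) Z * h Z \<partial>lborel) \<partial>\<tau>))"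
    using mH by (subst nn_integral_add) (auto simp: nn_integral_cmult)
  also have "\<dots> \<le> ennreal (C / \<epsilon> powr d) * (ennreal (2 * unit_ball_vol N * ?s powr N) * ennreal ?K
      + ennreal (2 * C0 * ?s\<^sup>2) * (ennreal (C * ?s powr d) * ennreal (?s powr (N - 1 - d) * E)))"
    by (intro mult_left_mono add_mono boundary_average_le s order_trans[OF nn_integral_\<tau>_ball_le[OF h s]] collar_energy) auto
  also have "\<dots> = ennreal (C / \<epsilon> powr d * (2 * unit_ball_vol N * ?s powr N * ?K + 2 * C0 * ?s\<^sup>2 * (C * ?s powr d * (?s powr (N - 1 - d) * E))))"
    using C0 C E e vol_pos by (simp add: ennreal_mult[symmetric] ennreal_plus[symmetric] del: ennreal_plus)
  also have "C / \<epsilon> powr d * (2 * unit_ball_vol N * ?s powr N * ?K + 2 * C0 * ?s\<^sup>2 * (C * ?s powr d * (?s powr (N - 1 - d) * E))) = hardy_const * \<epsilon> * \<epsilon> powr (N - d)"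
  proof -
    have 1: "2 * unit_ball_vol N * ?s powr N * ?K = ?s powr N * (8 * C0 * 4 powr N * C * E) * ?s"
      using vol_pos by simp
    have "?s powr d * ?s powr (N - 1 - d) = ?s powr (N - 1)"
      using s by (simp add: powr_add[symmetric])
    also have "\<dots> = ?s powr N / ?s"
      using s by (simp add: powr_diff)
    finally have "?s\<^sup>2 * (?s powr d * ?s powr (N - 1 - d)) = ?s powr N * ?s"
      using s by (simp add: power2_eq_square)
    then have 2: "2 * C0 * ?s\<^sup>2 * (C * ?s powr d * (?s powr (N - 1 - d) * E)) = ?s powr N * (2 * C0 * C * E) * ?s"
    proof -
      assume *: "?s\<^sup>2 * (?s powr d * ?s powr (N - 1 - d)) = ?s powr N * ?s"
      have "2 * C0 * ?s\<^sup>2 * (C * ?s powr d * (?s powr (N - 1 - d) * E)) = (2 * C0 * C * E) * (?s\<^sup>2 * (?s powr d * ?s powr (N - 1 - d)))"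
        by (simp only: mult_ac)
      then show ?thesis unfolding * by (simp only: mult_ac)
    qed
    have "\<epsilon> powr (N - d) = \<epsilon> powr N / \<epsilon> powr d" "?s powr N = 2 powr N * \<epsilon> powr N"
      using e by (simp_all add: powr_mult powr_diff)
    then show ?thesis
      unfolding 1 2 hardy_const_def by (simp add: algebra_simps)
  qed
  finally show ?thesis .
qed

text \<open>One factor \<epsilon> of the collar estimate is bounded by \<open>R\<close>, which
  leaves the power \<open>N - d\<close> that the dyadic summation expects; the summation contributes
  the second factor \<open>R\<close>.\<close>

theorem hardy:
  assumes R: "R > 0"
  shows "(\<integral>\<^sup>+X. indicator {X. 0 < \<delta> X \<and> \<delta> X < R} X * (ennreal (weight d \<Gamma> X) * ennreal ((cmod (w X))\<^sup>2)) \<partial>lborel)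
    \<le> ennreal (hardy_const * 2 powr (N - d) * R\<^sup>2)"
proof -
  have "(\<integral>\<^sup>+X. indicator {X. 0 < \<delta> X \<and> \<delta> X < R} X * (ennreal (weight d \<Gamma> X) * ennreal ((cmod (w X))\<^sup>2)) \<partial>lborel)
    \<le> ennreal (hardy_const * R * 2 powr (N - d) * R)"
  proof (rule dyadic_weight_le[OF _ R])
    fix \<epsilon> assume e: "0 < \<epsilon>" "\<epsilon> \<le> R"
    have "hardy_const * \<epsilon> * \<epsilon> powr (N - d) \<le> hardy_const * R * \<epsilon> powr (N - d)"
      using e hardy_const_nonneg by (intro mult_right_mono mult_left_mono) auto
    then show "(\<integral>\<^sup>+X. indicator {X. \<delta> X < \<epsilon>} X * ennreal ((cmod (w X))\<^sup>2) \<partial>lborel) \<le> ennreal (hardy_const * R * \<epsilon> powr (N - d))"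
      by (intro order_trans[OF collar_square_le[OF e(1)] ennreal_leI])
  qed (use hardy_const_nonneg R in auto)
  then show ?thesis by (simp add: power2_eq_square mult_ac)
qed

end

section \<open>The nonlinear test function and \<open>q\<close>-ellipticity\<close>

lemma cdot_mult_left: "cdot (\<chi> i. a * \<xi> $ i) \<zeta> = a * cdot \<xi> \<zeta>"
  by (simp add: cdot_def sum_distrib_left mult.assoc)

lemma cdot_mult_right: "cdot \<xi> (\<chi> i. a * \<zeta> $ i) = a * cdot \<xi> \<zeta>"
  by (simp add: cdot_def sum_distrib_left mult.left_commute)

lemma cdot_scaleR_left: "cdot (s *\<^sub>R v) z = complex_of_real s * cdot v z"
  by (simp only: cdot_def vector_scaleR_component) (simp only: scaleR_conv_of_real sum_distrib_left mult.assoc)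

lemma cdot_add_right: "cdot \<xi> (\<zeta> + \<eta>) = cdot \<xi> \<zeta> + cdot \<xi> \<eta>"
  by (simp add: cdot_def sum.distrib distrib_left)

lemma matrix_vector_mult_complex: "(M :: complex ^ 'n::finite ^ 'm::finite) *v (\<chi> i. a * \<xi> $ i) = (\<chi> i. a * (M *v \<xi>) $ i)"
  by (simp add: matrix_vector_mult_def vec_eq_iff sum_distrib_left mult.left_commute)

lemma norm_vec_unit_mult:
  fixes \<xi> :: "complex ^ 'n::finite"
  assumes "cmod a = 1"
  shows "norm (\<chi> i. a * \<xi> $ i) = norm \<xi>"
  using assms by (simp add: norm_vec_def norm_mult)

text \<open>The vector \<open>\<xi> + (q - 2) \<theta> Re \<xi>\<close> interpolates between \<open>\<xi>\<close> and
  \<open>(q - 1) Re \<xi> + i Im \<xi> = q i J_map q (- i \<xi>)\<close>.\<close>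

lemma q_ellipticity_interpolation:
  fixes M :: "complex ^ 'n::finite ^ 'n" and \<xi> :: "complex ^ 'n"
  assumes ell: "\<And>\<xi>. a * (norm \<xi>)\<^sup>2 \<le> Re (cdot (M *v \<xi>) (vec_cnj \<xi>))"
    and qell: "\<And>\<xi>. c * (norm \<xi>)\<^sup>2 \<le> Re (cdot (M *v \<xi>) (vec_cnj (J_map q \<xi>)))"
    and \<theta>: "0 \<le> \<theta>" "\<theta> \<le> 1" and q: "q > 0"
  shows "min a (q * c) * (norm \<xi>)\<^sup>2
    \<le> Re (cdot (M *v \<xi>) (\<chi> i. cnj (\<xi> $ i) + complex_of_real ((q - 2) * \<theta> * Re (\<xi> $ i))))"
proof -
  define \<eta> where "\<eta> = (\<chi> i. - \<i> * \<xi> $ i)"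
  have n\<eta>: "norm \<eta> = norm \<xi>" unfolding \<eta>_def by (rule norm_vec_unit_mult) simp
  have M\<eta>: "M *v \<eta> = (\<chi> i. - \<i> * (M *v \<xi>) $ i)"
    unfolding \<eta>_def by (rule matrix_vector_mult_complex)
  let ?p = "\<chi> i. cnj (\<xi> $ i) + complex_of_real ((q - 2) * Re (\<xi> $ i))"
  have "(\<chi> i. complex_of_real q * (\<chi> i. - \<i> * vec_cnj (J_map q \<eta>) $ i) $ i) = ?p"
    using q by (simp add: vec_eq_iff vec_cnj_def J_map_def \<eta>_def complex_eq_iff algebra_simps)
  then have "cdot (M *v \<xi>) ?p = complex_of_real q * (- \<i> * cdot (M *v \<xi>) (vec_cnj (J_map q \<eta>)))"
    using cdot_mult_right by metis
  also have "- \<i> * cdot (M *v \<xi>) (vec_cnj (J_map q \<eta>)) = cdot (M *v \<eta>) (vec_cnj (J_map q \<eta>))"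
    unfolding M\<eta> by (rule cdot_mult_left[symmetric])
  finally have "Re (cdot (M *v \<xi>) ?p) = q * Re (cdot (M *v \<eta>) (vec_cnj (J_map q \<eta>)))"
    by simp
  then have 2: "q * c * (norm \<xi>)\<^sup>2 \<le> Re (cdot (M *v \<xi>) ?p)"
    using mult_left_mono[OF qell[of \<eta>], of q] q by (simp add: n\<eta> mult.assoc)
  have "(\<chi> i. cnj (\<xi> $ i) + complex_of_real ((q - 2) * \<theta> * Re (\<xi> $ i)))
    = (\<chi> i. complex_of_real (1 - \<theta>) * vec_cnj \<xi> $ i) + (\<chi> i. complex_of_real \<theta> * ?p $ i)"
    by (simp add: vec_eq_iff vec_cnj_def algebra_simps)
  then have "Re (cdot (M *v \<xi>) (\<chi> i. cnj (\<xi> $ i) + complex_of_real ((q - 2) * \<theta> * Re (\<xi> $ i))))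
    = (1 - \<theta>) * Re (cdot (M *v \<xi>) (vec_cnj \<xi>)) + \<theta> * Re (cdot (M *v \<xi>) ?p)"
    by (simp only: cdot_add_right cdot_mult_right) simp
  moreover have "(1 - \<theta>) * (min a (q * c) * (norm \<xi>)\<^sup>2) \<le> (1 - \<theta>) * Re (cdot (M *v \<xi>) (vec_cnj \<xi>))"
    using \<theta> by (intro mult_left_mono order_trans[OF mult_right_mono ell]) auto
  moreover have "\<theta> * (min a (q * c) * (norm \<xi>)\<^sup>2) \<le> \<theta> * Re (cdot (M *v \<xi>) ?p)"
    using \<theta> by (intro mult_left_mono order_trans[OF mult_right_mono 2]) auto
  ultimately show ?thesis by (simp add: algebra_simps)
qed

text \<open>A bounded regularisation of \<open>s \<mapsto> s powr ((q - 2) / 2)\<close>, bounded away from zero.\<close>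

definition reg_weight :: "real \<Rightarrow> real \<Rightarrow> real \<Rightarrow> real" where
  "reg_weight q k s = ((k + s) / (1 + k * s)) powr ((q - 2) / 2)"

text \<open>Up to the factor \<open>(q - 2) / 2\<close> this is \<open>s\<close> times the
  logarithmic derivative of \<open>reg_weight q k\<close>. It becomes the interpolation parameter
  \<theta> of \<open>q_ellipticity_interpolation\<close>.\<close>

definition reg_ratio :: "real \<Rightarrow> real \<Rightarrow> real" where
  "reg_ratio k s = s * (1 - k\<^sup>2) / ((k + s) * (1 + k * s))"

definition reg_power :: "real \<Rightarrow> real \<Rightarrow> complex \<Rightarrow> complex" where
  "reg_power q k z = reg_weight q k ((cmod z)\<^sup>2) *\<^sub>R cnj z"

definition reg_power_deriv :: "real \<Rightarrow> real \<Rightarrow> complex \<Rightarrow> complex \<Rightarrow> complex" where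
  "reg_power_deriv q k z v = reg_weight q k ((cmod z)\<^sup>2) *\<^sub>R cnj v
    + ((q - 2) * reg_weight q k ((cmod z)\<^sup>2) * (1 - k\<^sup>2) / ((k + (cmod z)\<^sup>2) * (1 + k * (cmod z)\<^sup>2)) * Re (cnj z * v)) *\<^sub>R cnj z"

lemma one_plus_mult_pos: "0 < 1 + k * s" if "0 < k" "0 \<le> s" for k s :: real
  using mult_nonneg_nonneg[of k s] that by linarith

lemma reg_ratio_bounds:
  assumes "0 < k" "k \<le> 1" "0 \<le> s"
  shows "0 \<le> reg_ratio k s" "reg_ratio k s \<le> 1"
proof -
  have k2: "k\<^sup>2 \<le> 1" using assms by (simp add: power_le_one)
  have p: "(k + s) * (1 + k * s) > 0" using assms by (intro mult_pos_pos one_plus_mult_pos) auto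
  show "0 \<le> reg_ratio k s"
    unfolding reg_ratio_def using assms k2 p by (intro divide_nonneg_pos mult_nonneg_nonneg) auto
  have "s * (1 - k\<^sup>2) \<le> s" using assms by (simp add: mult_left_le)
  also have "s \<le> (k + s) * 1" using assms by simp
  also have "\<dots> \<le> (k + s) * (1 + k * s)" using assms by (intro mult_left_mono) auto
  finally show "reg_ratio k s \<le> 1"
    unfolding reg_ratio_def using p by (simp add: divide_le_eq)
qed

text \<open>As a function of \<open>s\<close> the quotient is a Moebius transformation,
  nondecreasing for \<open>k \<le> 1\<close>, with value \<open>k\<close> at 0 and limit
  \<open>1 / k\<close> at infinity.\<close>

lemma reg_quotient_bounds:
  fixes k s :: real
  assumes "0 < k" "k \<le> 1" "0 \<le> s"
  shows "k \<le> (k + s) / (1 + k * s)" "(k + s) / (1 + k * s) \<le> 1 / k" "(k + s) / (1 + k * s) > 0"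
proof -
  have p: "1 + k * s > 0" using assms by (intro one_plus_mult_pos)
  have k2: "k\<^sup>2 \<le> 1" using assms by (simp add: power_le_one)
  have "k * (k * s) \<le> 1 * s" using assms k2 mult_right_mono[of "k * k" 1 s] by (simp add: mult.assoc[symmetric] power2_eq_square)
  then show "k \<le> (k + s) / (1 + k * s)"
    using p by (simp add: le_divide_eq distrib_left)
  show "(k + s) / (1 + k * s) \<le> 1 / k"
    using p assms k2 by (simp add: divide_le_eq le_divide_eq distrib_left distrib_right power2_eq_square mult.commute)
  show "(k + s) / (1 + k * s) > 0" using p assms by (intro divide_pos_pos) auto
qed

lemma reg_weight_bounds:
  assumes "0 < k" "k \<le> 1" "0 \<le> s"
  shows "0 < reg_weight q k s" "reg_weight q k s \<le> (1 / k) powr \<bar>(q - 2) / 2\<bar>"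
proof -
  note b = reg_quotient_bounds[OF assms]
  show "0 < reg_weight q k s" unfolding reg_weight_def using b(3) by (metis powr_gt_zero less_irrefl)
  show "reg_weight q k s \<le> (1 / k) powr \<bar>(q - 2) / 2\<bar>"
  proof (cases "q \<ge> 2")
    case True
    then show ?thesis unfolding reg_weight_def using b by (simp add: powr_mono2)
  next
    case False
    then have "reg_weight q k s \<le> k powr ((q - 2) / 2)"
      unfolding reg_weight_def using b assms by (intro powr_mono2') auto
    also have "\<dots> = (1 / k) powr \<bar>(q - 2) / 2\<bar>"
      using False assms by (simp add: powr_divide powr_minus_divide[symmetric] minus_divide_left)
    finally show ?thesis .
  qed
qed

lemma reg_weight_has_derivative:
  assumes k: "0 < k" "k \<le> 1" and s: "0 \<le> s"
  shows "(reg_weight q k has_real_derivative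
    ((q - 2) / 2 * reg_weight q k s * (1 - k\<^sup>2) / ((k + s) * (1 + k * s)))) (at s)"
proof -
  have p: "1 + k * s > 0" "k + s > 0" using k s one_plus_mult_pos by auto
  have "((\<lambda>s. (k + s) / (1 + k * s)) has_real_derivative ((1 - k\<^sup>2) / (1 + k * s)\<^sup>2)) (at s)"
    using p by (auto intro!: derivative_eq_intros simp: power2_eq_square field_simps)
  from DERIV_fun_powr[OF this reg_quotient_bounds(3)[OF k s], of "(q - 2) / 2"]
  have "(reg_weight q k has_real_derivative
      (q - 2) / 2 * ((k + s) / (1 + k * s)) powr ((q - 2) / 2 - 1) * ((1 - k\<^sup>2) / (1 + k * s)\<^sup>2)) (at s)"
    by (simp add: reg_weight_def[abs_def])
  moreover have "(q - 2) / 2 * ((k + s) / (1 + k * s)) powr ((q - 2) / 2 - 1) * ((1 - k\<^sup>2) / (1 + k * s)\<^sup>2)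
    = (q - 2) / 2 * reg_weight q k s * (1 - k\<^sup>2) / ((k + s) * (1 + k * s))"
  proof -
    have "((k + s) / (1 + k * s)) powr ((q - 2) / 2 - 1) = reg_weight q k s / ((k + s) / (1 + k * s))"
      using reg_quotient_bounds(3)[OF k s] p by (simp add: reg_weight_def powr_diff)
    also have "\<dots> = reg_weight q k s * (1 + k * s) / (k + s)" by (simp only: divide_divide_eq_right)
    finally have e: "((k + s) / (1 + k * s)) powr ((q - 2) / 2 - 1) = reg_weight q k s * (1 + k * s) / (k + s)" .
    have alg: "c * (r * p / t) * (m / p\<^sup>2) = c * r * m / (t * p)" if "p \<noteq> 0" for c r m t p :: real
      using that by (simp add: power2_eq_square)
    show ?thesis unfolding e by (rule alg) (use p in simp)
  qed
  ultimately show ?thesis by simp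
qed

text \<open>The global Lipschitz constant blows up as \<open>k\<close> tends to 0 for
  \<open>q\<close> other than 2 and serves only to make \<open>reg_power\<close> admissible in the
  chain rule. The pointwise bound by \<open>reg_weight\<close> is the one that enters estimates
  uniform in \<open>k\<close>.\<close>

lemma C1_lipschitz_reg_power:
  assumes k: "0 < k" "k \<le> 1"
  shows "C1_lipschitz (reg_power q k) (reg_power_deriv q k) ((1 + \<bar>q - 2\<bar>) * (1 / k) powr \<bar>(q - 2) / 2\<bar>)"
    and "cmod (reg_power_deriv q k z v) \<le> (1 + \<bar>q - 2\<bar>) * reg_weight q k ((cmod z)\<^sup>2) * cmod v"
proof -
  show bd: "cmod (reg_power_deriv q k z v) \<le> (1 + \<bar>q - 2\<bar>) * reg_weight q k ((cmod z)\<^sup>2) * cmod v" for z v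
  proof -
    let ?s = "(cmod z)\<^sup>2"
    let ?\<phi> = "reg_weight q k ?s"
    have s: "0 \<le> ?s" by simp
    note \<phi> = reg_weight_bounds[OF k s, of q] and \<theta> = reg_ratio_bounds[OF k s]
    define a where "a = (1 - k\<^sup>2) / ((k + ?s) * (1 + k * ?s))"
    have a: "a \<ge> 0"
      unfolding a_def using k s by (intro divide_nonneg_nonneg mult_nonneg_nonneg add_nonneg_nonneg) (auto simp: power_le_one)
    have "\<bar>(q - 2) * ?\<phi> * (1 - k\<^sup>2) / ((k + ?s) * (1 + k * ?s)) * Re (cnj z * v)\<bar> = \<bar>(q - 2) * ?\<phi> * a * Re (cnj z * v)\<bar>"
      by (simp add: a_def)
    also have "\<dots> = \<bar>q - 2\<bar> * ?\<phi> * a * \<bar>Re (cnj z * v)\<bar>"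
      using \<phi>(1) a by (simp only: abs_mult abs_of_nonneg abs_of_pos)
    also have "\<dots> \<le> \<bar>q - 2\<bar> * ?\<phi> * a * (cmod z * cmod v)"
      using \<phi>(1) a abs_Re_le_cmod[of "cnj z * v"] by (intro mult_left_mono) (auto simp: norm_mult)
    finally have "\<bar>(q - 2) * ?\<phi> * (1 - k\<^sup>2) / ((k + ?s) * (1 + k * ?s)) * Re (cnj z * v)\<bar> * cmod z
        \<le> (\<bar>q - 2\<bar> * ?\<phi> * a * (cmod z * cmod v)) * cmod z"
      by (rule mult_right_mono) simp
    \<comment> \<open>The two factors \<open>cmod z\<close> complete \<open>a\<close> to
      \<open>reg_ratio\<close>, which is at most 1; the derivative of the weight thus costs no more
      than the weight itself.\<close>
    also have "\<dots> = \<bar>q - 2\<bar> * ?\<phi> * reg_ratio k ?s * cmod v"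
      by (simp add: reg_ratio_def a_def power2_eq_square mult_ac)
    also have "\<dots> \<le> \<bar>q - 2\<bar> * ?\<phi> * 1 * cmod v"
      using \<phi>(1) \<theta> by (intro mult_right_mono mult_left_mono) auto
    finally have 2: "\<bar>(q - 2) * ?\<phi> * (1 - k\<^sup>2) / ((k + ?s) * (1 + k * ?s)) * Re (cnj z * v)\<bar> * cmod z \<le> \<bar>q - 2\<bar> * ?\<phi> * cmod v"
      by simp
    have "cmod (reg_power_deriv q k z v) \<le> ?\<phi> * cmod v + \<bar>(q - 2) * ?\<phi> * (1 - k\<^sup>2) / ((k + ?s) * (1 + k * ?s)) * Re (cnj z * v)\<bar> * cmod z"
      unfolding reg_power_deriv_def using \<phi>(1) by (intro order_trans[OF norm_triangle_ineq]) simp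
    with 2 show ?thesis by (simp add: algebra_simps)
  qed
  show "C1_lipschitz (reg_power q k) (reg_power_deriv q k) ((1 + \<bar>q - 2\<bar>) * (1 / k) powr \<bar>(q - 2) / 2\<bar>)"
  proof
    fix z v
    have s: "0 \<le> (cmod z)\<^sup>2" by simp
    have n: "((\<lambda>z. (cmod z)\<^sup>2) has_derivative (\<lambda>v. 2 * Re (cnj z * v))) (at z)"
    proof -
      have "((\<lambda>z. z \<bullet> z) has_derivative (\<lambda>v. z \<bullet> v + v \<bullet> z)) (at z)"
        by (intro has_derivative_inner has_derivative_ident)
      then show ?thesis
        by (simp add: dot_square_norm inner_complex_def mult.commute)
    qed
    have "((\<lambda>z. reg_weight q k ((cmod z)\<^sup>2)) has_derivative
      (\<lambda>v. ((q - 2) / 2 * reg_weight q k ((cmod z)\<^sup>2) * (1 - k\<^sup>2) / ((k + (cmod z)\<^sup>2) * (1 + k * (cmod z)\<^sup>2))) * (2 * Re (cnj z * v)))) (at z)"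
      by (rule has_derivative_compose[OF n reg_weight_has_derivative[OF k s, unfolded has_field_derivative_def]])
    moreover have "(q - 2) / 2 * a * b / e * (2 * r) = (q - 2) * a * b / e * r" for a b e r :: real
      by simp
    ultimately have "((\<lambda>z. reg_weight q k ((cmod z)\<^sup>2)) has_derivative
      (\<lambda>v. (q - 2) * reg_weight q k ((cmod z)\<^sup>2) * (1 - k\<^sup>2) / ((k + (cmod z)\<^sup>2) * (1 + k * (cmod z)\<^sup>2)) * Re (cnj z * v))) (at z)"
      by (simp only:)
    from has_derivative_scaleR[OF this bounded_linear.has_derivative[OF bounded_linear_cnj has_derivative_ident]]
    show "(reg_power q k has_derivative reg_power_deriv q k z) (at z)"
      unfolding reg_power_def[abs_def] reg_power_deriv_def[abs_def] by (simp add: mult_ac)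
    have "continuous_on {0..} (reg_weight q k)"
      using reg_weight_has_derivative[OF k] by (auto intro!: continuous_at_imp_continuous_on DERIV_isCont)
    then have c: "continuous_on UNIV (\<lambda>z::complex. reg_weight q k ((cmod z)\<^sup>2))"
      by (rule continuous_on_compose2) (auto intro!: continuous_intros)
    have "k + (cmod z)\<^sup>2 \<noteq> 0" "1 + k * (cmod z)\<^sup>2 \<noteq> 0" for z
      using k add_pos_nonneg[of k "(cmod z)\<^sup>2"] add_pos_nonneg[of 1 "k * (cmod z)\<^sup>2"] by auto
    then show "continuous_on UNIV (\<lambda>z. reg_power_deriv q k z v)"
      unfolding reg_power_deriv_def by (intro continuous_intros c) auto
    have "(1 + \<bar>q - 2\<bar>) * reg_weight q k ((cmod z)\<^sup>2) * cmod v \<le> (1 + \<bar>q - 2\<bar>) * (1 / k) powr \<bar>(q - 2) / 2\<bar> * cmod v"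
      by (intro mult_right_mono mult_left_mono reg_weight_bounds(2)[OF k s]) auto
    then show "cmod (reg_power_deriv q k z v) \<le> (1 + \<bar>q - 2\<bar>) * (1 / k) powr \<bar>(q - 2) / 2\<bar> * cmod v"
      using bd[of z v] by linarith
  qed
qed

text \<open>Rotate by the phase \<open>e\<close> of \<open>u\<close>: \<open>M\<close> is complex
  linear, so \<open>M *v G\<close> carries the factor \<open>e\<close>, while the derivative of
  \<open>reg_power\<close> carries \<open>cnj e\<close>, and the phases cancel. What is left is the
  interpolated form at the rotated gradient with parameter \<open>reg_ratio\<close>.\<close>

lemma reg_power_elliptic:
  fixes M :: "complex ^ 'n::finite ^ 'n" and G :: "complex ^ 'n"
  assumes ell: "\<And>\<xi>. a * (norm \<xi>)\<^sup>2 \<le> Re (cdot (M *v \<xi>) (vec_cnj \<xi>))"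
    and qell: "\<And>\<xi>. c * (norm \<xi>)\<^sup>2 \<le> Re (cdot (M *v \<xi>) (vec_cnj (J_map q \<xi>)))"
    and k: "0 < k" "k \<le> 1" and q: "q > 0"
  shows "min a (q * c) * (reg_weight q k ((cmod u)\<^sup>2) * (norm G)\<^sup>2)
    \<le> Re (cdot (M *v G) (\<chi> i. reg_power_deriv q k u (G $ i)))"
proof -
  let ?s = "(cmod u)\<^sup>2"
  let ?\<phi> = "reg_weight q k ?s"
  have s: "0 \<le> ?s" by simp
  \<comment> \<open>At \<open>u = 0\<close> any unit number serves as phase, because the terms
    containing \<open>u\<close> vanish.\<close>
  define e where "e = (if u = 0 then 1 else u / cmod u)"
  have e: "cmod e = 1" by (simp add: e_def norm_divide)
  have ue: "u = cmod u * e" by (simp add: e_def)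
  have ee: "e * cnj e = 1" using e by (simp add: complex_norm_square[symmetric])
  define \<xi> where "\<xi> = (\<chi> i. cnj e * G $ i)"
  have n: "norm \<xi> = norm G" unfolding \<xi>_def using e by (intro norm_vec_unit_mult) simp
  have G: "G = (\<chi> i. e * \<xi> $ i)"
    using ee by (simp add: \<xi>_def vec_eq_iff mult.assoc[symmetric])
  let ?p = "\<chi> i. cnj (\<xi> $ i) + complex_of_real ((q - 2) * reg_ratio k ?s * Re (\<xi> $ i))"
  have D: "reg_power_deriv q k u (G $ i) = cnj e * (complex_of_real ?\<phi> * ?p $ i)" for i
  proof -
    have "cnj u * G $ i = cmod u * \<xi> $ i"
      by (subst ue) (simp add: \<xi>_def)
    then have "Re (cnj u * G $ i) = cmod u * Re (\<xi> $ i)" by simp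
    moreover have "cnj (G $ i) = cnj e * cnj (\<xi> $ i)" by (subst G) simp
    moreover have "cnj u = cmod u * cnj e" by (subst ue) simp
    ultimately have "reg_power_deriv q k u (G $ i) = ?\<phi> *\<^sub>R (cnj e * cnj (\<xi> $ i))
      + ((q - 2) * ?\<phi> * (1 - k\<^sup>2) / ((k + ?s) * (1 + k * ?s)) * (cmod u * Re (\<xi> $ i))) *\<^sub>R (cmod u * cnj e)"
      unfolding reg_power_deriv_def by (simp only:)
    also have "\<dots> = cnj e * (complex_of_real ?\<phi> * ?p $ i)"
      by (simp add: reg_ratio_def scaleR_conv_of_real power2_eq_square algebra_simps)
    finally show ?thesis .
  qed
  have "cdot (M *v G) (\<chi> i. reg_power_deriv q k u (G $ i)) = e * (cnj e * (complex_of_real ?\<phi> * cdot (M *v \<xi>) ?p))"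
  proof -
    have "M *v G = (\<chi> i. e * (M *v \<xi>) $ i)"
      by (subst G) (rule matrix_vector_mult_complex)
    then show ?thesis
      unfolding D by (simp add: cdot_def sum_distrib_left mult_ac)
  qed
  also have "\<dots> = complex_of_real ?\<phi> * cdot (M *v \<xi>) ?p"
    using ee by (simp add: mult.assoc[symmetric])
  finally have "Re (cdot (M *v G) (\<chi> i. reg_power_deriv q k u (G $ i))) = ?\<phi> * Re (cdot (M *v \<xi>) ?p)"
    by simp
  moreover have "min a (q * c) * (norm \<xi>)\<^sup>2 \<le> Re (cdot (M *v \<xi>) ?p)"
    by (rule q_ellipticity_interpolation[OF ell qell reg_ratio_bounds[OF k s] q])
  ultimately show ?thesis
    using mult_left_mono[of _ _ ?\<phi>] reg_weight_bounds(1)[OF k s, of q] by (simp add: n mult_ac)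
qed

text \<open>A bound free of \<open>k\<close>; it controls the derivative of \<open>reg_power\<close>
  at the bounded boundary datum when \<open>q \<ge> 2\<close>.\<close>

lemma reg_weight_le:
  assumes "0 < k" "k \<le> 1" "0 \<le> s" "2 \<le> q"
  shows "reg_weight q k s \<le> (1 + s) powr ((q - 2) / 2)"
proof -
  have p: "1 + k * s \<ge> 1" "1 + k * s > 0" using assms one_plus_mult_pos by auto
  have "(k + s) / (1 + k * s) \<le> (k + s) / 1"
    using p assms by (intro divide_left_mono) auto
  also have "\<dots> \<le> 1 + s" using assms by simp
  finally show ?thesis
    unfolding reg_weight_def using assms reg_quotient_bounds(3)[OF assms(1-3)] by (intro powr_mono2) auto
qed

text \<open>For \<open>q < 2\<close> the limiting weight is singular at 0, but \<open>q > 1\<close>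
  bounds the regularised one by \<open>sqrt (1 + 1 / s)\<close> with
  \<open>s = (cmod z)\<^sup>2\<close>; multiplication by \<open>cmod z\<close> removes the
  singularity uniformly in \<open>k\<close>.\<close>

lemma norm_reg_power_le:
  assumes k: "0 < k" "k \<le> 1" and q: "1 < q" "q < 2"
  shows "cmod (reg_power q k z) \<le> 1 + cmod z"
proof (cases "z = 0")
  case False
  let ?s = "(cmod z)\<^sup>2"
  have s: "?s > 0" using False by simp
  have p: "(k + ?s) / (1 + k * ?s) > 0" using reg_quotient_bounds(3)[OF k, of ?s] s by simp
  have p1: "1 + k * ?s > 0" "k + ?s > 0" using k s one_plus_mult_pos[of k ?s] by (auto intro: add_pos_pos)
  have "(1 + k * ?s) / (k + ?s) \<le> (1 + ?s) / ?s"
    using p1 s k by (intro frac_le) (auto simp: mult_left_le_one_le)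
  then have t: "(1 + k * ?s) / (k + ?s) \<le> 1 + 1 / ?s" using s by (simp add: add_divide_distrib)
  have "reg_weight q k ?s = ((1 + k * ?s) / (k + ?s)) powr ((2 - q) / 2)"
  proof -
    have "((k + ?s) / (1 + k * ?s)) powr ((q - 2) / 2) = (1 / ((k + ?s) / (1 + k * ?s))) powr ((2 - q) / 2)"
      using powr_minus_divide[of "(k + ?s) / (1 + k * ?s)" "(2 - q) / 2"] powr_divide[of 1 "(k + ?s) / (1 + k * ?s)" "(2 - q) / 2"] p
      by (simp add: minus_divide_left[symmetric] del: divide_divide_eq_right) (metis minus_diff_eq minus_divide_left)
    then show ?thesis by (simp add: reg_weight_def)
  qed
  also have "\<dots> \<le> (1 + 1 / ?s) powr ((2 - q) / 2)"
    using t p1 q by (intro powr_mono2) auto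
  also have "\<dots> \<le> (1 + 1 / ?s) powr (1 / 2)"
    using q s by (intro powr_mono) auto
  also have "\<dots> = sqrt (1 + 1 / ?s)" using s by (simp add: powr_half_sqrt)
  finally have "cmod (reg_power q k z) \<le> sqrt (1 + 1 / ?s) * cmod z"
    using reg_weight_bounds(1)[OF k, of ?s q] s by (simp add: reg_power_def mult_right_mono)
  also have "\<dots> = sqrt ((1 + 1 / ?s) * ?s)" by (simp add: real_sqrt_mult)
  also have "(1 + 1 / ?s) * ?s = ?s + 1" using s by (simp add: field_simps)
  also have "sqrt (?s + 1) \<le> sqrt ((1 + cmod z)\<^sup>2)"
    by (intro real_sqrt_le_mono) (simp add: power2_sum)
  finally show ?thesis by simp
qed (simp add: reg_power_def)

lemma reg_weight_tendsto:
  assumes "z \<noteq> 0"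
  shows "(\<lambda>j. reg_weight q (1 / real (Suc j)) ((cmod z)\<^sup>2)) \<longlonglongrightarrow> cmod z powr (q - 2)"
proof -
  let ?s = "(cmod z)\<^sup>2"
  have l: "(\<lambda>j. 1 / real (Suc j)) \<longlonglongrightarrow> 0" by (rule LIMSEQ_Suc[OF lim_1_over_n])
  have "(\<lambda>j. (1 / real (Suc j) + ?s) / (1 + 1 / real (Suc j) * ?s)) \<longlonglongrightarrow> (0 + ?s) / (1 + 0 * ?s)"
    by (intro tendsto_divide tendsto_add tendsto_mult tendsto_const l) auto
  then have "(\<lambda>j. reg_weight q (1 / real (Suc j)) ?s) \<longlonglongrightarrow> ?s powr ((q - 2) / 2)"
    unfolding reg_weight_def using assms by (intro tendsto_powr tendsto_const) auto
  also have "?s powr ((q - 2) / 2) = cmod z powr (q - 2)"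
  proof -
    have "?s = cmod z powr 2" using assms by simp
    moreover have "2 * ((q - 2) / 2) = q - 2" by simp
    ultimately show ?thesis by (simp only: powr_powr)
  qed
  finally show ?thesis .
qed

section \<open>The energy inequality\<close>

text \<open>Here \<open>h\<close> will be the integrand of the weak equation. Integrability of
  \<open>f\<close> is a consequence: either the bound is infinite, or \<open>f\<close> is dominated
  by \<open>Re h + T\<close>.\<close>

lemma nn_integral_le_of_zero_mean:
  fixes h :: "'a \<Rightarrow> complex"
  assumes h: "integrable M h" "(LINT x|M. h x) = 0"
    and [measurable]: "f \<in> borel_measurable M" "T \<in> borel_measurable M"
    and f: "\<And>x. 0 \<le> f x" and T: "\<And>x. 0 \<le> T x"
    and le: "AE x in M. f x \<le> Re (h x) + T x"
  shows "(\<integral>\<^sup>+x. ennreal (f x) \<partial>M) \<le> (\<integral>\<^sup>+x. ennreal (T x) \<partial>M)"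
proof (cases "(\<integral>\<^sup>+x. ennreal (T x) \<partial>M) = \<infinity>")
  case False
  then have IT: "integrable M T"
    using T by (intro integrableI_nonneg) (auto simp: less_top)
  have Ih: "integrable M (\<lambda>x. Re (h x))" using h(1) by (rule integrable_Re)
  have If: "integrable M f"
    by (rule Bochner_Integration.integrable_bound[OF Bochner_Integration.integrable_add[OF Ih IT]])
      (use le in \<open>auto elim!: eventually_mono simp: f abs_of_nonneg\<close>)
  have "(LINT x|M. f x) \<le> (LINT x|M. Re (h x) + T x)"
    by (rule integral_mono_AE[OF If _ le]) (intro Bochner_Integration.integrable_add Ih IT)
  also have "\<dots> = Re (LINT x|M. h x) + (LINT x|M. T x)"
    using h(1) Ih IT by simp
  finally have "(LINT x|M. f x) \<le> (LINT x|M. T x)" using h(2) by simp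
  then show ?thesis
    using If IT f T by (simp add: nn_integral_eq_integral ennreal_leI)
qed simp

lemma power2_le_imp_le_ennreal: "a\<^sup>2 \<le> b\<^sup>2 \<Longrightarrow> a \<le> b" for a b :: ennreal
proof (cases b rule: ennreal_cases)
  case b: (real y)
  assume le: "a\<^sup>2 \<le> b\<^sup>2"
  show ?thesis
  proof (cases a rule: ennreal_cases)
    case a: (real x)
    have "x\<^sup>2 \<le> y\<^sup>2"
      using le a b by (simp add: ennreal_power)
    then have "x \<le> y"
      using b(1) by (rule power2_le_imp_le)
    then show ?thesis
      unfolding a(2) b(2) by (rule ennreal_leI)
  next
    case top
    have "b\<^sup>2 = ennreal (y\<^sup>2)" unfolding b(2) using b(1) by (rule ennreal_power)
    then show ?thesis using le top by (simp add: power2_eq_square top_unique)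
  qed
qed simp

lemma norm_grad_of_real_le:
  fixes f :: "real ^ 'n::finite \<Rightarrow> real"
  assumes f: "smooth_fun f" and le: "\<And>v. \<bar>frechet_derivative f (at X) v\<bar> \<le> c * norm v"
  shows "norm (classical_grad (\<lambda>X. complex_of_real (f X)) X) \<le> real CARD('n) * c"
proof -
  have "frechet_derivative (\<lambda>X. complex_of_real (f X)) (at X) = (\<lambda>v. complex_of_real (frechet_derivative f (at X) v))"
    by (rule frechet_derivative_at[symmetric]) (rule has_derivative_of_real[OF smooth_fun_has_derivative[OF f]])
  then have "cmod (classical_grad (\<lambda>X. complex_of_real (f X)) X $ i) \<le> c" for i
    using le[of "axis i 1"] by (simp add: classical_grad_def)
  then have "(\<Sum>i\<in>UNIV. norm (classical_grad (\<lambda>X. complex_of_real (f X)) X $ i)) \<le> (\<Sum>i\<in>(UNIV::'n set). c)"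
    by (intro sum_mono)
  then show ?thesis
    using L2_set_le_sum_abs[of "\<lambda>i. norm (classical_grad (\<lambda>X. complex_of_real (f X)) X $ i)" UNIV]
    by (simp add: norm_vec_def)
qed

lemma classical_grad_of_real_eq_0:
  "smooth_fun f \<Longrightarrow> frechet_derivative f (at X) = (\<lambda>v. 0) \<Longrightarrow> classical_grad (\<lambda>X. complex_of_real (f X)) X = 0"
  using norm_grad_of_real_le[of f X 0] by simp

section \<open>The weighted measure as a Borel density\<close>

context ahlfors
begin

definition \<nu> :: "(real ^ 'n) measure" where
  "\<nu> = density lborel (\<lambda>X. indicator (- \<Gamma>) X * ennreal (weight d \<Gamma> X))"

lemma sets_\<nu>[measurable_cong]: "sets \<nu> = sets borel"
  by (simp add: \<nu>_def)

lemma nn_integral_\<nu>: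
  assumes [measurable]: "f \<in> borel_measurable borel"
  shows "(\<integral>\<^sup>+X. f X \<partial>\<nu>) = (\<integral>\<^sup>+X. indicator (- \<Gamma>) X * (ennreal (weight d \<Gamma> X) * f X) \<partial>lborel)"
  unfolding \<nu>_def by (subst nn_integral_density) (auto simp: mult.assoc)

lemma weight_nonneg: "0 \<le> weight d \<Gamma> X"
  by (simp add: weight_eq)

lemma weight_pos: "X \<notin> \<Gamma> \<Longrightarrow> 0 < weight d \<Gamma> X"
  using \<delta>_pos_iff[of X] by (simp add: weight_eq)

text \<open>The density is strictly positive off \<Gamma> and zero on \<Gamma>, so the \<nu>-null
  Borel sets are those that are Lebesgue null off \<Gamma>.\<close>

lemma AE_\<nu>_iff: "(AE X in \<nu>. P X) \<longleftrightarrow> (AE X in lborel. X \<notin> \<Gamma> \<longrightarrow> P X)"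
proof -
  have "0 < indicator (- \<Gamma>) X * ennreal (weight d \<Gamma> X) \<longleftrightarrow> X \<notin> \<Gamma>" for X
    using weight_pos[of X] by (auto simp: indicator_def)
  then show ?thesis
    unfolding \<nu>_def by (subst AE_density) auto
qed

text \<open>A default value: \<open>0 powr _ = 0\<close>, although the weight blows up when \<Gamma>
  is approached.\<close>

lemma weight_\<Gamma>: "X \<in> \<Gamma> \<Longrightarrow> weight d \<Gamma> X = 0"
  by (simp add: weight_eq)

lemma nn_integral_\<nu>_real:
  assumes [measurable]: "f \<in> borel_measurable borel" and f: "\<And>X. 0 \<le> f X"
  shows "(\<integral>\<^sup>+X. ennreal (f X) \<partial>\<nu>) = (\<integral>\<^sup>+X. ennreal (weight d \<Gamma> X * f X) \<partial>lborel)"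
  by (subst nn_integral_\<nu>)
    (auto intro!: nn_integral_cong simp: indicator_def ennreal_mult weight_nonneg f weight_\<Gamma>)

lemma continuous_weight: "continuous_on (- \<Gamma>) (weight d \<Gamma>)"
  unfolding weight_eq[abs_def] by (intro continuous_intros) (use \<delta>_pos_iff in force)

lemma weight_compact_bounds:
  assumes "compact K" "K \<subseteq> - \<Gamma>"
  obtains b B where "b > 0" "B > 0" "\<And>X. X \<in> K \<Longrightarrow> b \<le> weight d \<Gamma> X" "\<And>X. X \<in> K \<Longrightarrow> weight d \<Gamma> X \<le> B"
proof (cases "K = {}")
  case True
  then show ?thesis using that[of 1 1] by simp
next
  case False
  have c: "continuous_on K (weight d \<Gamma>)"
    using continuous_weight assms(2) by (rule continuous_on_subset)
  obtain a where a: "a \<in> K" "\<And>X. X \<in> K \<Longrightarrow> weight d \<Gamma> a \<le> weight d \<Gamma> X"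
    using continuous_attains_inf[OF assms(1) False c] by blast
  obtain e where e: "e \<in> K" "\<And>X. X \<in> K \<Longrightarrow> weight d \<Gamma> X \<le> weight d \<Gamma> e"
    using continuous_attains_sup[OF assms(1) False c] by blast
  show ?thesis
    using a e assms(2) by (intro that[of "weight d \<Gamma> a" "weight d \<Gamma> e"] weight_pos) auto
qed

lemma nn_integral_compact_le_\<nu>:
  assumes "compact K" "K \<subseteq> - \<Gamma>"
  obtains c where "c \<ge> 0" "\<And>f. f \<in> borel_measurable borel \<Longrightarrow> (\<integral>\<^sup>+X. indicator K X * f X \<partial>lborel) \<le> ennreal c * (\<integral>\<^sup>+X. f X \<partial>\<nu>)"
proof -
  obtain b B where b: "b > 0" "\<And>X. X \<in> K \<Longrightarrow> b \<le> weight d \<Gamma> X"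
    using weight_compact_bounds[OF assms] by metis
  have [measurable]: "K \<in> sets borel" using assms(1) by (rule borel_compact)
  have "(\<integral>\<^sup>+X. indicator K X * f X \<partial>lborel) \<le> ennreal (1 / b) * (\<integral>\<^sup>+X. f X \<partial>\<nu>)" if [measurable]: "f \<in> borel_measurable borel" for f
  proof -
    have "(\<integral>\<^sup>+X. indicator K X * f X \<partial>lborel) \<le> (\<integral>\<^sup>+X. ennreal (1 / b) * (indicator (- \<Gamma>) X * (ennreal (weight d \<Gamma> X) * f X)) \<partial>lborel)"
    proof (intro nn_integral_mono)
      fix X
      show "indicator K X * f X \<le> ennreal (1 / b) * (indicator (- \<Gamma>) X * (ennreal (weight d \<Gamma> X) * f X))"
      proof (cases "X \<in> K")
        case True
        then have "1 \<le> 1 / b * weight d \<Gamma> X" using b(1) b(2)[OF True] by simp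
        moreover have "ennreal (1 / b * weight d \<Gamma> X) = ennreal (1 / b) * ennreal (weight d \<Gamma> X)"
          using b(1) weight_nonneg[of X] by (intro ennreal_mult) auto
        ultimately have "1 \<le> ennreal (1 / b) * ennreal (weight d \<Gamma> X)"
          using ennreal_leI[of 1 "1 / b * weight d \<Gamma> X"] by simp
        then have "1 * f X \<le> (ennreal (1 / b) * ennreal (weight d \<Gamma> X)) * f X"
          by (rule mult_right_mono) simp
        then show ?thesis using True assms(2) by (auto simp: mult.assoc)
      qed simp
    qed
    also have "\<dots> = ennreal (1 / b) * (\<integral>\<^sup>+X. f X \<partial>\<nu>)"
      by (subst nn_integral_cmult) (auto simp: nn_integral_\<nu>)
    finally show ?thesis .
  qed
  then show ?thesis using that[of "1 / b"] b(1) by simp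
qed

end

text \<open>\<open>V\<close> stands for the flux \<open>\<A> \<nabla>u\<close>. The point \<open>x0\<close> is the centre of the cutoffs at infinity.\<close>

locale energy_data = ahlfors \<Gamma> \<tau> d C N
  for \<Gamma> :: "(real ^ 'n::finite) set" and \<tau> d C N +
  fixes u g :: "real ^ 'n \<Rightarrow> complex" and G V :: "real ^ 'n \<Rightarrow> complex ^ 'n" and K0 :: real and x0 :: "real ^ 'n"
  assumes uG: "wgrad (- \<Gamma>) u G" and V[measurable]: "V \<in> borel_measurable borel"
    and V2: "(\<integral>\<^sup>+X. ennreal ((norm (V X))\<^sup>2) \<partial>\<nu>) < \<infinity>" and G2: "(\<integral>\<^sup>+X. ennreal ((norm (G X))\<^sup>2) \<partial>\<nu>) < \<infinity>"
    and weak: "\<phi> \<in> test_functions (- \<Gamma>) \<Longrightarrow> (LINT X|lborel. cdot (weight d \<Gamma> X *\<^sub>R V X) (classical_grad \<phi> X)) = 0"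
    and g: "g \<in> test_functions UNIV" and K0: "0 \<le> K0"
    and hardy: "0 < R \<Longrightarrow> (\<integral>\<^sup>+X. indicator {X. 0 < \<delta> X \<and> \<delta> X < R} X * (ennreal (weight d \<Gamma> X) * ennreal ((cmod (u X - g X))\<^sup>2)) \<partial>lborel) \<le> ennreal (K0 * R\<^sup>2)"
    and x0: "x0 \<in> \<Gamma>"
begin

lemma u_meas[measurable]: "u \<in> borel_measurable borel" and G_meas[measurable]: "G \<in> borel_measurable borel"
  using wgradD(1,2)[OF uG] by auto

lemmas g_smooth = test_functionsD(1)[OF g]

lemma g_meas[measurable]: "g \<in> borel_measurable borel" and g_grad_meas[measurable]: "classical_grad g \<in> borel_measurable borel"
  using g_smooth by (auto intro: borel_measurable_continuous_onI smooth_fun_continuous borel_measurable_classical_grad)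

lemma hardy_\<nu>:
  assumes "0 < R"
  shows "(\<integral>\<^sup>+X. indicator {X. \<delta> X < R} X * ennreal ((cmod (u X - g X))\<^sup>2) \<partial>\<nu>) \<le> ennreal (K0 * R\<^sup>2)"
proof -
  have "(\<integral>\<^sup>+X. indicator {X. \<delta> X < R} X * ennreal ((cmod (u X - g X))\<^sup>2) \<partial>\<nu>)
    = (\<integral>\<^sup>+X. indicator {X. 0 < \<delta> X \<and> \<delta> X < R} X * (ennreal (weight d \<Gamma> X) * ennreal ((cmod (u X - g X))\<^sup>2)) \<partial>lborel)"
    by (subst nn_integral_\<nu>) (auto intro!: nn_integral_cong simp: indicator_def \<delta>_pos_iff)
  then show ?thesis using hardy[OF assms] by simp
qed

lemma wV_square_integrable:
  assumes K: "compact K" "K \<subseteq> - \<Gamma>"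
  shows "set_integrable lborel K (\<lambda>X. (norm (weight d \<Gamma> X *\<^sub>R V X))\<^sup>2)"
  unfolding set_integrable_def
proof (rule integrableI_nonneg)
  have [measurable]: "K \<in> sets borel" using K(1) by (rule borel_compact)
  show "(\<lambda>X. indicat_real K X *\<^sub>R (norm (weight d \<Gamma> X *\<^sub>R V X))\<^sup>2) \<in> borel_measurable lborel" by measurable
  obtain b B where B: "B > 0" "\<And>X. X \<in> K \<Longrightarrow> weight d \<Gamma> X \<le> B"
    using weight_compact_bounds[OF K] by metis
  have "(\<integral>\<^sup>+X. ennreal (indicat_real K X *\<^sub>R (norm (weight d \<Gamma> X *\<^sub>R V X))\<^sup>2) \<partial>lborel)
    \<le> (\<integral>\<^sup>+X. ennreal B * (indicator (- \<Gamma>) X * (ennreal (weight d \<Gamma> X) * ennreal ((norm (V X))\<^sup>2))) \<partial>lborel)"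
  proof (intro nn_integral_mono)
    fix X
    show "ennreal (indicat_real K X *\<^sub>R (norm (weight d \<Gamma> X *\<^sub>R V X))\<^sup>2)
      \<le> ennreal B * (indicator (- \<Gamma>) X * (ennreal (weight d \<Gamma> X) * ennreal ((norm (V X))\<^sup>2)))"
    proof (cases "X \<in> K")
      case True
      have "(norm (weight d \<Gamma> X *\<^sub>R V X))\<^sup>2 = weight d \<Gamma> X * (weight d \<Gamma> X * (norm (V X))\<^sup>2)"
        using weight_nonneg[of X] by (simp add: power_mult_distrib power2_eq_square)
      also have "\<dots> \<le> B * (weight d \<Gamma> X * (norm (V X))\<^sup>2)"
        using weight_nonneg[of X] B(2)[OF True] by (intro mult_right_mono) auto
      finally show ?thesis
        using True K(2) B(1) weight_nonneg[of X] by (auto simp: ennreal_mult[symmetric] ennreal_leI)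
    qed simp
  qed
  also have "\<dots> = ennreal B * (\<integral>\<^sup>+X. ennreal ((norm (V X))\<^sup>2) \<partial>\<nu>)"
    by (subst nn_integral_cmult) (auto simp: nn_integral_\<nu>)
  also have "\<dots> < \<infinity>" using V2 by (simp add: ennreal_mult_less_top)
  finally show "(\<integral>\<^sup>+X. ennreal (indicat_real K X *\<^sub>R (norm (weight d \<Gamma> X *\<^sub>R V X))\<^sup>2) \<partial>lborel) < \<infinity>" .
qed simp

text \<open>Cauchy-Schwarz. The Hardy inequality turns the first factor into
  \<open>R * sqrt K0\<close>, while the second retains the energy of \<open>V\<close> on
  \<open>S\<close> alone, which is what tends to 0 later.\<close>

lemma collar_product_le:
  assumes [measurable]: "S \<in> sets borel" and S: "S \<subseteq> {X. \<delta> X < R}" and R: "R > 0"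
  shows "(\<integral>\<^sup>+X. indicator S X * ennreal (cmod (u X - g X) * norm (V X)) \<partial>\<nu>)
    \<le> ennreal (R * sqrt (K0 * enn2real (\<integral>\<^sup>+X. indicator S X * ennreal ((norm (V X))\<^sup>2) \<partial>\<nu>)))"
proof -
  let ?v = "\<integral>\<^sup>+X. indicator S X * ennreal ((norm (V X))\<^sup>2) \<partial>\<nu>"
  have "?v \<le> (\<integral>\<^sup>+X. ennreal ((norm (V X))\<^sup>2) \<partial>\<nu>)"
    by (intro nn_integral_mono) (auto simp: indicator_def)
  then have v: "?v = ennreal (enn2real ?v)" using V2 by (auto simp: ennreal_enn2real_if top_unique)
  have "(\<integral>\<^sup>+X. indicator S X * ennreal (cmod (u X - g X) * norm (V X)) \<partial>\<nu>)
    = (\<integral>\<^sup>+X. (indicator S X * ennreal (cmod (u X - g X))) * (indicator S X * ennreal (norm (V X))) \<partial>\<nu>)"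
    by (intro nn_integral_cong) (simp add: indicator_def ennreal_mult)
  then have "(\<integral>\<^sup>+X. indicator S X * ennreal (cmod (u X - g X) * norm (V X)) \<partial>\<nu>)\<^sup>2
    \<le> (\<integral>\<^sup>+X. (indicator S X * ennreal (cmod (u X - g X)))\<^sup>2 \<partial>\<nu>) * (\<integral>\<^sup>+X. (indicator S X * ennreal (norm (V X)))\<^sup>2 \<partial>\<nu>)"
    by (simp only:) (rule Cauchy_Schwarz_nn_integral; measurable)
  also have "(\<integral>\<^sup>+X. (indicator S X * ennreal (norm (V X)))\<^sup>2 \<partial>\<nu>) = ?v"
    by (intro nn_integral_cong) (simp add: indicator_def ennreal_power)
  also have "(\<integral>\<^sup>+X. (indicator S X * ennreal (cmod (u X - g X)))\<^sup>2 \<partial>\<nu>) \<le> (\<integral>\<^sup>+X. indicator {X. \<delta> X < R} X * ennreal ((cmod (u X - g X))\<^sup>2) \<partial>\<nu>)"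
    using S by (intro nn_integral_mono) (auto simp: indicator_def ennreal_power)
  also have "\<dots> \<le> ennreal (K0 * R\<^sup>2)" by (rule hardy_\<nu>[OF R])
  also have "ennreal (K0 * R\<^sup>2) * ?v = ennreal (K0 * R\<^sup>2 * enn2real ?v)"
    by (subst v) (use K0 in \<open>simp add: ennreal_mult\<close>)
  also have "K0 * R\<^sup>2 * enn2real ?v = (R * sqrt (K0 * enn2real ?v))\<^sup>2"
    using K0 by (simp add: power_mult_distrib)
  also have "ennreal \<dots> = (ennreal (R * sqrt (K0 * enn2real ?v)))\<^sup>2"
    using R K0 by (subst ennreal_power) auto
  finally have "(\<integral>\<^sup>+X. indicator S X * ennreal (cmod (u X - g X) * norm (V X)) \<partial>\<nu>)\<^sup>2 \<le> (ennreal (R * sqrt (K0 * enn2real ?v)))\<^sup>2"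
    by (simp add: mult_right_mono)
  then show ?thesis
    by (rule power2_le_imp_le_ennreal)
qed

end

lemma norm_vec_mult: "norm (\<chi> i. a * v $ i) = cmod a * norm (v :: complex ^ 'n::finite)"
  by (simp add: norm_vec_def norm_mult L2_set_right_distrib)

lemma ennreal_plus4:
  "0 \<le> a \<Longrightarrow> 0 \<le> b \<Longrightarrow> 0 \<le> c \<Longrightarrow> 0 \<le> e \<Longrightarrow> ennreal (a + b + (c + e)) = ennreal a + ennreal b + (ennreal c + ennreal e)"
  by simp

lemma triple_sum_square_le: "(a + b + c)\<^sup>2 \<le> 3 * (a\<^sup>2 + b\<^sup>2 + c\<^sup>2)" for a b c :: real
  using sum_squares_bound[of a b] sum_squares_bound[of b c] sum_squares_bound[of a c]
  by (simp add: power2_eq_square algebra_simps)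

lemma (in ahlfors) nn_integral_\<nu>_bounded:
  assumes [measurable]: "K \<in> sets borel" "f \<in> borel_measurable borel" and K: "bounded K" and M: "\<And>X. X \<in> K \<Longrightarrow> f X \<le> M"
  shows "(\<integral>\<^sup>+X. indicator K X * ennreal (f X) \<partial>\<nu>) < \<infinity>"
proof -
  obtain R where R: "K \<subseteq> ball 0 R" using bounded_subset_ballD[OF K, of 0] by auto
  have [measurable]: "ball (0::real^'n) R \<in> sets borel" by simp
  have "(\<integral>\<^sup>+X. indicator K X * ennreal (f X) \<partial>\<nu>) \<le> (\<integral>\<^sup>+X. ennreal M * indicator (ball 0 R) X \<partial>\<nu>)"
    using R M by (intro nn_integral_mono) (auto simp: indicator_def intro!: ennreal_leI)
  also have "\<dots> = ennreal M * (\<integral>\<^sup>+X. indicator (ball 0 R) X \<partial>\<nu>)"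
    by (rule nn_integral_cmult) measurable
  also have "\<dots> < \<infinity>"
    using nn_integral_weight_ball[of R] by (subst nn_integral_\<nu>) (auto simp: ennreal_mult_less_top)
  finally show ?thesis .
qed

context energy_data
begin

text \<open>\<open>\<theta>1\<close> cuts off a neighbourhood of \<open>\<Gamma>\<close> at scale \<open>\<epsilon>\<close> and \<open>\<theta>2\<close> cuts off at distance of order \<open>R\<close>.
  The gradients of both live where the Hardy inequality compensates the factors \<open>1 / \<epsilon>\<close> and \<open>1 / R\<close>.\<close>

lemma energy_inequality_cutoff:
  assumes P: "C1_lipschitz P D L"
    and \<eta>: "smooth_fun \<eta>" "\<And>X. 0 \<le> \<eta> X" "\<And>X. \<eta> X \<le> (1::real)"
    and \<psi>[measurable]: "\<psi> \<in> borel_measurable borel" and \<psi>0: "\<And>X. 0 \<le> \<psi> X"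
    and ell: "AE X in \<nu>. \<psi> X \<le> Re (cdot (V X) (\<chi> i. D (u X) (G X $ i)))"
    and \<epsilon>: "0 < \<epsilon>" and R: "0 < R" and Cc: "0 < Cc"
    and c1: "cutoff_fun Cc ({X. \<delta> X \<le> 2 * \<epsilon>} \<inter> cball x0 (3 * R + \<epsilon>)) \<epsilon> \<theta>1"
    and c2: "cutoff_fun Cc (ball x0 (2 * R)) R \<theta>2"
  shows "(\<integral>\<^sup>+X. ennreal (\<eta> X * ((1 - \<theta>1 X) * \<theta>2 X) * \<psi> X) \<partial>\<nu>)
    \<le> (\<integral>\<^sup>+X. ennreal (\<eta> X * (norm (V X) * norm (\<chi> i. D (g X) (classical_grad g X $ i)))) \<partial>\<nu>)
    + (\<integral>\<^sup>+X. ennreal (cmod (P (u X) - P (g X)) * (norm (V X) * norm (classical_grad (\<lambda>X. complex_of_real (\<eta> X)) X))) \<partial>\<nu>)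
    + (ennreal (L * (N * (Cc / \<epsilon>))) * (\<integral>\<^sup>+X. indicator {X. \<delta> X < 4 * \<epsilon>} X * ennreal (cmod (u X - g X) * norm (V X)) \<partial>\<nu>)
     + ennreal (L * (N * (Cc / R))) * (\<integral>\<^sup>+X. indicator {X. R \<le> dist x0 X \<and> \<delta> X < 4 * R} X * ennreal (cmod (u X - g X) * norm (V X)) \<partial>\<nu>))"
proof -
  interpret P: C1_lipschitz P D L by (rule P)
  note t1 = cutoff_funD[OF c1] and t2 = cutoff_funD[OF c2]
  \<comment> \<open>Because \<open>x0\<close> lies on \<Gamma>, the outer annulus is contained in a
    collar of width comparable to \<open>R\<close>, and the Hardy inequality is available
    there.\<close>
  have \<delta>x0: "\<delta> X \<le> dist x0 X" for X
    using x0 infdist_le[OF x0, of X] by (simp add: dist_commute)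
  let ?e = "\<lambda>X. complex_of_real (\<eta> X)" and ?a = "\<lambda>X. complex_of_real (1 + (-1) * \<theta>1 X)" and ?b = "\<lambda>X. complex_of_real (\<theta>2 X)"
  have sm1: "smooth_fun (\<lambda>X. 1 + (-1) * \<theta>1 X)"
    by (intro smooth_fun_add smooth_fun_const smooth_fun_mult t1)
  have sme: "smooth_fun ?e" and sma: "smooth_fun ?a" and smb: "smooth_fun ?b"
    by (rule smooth_fun_of_real, rule \<eta>(1) sm1 t2(1))+
  have smab: "smooth_fun (\<lambda>X. ?a X * ?b X)" by (rule smooth_fun_mult[OF sma smb])
  define \<kappa> where "\<kappa> X = \<eta> X * ((1 - \<theta>1 X) * \<theta>2 X)" for X
  define \<kappa>c where "\<kappa>c X = ?e X * (?a X * ?b X)" for X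
  have sm\<kappa>: "smooth_fun \<kappa>c" unfolding \<kappa>c_def[abs_def] by (rule smooth_fun_mult[OF sme smab])
  have \<kappa>c: "\<kappa>c X = complex_of_real (\<kappa> X)" for X by (simp add: \<kappa>c_def \<kappa>_def)
  have \<kappa>01: "0 \<le> \<kappa> X" "\<kappa> X \<le> \<eta> X" "\<kappa> X \<le> 1" for X
  proof -
    have "0 \<le> (1 - \<theta>1 X) * \<theta>2 X" "(1 - \<theta>1 X) * \<theta>2 X \<le> 1"
      using t1(2,3)[of X] t2(2,3)[of X] by (auto intro: mult_le_one)
    then show "0 \<le> \<kappa> X" "\<kappa> X \<le> \<eta> X" "\<kappa> X \<le> 1"
      using \<eta>(2,3)[of X] by (auto simp: \<kappa>_def mult_left_le intro: mult_le_one)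
  qed
  \<comment> \<open>This set contains the support of the whole cutoff: \<theta>2 vanishes outside
    \<open>cball x0 (3 * R)\<close>, and inside it \<open>1 - \<theta>1\<close> vanishes at distance
    less than \<epsilon> from \<Gamma>.\<close>
  define Kc where "Kc = cball x0 (3 * R) \<inter> {X. \<epsilon> \<le> \<delta> X}"
  have Kc: "compact Kc" "Kc \<subseteq> - \<Gamma>"
  proof -
    show "compact Kc" unfolding Kc_def by (intro compact_Int_closed compact_cball closed_Collect_le continuous_intros)
    show "Kc \<subseteq> - \<Gamma>" using \<epsilon> by (auto simp: Kc_def not_le[symmetric])
  qed
  have [measurable]: "Kc \<in> sets borel" using Kc(1) by (rule borel_compact)
  have z: "\<kappa>c X = 0" if "X \<notin> Kc" for X
  proof (cases "dist x0 X \<le> 3 * R")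
    case True
    then have lt: "\<delta> X < \<epsilon>" using that by (auto simp: Kc_def)
    \<comment> \<open>The radius \<open>3 * R + \<epsilon>\<close> leaves room for the
      \<epsilon>-balls around all points of \<open>cball x0 (3 * R)\<close>.\<close>
    have "ball X \<epsilon> \<subseteq> {X. \<delta> X \<le> 2 * \<epsilon>} \<inter> cball x0 (3 * R + \<epsilon>)"
    proof
      fix y assume y: "y \<in> ball X \<epsilon>"
      show "y \<in> {X. \<delta> X \<le> 2 * \<epsilon>} \<inter> cball x0 (3 * R + \<epsilon>)"
        using y lt True infdist_triangle[of y \<Gamma> X] dist_triangle[of x0 y X] by (auto simp: dist_commute)
    qed
    then show ?thesis using t1(4) by (simp add: \<kappa>c_def)
  next
    case False
    then have "ball X R \<inter> ball x0 (2 * R) = {}"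
      by (intro disjoint_ballI) (simp add: dist_commute)
    then show ?thesis using t2(6) by (simp add: \<kappa>c_def)
  qed
  have sub: "closure {X. \<kappa>c X \<noteq> 0} \<subseteq> Kc"
    by (intro closure_minimal compact_imp_closed[OF Kc(1)]) (use z in auto)
  have zg: "classical_grad \<kappa>c X = 0" if "X \<notin> Kc" for X
  proof -
    have "X \<notin> closure {X. \<kappa>c X \<noteq> 0}" using sub that by blast
    from frechet_derivative_eq_0_off_support[OF sm\<kappa> this] show ?thesis
      by (simp add: classical_grad_def vec_eq_iff)
  qed
  have gradle: "norm (classical_grad \<kappa>c X) \<le> norm (classical_grad ?e X) + (norm (classical_grad ?a X) + norm (classical_grad ?b X))" for X
  proof -
    have eq: "classical_grad \<kappa>c X = (\<chi> i. (?a X * ?b X) * classical_grad ?e X $ i) + ((\<chi> i. (?e X * ?b X) * classical_grad ?a X $ i) + (\<chi> i. (?e X * ?a X) * classical_grad ?b X $ i))"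
    proof -
      have "classical_grad \<kappa>c X $ i = ?e X * (?a X * classical_grad ?b X $ i + classical_grad ?a X $ i * ?b X) + classical_grad ?e X $ i * (?a X * ?b X)" for i
        by (simp only: \<kappa>c_def[abs_def] classical_grad_mult[OF sme smab] classical_grad_mult[OF sma smb])
      then show ?thesis
        by (simp only: vec_eq_iff vector_add_component vec_lambda_beta distrib_left) (simp only: mult_ac add_ac simp_thms)
    qed
    have "norm (classical_grad \<kappa>c X) \<le> cmod (?a X * ?b X) * norm (classical_grad ?e X) + (cmod (?e X * ?b X) * norm (classical_grad ?a X) + cmod (?e X * ?a X) * norm (classical_grad ?b X))"
      unfolding eq norm_vec_mult[symmetric] by (intro norm_triangle_mono order_refl norm_triangle_ineq)
    also have "\<dots> \<le> 1 * norm (classical_grad ?e X) + (1 * norm (classical_grad ?a X) + 1 * norm (classical_grad ?b X))"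
    proof (intro add_mono mult_right_mono norm_ge_zero)
      have "cmod (?a X) \<le> 1" "cmod (?b X) \<le> 1" "cmod (?e X) \<le> 1"
        unfolding norm_of_real using t1(2,3)[of X] t2(2,3)[of X] \<eta>(2,3)[of X] by linarith+
      then show "cmod (?a X * ?b X) \<le> 1" "cmod (?e X * ?b X) \<le> 1" "cmod (?e X * ?a X) \<le> 1"
        unfolding norm_mult by (blast intro: mult_le_one norm_ge_zero)+
    qed
    finally show ?thesis by simp
  qed
  have Da: "frechet_derivative (\<lambda>X. 1 + (-1) * \<theta>1 X) (at X) = (\<lambda>v. 0 + (-1) * frechet_derivative \<theta>1 (at X) v)" for X
    by (rule frechet_derivative_at[symmetric])
      (intro has_derivative_add has_derivative_const has_derivative_mult_right smooth_fun_has_derivative[OF t1(1)])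
  have ga: "norm (classical_grad ?a X) \<le> N * (Cc / \<epsilon>) * indicator {X. \<delta> X < 4 * \<epsilon>} X" for X
  proof (cases "\<delta> X < 4 * \<epsilon>")
    case True
    have "\<bar>frechet_derivative (\<lambda>X. 1 + (-1) * \<theta>1 X) (at X) v\<bar> \<le> Cc / \<epsilon> * norm v" for v
      unfolding Da using t1(8)[of X v] by simp
    from norm_grad_of_real_le[OF sm1 this] show ?thesis
      using True by (simp add: N)
  next
    case False
    have "ball X \<epsilon> \<inter> ({X. \<delta> X \<le> 2 * \<epsilon>} \<inter> cball x0 (3 * R + \<epsilon>)) = {}"
    proof (rule ccontr)
      assume "ball X \<epsilon> \<inter> ({X. \<delta> X \<le> 2 * \<epsilon>} \<inter> cball x0 (3 * R + \<epsilon>)) \<noteq> {}"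
      then obtain y where "dist X y < \<epsilon>" "\<delta> y \<le> 2 * \<epsilon>" by auto
      then show False using False infdist_triangle[of X \<Gamma> y] \<epsilon> by simp
    qed
    then have "frechet_derivative (\<lambda>X. 1 + (-1) * \<theta>1 X) (at X) = (\<lambda>v. 0)"
      unfolding Da using t1(7)[of X] by simp
    from classical_grad_of_real_eq_0[OF sm1 this] show ?thesis using False by simp
  qed
  have gb: "norm (classical_grad ?b X) \<le> N * (Cc / R) * indicator {X. R \<le> dist x0 X \<and> \<delta> X < 4 * R} X" for X
  proof (cases "R \<le> dist x0 X \<and> \<delta> X < 4 * R")
    case True
    then show ?thesis
      using norm_grad_of_real_le[OF t2(1), of X "Cc / R"] t2(8)[of X] by (simp add: N)
  next
    case False
    \<comment> \<open>Either \<open>dist x0 X < R\<close>, where \<theta>2 is locally at its value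
      1, or \<open>\<delta> X \<ge> 4 * R\<close> forces \<open>dist x0 X \<ge> 4 * R\<close>,
      beyond the support of \<theta>2.\<close>
    have "frechet_derivative \<theta>2 (at X) = (\<lambda>v. 0)"
    proof (cases "R \<le> dist x0 X")
      case True
      then have far: "dist x0 X \<ge> 4 * R" using False \<delta>x0[of X] by linarith
      show ?thesis
        by (rule t2(7), rule disjoint_ballI) (use far R in \<open>simp add: dist_commute\<close>)
    next
      case close: False
      show ?thesis
        by (rule t2(5)) (use close in \<open>simp add: ball_subset_ball_iff dist_commute\<close>)
    qed
    from classical_grad_of_real_eq_0[OF t2(1) this] show ?thesis using False by simp
  qed
  let ?Du = "\<lambda>X. \<chi> i. D (u X) (G X $ i)" and ?Dg = "\<lambda>X. \<chi> i. D (g X) (classical_grad g X $ i)"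
  let ?w = "\<lambda>X. P (u X) - P (g X)"
  have op: "open (- \<Gamma>)" using closed by (simp add: open_Compl)
  have W: "wgrad (- \<Gamma>) ?w (\<lambda>X. ?Du X - ?Dg X)"
    by (intro wgrad_diff P.wgrad_chain op uG wgrad_smooth g_smooth)
  define F where "F X = \<kappa>c X * ?w X" for X
  define H where "H X = (\<chi> i. \<kappa>c X * (?Du X - ?Dg X) $ i + classical_grad \<kappa>c X $ i * ?w X)" for X
  have FH: "wgrad (- \<Gamma>) F H"
    unfolding F_def H_def by (rule wgrad_mult_smooth[OF W sm\<kappa>])
  note [measurable] = wgradD(1,2)[OF W] wgradD(1,2)[OF FH] P.borel_measurable_P[OF u_meas] P.borel_measurable_P[OF g_meas]
  have [measurable]: "classical_grad \<kappa>c \<in> borel_measurable borel" "classical_grad ?e \<in> borel_measurable borel"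
    by (rule borel_measurable_classical_grad, rule sm\<kappa> sme)+
  have [measurable]: "\<eta> \<in> borel_measurable borel" "\<theta>1 \<in> borel_measurable borel" "\<theta>2 \<in> borel_measurable borel"
    by (rule borel_measurable_continuous_onI, rule smooth_fun_continuous, rule \<eta>(1) t1(1) t2(1))+
  have [measurable]: "\<kappa> \<in> borel_measurable borel"
    unfolding \<kappa>_def[abs_def] by measurable
  have mDu[measurable]: "?Du \<in> borel_measurable borel" "?Dg \<in> borel_measurable borel"
    by (rule borel_measurable_vec_lambda, rule P.borel_measurable_D; measurable)+
  have Dle: "norm (\<chi> i. D z (v $ i)) \<le> L * norm v" for z and v :: "complex ^ 'n"
  proof -
    have "norm (\<chi> i. D z (v $ i)) \<le> L2_set (\<lambda>i. L * norm (v $ i)) UNIV"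
      unfolding norm_vec_def by (rule L2_set_mono) (auto intro: P.bound)
    also have "\<dots> = L * norm v"
      using P.L_nonneg by (simp add: norm_vec_def L2_set_right_distrib)
    finally show ?thesis .
  qed
  have H0: "H X = 0" if "X \<notin> Kc" for X
    using z[OF that] zg[OF that] by (simp add: H_def vec_eq_iff)
  \<comment> \<open>The term with the gradient of the cutoff contains
    \<open>P (u X) - P (g X)\<close>. Its square integrability on \<open>Kc\<close> comes from the
    Lipschitz bound and the Hardy inequality for \<open>u - g\<close>, at a width that covers all of
    \<open>Kc\<close>.\<close>
  have H2: "integrable lborel (\<lambda>X. (norm (H X))\<^sup>2)"
  proof (rule integrableI_nonneg)
    have "bounded (classical_grad \<kappa>c ` Kc)"
      using Kc(1) by (intro compact_imp_bounded compact_continuous_image continuous_on_subset[OF continuous_on_classical_grad[OF sm\<kappa>]]) auto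
    then obtain M where M: "\<And>X. X \<in> Kc \<Longrightarrow> norm (classical_grad \<kappa>c X) \<le> M" by (auto simp: bounded_iff)
    have "bounded (classical_grad g ` Kc)"
      using Kc(1) by (intro compact_imp_bounded compact_continuous_image continuous_on_subset[OF continuous_on_classical_grad[OF g_smooth]]) auto
    then obtain M' where M': "\<And>X. X \<in> Kc \<Longrightarrow> norm (classical_grad g X) \<le> M'" by (auto simp: bounded_iff)
    obtain c where c: "c \<ge> 0" "\<And>f. f \<in> borel_measurable borel \<Longrightarrow> (\<integral>\<^sup>+X. indicator Kc X * f X \<partial>lborel) \<le> ennreal c * (\<integral>\<^sup>+X. f X \<partial>\<nu>)"
      using nn_integral_compact_le_\<nu>[OF Kc] by blast
    let ?q = "\<lambda>X. ennreal (3 * L\<^sup>2) * ennreal ((norm (G X))\<^sup>2) + ennreal (3 * L\<^sup>2) * (indicator Kc X * ennreal ((norm (classical_grad g X))\<^sup>2))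
      + ennreal (3 * (\<bar>M\<bar> * L)\<^sup>2) * (indicator {X. \<delta> X < 3 * R + 1} X * ennreal ((cmod (u X - g X))\<^sup>2))"
    have "(\<integral>\<^sup>+X. ennreal ((norm (H X))\<^sup>2) \<partial>lborel) \<le> (\<integral>\<^sup>+X. indicator Kc X * ?q X \<partial>lborel)"
    proof (intro nn_integral_mono)
      fix X
      show "ennreal ((norm (H X))\<^sup>2) \<le> indicator Kc X * ?q X"
      proof (cases "X \<in> Kc")
        case True
        have eq: "H X = (\<chi> i. \<kappa>c X * ?Du X $ i) + (\<chi> i. - \<kappa>c X * ?Dg X $ i) + (\<chi> i. ?w X * classical_grad \<kappa>c X $ i)"
          by (simp add: H_def vec_eq_iff algebra_simps)
        have "norm (H X) \<le> cmod (\<kappa>c X) * norm (?Du X) + cmod (- \<kappa>c X) * norm (?Dg X) + cmod (?w X) * norm (classical_grad \<kappa>c X)"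
          unfolding eq norm_vec_mult[symmetric] by (intro norm_triangle_mono order_refl norm_triangle_ineq)
        also have "\<dots> \<le> 1 * (L * norm (G X)) + 1 * (L * norm (classical_grad g X)) + (L * cmod (u X - g X)) * \<bar>M\<bar>"
          using \<kappa>01[of X] M[OF True] P.L_nonneg
          by (intro add_mono mult_mono Dle P.lipschitz) (auto simp: \<kappa>c)
        finally have "(norm (H X))\<^sup>2 \<le> (L * norm (G X) + L * norm (classical_grad g X) + \<bar>M\<bar> * L * cmod (u X - g X))\<^sup>2"
          by (intro power_mono) (simp_all add: mult_ac)
        also have "\<dots> \<le> 3 * L\<^sup>2 * (norm (G X))\<^sup>2 + 3 * L\<^sup>2 * (norm (classical_grad g X))\<^sup>2 + 3 * (\<bar>M\<bar> * L)\<^sup>2 * (cmod (u X - g X))\<^sup>2"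
          by (rule order_trans[OF triple_sum_square_le]) (simp add: power_mult_distrib algebra_simps)
        finally have "ennreal ((norm (H X))\<^sup>2) \<le> ennreal (3 * L\<^sup>2 * (norm (G X))\<^sup>2 + 3 * L\<^sup>2 * (norm (classical_grad g X))\<^sup>2 + 3 * (\<bar>M\<bar> * L)\<^sup>2 * (cmod (u X - g X))\<^sup>2)"
          by (rule ennreal_leI)
        also have "\<dots> = ennreal (3 * L\<^sup>2) * ennreal ((norm (G X))\<^sup>2) + ennreal (3 * L\<^sup>2) * ennreal ((norm (classical_grad g X))\<^sup>2)
            + ennreal (3 * (\<bar>M\<bar> * L)\<^sup>2) * ennreal ((cmod (u X - g X))\<^sup>2)"
          by (simp only: ennreal_plus ennreal_mult mult_nonneg_nonneg zero_le_power2 zero_le_numeral add_nonneg_nonneg)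
        also have "\<dots> = indicator Kc X * ?q X"
          using True \<delta>x0[of X] by (auto simp: Kc_def indicator_def)
        finally show ?thesis .
      qed (simp add: H0)
    qed
    also have "\<dots> \<le> ennreal c * (\<integral>\<^sup>+X. ?q X \<partial>\<nu>)"
      by (rule c(2)) measurable
    also have "(\<integral>\<^sup>+X. ?q X \<partial>\<nu>) = ennreal (3 * L\<^sup>2) * (\<integral>\<^sup>+X. ennreal ((norm (G X))\<^sup>2) \<partial>\<nu>)
      + ennreal (3 * L\<^sup>2) * (\<integral>\<^sup>+X. indicator Kc X * ennreal ((norm (classical_grad g X))\<^sup>2) \<partial>\<nu>)
      + ennreal (3 * (\<bar>M\<bar> * L)\<^sup>2) * (\<integral>\<^sup>+X. indicator {X. \<delta> X < 3 * R + 1} X * ennreal ((cmod (u X - g X))\<^sup>2) \<partial>\<nu>)"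
      by (subst nn_integral_add, measurable)+ (subst nn_integral_cmult, measurable)+
    also have "ennreal c * \<dots> < \<infinity>"
    proof -
      have "(\<integral>\<^sup>+X. indicator Kc X * ennreal ((norm (classical_grad g X))\<^sup>2) \<partial>\<nu>) < \<infinity>"
        by (rule nn_integral_\<nu>_bounded[where M = "M'\<^sup>2"]) (use M' Kc(1) in \<open>auto intro!: power_mono compact_imp_bounded\<close>)
      moreover have "(\<integral>\<^sup>+X. indicator {X. \<delta> X < 3 * R + 1} X * ennreal ((cmod (u X - g X))\<^sup>2) \<partial>\<nu>) < \<infinity>"
        by (rule le_less_trans[OF hardy_\<nu>]) (use R in auto)
      ultimately show ?thesis using G2 by (simp add: ennreal_mult_less_top ennreal_add_less_top)
    qed
    finally show "(\<integral>\<^sup>+X. ennreal ((norm (H X))\<^sup>2) \<partial>lborel) < \<infinity>" .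
  qed auto
  let ?wV = "\<lambda>X. weight d \<Gamma> X *\<^sub>R V X"
  have F0: "F X = 0" if "X \<notin> Kc" for X using z[OF that] by (simp add: F_def)
  have mwV[measurable]: "?wV \<in> borel_measurable borel" by measurable
  have zero: "(LINT X|lborel. cdot (?wV X) (H X)) = 0"
    by (rule weak_form_extension[OF op mwV wV_square_integrable weak FH Kc F0 H0 H2])
  have Ih: "integrable lborel (\<lambda>X. cdot (?wV X) (H X))"
    by (rule integrable_cdot[OF mwV _ wV_square_integrable[OF Kc] H2 H0]) measurable
  \<comment> \<open>The two error terms: the flux against the gradient of \<open>P g\<close>, and
    the flux against the gradient of the cutoff. The flux against the gradient of \<open>P u\<close>
    is the main term and dominates \<psi>.\<close>
  let ?T = "\<lambda>X. \<kappa> X * (norm (V X) * norm (?Dg X)) + cmod (?w X) * (norm (V X) * norm (classical_grad \<kappa>c X))"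
  have T0: "0 \<le> ?T X" for X using \<kappa>01[of X] by simp
  have "(\<integral>\<^sup>+X. ennreal (weight d \<Gamma> X * (\<kappa> X * \<psi> X)) \<partial>lborel) \<le> (\<integral>\<^sup>+X. ennreal (weight d \<Gamma> X * ?T X) \<partial>lborel)"
  proof (rule nn_integral_le_of_zero_mean[OF Ih zero])
    show "0 \<le> weight d \<Gamma> X * (\<kappa> X * \<psi> X)" for X
      using weight_nonneg[of X] \<kappa>01(1)[of X] \<psi>0[of X] by simp
    show "0 \<le> weight d \<Gamma> X * ?T X" for X
      using weight_nonneg[of X] T0[of X] by (rule mult_nonneg_nonneg)
    show "AE X in lborel. weight d \<Gamma> X * (\<kappa> X * \<psi> X) \<le> Re (cdot (?wV X) (H X)) + weight d \<Gamma> X * ?T X"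
      using ell[unfolded AE_\<nu>_iff]
    proof eventually_elim
      case (elim X)
      have H: "H X = (\<chi> i. complex_of_real (\<kappa> X) * ?Du X $ i) + ((\<chi> i. complex_of_real (- \<kappa> X) * ?Dg X $ i) + (\<chi> i. ?w X * classical_grad \<kappa>c X $ i))"
        by (simp add: H_def vec_eq_iff \<kappa>c algebra_simps)
      have eq: "Re (cdot (?wV X) (H X)) = weight d \<Gamma> X * (\<kappa> X * Re (cdot (V X) (?Du X)) - \<kappa> X * Re (cdot (V X) (?Dg X)) + Re (?w X * cdot (V X) (classical_grad \<kappa>c X)))"
        unfolding H cdot_scaleR_left cdot_add_right cdot_mult_right by (simp add: algebra_simps)
      have 1: "\<kappa> X * Re (cdot (V X) (?Dg X)) \<le> \<kappa> X * (norm (V X) * norm (?Dg X))"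
        by (intro mult_left_mono \<kappa>01 order_trans[OF complex_Re_le_cmod norm_cdot_le])
      have 2: "- Re (?w X * cdot (V X) (classical_grad \<kappa>c X)) \<le> cmod (?w X) * (norm (V X) * norm (classical_grad \<kappa>c X))"
      proof -
        have "- Re (?w X * cdot (V X) (classical_grad \<kappa>c X)) \<le> cmod (?w X * cdot (V X) (classical_grad \<kappa>c X))"
          using abs_Re_le_cmod[of "?w X * cdot (V X) (classical_grad \<kappa>c X)"] by linarith
        also have "\<dots> \<le> cmod (?w X) * (norm (V X) * norm (classical_grad \<kappa>c X))"
          unfolding norm_mult by (intro mult_left_mono norm_cdot_le) simp
        finally show ?thesis .
      qed
      show ?case
      proof (cases "X \<in> \<Gamma>")
        case True
        then show ?thesis unfolding eq by (simp add: weight_\<Gamma>)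
      next
        case False
        then have "\<kappa> X * \<psi> X \<le> \<kappa> X * Re (cdot (V X) (?Du X))"
          using elim \<kappa>01(1)[of X] by (intro mult_left_mono) auto
        then have "\<kappa> X * \<psi> X \<le> (\<kappa> X * Re (cdot (V X) (?Du X)) - \<kappa> X * Re (cdot (V X) (?Dg X)) + Re (?w X * cdot (V X) (classical_grad \<kappa>c X))) + ?T X"
          using 1 2 by linarith
        then show ?thesis
          unfolding eq distrib_left[symmetric] by (rule mult_left_mono[OF _ weight_nonneg])
      qed
    qed
  qed measurable
  also have "(\<integral>\<^sup>+X. ennreal (weight d \<Gamma> X * (\<kappa> X * \<psi> X)) \<partial>lborel) = (\<integral>\<^sup>+X. ennreal (\<kappa> X * \<psi> X) \<partial>\<nu>)"
    by (rule nn_integral_\<nu>_real[symmetric]) (use \<kappa>01 \<psi>0 in auto)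
  also have "(\<integral>\<^sup>+X. ennreal (weight d \<Gamma> X * ?T X) \<partial>lborel) = (\<integral>\<^sup>+X. ennreal (?T X) \<partial>\<nu>)"
    by (rule nn_integral_\<nu>_real[OF _ T0, symmetric]) measurable
  also have "\<dots> \<le> (\<integral>\<^sup>+X. ennreal (\<eta> X * (norm (V X) * norm (?Dg X))) + ennreal (cmod (?w X) * (norm (V X) * norm (classical_grad ?e X)))
      + (ennreal (L * (N * (Cc / \<epsilon>))) * (indicator {X. \<delta> X < 4 * \<epsilon>} X * ennreal (cmod (u X - g X) * norm (V X)))
       + ennreal (L * (N * (Cc / R))) * (indicator {X. R \<le> dist x0 X \<and> \<delta> X < 4 * R} X * ennreal (cmod (u X - g X) * norm (V X)))) \<partial>\<nu>)"
  proof (intro nn_integral_mono)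
    fix X
    let ?i1 = "indicat_real {X. \<delta> X < 4 * \<epsilon>} X" and ?i2 = "indicat_real {X. R \<le> dist x0 X \<and> \<delta> X < 4 * R} X"
    let ?p = "cmod (u X - g X) * norm (V X)"
    have NN: "N \<ge> 0" using N by simp
    have "cmod (?w X) * (norm (V X) * norm (classical_grad \<kappa>c X))
      \<le> cmod (?w X) * (norm (V X) * (norm (classical_grad ?e X) + (N * (Cc / \<epsilon>) * ?i1 + N * (Cc / R) * ?i2)))"
      by (intro mult_left_mono order_trans[OF gradle] add_mono ga gb order_refl) auto
    also have "\<dots> = cmod (?w X) * (norm (V X) * norm (classical_grad ?e X)) + cmod (?w X) * (norm (V X) * (N * (Cc / \<epsilon>) * ?i1 + N * (Cc / R) * ?i2))"
      by (simp only: distrib_left)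
    also have "\<dots> \<le> cmod (?w X) * (norm (V X) * norm (classical_grad ?e X)) + (L * cmod (u X - g X)) * (norm (V X) * (N * (Cc / \<epsilon>) * ?i1 + N * (Cc / R) * ?i2))"
      using NN Cc \<epsilon> R by (intro add_left_mono mult_right_mono P.lipschitz) auto
    also have "(L * cmod (u X - g X)) * (norm (V X) * (N * (Cc / \<epsilon>) * ?i1 + N * (Cc / R) * ?i2)) = L * (N * (Cc / \<epsilon>)) * (?i1 * ?p) + L * (N * (Cc / R)) * (?i2 * ?p)"
      by (simp only: distrib_left mult_ac)
    finally have "?T X \<le> \<eta> X * (norm (V X) * norm (?Dg X)) + cmod (?w X) * (norm (V X) * norm (classical_grad ?e X)) + (L * (N * (Cc / \<epsilon>)) * (?i1 * ?p) + L * (N * (Cc / R)) * (?i2 * ?p))"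
      using mult_right_mono[OF \<kappa>01(2)[of X], of "norm (V X) * norm (?Dg X)"] by simp
    from ennreal_leI[OF this]
    have le: "ennreal (?T X) \<le> ennreal (\<eta> X * (norm (V X) * norm (?Dg X)) + cmod (?w X) * (norm (V X) * norm (classical_grad ?e X)) + (L * (N * (Cc / \<epsilon>)) * (?i1 * ?p) + L * (N * (Cc / R)) * (?i2 * ?p)))" .
    have nn: "0 \<le> \<eta> X * (norm (V X) * norm (?Dg X))" "0 \<le> cmod (?w X) * (norm (V X) * norm (classical_grad ?e X))"
      "0 \<le> L * (N * (Cc / \<epsilon>)) * (?i1 * ?p)" "0 \<le> L * (N * (Cc / R)) * (?i2 * ?p)"
      using \<eta>(2)[of X] P.L_nonneg NN Cc \<epsilon> R by auto
    have e1: "ennreal (L * (N * (Cc / \<epsilon>)) * (?i1 * ?p)) = ennreal (L * (N * (Cc / \<epsilon>))) * (indicator {X. \<delta> X < 4 * \<epsilon>} X * ennreal ?p)"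
      using P.L_nonneg NN Cc \<epsilon> by (subst ennreal_mult) (auto simp: indicator_def)
    have e2: "ennreal (L * (N * (Cc / R)) * (?i2 * ?p)) = ennreal (L * (N * (Cc / R))) * (indicator {X. R \<le> dist x0 X \<and> \<delta> X < 4 * R} X * ennreal ?p)"
      using P.L_nonneg NN Cc R by (subst ennreal_mult) (auto simp: indicator_def)
    show "ennreal (?T X) \<le> ennreal (\<eta> X * (norm (V X) * norm (?Dg X))) + ennreal (cmod (?w X) * (norm (V X) * norm (classical_grad ?e X)))
      + (ennreal (L * (N * (Cc / \<epsilon>))) * (indicator {X. \<delta> X < 4 * \<epsilon>} X * ennreal ?p)
       + ennreal (L * (N * (Cc / R))) * (indicator {X. R \<le> dist x0 X \<and> \<delta> X < 4 * R} X * ennreal ?p))"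
      using le unfolding ennreal_plus4[OF nn] e1 e2 .
  qed
  also have "\<dots> = (\<integral>\<^sup>+X. ennreal (\<eta> X * (norm (V X) * norm (?Dg X))) \<partial>\<nu>) + (\<integral>\<^sup>+X. ennreal (cmod (?w X) * (norm (V X) * norm (classical_grad ?e X))) \<partial>\<nu>)
    + (ennreal (L * (N * (Cc / \<epsilon>))) * (\<integral>\<^sup>+X. indicator {X. \<delta> X < 4 * \<epsilon>} X * ennreal (cmod (u X - g X) * norm (V X)) \<partial>\<nu>)
     + ennreal (L * (N * (Cc / R))) * (\<integral>\<^sup>+X. indicator {X. R \<le> dist x0 X \<and> \<delta> X < 4 * R} X * ennreal (cmod (u X - g X) * norm (V X)) \<partial>\<nu>))"
    by (subst nn_integral_add, measurable)+ (subst nn_integral_cmult, measurable)+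
  finally show ?thesis by (simp add: \<kappa>_def)
qed

end

section \<open>Removing the cutoffs and the regularisation\<close>

context energy_data
begin

lemma nn_integral_shrinking_tendsto_0:
  assumes [measurable]: "\<And>j. S j \<in> sets borel" and ev: "\<And>X. X \<notin> \<Gamma> \<Longrightarrow> eventually (\<lambda>j. X \<notin> S j) sequentially"
  shows "(\<lambda>j. enn2real (\<integral>\<^sup>+X. indicator (S j) X * ennreal ((norm (V X))\<^sup>2) \<partial>\<nu>)) \<longlonglongrightarrow> 0"
proof -
  have "(\<lambda>j. \<integral>\<^sup>+X. indicator (S j) X * ennreal ((norm (V X))\<^sup>2) \<partial>\<nu>) \<longlonglongrightarrow> (\<integral>\<^sup>+X. 0 \<partial>\<nu>)"
  proof (rule nn_integral_dominated_convergence[OF _ _ _ _ V2])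
    show "AE X in \<nu>. indicator (S j) X * ennreal ((norm (V X))\<^sup>2) \<le> ennreal ((norm (V X))\<^sup>2)" for j
      by (intro AE_I2) (simp add: indicator_def)
    show "AE X in \<nu>. (\<lambda>j. indicator (S j) X * ennreal ((norm (V X))\<^sup>2)) \<longlonglongrightarrow> 0"
      unfolding AE_\<nu>_iff
    proof (intro AE_I2 impI)
      fix X assume "X \<notin> \<Gamma>"
      from ev[OF this] have "eventually (\<lambda>j. indicator (S j) X * ennreal ((norm (V X))\<^sup>2) = 0) sequentially"
        by eventually_elim simp
      then show "(\<lambda>j. indicator (S j) X * ennreal ((norm (V X))\<^sup>2)) \<longlonglongrightarrow> 0"
        by (rule tendsto_eventually)
    qed
  qed measurable
  then have "(\<lambda>j. \<integral>\<^sup>+X. indicator (S j) X * ennreal ((norm (V X))\<^sup>2) \<partial>\<nu>) \<longlonglongrightarrow> ennreal 0" by simp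
  then show ?thesis by (rule tendsto_enn2real) simp
qed

text \<open>Cutoffs with \<epsilon> tending to 0 and \<open>R\<close> tending to infinity: the Hardy
  inequality on collars of widths \<open>4 * \<epsilon>\<close> and \<open>4 * R\<close> cancels
  \<open>1 / \<epsilon>\<close> and \<open>1 / R\<close>, leaving the square root of the energy of
  \<open>V\<close> on sets from which every point off \<Gamma> eventually disappears. Fatou's lemma
  treats the left side.\<close>

lemma energy_inequality:
  assumes P: "C1_lipschitz P D L"
    and \<eta>: "smooth_fun \<eta>" "\<And>X. 0 \<le> \<eta> X" "\<And>X. \<eta> X \<le> (1::real)"
    and \<psi>[measurable]: "\<psi> \<in> borel_measurable borel" and \<psi>0: "\<And>X. 0 \<le> \<psi> X"
    and ell: "AE X in \<nu>. \<psi> X \<le> Re (cdot (V X) (\<chi> i. D (u X) (G X $ i)))"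
  shows "(\<integral>\<^sup>+X. ennreal (\<eta> X * \<psi> X) \<partial>\<nu>)
    \<le> (\<integral>\<^sup>+X. ennreal (\<eta> X * (norm (V X) * norm (\<chi> i. D (g X) (classical_grad g X $ i)))) \<partial>\<nu>)
    + (\<integral>\<^sup>+X. ennreal (cmod (P (u X) - P (g X)) * (norm (V X) * norm (classical_grad (\<lambda>X. complex_of_real (\<eta> X)) X))) \<partial>\<nu>)"
    (is "_ \<le> ?A + ?B")
proof -
  interpret P: C1_lipschitz P D L by (rule P)
  obtain Cc where Cc: "Cc > 0" and cut: "\<forall>(S::(real^'n) set) r. S \<in> sets borel \<longrightarrow> bounded S \<longrightarrow> r > 0 \<longrightarrow> (\<exists>\<theta>. cutoff_fun Cc S r \<theta>)"
    using cutoff_exists by blast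
  define \<epsilon> where "\<epsilon> j = 1 / real (Suc j)" for j
  define R where "R j = real (Suc j)" for j
  have \<epsilon>: "0 < \<epsilon> j" and R: "0 < R j" for j by (auto simp: \<epsilon>_def R_def)
  have \<epsilon>0: "\<epsilon> \<longlonglongrightarrow> 0" unfolding \<epsilon>_def by (rule LIMSEQ_Suc[OF lim_1_over_n])
  have evR: "eventually (\<lambda>j. a < R j) sequentially" for a
    using filterlim_compose[OF filterlim_real_sequentially filterlim_Suc] unfolding R_def filterlim_at_top_dense by blast
  have ev\<epsilon>: "eventually (\<lambda>j. a * \<epsilon> j < b) sequentially" if "0 < b" for a b
    using tendsto_mult_left[OF \<epsilon>0, of a] that by (intro order_tendstoD(2)[where y = 0]) auto
  have "\<exists>\<theta>. cutoff_fun Cc ({X. \<delta> X \<le> 2 * \<epsilon> j} \<inter> cball x0 (3 * R j + \<epsilon> j)) (\<epsilon> j) \<theta>" for j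
  proof -
    have "bounded ({X. \<delta> X \<le> 2 * \<epsilon> j} \<inter> cball x0 (3 * R j + \<epsilon> j))"
      by (rule bounded_subset[OF bounded_cball]) auto
    then show ?thesis using cut \<epsilon>[of j] by auto
  qed
  then obtain \<theta>1 where \<theta>1: "\<And>j. cutoff_fun Cc ({X. \<delta> X \<le> 2 * \<epsilon> j} \<inter> cball x0 (3 * R j + \<epsilon> j)) (\<epsilon> j) (\<theta>1 j)"
    by metis
  have "\<exists>\<theta>. cutoff_fun Cc (ball x0 (2 * R j)) (R j) \<theta>" for j
    using cut R[of j] by auto
  then obtain \<theta>2 where \<theta>2: "\<And>j. cutoff_fun Cc (ball x0 (2 * R j)) (R j) (\<theta>2 j)"
    by metis
  define S1 where "S1 j = {X. \<delta> X < 4 * \<epsilon> j}" for j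
  define S2 where "S2 j = {X. R j \<le> dist x0 X \<and> \<delta> X < 4 * R j}" for j
  have [measurable]: "S1 j \<in> sets borel" "S2 j \<in> sets borel" for j
    unfolding S1_def S2_def by measurable
  define v1 where "v1 j = enn2real (\<integral>\<^sup>+X. indicator (S1 j) X * ennreal ((norm (V X))\<^sup>2) \<partial>\<nu>)" for j
  define v2 where "v2 j = enn2real (\<integral>\<^sup>+X. indicator (S2 j) X * ennreal ((norm (V X))\<^sup>2) \<partial>\<nu>)" for j
  have v1: "v1 \<longlonglongrightarrow> 0" unfolding v1_def
  proof (rule nn_integral_shrinking_tendsto_0)
    fix X assume "X \<notin> \<Gamma>"
    then have "0 < \<delta> X" using \<delta>_pos_iff by blast
    from ev\<epsilon>[OF this, of 4] show "eventually (\<lambda>j. X \<notin> S1 j) sequentially"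
      by eventually_elim (simp add: S1_def)
  qed measurable
  have v2: "v2 \<longlonglongrightarrow> 0" unfolding v2_def
  proof (rule nn_integral_shrinking_tendsto_0)
    show "eventually (\<lambda>j. X \<notin> S2 j) sequentially" for X
      using evR[of "dist x0 X"] by eventually_elim (simp add: S2_def)
  qed measurable
  \<comment> \<open>The 4 is the ratio of the collar width to the cutoff scale; \<open>N\<close>
    stems from estimating the norm of a gradient by its components.\<close>
  let ?c = "4 * L * N * Cc"
  have c0: "0 \<le> ?c" using P.L_nonneg N Cc by simp
  define F where "F j X = ennreal (\<eta> X * ((1 - \<theta>1 j X) * \<theta>2 j X) * \<psi> X)" for j X
  have mth[measurable]: "\<theta>1 j \<in> borel_measurable borel" "\<theta>2 j \<in> borel_measurable borel" "\<eta> \<in> borel_measurable borel" for j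
    using cutoff_funD(1)[OF \<theta>1] cutoff_funD(1)[OF \<theta>2] \<eta>(1) by (auto intro: borel_measurable_continuous_onI smooth_fun_continuous)
  have [measurable]: "F j \<in> borel_measurable borel" for j unfolding F_def by measurable
  have Fle: "(\<integral>\<^sup>+X. F j X \<partial>\<nu>) \<le> ?A + ?B + (ennreal (?c * sqrt (K0 * v1 j)) + ennreal (?c * sqrt (K0 * v2 j)))" for j
  proof -
    have e: "ennreal (L * (N * (Cc / r))) * ennreal (4 * r * s) = ennreal (?c * s)" if "r > 0" "s \<ge> 0" for r s
      using that P.L_nonneg N Cc by (subst ennreal_mult[symmetric]) (auto simp: field_simps)
    have 1: "ennreal (L * (N * (Cc / \<epsilon> j))) * (\<integral>\<^sup>+X. indicator (S1 j) X * ennreal (cmod (u X - g X) * norm (V X)) \<partial>\<nu>) \<le> ennreal (?c * sqrt (K0 * v1 j))"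
    proof -
      have "(\<integral>\<^sup>+X. indicator (S1 j) X * ennreal (cmod (u X - g X) * norm (V X)) \<partial>\<nu>) \<le> ennreal (4 * \<epsilon> j * sqrt (K0 * v1 j))"
        unfolding v1_def by (rule collar_product_le) (use \<epsilon>[of j] in \<open>auto simp: S1_def\<close>)
      from mult_left_mono[OF this, of "ennreal (L * (N * (Cc / \<epsilon> j)))"] show ?thesis
        using e[OF \<epsilon>[of j], of "sqrt (K0 * v1 j)"] K0 by (simp add: v1_def)
    qed
    have 2: "ennreal (L * (N * (Cc / R j))) * (\<integral>\<^sup>+X. indicator (S2 j) X * ennreal (cmod (u X - g X) * norm (V X)) \<partial>\<nu>) \<le> ennreal (?c * sqrt (K0 * v2 j))"
    proof -
      have "(\<integral>\<^sup>+X. indicator (S2 j) X * ennreal (cmod (u X - g X) * norm (V X)) \<partial>\<nu>) \<le> ennreal (4 * R j * sqrt (K0 * v2 j))"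
        unfolding v2_def by (rule collar_product_le) (use R[of j] in \<open>auto simp: S2_def\<close>)
      from mult_left_mono[OF this, of "ennreal (L * (N * (Cc / R j)))"] show ?thesis
        using e[OF R[of j], of "sqrt (K0 * v2 j)"] K0 by (simp add: v2_def)
    qed
    have "(\<integral>\<^sup>+X. F j X \<partial>\<nu>) \<le> ?A + ?B
      + (ennreal (L * (N * (Cc / \<epsilon> j))) * (\<integral>\<^sup>+X. indicator (S1 j) X * ennreal (cmod (u X - g X) * norm (V X)) \<partial>\<nu>)
       + ennreal (L * (N * (Cc / R j))) * (\<integral>\<^sup>+X. indicator (S2 j) X * ennreal (cmod (u X - g X) * norm (V X)) \<partial>\<nu>))"
      unfolding F_def S1_def S2_def by (rule energy_inequality_cutoff[OF P \<eta> \<psi> \<psi>0 ell \<epsilon> R Cc \<theta>1 \<theta>2])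
    also have "\<dots> \<le> ?A + ?B + (ennreal (?c * sqrt (K0 * v1 j)) + ennreal (?c * sqrt (K0 * v2 j)))"
      by (intro add_left_mono add_mono 1 2)
    finally show ?thesis .
  qed
  have "(\<integral>\<^sup>+X. ennreal (\<eta> X * \<psi> X) \<partial>\<nu>) \<le> (\<integral>\<^sup>+X. liminf (\<lambda>j. F j X) \<partial>\<nu>)"
  proof (rule nn_integral_mono_AE, unfold AE_\<nu>_iff, intro AE_I2 impI)
    fix X assume "X \<notin> \<Gamma>"
    then have p: "0 < \<delta> X" using \<delta>_pos_iff by blast
    \<comment> \<open>For a fixed point off \<Gamma> both cutoff factors are equal to 1 from some
      index on.\<close>
    have "eventually (\<lambda>j. F j X = ennreal (\<eta> X * \<psi> X)) sequentially"
      using ev\<epsilon>[OF p, of 3] evR[of "dist x0 X"]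
    proof eventually_elim
      case (elim j)
      have "ball X (\<epsilon> j) \<inter> ({X. \<delta> X \<le> 2 * \<epsilon> j} \<inter> cball x0 (3 * R j + \<epsilon> j)) = {}"
      proof (rule ccontr)
        assume "ball X (\<epsilon> j) \<inter> ({X. \<delta> X \<le> 2 * \<epsilon> j} \<inter> cball x0 (3 * R j + \<epsilon> j)) \<noteq> {}"
        then obtain y where "dist X y < \<epsilon> j" "\<delta> y \<le> 2 * \<epsilon> j" by auto
        then show False using elim(1) infdist_triangle[of X \<Gamma> y] by simp
      qed
      then have "\<theta>1 j X = 0" by (rule cutoff_funD(6)[OF \<theta>1])
      moreover have "ball X (R j) \<subseteq> ball x0 (2 * R j)"
        using elim(2) by (simp add: ball_subset_ball_iff dist_commute)
      then have "\<theta>2 j X = 1" by (rule cutoff_funD(4)[OF \<theta>2])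
      ultimately show ?case by (simp add: F_def)
    qed
    from lim_imp_Liminf[OF _ tendsto_eventually[OF this]] show "ennreal (\<eta> X * \<psi> X) \<le> liminf (\<lambda>j. F j X)"
      by simp
  qed
  also have "\<dots> \<le> liminf (\<lambda>j. \<integral>\<^sup>+X. F j X \<partial>\<nu>)"
    by (rule nn_integral_liminf) measurable
  also have "\<dots> \<le> liminf (\<lambda>j. ?A + ?B + (ennreal (?c * sqrt (K0 * v1 j)) + ennreal (?c * sqrt (K0 * v2 j))))"
    by (rule Liminf_mono) (use Fle in auto)
  also have "\<dots> = ?A + ?B"
  proof (rule lim_imp_Liminf)
    have "(\<lambda>j. ?A + ?B + (ennreal (?c * sqrt (K0 * v1 j)) + ennreal (?c * sqrt (K0 * v2 j)))) \<longlonglongrightarrow> ?A + ?B + (ennreal (?c * sqrt (K0 * 0)) + ennreal (?c * sqrt (K0 * 0)))"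
      by (intro tendsto_add tendsto_const tendsto_ennrealI tendsto_mult tendsto_real_sqrt v1 v2)
    then show "(\<lambda>j. ?A + ?B + (ennreal (?c * sqrt (K0 * v1 j)) + ennreal (?c * sqrt (K0 * v2 j)))) \<longlonglongrightarrow> ?A + ?B"
      by simp
  qed simp
  finally show ?thesis .
qed

definition q_density :: "real \<Rightarrow> real ^ 'n \<Rightarrow> real" where
  "q_density q X = (if u X = 0 then 0 else (norm (G X))\<^sup>2 * cmod (u X) powr (q - 2))"

text \<open>The bound \<open>M\<close> has to be uniform in \<open>k\<close>, so that
  \<open>k\<close> can tend to 0 along \<open>1 / real (Suc j)\<close> by Fatou's lemma. Where
  \<open>u\<close> vanishes the density is 0 by convention, and no convergence of the weights is
  required there.\<close>

lemma q_density_integral_le: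
  assumes c: "c > 0" and \<eta>: "smooth_fun \<eta>" "\<And>X. 0 \<le> \<eta> X" "\<And>X. \<eta> X \<le> (1::real)"
    and ell: "AE X in \<nu>. \<forall>k. 0 < k \<longrightarrow> k \<le> 1 \<longrightarrow> c * (reg_weight q k ((cmod (u X))\<^sup>2) * (norm (G X))\<^sup>2)
      \<le> Re (cdot (V X) (\<chi> i. reg_power_deriv q k (u X) (G X $ i)))"
    and M: "\<And>k. 0 < k \<Longrightarrow> k \<le> 1 \<Longrightarrow>
      (\<integral>\<^sup>+X. ennreal (\<eta> X * (norm (V X) * norm (\<chi> i. reg_power_deriv q k (g X) (classical_grad g X $ i)))) \<partial>\<nu>)
      + (\<integral>\<^sup>+X. ennreal (cmod (reg_power q k (u X) - reg_power q k (g X)) * (norm (V X) * norm (classical_grad (\<lambda>X. complex_of_real (\<eta> X)) X))) \<partial>\<nu>) \<le> M"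
  shows "(\<integral>\<^sup>+X. ennreal (\<eta> X * q_density q X) \<partial>\<nu>) \<le> ennreal (1 / c) * M"
proof -
  define k where "k j = 1 / real (Suc j)" for j
  have k: "0 < k j" "k j \<le> 1" for j by (auto simp: k_def)
  have [measurable]: "\<eta> \<in> borel_measurable borel"
    using \<eta>(1) by (auto intro: borel_measurable_continuous_onI smooth_fun_continuous)
  let ?\<psi> = "\<lambda>j X. reg_weight q (k j) ((cmod (u X))\<^sup>2) * (norm (G X))\<^sup>2"
  have [measurable]: "?\<psi> j \<in> borel_measurable borel" for j
    unfolding reg_weight_def by measurable
  have \<psi>0: "0 \<le> ?\<psi> j X" for j X
    using reg_weight_bounds(1)[OF k, of "(cmod (u X))\<^sup>2" q] by (simp add: less_imp_le)
  have le: "(\<integral>\<^sup>+X. ennreal (\<eta> X * ?\<psi> j X) \<partial>\<nu>) \<le> ennreal (1 / c) * M" for j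
  proof -
    have "(\<integral>\<^sup>+X. ennreal (\<eta> X * (c * ?\<psi> j X)) \<partial>\<nu>) \<le> M"
    proof (rule order_trans[OF energy_inequality[OF C1_lipschitz_reg_power(1)[OF k] \<eta>] M[OF k]])
      show "AE X in \<nu>. c * ?\<psi> j X \<le> Re (cdot (V X) (\<chi> i. reg_power_deriv q (k j) (u X) (G X $ i)))"
        using ell by eventually_elim (use k in blast)
    qed (use c \<psi>0 in auto)
    have "(\<integral>\<^sup>+X. ennreal (\<eta> X * ?\<psi> j X) \<partial>\<nu>) = (\<integral>\<^sup>+X. ennreal (1 / c) * ennreal (\<eta> X * (c * ?\<psi> j X)) \<partial>\<nu>)"
      using c \<eta>(2) \<psi>0 by (intro nn_integral_cong) (subst ennreal_mult[symmetric], auto)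
    also have "\<dots> = ennreal (1 / c) * (\<integral>\<^sup>+X. ennreal (\<eta> X * (c * ?\<psi> j X)) \<partial>\<nu>)"
      by (rule nn_integral_cmult) measurable
    also have "\<dots> \<le> ennreal (1 / c) * M"
      by (rule mult_left_mono) (fact, simp)
    finally show ?thesis .
  qed
  have "(\<integral>\<^sup>+X. ennreal (\<eta> X * q_density q X) \<partial>\<nu>) \<le> (\<integral>\<^sup>+X. liminf (\<lambda>j. ennreal (\<eta> X * ?\<psi> j X)) \<partial>\<nu>)"
  proof (intro nn_integral_mono)
    fix X
    show "ennreal (\<eta> X * q_density q X) \<le> liminf (\<lambda>j. ennreal (\<eta> X * ?\<psi> j X))"
    proof (cases "u X = 0")
      case False
      have "(\<lambda>j. ennreal (\<eta> X * ?\<psi> j X)) \<longlonglongrightarrow> ennreal (\<eta> X * (cmod (u X) powr (q - 2) * (norm (G X))\<^sup>2))"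
        unfolding k_def by (intro tendsto_ennrealI tendsto_mult tendsto_const reg_weight_tendsto False)
      from lim_imp_Liminf[OF _ this] False show ?thesis by (simp add: q_density_def mult_ac)
    qed (simp add: q_density_def)
  qed
  also have "\<dots> \<le> liminf (\<lambda>j. \<integral>\<^sup>+X. ennreal (\<eta> X * ?\<psi> j X) \<partial>\<nu>)"
    by (rule nn_integral_liminf) measurable
  also have "\<dots> \<le> liminf (\<lambda>j::nat. ennreal (1 / c) * M)"
    by (rule Liminf_mono) (use le in auto)
  also have "\<dots> = ennreal (1 / c) * M" by (simp add: Liminf_const)
  finally show ?thesis .
qed

lemma reg_power_grad_bound:
  assumes "0 < k" "k \<le> 1"
  shows "norm (\<chi> i. reg_power_deriv q k z (v $ i)) \<le> (1 + \<bar>q - 2\<bar>) * reg_weight q k ((cmod z)\<^sup>2) * norm (v :: complex ^ 'n)"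
proof -
  have b: "0 \<le> (1 + \<bar>q - 2\<bar>) * reg_weight q k ((cmod z)\<^sup>2)"
    using reg_weight_bounds(1)[OF assms, of "(cmod z)\<^sup>2" q] by simp
  have "norm (\<chi> i. reg_power_deriv q k z (v $ i)) \<le> L2_set (\<lambda>i. (1 + \<bar>q - 2\<bar>) * reg_weight q k ((cmod z)\<^sup>2) * norm (v $ i)) UNIV"
    unfolding norm_vec_def by (rule L2_set_mono) (auto intro: C1_lipschitz_reg_power(2)[OF assms])
  also have "\<dots> = (1 + \<bar>q - 2\<bar>) * reg_weight q k ((cmod z)\<^sup>2) * norm v"
    using b by (simp add: norm_vec_def L2_set_right_distrib)
  finally show ?thesis .
qed

text \<open>With \<eta> equal to 1 only the term with the gradient of \<open>P g\<close> survives.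
  It lives on a bounded set, where the weight at \<open>g\<close> is bounded uniformly in
  \<open>k\<close> since \<open>q \<ge> 2\<close>.\<close>

theorem q_energy_finite_ge_2:
  assumes c: "c > 0" and q: "2 \<le> q"
    and ell: "AE X in \<nu>. \<forall>k. 0 < k \<longrightarrow> k \<le> 1 \<longrightarrow> c * (reg_weight q k ((cmod (u X))\<^sup>2) * (norm (G X))\<^sup>2)
      \<le> Re (cdot (V X) (\<chi> i. reg_power_deriv q k (u X) (G X $ i)))"
  shows "(\<integral>\<^sup>+X. ennreal (q_density q X) \<partial>\<nu>) < \<infinity>"
proof -
  obtain \<rho> where \<rho>: "\<And>X. norm X > \<rho> \<Longrightarrow> g X = 0" "closure {X. g X \<noteq> 0} \<subseteq> cball 0 \<rho>"
    using test_function_cball[OF g] by metis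
  have gg0: "classical_grad g X = 0" if "norm X > \<rho>" for X
    by (rule classical_grad_eq_0_outside[OF g_smooth \<rho>(1) that])
  obtain M1 where M1: "\<And>X. cmod (g X) \<le> M1" "M1 > 0"
    using bounded_continuous_cball[OF smooth_fun_continuous[OF g_smooth] \<rho>(1)] by metis
  from bounded_continuous_cball[OF continuous_on_classical_grad[OF g_smooth] gg0] obtain M2 where M2: "\<And>X. norm (classical_grad g X) \<le> M2" "M2 > 0"
    by blast
  \<comment> \<open>A bound, uniform in \<open>k\<close>, for the gradient of \<open>P g\<close>:
    the derivative bound of \<open>reg_power\<close>, the weight bound at
    \<open>cmod (g X) \<le> M1\<close>, and \<open>M2\<close> for the gradient of
    \<open>g\<close>.\<close>
  define B where "B = (1 + \<bar>q - 2\<bar>) * (1 + M1\<^sup>2) powr ((q - 2) / 2) * M2"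
  have B: "0 \<le> B" using M2 by (simp add: B_def)
  have [measurable]: "cball (0::real^'n) \<rho> \<in> sets borel" by simp
  define M where "M = (\<integral>\<^sup>+X. ennreal ((norm (V X))\<^sup>2) \<partial>\<nu>) + (\<integral>\<^sup>+X. indicator (cball 0 \<rho>) X * ennreal (B\<^sup>2) \<partial>\<nu>)"
  have Mfin: "M < \<infinity>"
    unfolding M_def using V2 nn_integral_\<nu>_bounded[of "cball 0 \<rho>" "\<lambda>_. B\<^sup>2" "B\<^sup>2"] by (simp add: ennreal_add_less_top)
  have g1: "classical_grad (\<lambda>X. complex_of_real 1) X = 0" for X :: "real^'n"
    by (simp add: classical_grad_def vec_eq_iff)
  have "(\<integral>\<^sup>+X. ennreal (1 * q_density q X) \<partial>\<nu>) \<le> ennreal (1 / c) * M"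
  proof (rule q_density_integral_le[OF c _ _ _ ell, where \<eta> = "\<lambda>_. 1"])
    fix k :: real assume k: "0 < k" "k \<le> 1"
    have "norm (V X) * norm (\<chi> i. reg_power_deriv q k (g X) (classical_grad g X $ i)) \<le> (norm (V X))\<^sup>2 + indicator (cball 0 \<rho>) X * B\<^sup>2" for X
    proof (cases "norm X \<le> \<rho>")
      case True
      have "norm (\<chi> i. reg_power_deriv q k (g X) (classical_grad g X $ i)) \<le> (1 + \<bar>q - 2\<bar>) * reg_weight q k ((cmod (g X))\<^sup>2) * norm (classical_grad g X)"
        by (rule reg_power_grad_bound[OF k])
      also have "\<dots> \<le> (1 + \<bar>q - 2\<bar>) * (1 + M1\<^sup>2) powr ((q - 2) / 2) * M2"
      proof (intro mult_mono M2 mult_left_mono)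
        have "reg_weight q k ((cmod (g X))\<^sup>2) \<le> (1 + (cmod (g X))\<^sup>2) powr ((q - 2) / 2)"
          by (rule reg_weight_le[OF k _ q]) simp
        also have "\<dots> \<le> (1 + M1\<^sup>2) powr ((q - 2) / 2)"
          using q M1(1)[of X] by (intro powr_mono2 add_left_mono power_mono) auto
        finally show "reg_weight q k ((cmod (g X))\<^sup>2) \<le> (1 + M1\<^sup>2) powr ((q - 2) / 2)" .
        show "0 \<le> (1 + \<bar>q - 2\<bar>) * (1 + M1\<^sup>2) powr ((q - 2) / 2)" by simp
      qed (use reg_weight_bounds(1)[OF k, of "(cmod (g X))\<^sup>2" q] in auto)
      finally have b: "norm (\<chi> i. reg_power_deriv q k (g X) (classical_grad g X $ i)) \<le> B" by (simp add: B_def)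
      have "norm (V X) * norm (\<chi> i. reg_power_deriv q k (g X) (classical_grad g X $ i)) \<le> norm (V X) * B"
        by (intro mult_left_mono b) simp
      also have "\<dots> \<le> (norm (V X))\<^sup>2 + B\<^sup>2"
      proof -
        have "0 \<le> norm (V X) * B" using B by simp
        then show ?thesis using sum_squares_bound[of "norm (V X)" B] by linarith
      qed
      finally show ?thesis using True by simp
    next
      case False
      then have "norm (\<chi> i. reg_power_deriv q k (g X) (classical_grad g X $ i)) = 0"
        using reg_power_grad_bound[OF k, of q "g X" "classical_grad g X"] gg0[of X] by simp
      then show ?thesis by simp
    qed
    then have "(\<integral>\<^sup>+X. ennreal (1 * (norm (V X) * norm (\<chi> i. reg_power_deriv q k (g X) (classical_grad g X $ i)))) \<partial>\<nu>)
      \<le> (\<integral>\<^sup>+X. ennreal ((norm (V X))\<^sup>2) + indicator (cball 0 \<rho>) X * ennreal (B\<^sup>2) \<partial>\<nu>)"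
    proof (intro nn_integral_mono)
      fix X
      assume le: "\<And>X. norm (V X) * norm (\<chi> i. reg_power_deriv q k (g X) (classical_grad g X $ i)) \<le> (norm (V X))\<^sup>2 + indicator (cball 0 \<rho>) X * B\<^sup>2"
      have "ennreal (1 * (norm (V X) * norm (\<chi> i. reg_power_deriv q k (g X) (classical_grad g X $ i)))) \<le> ennreal ((norm (V X))\<^sup>2 + indicator (cball 0 \<rho>) X * B\<^sup>2)"
        using ennreal_leI[OF le[of X]] by simp
      also have "\<dots> = ennreal ((norm (V X))\<^sup>2) + indicator (cball 0 \<rho>) X * ennreal (B\<^sup>2)"
        by (simp add: indicator_def)
      finally show "ennreal (1 * (norm (V X) * norm (\<chi> i. reg_power_deriv q k (g X) (classical_grad g X $ i)))) \<le> ennreal ((norm (V X))\<^sup>2) + indicator (cball 0 \<rho>) X * ennreal (B\<^sup>2)" .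
    qed
    also have "\<dots> = M"
      unfolding M_def by (rule nn_integral_add) measurable
    finally show "(\<integral>\<^sup>+X. ennreal (1 * (norm (V X) * norm (\<chi> i. reg_power_deriv q k (g X) (classical_grad g X $ i)))) \<partial>\<nu>)
      + (\<integral>\<^sup>+X. ennreal (cmod (reg_power q k (u X) - reg_power q k (g X)) * (norm (V X) * norm (classical_grad (\<lambda>X. complex_of_real 1) X))) \<partial>\<nu>) \<le> M"
      unfolding g1 by simp
  qed (auto intro: smooth_fun_const)
  also have "\<dots> < \<infinity>" using Mfin by (simp add: ennreal_mult_less_top)
  finally show ?thesis by simp
qed

text \<open>Since \<eta> vanishes on a ball larger than the support of \<open>g\<close>, the term
  with the gradient of \<open>P g\<close> disappears. The gradient of \<eta> lives in an annulus
  where \<open>g = 0\<close>; there \<open>cmod (P u)\<close> is at most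
  \<open>1 + cmod (u - g)\<close>, which the Hardy inequality makes locally square integrable with
  respect to \<nu>.\<close>

theorem q_energy_finite_less_2:
  assumes c: "c > 0" and q: "1 < q" "q < 2"
    and ell: "AE X in \<nu>. \<forall>k. 0 < k \<longrightarrow> k \<le> 1 \<longrightarrow> c * (reg_weight q k ((cmod (u X))\<^sup>2) * (norm (G X))\<^sup>2)
      \<le> Re (cdot (V X) (\<chi> i. reg_power_deriv q k (u X) (G X $ i)))"
  obtains r where "0 < r" "(\<integral>\<^sup>+X. indicator (- ball 0 r) X * ennreal (q_density q X) \<partial>\<nu>) < \<infinity>"
proof -
  obtain \<rho>' where \<rho>': "\<And>X. norm X > \<rho>' \<Longrightarrow> g X = 0"
    using test_function_cball[OF g] by metis
  define \<rho> where "\<rho> = \<bar>\<rho>'\<bar>"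
  have \<rho>: "\<rho> \<ge> 0" "\<And>X. norm X > \<rho> \<Longrightarrow> g X = 0" using \<rho>' by (auto simp: \<rho>_def)
  have gg0: "classical_grad g X = 0" if "norm X > \<rho>" for X
    by (rule classical_grad_eq_0_outside[OF g_smooth \<rho>(2) that])
  obtain Cc where Cc: "Cc > 0" and cut: "\<forall>(S::(real^'n) set) r. S \<in> sets borel \<longrightarrow> bounded S \<longrightarrow> r > 0 \<longrightarrow> (\<exists>\<theta>. cutoff_fun Cc S r \<theta>)"
    using cutoff_exists by blast
  \<comment> \<open>At scale 1 the radius \<open>\<rho> + 2\<close> makes
    \<open>1 - \<theta>\<close> equal to 0 up to radius \<open>\<rho> + 1\<close> and equal to 1
    beyond \<open>\<rho> + 3\<close>.\<close>
  obtain \<theta> where \<theta>: "cutoff_fun Cc (ball (0::real^'n) (\<rho> + 2)) 1 \<theta>"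
    using cut by force
  note t = cutoff_funD[OF \<theta>]
  let ?\<eta> = "\<lambda>X. 1 + (-1) * \<theta> X"
  have sm: "smooth_fun ?\<eta>" by (intro smooth_fun_add smooth_fun_const smooth_fun_mult t)
  have D: "frechet_derivative ?\<eta> (at X) = (\<lambda>v. 0 + (-1) * frechet_derivative \<theta> (at X) v)" for X
    by (rule frechet_derivative_at[symmetric])
      (intro has_derivative_add has_derivative_const has_derivative_mult_right smooth_fun_has_derivative[OF t(1)])
  have inner: "\<theta> X = 1 \<and> frechet_derivative \<theta> (at X) = (\<lambda>v. 0)" if "norm X \<le> \<rho> + 1" for X
  proof -
    have "ball X 1 \<subseteq> ball 0 (\<rho> + 2)"
      using that by (simp add: ball_subset_ball_iff)
    then show ?thesis using t(4,5) by blast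
  qed
  have outer: "\<theta> X = 0 \<and> frechet_derivative \<theta> (at X) = (\<lambda>v. 0)" if "norm X \<ge> \<rho> + 3" for X
  proof -
    have "ball X 1 \<inter> ball 0 (\<rho> + 2) = {}"
      by (rule disjoint_ballI) (use that in simp)
    then show ?thesis using t(6,7) by blast
  qed
  let ?gr = "\<lambda>X. classical_grad (\<lambda>X. complex_of_real (?\<eta> X)) X"
  have gr: "norm (?gr X) \<le> N * Cc" for X
  proof -
    have "\<bar>frechet_derivative ?\<eta> (at X) v\<bar> \<le> Cc * norm v" for v
      unfolding D using t(8)[of X v] by simp
    from norm_grad_of_real_le[OF sm this] show ?thesis by (simp add: N)
  qed
  have gr0: "?gr X = 0" if "norm X \<le> \<rho> + 1 \<or> norm X \<ge> \<rho> + 3" for X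
  proof (rule classical_grad_of_real_eq_0[OF sm])
    show "frechet_derivative ?\<eta> (at X) = (\<lambda>v. 0)"
      unfolding D using inner[of X] outer[of X] that by auto
  qed
  let ?b = "ball (0::real^'n) (\<rho> + 3)"
  \<comment> \<open>A collar width large enough to contain the ball \<open>?b\<close>, so that the
    Hardy inequality covers the annulus.\<close>
  define Rb where "Rb = dist x0 0 + \<rho> + 3"
  have Rb: "Rb > 0" using \<rho>(1) unfolding Rb_def by (simp add: add_nonneg_pos)
  have near: "\<delta> X < Rb" if "X \<in> ?b" for X
    using infdist_le[OF x0, of X] dist_triangle[of X x0 0] that by (simp add: Rb_def dist_commute)
  have [measurable]: "?b \<in> sets borel" by simp
  \<comment> \<open>The majorant reflects \<open>(1 + x) * y \<le> 1 + x^2 + 2 * y^2\<close> with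
    \<open>x = cmod (u X - g X)\<close> and \<open>y = norm (V X)\<close>; all three parts have
    finite \<nu>-integral and none depends on \<open>k\<close>.\<close>
  define I where "I X = indicator ?b X * ennreal 1 + (indicator {X. \<delta> X < Rb} X * ennreal ((cmod (u X - g X))\<^sup>2) + 2 * ennreal ((norm (V X))\<^sup>2))" for X
  define M where "M = ennreal (N * Cc) * (\<integral>\<^sup>+X. I X \<partial>\<nu>)"
  have "(\<integral>\<^sup>+X. I X \<partial>\<nu>) = (\<integral>\<^sup>+X. indicator ?b X * ennreal 1 \<partial>\<nu>) + ((\<integral>\<^sup>+X. indicator {X. \<delta> X < Rb} X * ennreal ((cmod (u X - g X))\<^sup>2) \<partial>\<nu>) + 2 * (\<integral>\<^sup>+X. ennreal ((norm (V X))\<^sup>2) \<partial>\<nu>))"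
    unfolding I_def by (subst nn_integral_add, measurable)+ (subst nn_integral_cmult, measurable)
  also have "\<dots> < \<infinity>"
  proof -
    have "(\<integral>\<^sup>+X. indicator ?b X * ennreal 1 \<partial>\<nu>) < \<infinity>"
      by (rule nn_integral_\<nu>_bounded[where M = 1]) auto
    moreover have "(\<integral>\<^sup>+X. indicator {X. \<delta> X < Rb} X * ennreal ((cmod (u X - g X))\<^sup>2) \<partial>\<nu>) < \<infinity>"
      by (rule le_less_trans[OF hardy_\<nu>[OF Rb]]) simp
    ultimately show ?thesis using V2 by (simp add: ennreal_add_less_top ennreal_mult_less_top)
  qed
  finally have Mfin: "M < \<infinity>" by (simp add: M_def ennreal_mult_less_top)
  have "(\<integral>\<^sup>+X. ennreal (?\<eta> X * q_density q X) \<partial>\<nu>) \<le> ennreal (1 / c) * M"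
  proof (rule q_density_integral_le[OF c sm _ _ ell])
    fix k :: real assume k: "0 < k" "k \<le> 1"
    have "?\<eta> X * (norm (V X) * norm (\<chi> i. reg_power_deriv q k (g X) (classical_grad g X $ i))) = 0" for X
    proof (cases "norm X \<le> \<rho>")
      case True
      then show ?thesis using inner[of X] by simp
    next
      case False
      then have "norm (\<chi> i. reg_power_deriv q k (g X) (classical_grad g X $ i)) = 0"
        using reg_power_grad_bound[OF k, of q "g X" "classical_grad g X"] gg0[of X] by simp
      then show ?thesis by simp
    qed
    then have A: "(\<integral>\<^sup>+X. ennreal (?\<eta> X * (norm (V X) * norm (\<chi> i. reg_power_deriv q k (g X) (classical_grad g X $ i)))) \<partial>\<nu>) = 0"
      by (simp only:) simp
    have "(\<integral>\<^sup>+X. ennreal (cmod (reg_power q k (u X) - reg_power q k (g X)) * (norm (V X) * norm (?gr X))) \<partial>\<nu>)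
      \<le> (\<integral>\<^sup>+X. ennreal (N * Cc) * I X \<partial>\<nu>)"
    proof (intro nn_integral_mono)
      fix X
      show "ennreal (cmod (reg_power q k (u X) - reg_power q k (g X)) * (norm (V X) * norm (?gr X))) \<le> ennreal (N * Cc) * I X"
      proof (cases "norm X \<le> \<rho> + 1 \<or> norm X \<ge> \<rho> + 3")
        case True
        then show ?thesis using gr0[OF True] by simp
      next
        case False
        then have g0: "g X = 0" using \<rho>(2)[of X] by simp
        let ?x = "cmod (u X - g X)" and ?y = "norm (V X)"
        have "cmod (reg_power q k (u X) - reg_power q k (g X)) \<le> 1 + ?x"
          using norm_reg_power_le[OF k q, of "u X"] by (simp add: g0 reg_power_def)
        then have "cmod (reg_power q k (u X) - reg_power q k (g X)) * (?y * norm (?gr X)) \<le> (1 + ?x) * (?y * (N * Cc))"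
          by (intro mult_mono gr mult_left_mono) auto
        also have "\<dots> = (N * Cc) * ((1 + ?x) * ?y)" by (simp only: mult_ac)
        also have "\<dots> \<le> (N * Cc) * (1 + (?x\<^sup>2 + 2 * ?y\<^sup>2))"
        proof (rule mult_left_mono)
          have "0 \<le> ?x * ?y" by simp
          then have "?x * ?y \<le> ?x\<^sup>2 + ?y\<^sup>2" using sum_squares_bound[of ?x ?y] by linarith
          moreover have "?y \<le> 1 + ?y\<^sup>2"
            using sum_squares_bound[of ?y 1] norm_ge_zero[of "V X"] unfolding one_power2 by linarith
          ultimately show "(1 + ?x) * ?y \<le> 1 + (?x\<^sup>2 + 2 * ?y\<^sup>2)" unfolding distrib_right by linarith
        qed (use N Cc in simp)
        finally have "ennreal (cmod (reg_power q k (u X) - reg_power q k (g X)) * (?y * norm (?gr X))) \<le> ennreal ((N * Cc) * (1 + (?x\<^sup>2 + 2 * ?y\<^sup>2)))"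
          by (rule ennreal_leI)
        also have "\<dots> = ennreal (N * Cc) * (ennreal 1 + (ennreal (?x\<^sup>2) + 2 * ennreal (?y\<^sup>2)))"
        proof -
          have "ennreal (1 + (?x\<^sup>2 + 2 * ?y\<^sup>2)) = ennreal 1 + (ennreal (?x\<^sup>2) + ennreal (2 * ?y\<^sup>2))"
            by (simp only: ennreal_plus zero_le_power2 zero_le_one mult_nonneg_nonneg zero_le_numeral add_nonneg_nonneg)
          also have "ennreal (2 * ?y\<^sup>2) = 2 * ennreal (?y\<^sup>2)" by (simp add: ennreal_mult)
          finally show ?thesis using N Cc by (simp only:) (subst ennreal_mult, auto)
        qed
        also have "\<dots> = ennreal (N * Cc) * I X"
          using False near[of X] by (simp add: I_def)
        finally show ?thesis .
      qed
    qed
    also have "\<dots> = M"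
      unfolding M_def I_def by (rule nn_integral_cmult) measurable
    finally show "(\<integral>\<^sup>+X. ennreal (?\<eta> X * (norm (V X) * norm (\<chi> i. reg_power_deriv q k (g X) (classical_grad g X $ i)))) \<partial>\<nu>)
      + (\<integral>\<^sup>+X. ennreal (cmod (reg_power q k (u X) - reg_power q k (g X)) * (norm (V X) * norm (?gr X))) \<partial>\<nu>) \<le> M"
      unfolding A by simp
  qed (use t(2,3) in auto)
  also have "\<dots> < \<infinity>" using Mfin by (simp add: ennreal_mult_less_top)
  finally have fin: "(\<integral>\<^sup>+X. ennreal (?\<eta> X * q_density q X) \<partial>\<nu>) < \<infinity>" .
  have "(\<integral>\<^sup>+X. indicator (- ?b) X * ennreal (q_density q X) \<partial>\<nu>) \<le> (\<integral>\<^sup>+X. ennreal (?\<eta> X * q_density q X) \<partial>\<nu>)"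
  proof (intro nn_integral_mono)
    fix X
    show "indicator (- ?b) X * ennreal (q_density q X) \<le> ennreal (?\<eta> X * q_density q X)"
      using outer[of X] by (cases "X \<in> ?b") auto
  qed
  with fin have "(\<integral>\<^sup>+X. indicator (- ?b) X * ennreal (q_density q X) \<partial>\<nu>) < \<infinity>" by (rule le_less_trans[rotated])
  then show ?thesis using that[of "\<rho> + 3"] \<rho>(1) by simp
qed

end

section \<open>Reduction to Borel representatives\<close>

lemma borel_representative_complex:
  fixes f :: "'a \<Rightarrow> complex"
  assumes "f \<in> borel_measurable (completion M)"
  obtains f' where "f' \<in> borel_measurable M" "AE x in M. f x = f' x"
proof -
  have "(\<lambda>x. Re (f x)) \<in> borel_measurable (completion M)" "(\<lambda>x. Im (f x)) \<in> borel_measurable (completion M)"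
    using assms by measurable
  from this[THEN completion_ex_borel_measurable_real]
  obtain a b where ab: "a \<in> borel_measurable M" "AE x in M. Re (f x) = a x" "b \<in> borel_measurable M" "AE x in M. Im (f x) = b x"
    by blast
  show ?thesis
  proof (rule that)
    show "(\<lambda>x. complex_of_real (a x) + \<i> * complex_of_real (b x)) \<in> borel_measurable M"
      using ab(1,3) by measurable
    show "AE x in M. f x = complex_of_real (a x) + \<i> * complex_of_real (b x)"
      using ab(2,4) by eventually_elim (simp add: complex_eq_iff)
  qed
qed

lemma borel_representative_vec:
  fixes f :: "'a \<Rightarrow> complex ^ 'n::finite"
  assumes "f \<in> borel_measurable (completion M)"
  obtains f' where "f' \<in> borel_measurable M" "AE x in M. f x = f' x"
proof -
  have "\<exists>h. h \<in> borel_measurable M \<and> (AE x in M. f x $ i = h x)" for i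
    using borel_representative_complex[of "\<lambda>x. f x $ i" M] assms by (metis borel_measurable_vec_nth)
  then obtain h where h: "\<And>i. h i \<in> borel_measurable M" "\<And>i. AE x in M. f x $ i = h i x" by metis
  show ?thesis
  proof (rule that)
    show "(\<lambda>x. \<chi> i. h i x) \<in> borel_measurable M"
      using h(1) by (rule borel_measurable_vec_lambda)
    have "AE x in M. \<forall>i\<in>UNIV. f x $ i = h i x"
      using h(2) by (intro AE_finite_allI) auto
    then show "AE x in M. f x = (\<chi> i. h i x)"
      by eventually_elim (simp add: vec_eq_iff)
  qed
qed

lemma borel_imp_lebesgue_measurable: "f \<in> borel_measurable borel \<Longrightarrow> f \<in> borel_measurable lebesgue"
  by (rule measurable_completion) simp

lemma LINT_lebesgue_eq_lborel:
  fixes f :: "'a::euclidean_space \<Rightarrow> 'b::{banach, second_countable_topology}"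
  assumes "f \<in> borel_measurable lebesgue" "f' \<in> borel_measurable borel" "AE x in lborel. f x = f' x"
  shows "(LINT x|lebesgue. f x) = (LINT x|lborel. f' x)" "integrable lebesgue f \<longleftrightarrow> integrable lborel f'"
proof -
  have m: "f' \<in> borel_measurable lebesgue" by (rule borel_imp_lebesgue_measurable[OF assms(2)])
  have ae: "AE x in lebesgue. f x = f' x" by (rule AE_completion[OF assms(3)])
  have "(LINT x|lebesgue. f x) = (LINT x|lebesgue. f' x)"
    by (rule integral_cong_AE[OF assms(1) m ae])
  also have "\<dots> = (LINT x|lborel. f' x)"
    by (rule integral_completion) (use assms(2) in simp)
  finally show "(LINT x|lebesgue. f x) = (LINT x|lborel. f' x)" .
  have "integrable lebesgue f \<longleftrightarrow> integrable lebesgue f'"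
    by (rule integrable_cong_AE[OF assms(1) m ae])
  also have "\<dots> \<longleftrightarrow> integrable lborel f'"
    by (rule integrable_completion) (use assms(2) in simp)
  finally show "integrable lebesgue f \<longleftrightarrow> integrable lborel f'" .
qed

text \<open>Local integrability gives measurability on each compact subset of the open complement; a
  compact exhaustion extends it to the whole complement.\<close>

lemma locally_integrable_measurable:
  fixes f :: "real ^ 'n::finite \<Rightarrow> 'b::{banach, second_countable_topology}"
  assumes \<Gamma>: "closed \<Gamma>" "\<Gamma> \<noteq> {}" and f: "locally_integrable (- \<Gamma>) f"
  shows "(\<lambda>X. indicat_real (- \<Gamma>) X *\<^sub>R f X) \<in> borel_measurable lebesgue"
proof (rule borel_measurable_LIMSEQ_metric)
  \<comment> \<open>The lower bound on the distance is positive, so these compact sets avoid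
    \<Gamma> while exhausting its complement.\<close>
  define K where "K j = cball 0 (real j) \<inter> {X. 1 / real (Suc j) \<le> infdist X \<Gamma>}" for j
  show "(\<lambda>X. indicat_real (K j) X *\<^sub>R f X) \<in> borel_measurable lebesgue" for j
  proof -
    have "compact (K j)"
      unfolding K_def by (intro compact_Int_closed compact_cball closed_Collect_le continuous_intros)
    moreover have "K j \<subseteq> - \<Gamma>"
      unfolding K_def by (auto simp: not_le[symmetric])
    ultimately show ?thesis
      using f unfolding locally_integrable_def set_integrable_def by auto
  qed
  fix X
  show "(\<lambda>j. indicat_real (K j) X *\<^sub>R f X) \<longlonglongrightarrow> indicat_real (- \<Gamma>) X *\<^sub>R f X"
  proof (cases "X \<in> \<Gamma>")
    case True
    then have "indicat_real (K j) X *\<^sub>R f X = indicat_real (- \<Gamma>) X *\<^sub>R f X" for j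
      by (auto simp: K_def indicator_def divide_le_0_iff)
    then show ?thesis by (simp only: tendsto_const)
  next
    case False
    then have p: "infdist X \<Gamma> > 0"
      using \<Gamma> by (metis in_closed_iff_infdist_zero infdist_nonneg less_eq_real_def)
    have "eventually (\<lambda>j. 1 / real (Suc j) < infdist X \<Gamma>) sequentially"
      using LIMSEQ_Suc[OF lim_1_over_n] p by (intro order_tendstoD(2)[where y = 0]) auto
    moreover have "eventually (\<lambda>j. norm X \<le> real j) sequentially"
      by (rule eventually_mono[OF filterlim_at_top[THEN iffD1, OF filterlim_real_sequentially, rule_format]])
    ultimately have "eventually (\<lambda>j. indicat_real (K j) X *\<^sub>R f X = indicat_real (- \<Gamma>) X *\<^sub>R f X) sequentially"
      by eventually_elim (use False in \<open>auto simp: K_def\<close>)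
    then show ?thesis by (rule tendsto_eventually)
  qed
qed

text \<open>Compact subsets of \<open>U\<close> and test functions on \<open>U\<close> see the
  values on \<open>U\<close> only. This permits setting a gradient to 0 on \<Gamma>.\<close>

lemma wgrad_cong_open:
  assumes "wgrad U u G" "u' \<in> borel_measurable borel" "G' \<in> borel_measurable borel"
    and eq: "\<And>X. X \<in> U \<Longrightarrow> u' X = u X" "\<And>X. X \<in> U \<Longrightarrow> G' X = G X"
  shows "wgrad U u' G'"
  unfolding wgrad_def
proof (intro conjI allI ballI impI assms(2,3))
  note u = wgradD[OF assms(1)]
  fix K assume K: "compact K \<and> K \<subseteq> U"
  have "(\<lambda>X. indicat_real K X *\<^sub>R u' X) = (\<lambda>X. indicat_real K X *\<^sub>R u X)" "(\<lambda>X. indicat_real K X *\<^sub>R G' X) = (\<lambda>X. indicat_real K X *\<^sub>R G X)"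
    using K eq by (auto simp: indicator_def fun_eq_iff)
  then show "set_integrable lborel K u'" "set_integrable lborel K G'"
    using K u(3,4) by (auto simp: set_integrable_def)
next
  note u = wgradD[OF assms(1)]
  fix \<phi> i assume \<phi>: "\<phi> \<in> test_functions U"
  note \<phi>' = test_functionsD[OF \<phi>]
  have z: "\<phi> X = 0 \<and> classical_grad \<phi> X $ i = 0" if "X \<notin> U" for X
  proof -
    have X: "X \<notin> closure {X. \<phi> X \<noteq> 0}" using \<phi>'(3) that by blast
    from \<phi>'(4)[OF X] frechet_derivative_eq_0_off_support[OF \<phi>'(1) X] show ?thesis
      by (simp add: classical_grad_def)
  qed
  have e: "u' X * classical_grad \<phi> X $ i = u X * classical_grad \<phi> X $ i" "G' X $ i * \<phi> X = G X $ i * \<phi> X" for X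
    using z[of X] eq[of X] by (cases "X \<in> U"; simp)+
  show "(LINT X|lborel. u' X * classical_grad \<phi> X $ i) = - (LINT X|lborel. G' X $ i * \<phi> X)"
    unfolding e by (rule u(5)[OF \<phi>])
qed

lemma cdot_vec_cnj_self: "cdot v (vec_cnj v) = complex_of_real ((norm v)\<^sup>2)"
proof -
  have "cdot v (vec_cnj v) = (\<Sum>i\<in>UNIV. complex_of_real ((norm (v $ i))\<^sup>2))"
    unfolding cdot_def vec_cnj_def by (simp only: complex_norm_square vec_lambda_beta)
  also have "\<dots> = complex_of_real ((norm v)\<^sup>2)"
    by (simp add: norm_vec_def L2_set_def sum_nonneg)
  finally show ?thesis .
qed

text \<open>Since \<Gamma> is closed, every \<open>X\<close> has a nearest point on \<Gamma>. A ball
  about \<open>X\<close> that meets \<Gamma> lies in the ball of twice the radius about that point,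
  and conversely \<open>ball X (2 * r)\<close> contains its r-ball if
  \<open>infdist X \<Gamma> < r\<close>.\<close>

lemma ahlfors_of_regular_measure:
  fixes \<Gamma> :: "(real ^ 'n::finite) set"
  assumes "ahlfors_regular_measure d \<Gamma> \<sigma>" "0 < d" "d < real CARD('n) - 1"
  obtains C where "ahlfors \<Gamma> (distr \<sigma> borel (\<lambda>x. x)) d C (real CARD('n))"
proof -
  obtain C where C: "C > 0" and b: "\<And>X r. X \<in> \<Gamma> \<Longrightarrow> r > 0 \<Longrightarrow>
        ennreal (r powr d / C) \<le> emeasure \<sigma> (\<Gamma> \<inter> ball X r) \<and> emeasure \<sigma> (\<Gamma> \<inter> ball X r) \<le> ennreal (C * r powr d)"
    and cl: "closed \<Gamma>" "\<Gamma> \<noteq> {}" and sets: "sets \<sigma> = sets (restrict_space borel \<Gamma>)"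
    using assms(1) unfolding ahlfors_regular_measure_def by metis
  have sp: "space \<sigma> = \<Gamma>"
    using sets_eq_imp_space_eq[OF sets] by (simp add: space_restrict_space)
  have m: "(\<lambda>x. x) \<in> measurable \<sigma> borel"
    unfolding measurable_cong_sets[OF sets refl] by (rule measurable_restrict_space1) simp
  have e: "emeasure (distr \<sigma> borel (\<lambda>x. x)) (ball X r) = emeasure \<sigma> (\<Gamma> \<inter> ball X r)" for X r
    by (subst emeasure_distr[OF m]) (auto simp: sp Int_commute)
  \<comment> \<open>The factor \<open>2 powr d\<close> is the cost of recentring with doubled radius
    in the upper bound.\<close>
  define C' where "C' = C * 2 powr d"
  have "2 powr d \<ge> 1" using assms(2) by (simp add: ge_one_powr_ge_zero)
  then have C': "C' > 0" "C \<le> C'" using C by (auto simp: C'_def mult_le_cancel_left1)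
  have attain: "\<exists>x\<in>\<Gamma>. infdist X \<Gamma> = dist X x" for X
    using infdist_attains_inf[OF cl, of X] by metis
  have mono: "emeasure \<sigma> (\<Gamma> \<inter> ball x r) \<le> emeasure \<sigma> (\<Gamma> \<inter> ball y s)" if "ball x r \<subseteq> ball y s" for x y r s
  proof (rule emeasure_mono)
    show "\<Gamma> \<inter> ball y s \<in> sets \<sigma>" using cl unfolding sets by (auto simp: sets_restrict_space)
  qed (use that in blast)
  have empty: "emeasure \<sigma> (\<Gamma> \<inter> ball X r) = 0" if "r \<le> infdist X \<Gamma>" for X r
  proof -
    have "\<Gamma> \<inter> ball X r = {}"
    proof (rule ccontr)
      assume "\<Gamma> \<inter> ball X r \<noteq> {}"
      then obtain y where "y \<in> \<Gamma>" "dist X y < r" by auto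
      then show False using infdist_le[of y \<Gamma> X] that by simp
    qed
    then show ?thesis by simp
  qed
  have "ahlfors \<Gamma> (distr \<sigma> borel (\<lambda>x. x)) d C' (real CARD('n))"
  proof (unfold_locales, goal_cases)
    case (4 r X)
    show ?case
    proof (cases "infdist X \<Gamma> < r")
      case True
      obtain x where x: "x \<in> \<Gamma>" "dist X x < r" using attain[of X] True by auto
      have "ball X r \<subseteq> ball x (2 * r)"
        using x(2) by (simp add: ball_subset_ball_iff)
      from mono[OF this] b[OF x(1), of "2 * r"] 4 have "emeasure \<sigma> (\<Gamma> \<inter> ball X r) \<le> ennreal (C * (2 * r) powr d)"
        by (auto intro: order_trans)
      then show ?thesis using 4 by (simp add: e C'_def powr_mult mult_ac)
    next
      case False
      then show ?thesis by (simp add: e empty)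
    qed
  next
    case (5 r X)
    then show ?case by (simp add: e empty)
  next
    case (6 X r)
    obtain x where x: "x \<in> \<Gamma>" "dist X x < r" using attain[of X] 6 by auto
    have r: "r > 0" using x(2) by (meson le_less_trans zero_le_dist)
    have "ball x r \<subseteq> ball X (2 * r)"
      using x(2) by (simp add: ball_subset_ball_iff dist_commute)
    from order_trans[OF conjunct1[OF b[OF x(1) r]] mono[OF this]]
    have "ennreal (r powr d / C) \<le> emeasure \<sigma> (\<Gamma> \<inter> ball X (2 * r))" .
    moreover have "r powr d / C' \<le> r powr d / C"
      using C C' by (intro divide_left_mono) auto
    ultimately show ?case unfolding e by (meson ennreal_leI order_trans)
  qed (use cl C' assms in auto)
  then show ?thesis by (rule that)
qed

section \<open>Transfer from Lebesgue to Borel representatives\<close>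

context ahlfors
begin

lemma nn_integral_weighted_measure:
  assumes f: "f \<in> borel_measurable (lebesgue_on (- \<Gamma>))" and [measurable]: "f' \<in> borel_measurable borel"
    and eq: "AE X in lborel. X \<notin> \<Gamma> \<longrightarrow> f X = f' X"
  shows "(\<integral>\<^sup>+X. f X \<partial>weighted_measure d \<Gamma>) = (\<integral>\<^sup>+X. f' X \<partial>\<nu>)"
proof -
  have w: "(\<lambda>X. ennreal (weight d \<Gamma> X)) \<in> borel_measurable (lebesgue_on (- \<Gamma>))"
    by (intro measurable_restrict_space1 borel_imp_lebesgue_measurable) measurable
  have S: "- \<Gamma> \<in> sets lebesgue"
    using sets_\<Gamma> by auto
  have "(\<integral>\<^sup>+X. f X \<partial>weighted_measure d \<Gamma>) = (\<integral>\<^sup>+X. ennreal (weight d \<Gamma> X) * f X \<partial>lebesgue_on (- \<Gamma>))"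
    unfolding weighted_measure_def by (rule nn_integral_density[OF w f])
  also have "\<dots> = (\<integral>\<^sup>+X. (ennreal (weight d \<Gamma> X) * f X) * indicator (- \<Gamma>) X \<partial>lebesgue)"
    by (rule nn_integral_restrict_space) (use S in simp)
  also have "\<dots> = (\<integral>\<^sup>+X. (ennreal (weight d \<Gamma> X) * f X) * indicator (- \<Gamma>) X \<partial>lborel)"
    by (rule nn_integral_completion)
  also have "\<dots> = (\<integral>\<^sup>+X. indicator (- \<Gamma>) X * (ennreal (weight d \<Gamma> X) * f' X) \<partial>lborel)"
    by (rule nn_integral_cong_AE) (use eq in \<open>eventually_elim, auto simp: indicator_def\<close>)
  also have "\<dots> = (\<integral>\<^sup>+X. f' X \<partial>\<nu>)" by (simp add: nn_integral_\<nu>)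
  finally show ?thesis .
qed

lemma avg_tendsto_continuous:
  assumes c: "continuous_on UNIV f"
  shows "((\<lambda>r. avg f x r) \<longlongrightarrow> f x) (at_right 0)"
proof (rule tendstoI)
  fix e :: real assume e: "e > 0"
  then have e2: "e / 2 > 0" by simp
  obtain s where s: "s > 0" "\<And>y. dist y x < s \<Longrightarrow> dist (f y) (f x) < e / 2"
    using c e2 unfolding continuous_on_iff by (metis UNIV_I)
  have "dist (avg f x r) (f x) < e" if r: "0 < r" "r < s" for r
  proof -
    let ?m = "measure lborel (ball x r)"
    have m: "?m > 0" using r vol_pos by (simp add: measure_ball)
    have "set_integrable lborel (ball x r) f"
      by (rule set_integrable_subset[OF compact_set_integrable_continuous[OF c compact_cball[of x r]]]) auto
    then have I1: "integrable lborel (\<lambda>Y. indicat_real (ball x r) Y *\<^sub>R f Y)" by (simp add: set_integrable_def)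
    have Ii: "integrable lborel (indicat_real (ball x r))"
      by (intro integrable_real_indicator) (auto simp: emeasure_bounded_less_top)
    have I2: "integrable lborel (\<lambda>Y. indicat_real (ball x r) Y *\<^sub>R f x)"
      by (rule integrable_scaleR_left[OF Ii])
    have "avg f x r - f x = (1 / ?m) *\<^sub>R ((LINT Y|lborel. indicat_real (ball x r) Y *\<^sub>R f Y) - (LINT Y|lborel. indicat_real (ball x r) Y *\<^sub>R f x))"
      using m Ii by (simp add: avg_def scaleR_diff_right integral_scaleR_left)
    also have "\<dots> = (1 / ?m) *\<^sub>R (LINT Y|lborel. indicat_real (ball x r) Y *\<^sub>R f Y - indicat_real (ball x r) Y *\<^sub>R f x)"
      by (simp only: Bochner_Integration.integral_diff[OF I1 I2])
    finally have "norm (avg f x r - f x) = (1 / ?m) * norm (LINT Y|lborel. indicat_real (ball x r) Y *\<^sub>R f Y - indicat_real (ball x r) Y *\<^sub>R f x)"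
      using m by simp
    also have "\<dots> \<le> (1 / ?m) * (LINT Y|lborel. indicat_real (ball x r) Y * (e / 2))"
    proof (intro mult_left_mono LINT_norm_bound Bochner_Integration.integrable_diff I1 I2 integrable_mult_left Ii)
      fix Y
      show "norm (indicat_real (ball x r) Y *\<^sub>R f Y - indicat_real (ball x r) Y *\<^sub>R f x) \<le> indicat_real (ball x r) Y * (e / 2)"
        using s(2)[of Y] r by (cases "Y \<in> ball x r") (auto simp: dist_commute dist_norm less_imp_le)
    qed simp
    also have "\<dots> = e / 2" using m by simp
    also have "\<dots> < e" using e by simp
    finally show ?thesis by (simp add: dist_norm)
  qed
  then show "eventually (\<lambda>r. dist (avg f x r) (f x) < e) (at_right 0)"
    using s(1) unfolding eventually_at_right_field by blast
qed

end

context ahlfors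
begin

text \<open>Locally integrable functions on the complement agree almost everywhere with Borel
  functions. Extended by 0 to \<Gamma>, these turn integrals over \<open>- \<Gamma>\<close> with
  respect to \<open>lebesgue\<close> into integrals over the whole space with respect to
  \<open>lborel\<close>.\<close>

lemma borel_weak_gradient:
  assumes lu: "locally_integrable (- \<Gamma>) u" and G: "has_weak_grad (- \<Gamma>) u G"
  obtains u' G' where "wgrad (- \<Gamma>) u' G'" "AE X in lborel. X \<notin> \<Gamma> \<longrightarrow> u X = u' X" "AE X in lborel. X \<notin> \<Gamma> \<longrightarrow> G X = G' X"
    "\<forall>X\<in>\<Gamma>. u' X = 0"
proof -
  let ?i = "indicat_real (- \<Gamma>)"
  have lG: "locally_integrable (- \<Gamma>) G" and ibp: "\<And>\<phi> i. \<phi> \<in> test_functions (- \<Gamma>) \<Longrightarrow>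
      (LINT X:- \<Gamma>|lebesgue. u X * classical_grad \<phi> X $ i) = - (LINT X:- \<Gamma>|lebesgue. G X $ i * \<phi> X)"
    using G unfolding has_weak_grad_def by auto
  note mu = locally_integrable_measurable[OF closed ne lu] and mG = locally_integrable_measurable[OF closed ne lG]
  obtain u0 where u0: "u0 \<in> borel_measurable lborel" "AE X in lborel. ?i X *\<^sub>R u X = u0 X"
    using borel_representative_complex[OF mu] .
  obtain G0 where G0: "G0 \<in> borel_measurable lborel" "AE X in lborel. ?i X *\<^sub>R G X = G0 X"
    using borel_representative_vec[OF mG] .
  \<comment> \<open>The indicator makes \<open>u'\<close> vanish at every point of \<Gamma>; the
    trace averages, which omit \<Gamma>, then become averages over full balls.\<close>
  define u' where "u' X = ?i X *\<^sub>R u0 X" for X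
  define G' where "G' X = ?i X *\<^sub>R G0 X" for X
  have [measurable]: "u0 \<in> borel_measurable borel" "G0 \<in> borel_measurable borel" using u0(1) G0(1) by auto
  have [measurable]: "u' \<in> borel_measurable borel" "G' \<in> borel_measurable borel"
    unfolding u'_def G'_def by measurable
  have aeu: "AE X in lborel. ?i X *\<^sub>R u X = u' X"
    using u0(2) by eventually_elim (auto simp: u'_def indicator_def split: if_splits)
  have aeG: "AE X in lborel. ?i X *\<^sub>R G X = G' X"
    using G0(2) by eventually_elim (auto simp: G'_def indicator_def split: if_splits)
  show ?thesis
  proof (rule that)
    show "wgrad (- \<Gamma>) u' G'"
      unfolding wgrad_def
    proof (intro conjI allI impI ballI)
      show "u' \<in> borel_measurable borel" "G' \<in> borel_measurable borel" by measurable
      fix K assume K: "compact K \<and> K \<subseteq> - \<Gamma>"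
      then have [measurable]: "K \<in> sets borel" by (auto intro: borel_compact)
      have iK: "indicat_real K X * ?i X = indicat_real K X" for X using K by (auto simp: indicator_def)
      have Iu: "integrable lebesgue (\<lambda>X. indicat_real K X *\<^sub>R u X)" and IG: "integrable lebesgue (\<lambda>X. indicat_real K X *\<^sub>R G X)"
        using lu lG K by (auto simp: locally_integrable_def set_integrable_def)
      have "AE X in lborel. indicat_real K X *\<^sub>R u X = indicat_real K X *\<^sub>R u' X"
        using aeu by eventually_elim (metis iK scaleR_scaleR)
      then show "set_integrable lborel K u'" unfolding set_integrable_def
        by (rule LINT_lebesgue_eq_lborel(2)[THEN iffD1, OF borel_measurable_integrable[OF Iu] _ _ Iu, rotated]) measurable
      have "AE X in lborel. indicat_real K X *\<^sub>R G X = indicat_real K X *\<^sub>R G' X"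
        using aeG by eventually_elim (metis iK scaleR_scaleR)
      then show "set_integrable lborel K G'" unfolding set_integrable_def
        by (rule LINT_lebesgue_eq_lborel(2)[THEN iffD1, OF borel_measurable_integrable[OF IG] _ _ IG, rotated]) measurable
    next
      fix \<phi> i assume \<phi>: "\<phi> \<in> test_functions (- \<Gamma>)"
      note sm = test_functionsD(1)[OF \<phi>]
      have m[measurable]: "\<phi> \<in> borel_measurable borel" "(\<lambda>X. classical_grad \<phi> X $ i) \<in> borel_measurable borel"
        using sm by (auto intro: borel_measurable_continuous_onI smooth_fun_continuous continuous_classical_grad)
      note ml = m[THEN borel_imp_lebesgue_measurable]
      have "(LINT X:- \<Gamma>|lebesgue. u X * classical_grad \<phi> X $ i) = (LINT X|lborel. u' X * classical_grad \<phi> X $ i)"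
        unfolding set_lebesgue_integral_def
      proof (rule LINT_lebesgue_eq_lborel(1))
        show "(\<lambda>X. ?i X *\<^sub>R (u X * classical_grad \<phi> X $ i)) \<in> borel_measurable lebesgue"
          using borel_measurable_times[OF mu ml(2)] by simp
        show "AE X in lborel. ?i X *\<^sub>R (u X * classical_grad \<phi> X $ i) = u' X * classical_grad \<phi> X $ i"
          using aeu by eventually_elim (metis mult_scaleR_left)
      qed measurable
      moreover have "(LINT X:- \<Gamma>|lebesgue. G X $ i * \<phi> X) = (LINT X|lborel. G' X $ i * \<phi> X)"
        unfolding set_lebesgue_integral_def
      proof (rule LINT_lebesgue_eq_lborel(1))
        show "(\<lambda>X. ?i X *\<^sub>R (G X $ i * \<phi> X)) \<in> borel_measurable lebesgue"
          using borel_measurable_times[OF borel_measurable_vec_nth[OF mG, of i] ml(1)] by simp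
        show "AE X in lborel. ?i X *\<^sub>R (G X $ i * \<phi> X) = G' X $ i * \<phi> X"
          using aeG by eventually_elim (metis mult_scaleR_left vector_scaleR_component)
      qed measurable
      ultimately show "(LINT X|lborel. u' X * classical_grad \<phi> X $ i) = - (LINT X|lborel. G' X $ i * \<phi> X)"
        using ibp[OF \<phi>, of i] by simp
    qed
    show "AE X in lborel. X \<notin> \<Gamma> \<longrightarrow> u X = u' X"
      using aeu by eventually_elim auto
    show "AE X in lborel. X \<notin> \<Gamma> \<longrightarrow> G X = G' X"
      using aeG by eventually_elim auto
  qed (simp add: u'_def)
qed

text \<open>Off \<Gamma> the normalising factor is the reciprocal of the weight, so ellipticity with
  weight becomes ordinary ellipticity.\<close>

lemma normalized_matrix_bounds:
  fixes A :: "real ^ 'n \<Rightarrow> complex ^ 'n ^ 'n"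
  assumes X: "X \<notin> \<Gamma>" and Ce: "Ce > 0"
    and e1: "\<And>\<xi>. Re (cdot (A X *v \<xi>) (vec_cnj \<xi>)) \<ge> weight d \<Gamma> X * (norm \<xi>)\<^sup>2 / Ce"
    and e2: "\<And>\<xi> \<zeta>. cmod (cdot (A X *v \<xi>) (vec_cnj \<zeta>)) \<le> Ce * weight d \<Gamma> X * norm \<xi> * norm \<zeta>"
  shows "1 / Ce * (norm \<xi>)\<^sup>2 \<le> Re (cdot (normalized_matrix d \<Gamma> A X *v \<xi>) (vec_cnj \<xi>))"
    and "norm (normalized_matrix d \<Gamma> A X *v \<xi>) \<le> Ce * norm \<xi>"
proof -
  define s where "s = \<delta> X powr (N - d - 1)"
  have p: "0 < \<delta> X" using X \<delta>_pos_iff by blast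
  have s: "s > 0" using p by (simp add: s_def)
  have sw: "s * weight d \<Gamma> X = 1" using p by (simp add: s_def weight_eq powr_add[symmetric])
  have M: "normalized_matrix d \<Gamma> A X *v \<xi> = s *\<^sub>R (A X *v \<xi>)"
    by (simp add: normalized_matrix_def s_def N vec_eq_iff matrix_vector_mult_def scaleR_sum_right)
  have "s * (weight d \<Gamma> X * (norm \<xi>)\<^sup>2 / Ce) \<le> s * Re (cdot (A X *v \<xi>) (vec_cnj \<xi>))"
    using s by (intro mult_left_mono e1) auto
  moreover have "s * (weight d \<Gamma> X * (norm \<xi>)\<^sup>2 / Ce) = 1 / Ce * (norm \<xi>)\<^sup>2"
    using sw by (simp add: mult.assoc[symmetric])
  moreover have "Re (cdot (normalized_matrix d \<Gamma> A X *v \<xi>) (vec_cnj \<xi>)) = s * Re (cdot (A X *v \<xi>) (vec_cnj \<xi>))"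
    by (simp add: M cdot_scaleR_left)
  ultimately show "1 / Ce * (norm \<xi>)\<^sup>2 \<le> Re (cdot (normalized_matrix d \<Gamma> A X *v \<xi>) (vec_cnj \<xi>))"
    by (simp only:)
  let ?v = "A X *v \<xi>"
  \<comment> \<open>Testing the bound on the form with \<zeta> equal to the image vector itself
    yields the bound on the operator norm.\<close>
  have "(norm ?v)\<^sup>2 \<le> Ce * weight d \<Gamma> X * norm \<xi> * norm ?v"
    using e2[of \<xi> ?v] by (simp add: cdot_vec_cnj_self norm_power)
  then have "norm ?v \<le> Ce * weight d \<Gamma> X * norm \<xi>"
    using Ce weight_nonneg[of X] by (cases "norm ?v = 0") (auto simp: power2_eq_square)
  then have "s * norm ?v \<le> s * (Ce * weight d \<Gamma> X * norm \<xi>)"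
    using s by (intro mult_left_mono) auto
  also have "\<dots> = (s * weight d \<Gamma> X) * (Ce * norm \<xi>)" by (simp only: mult_ac)
  finally show "norm (normalized_matrix d \<Gamma> A X *v \<xi>) \<le> Ce * norm \<xi>"
    using s by (simp add: M sw)
qed

text \<open>\<open>A\<close> is only Lebesgue measurable on the complement, so the product with a
  Borel field is formed entrywise in \<open>lebesgue\<close> and then replaced by a Borel
  representative.\<close>

lemma borel_flux:
  fixes A :: "real ^ 'n \<Rightarrow> complex ^ 'n ^ 'n"
  assumes A: "A \<in> borel_measurable (lebesgue_on (- \<Gamma>))" and [measurable]: "G' \<in> borel_measurable borel"
  obtains V where "V \<in> borel_measurable borel" "AE X in lborel. X \<notin> \<Gamma> \<longrightarrow> normalized_matrix d \<Gamma> A X *v G' X = V X"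
proof -
  let ?i = "indicat_real (- \<Gamma>)"
  let ?V = "\<lambda>X. ?i X *\<^sub>R (normalized_matrix d \<Gamma> A X *v G' X)"
  have nth: "(\<lambda>M::complex^'n^'n. M $ k $ l) \<in> borel_measurable borel" for k l
    by (intro borel_measurable_continuous_onI continuous_intros)
  have "?V \<in> borel_measurable lebesgue"
    unfolding borel_measurable_vec_iff
  proof
    fix k
    have "(\<lambda>X. A X $ k $ l) \<in> borel_measurable (lebesgue_on (- \<Gamma>))" for l
      by (rule measurable_compose[OF A nth])
    moreover have "- \<Gamma> \<inter> space lebesgue \<in> sets lebesgue" using sets_\<Gamma> by auto
    ultimately have "(\<lambda>X. ?i X *\<^sub>R A X $ k $ l) \<in> borel_measurable lebesgue" for l
      using borel_measurable_restrict_space_iff[of "- \<Gamma>" lebesgue "\<lambda>X. A X $ k $ l"] by simp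
    then have "(\<lambda>X. (?i X *\<^sub>R A X $ k $ l) * (complex_of_real (\<delta> X powr (N - d - 1)) * G' X $ l)) \<in> borel_measurable lebesgue" for l
      by (rule borel_measurable_times[OF _ borel_imp_lebesgue_measurable]) measurable
    then have "(\<lambda>X. \<Sum>l\<in>UNIV. (?i X *\<^sub>R A X $ k $ l) * (complex_of_real (\<delta> X powr (N - d - 1)) * G' X $ l)) \<in> borel_measurable lebesgue"
      by (rule borel_measurable_sum)
    also have "(\<lambda>X. \<Sum>l\<in>UNIV. (?i X *\<^sub>R A X $ k $ l) * (complex_of_real (\<delta> X powr (N - d - 1)) * G' X $ l)) = (\<lambda>X. ?V X $ k)"
    proof
      fix X
      have "?V X $ k = ?i X *\<^sub>R (\<Sum>l\<in>UNIV. (\<delta> X powr (N - d - 1) *\<^sub>R A X $ k $ l) * G' X $ l)"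
        by (simp only: vector_scaleR_component normalized_matrix_def matrix_vector_mult_def vec_lambda_beta N)
      then show "(\<Sum>l\<in>UNIV. (?i X *\<^sub>R A X $ k $ l) * (complex_of_real (\<delta> X powr (N - d - 1)) * G' X $ l)) = ?V X $ k"
        by (cases "X \<in> \<Gamma>") (simp_all add: scaleR_sum_right scaleR_conv_of_real mult_ac del: vector_scaleR_component)
    qed
    finally show "(\<lambda>X. ?V X $ k) \<in> borel_measurable lebesgue" .
  qed
  from borel_representative_vec[OF this] obtain V where V: "V \<in> borel_measurable lborel" "AE X in lborel. ?V X = V X" .
  show ?thesis
    by (rule that[of V]) (use V in \<open>auto elim!: eventually_mono\<close>)
qed

text \<open>Averages of the continuous \<open>g\<close> converge to its values, which are the traces
  of \<open>u\<close>. Splitting the average of the difference requires integrability of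
  \<open>u'\<close> on balls, and this follows from that of \<open>u' - g\<close>.\<close>

lemma trace_difference:
  assumes \<sigma>: "sets \<sigma> = sets (restrict_space borel \<Gamma>)" "\<tau> = distr \<sigma> borel (\<lambda>x. x)"
    and tr: "AE x in \<sigma>. has_trace \<Gamma> u x (g x)" and cg: "continuous_on UNIV g"
    and lu: "locally_integrable (- \<Gamma>) u" and [measurable]: "u' \<in> borel_measurable borel"
    and eq: "AE X in lborel. X \<notin> \<Gamma> \<longrightarrow> u X = u' X" and z: "\<And>X. X \<in> \<Gamma> \<Longrightarrow> u' X = 0"
    and Iw: "\<And>c r. r > 0 \<Longrightarrow> set_integrable lborel (ball c r) (\<lambda>X. u' X - g X)"
  shows "AE x in \<tau>. ((\<lambda>r. avg (\<lambda>X. u' X - g X) x r) \<longlongrightarrow> 0) (at_right 0)"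
proof -
  have sp: "space \<sigma> = \<Gamma>"
    using sets_eq_imp_space_eq[OF \<sigma>(1)] by (simp add: space_restrict_space)
  have main: "((\<lambda>r. avg (\<lambda>X. u' X - g X) x r) \<longlongrightarrow> 0) (at_right 0)" if "has_trace \<Gamma> u x (g x)" for x
  proof -
    have avgu: "(1 / measure lebesgue (ball x r)) *\<^sub>R (LINT Y:ball x r - \<Gamma>|lebesgue. u Y) = avg u' x r" for r
    proof -
      have "(LINT Y:ball x r - \<Gamma>|lebesgue. u Y) = (LINT Y|lborel. indicat_real (ball x r) Y *\<^sub>R u' Y)"
        unfolding set_lebesgue_integral_def
      proof (rule LINT_lebesgue_eq_lborel(1))
        have b: "(\<lambda>Y. indicat_real (ball x r) Y) \<in> borel_measurable lebesgue"
          by (rule borel_imp_lebesgue_measurable[OF borel_measurable_indicator]) simp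
        have "(\<lambda>Y. indicat_real (ball x r) Y *\<^sub>R (indicat_real (- \<Gamma>) Y *\<^sub>R u Y)) \<in> borel_measurable lebesgue"
          by (rule borel_measurable_scaleR[OF b locally_integrable_measurable[OF closed ne lu]])
        moreover have "indicat_real (ball x r - \<Gamma>) Y *\<^sub>R u Y = indicat_real (ball x r) Y *\<^sub>R (indicat_real (- \<Gamma>) Y *\<^sub>R u Y)" for Y
          by (simp add: indicator_def)
        ultimately show "(\<lambda>Y. indicat_real (ball x r - \<Gamma>) Y *\<^sub>R u Y) \<in> borel_measurable lebesgue"
          by (simp only:)
        have [measurable]: "ball x r \<in> sets borel" by simp
        show "(\<lambda>Y. indicat_real (ball x r) Y *\<^sub>R u' Y) \<in> borel_measurable borel" by measurable
        show "AE Y in lborel. indicat_real (ball x r - \<Gamma>) Y *\<^sub>R u Y = indicat_real (ball x r) Y *\<^sub>R u' Y"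
          using eq by eventually_elim (auto simp: indicator_def z)
      qed
      then show ?thesis by (simp add: avg_def)
    qed
    have "((\<lambda>r. avg u' x r - avg g x r) \<longlongrightarrow> g x - g x) (at_right 0)"
      using that avg_tendsto_continuous[OF cg, of x] unfolding has_trace_def avgu by (rule tendsto_diff)
    moreover have "eventually (\<lambda>r. avg u' x r - avg g x r = avg (\<lambda>X. u' X - g X) x r) (at_right 0)"
      unfolding eventually_at_right_field
    proof (intro exI[of _ 1] conjI allI impI)
      fix r :: real assume r: "0 < r" "r < 1"
      have Ig: "set_integrable lborel (ball x r) g"
        by (rule set_integrable_subset[OF compact_set_integrable_continuous[OF cg compact_cball[of x r]]]) auto
      have "integrable lborel (\<lambda>Y. indicat_real (ball x r) Y *\<^sub>R (u' Y - g Y) + indicat_real (ball x r) Y *\<^sub>R g Y)"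
        using Iw[OF r(1), of x] Ig unfolding set_integrable_def by (rule Bochner_Integration.integrable_add)
      then have Iu: "integrable lborel (\<lambda>Y. indicat_real (ball x r) Y *\<^sub>R u' Y)"
        by (simp add: scaleR_diff_right)
      show "avg u' x r - avg g x r = avg (\<lambda>X. u' X - g X) x r"
        unfolding avg_def scaleR_diff_right Bochner_Integration.integral_diff[OF Iu Ig[unfolded set_integrable_def]] ..
    qed simp
    ultimately show ?thesis using tendsto_cong by force
  qed
  obtain Nl where "{x \<in> space \<sigma>. \<not> has_trace \<Gamma> u x (g x)} \<subseteq> Nl" "emeasure \<sigma> Nl = 0" "Nl \<in> sets \<sigma>"
    using tr by (rule AE_E)
  then have Nl: "Nl \<in> sets \<sigma>" "emeasure \<sigma> Nl = 0" and Nl3: "\<And>x. x \<in> \<Gamma> - Nl \<Longrightarrow> has_trace \<Gamma> u x (g x)"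
    unfolding sp by auto
  have Nb: "Nl \<in> sets borel" "Nl \<subseteq> \<Gamma>"
    using Nl(1) closed unfolding \<sigma>(1) by (auto simp: sets_restrict_space)
  have m: "(\<lambda>x. x) \<in> measurable \<sigma> borel"
    unfolding measurable_cong_sets[OF \<sigma>(1) refl] by (rule measurable_restrict_space1) simp
  \<comment> \<open>The complement of \<Gamma> is \<tau>-null, since \<tau> is an image of a measure
    living on \<Gamma>; hence exceptional sets transfer between the two measures.\<close>
  have "emeasure \<tau> (Nl \<union> - \<Gamma>) = emeasure \<sigma> Nl"
    unfolding \<sigma>(2) using Nb by (subst emeasure_distr[OF m]) (auto simp: sp intro!: arg_cong[where f = "emeasure \<sigma>"])
  then have "Nl \<union> - \<Gamma> \<in> null_sets \<tau>"
    using Nb Nl(2) by (simp add: null_sets_def sets_\<tau>)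
  then show ?thesis
    by (rule AE_I') (use main Nl3 in blast)
qed

lemma weak_form_lborel:
  fixes A :: "real ^ 'n \<Rightarrow> complex ^ 'n ^ 'n"
  assumes ws: "weak_solution d \<Gamma> A u" and [measurable]: "V \<in> borel_measurable borel"
    and VL: "AE X in lborel. X \<notin> \<Gamma> \<longrightarrow> normalized_matrix d \<Gamma> A X *v weak_grad (- \<Gamma>) u X = V X"
    and mV: "(\<lambda>X. normalized_matrix d \<Gamma> A X *v weak_grad (- \<Gamma>) u X) \<in> borel_measurable (lebesgue_on (- \<Gamma>))"
    and \<phi>: "\<phi> \<in> test_functions (- \<Gamma>)"
  shows "(LINT X|lborel. cdot (weight d \<Gamma> X *\<^sub>R V X) (classical_grad \<phi> X)) = 0"
proof -
  note \<phi>' = test_functionsD[OF \<phi>]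
  let ?F = "\<lambda>X. cdot (normalized_matrix d \<Gamma> A X *v weak_grad (- \<Gamma>) u X) (classical_grad \<phi> X)"
  have [measurable]: "classical_grad \<phi> \<in> borel_measurable borel"
    by (rule borel_measurable_classical_grad[OF \<phi>'(1)])
  \<comment> \<open>The weak equation pairs with the conjugate of the test function, so it is used
    with the conjugate of \<phi>.\<close>
  have "(\<lambda>X. cnj (\<phi> X)) \<in> test_functions (- \<Gamma>)"
    by (rule test_functionsI[OF smooth_fun_compose_linear[OF bounded_linear_cnj \<phi>'(1)] \<phi>'(2,3)]) (metis \<phi>'(4) complex_cnj_zero)
  from ws[unfolded weak_solution_def, rule_format, OF this]
  have zero: "(LINT X|weighted_measure d \<Gamma>. ?F X) = 0" by simp
  have S: "- \<Gamma> \<inter> space lebesgue \<in> sets lebesgue" using sets_\<Gamma> by auto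
  have mF: "?F \<in> borel_measurable (lebesgue_on (- \<Gamma>))"
    by (intro borel_measurable_cdot mV measurable_restrict_space1 borel_imp_lebesgue_measurable) measurable
  have mw: "weight d \<Gamma> \<in> borel_measurable (lebesgue_on (- \<Gamma>))"
    by (intro measurable_restrict_space1 borel_imp_lebesgue_measurable) measurable
  have mG: "(\<lambda>X. weight d \<Gamma> X *\<^sub>R ?F X) \<in> borel_measurable (lebesgue_on (- \<Gamma>))"
    by (intro borel_measurable_scaleR mw mF)
  have "0 = (LINT X|lebesgue_on (- \<Gamma>). weight d \<Gamma> X *\<^sub>R ?F X)"
    unfolding zero[symmetric] weighted_measure_def by (rule integral_density[OF mF mw]) (simp add: weight_nonneg)
  also have "\<dots> = (LINT X|lebesgue. indicat_real (- \<Gamma>) X *\<^sub>R (weight d \<Gamma> X *\<^sub>R ?F X))"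
    by (rule integral_restrict_space[OF S])
  also have "\<dots> = (LINT X|lborel. cdot (weight d \<Gamma> X *\<^sub>R V X) (classical_grad \<phi> X))"
  proof (rule LINT_lebesgue_eq_lborel(1))
    show "(\<lambda>X. indicat_real (- \<Gamma>) X *\<^sub>R (weight d \<Gamma> X *\<^sub>R ?F X)) \<in> borel_measurable lebesgue"
      by (rule borel_measurable_restrict_space_iff[OF S, THEN iffD1, OF mG])
    show "AE X in lborel. indicat_real (- \<Gamma>) X *\<^sub>R (weight d \<Gamma> X *\<^sub>R ?F X) = cdot (weight d \<Gamma> X *\<^sub>R V X) (classical_grad \<phi> X)"
      using VL
    proof eventually_elim
      case (elim X)
      show ?case
      proof (cases "X \<in> \<Gamma>")
        case True
        then show ?thesis unfolding cdot_scaleR_left by (simp add: weight_\<Gamma>)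
      next
        case False
        then show ?thesis using elim unfolding cdot_scaleR_left by (simp add: scaleR_conv_of_real)
      qed
    qed
  qed measurable
  finally show ?thesis by simp
qed

end

context ahlfors
begin

lemma measurable_on_complement_of_AE:
  fixes f :: "real ^ 'n \<Rightarrow> 'b::euclidean_space"
  assumes [measurable]: "f' \<in> borel_measurable borel" and eq: "AE X in lborel. X \<notin> \<Gamma> \<longrightarrow> f X = f' X"
  shows "f \<in> borel_measurable (lebesgue_on (- \<Gamma>))"
proof -
  have S: "- \<Gamma> \<inter> space lebesgue \<in> sets lebesgue" using sets_\<Gamma> by auto
  have "(\<lambda>X. indicat_real (- \<Gamma>) X *\<^sub>R f' X) \<in> borel_measurable lebesgue"
    by (rule borel_imp_lebesgue_measurable) measurable
  moreover have "AE X in lebesgue. indicat_real (- \<Gamma>) X *\<^sub>R f' X = indicat_real (- \<Gamma>) X *\<^sub>R f X"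
    by (rule AE_completion) (use eq in \<open>eventually_elim, auto simp: indicator_def\<close>)
  ultimately have "(\<lambda>X. indicat_real (- \<Gamma>) X *\<^sub>R f X) \<in> borel_measurable lebesgue"
    by (rule borel_measurable_AE)
  then show ?thesis by (rule borel_measurable_restrict_space_iff[OF S, THEN iffD2])
qed

text \<open>The trace hypothesis is conditional because integrability of \<open>u - g\<close> on
  balls crossing \<Gamma> is not known in advance: it comes out of the Poincare inequality,
  established inside this proof.\<close>

lemma hardy_difference:
  assumes uG: "wgrad (- \<Gamma>) u G" and G2: "(\<integral>\<^sup>+X. ennreal ((norm (G X))\<^sup>2) \<partial>\<nu>) < \<infinity>"
    and g: "g \<in> test_functions UNIV"
    and tr: "(\<And>c r. r > 0 \<Longrightarrow> set_integrable lborel (ball c r) (\<lambda>X. u X - g X)) \<Longrightarrow>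
      AE x in \<tau>. ((\<lambda>r. avg (\<lambda>X. u X - g X) x r) \<longlongrightarrow> 0) (at_right 0)"
  obtains K0 where "0 \<le> K0" "\<forall>R>0. (\<integral>\<^sup>+X. indicator {X. 0 < \<delta> X \<and> \<delta> X < R} X *
      (ennreal (weight d \<Gamma> X) * ennreal ((cmod (u X - g X))\<^sup>2)) \<partial>lborel) \<le> ennreal (K0 * R\<^sup>2)"
proof -
  note gs = test_functionsD(1)[OF g]
  \<comment> \<open>The indicator makes the gradient of the difference vanish on \<Gamma>, as the
    extension across \<Gamma> expects.\<close>
  define H where "H X = indicat_real (- \<Gamma>) X *\<^sub>R (G X - classical_grad g X)" for X
  note [measurable] = wgradD(1,2)[OF uG] borel_measurable_classical_grad[OF gs] borel_measurable_continuous_onI[OF smooth_fun_continuous[OF gs]]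
  have H[measurable]: "H \<in> borel_measurable borel" unfolding H_def by measurable
  have wH: "wgrad (- \<Gamma>) (\<lambda>X. u X - g X) H"
    by (rule wgrad_cong_open[OF wgrad_diff[OF uG wgrad_smooth[OF gs]]]) (simp_all add: H_def)
  have H0: "H X = 0" if "X \<in> \<Gamma>" for X using that by (simp add: H_def)
  obtain \<rho> where \<rho>: "\<And>X. norm X > \<rho> \<Longrightarrow> g X = 0"
    using test_function_cball[OF g] by metis
  have gg0: "classical_grad g X = 0" if "norm X > \<rho>" for X
    by (rule classical_grad_eq_0_outside[OF gs \<rho> that])
  from bounded_continuous_cball[OF continuous_on_classical_grad[OF gs] gg0] obtain M where M: "\<And>X. norm (classical_grad g X) \<le> M"
    by blast
  have [measurable]: "cball (0::real^'n) \<rho> \<in> sets borel" by simp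
  have "(\<integral>\<^sup>+X. ennreal ((norm (H X))\<^sup>2) \<partial>\<nu>)
      \<le> (\<integral>\<^sup>+X. 2 * ennreal ((norm (G X))\<^sup>2) + indicator (cball 0 \<rho>) X * ennreal (2 * M\<^sup>2) \<partial>\<nu>)"
  proof (rule nn_integral_mono)
    fix X
    have "(norm (H X))\<^sup>2 \<le> 2 * (norm (G X))\<^sup>2 + 2 * (norm (classical_grad g X))\<^sup>2"
    proof -
      have "norm (H X) \<le> norm (G X) + norm (classical_grad g X)"
        unfolding H_def using norm_triangle_ineq4[of "G X" "classical_grad g X"] by (simp add: indicator_def)
      then have "(norm (H X))\<^sup>2 \<le> (norm (G X) + norm (classical_grad g X))\<^sup>2" by (intro power_mono) auto
      also have "\<dots> \<le> 2 * (norm (G X))\<^sup>2 + 2 * (norm (classical_grad g X))\<^sup>2"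
        using sum_squares_bound[of "norm (G X)" "norm (classical_grad g X)"] by (simp add: power2_sum)
      finally show ?thesis .
    qed
    also have "\<dots> \<le> 2 * (norm (G X))\<^sup>2 + indicat_real (cball 0 \<rho>) X * (2 * M\<^sup>2)"
      using power_mono[OF M[of X], of 2] gg0[of X] by (cases "norm X > \<rho>") auto
    finally have "ennreal ((norm (H X))\<^sup>2) \<le> ennreal (2 * (norm (G X))\<^sup>2 + indicat_real (cball 0 \<rho>) X * (2 * M\<^sup>2))"
      by (rule ennreal_leI)
    then show "ennreal ((norm (H X))\<^sup>2) \<le> 2 * ennreal ((norm (G X))\<^sup>2) + indicator (cball 0 \<rho>) X * ennreal (2 * M\<^sup>2)"
      by (cases "norm X \<le> \<rho>") (auto simp: ennreal_mult)
  qed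
  also have "\<dots> < \<infinity>"
    using G2 nn_integral_\<nu>_bounded[of "cball 0 \<rho>" "\<lambda>_. 2 * M\<^sup>2" "2 * M\<^sup>2"]
    by (simp add: nn_integral_add nn_integral_cmult ennreal_add_less_top ennreal_mult_less_top)
  finally have fin: "(\<integral>\<^sup>+X. ennreal ((norm (H X))\<^sup>2) \<partial>\<nu>) < \<infinity>" .
  define E where "E = enn2real (\<integral>\<^sup>+X. ennreal ((norm (H X))\<^sup>2) \<partial>\<nu>)"
  have E: "0 \<le> E" by (simp add: E_def)
  have en: "(\<integral>\<^sup>+X. indicator (- \<Gamma>) X * (ennreal (weight d \<Gamma> X) * ennreal ((norm (H X))\<^sup>2)) \<partial>lborel) \<le> ennreal E"
    using fin by (simp add: E_def nn_integral_\<nu>[symmetric])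
  have h0: "ennreal ((norm (H X))\<^sup>2) = 0" if "X \<in> \<Gamma>" for X using H0[OF that] by simp
  have hm: "(\<lambda>X. ennreal ((norm (H X))\<^sup>2)) \<in> borel_measurable borel" by measurable
  have HK: "set_integrable lborel K (\<lambda>X. (norm (H X))\<^sup>2)" if K: "compact K" for K
    unfolding set_integrable_def
  proof (rule integrableI_nonneg)
    have [measurable]: "K \<in> sets borel" using K by (rule borel_compact)
    show "(\<lambda>X. indicat_real K X *\<^sub>R (norm (H X))\<^sup>2) \<in> borel_measurable lborel" by measurable
    obtain x where x: "x \<in> \<Gamma>" using ne by blast
    obtain \<epsilon> where e: "\<epsilon> > 0" "K \<subseteq> ball x \<epsilon>" using bounded_subset_ballD[OF compact_imp_bounded[OF K]] by blast
    \<comment> \<open>A ball centred on \<Gamma> lies in the collar of the same width, so the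
      weighted energy controls the unweighted energy on \<open>K\<close>.\<close>
    have sub: "X \<in> K \<Longrightarrow> \<delta> X < \<epsilon>" for X
      using e(2) infdist_le[OF x, of X] by (auto simp: dist_commute)
    have "(\<integral>\<^sup>+X. ennreal (indicat_real K X *\<^sub>R (norm (H X))\<^sup>2) \<partial>lborel) \<le> (\<integral>\<^sup>+X. indicator {X. \<delta> X < \<epsilon>} X * ennreal ((norm (H X))\<^sup>2) \<partial>lborel)"
      by (rule nn_integral_mono) (use sub in \<open>auto simp: indicator_def\<close>)
    also have "\<dots> \<le> ennreal (\<epsilon> powr (N - 1 - d) * E)"
      by (rule collar_energy_le[OF hm h0 E en e(1)])
    finally show "(\<integral>\<^sup>+X. ennreal (indicat_real K X *\<^sub>R (norm (H X))\<^sup>2) \<partial>lborel) < \<infinity>"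
      by (rule le_less_trans) simp
  qed simp
  \<comment> \<open>The constant 8 combines the squared diameter factor 4 with the factor 2 lost in
    the mollification.\<close>
  interpret w: poincare_function \<Gamma> \<tau> d C N "\<lambda>X. u X - g X" "\<lambda>X. ennreal ((norm (H X))\<^sup>2)" "8 * 2 ^ CARD('n)" E
  proof unfold_locales
    fix r :: real and c :: "real ^ 'n" assume r: "0 < r"
    have c2: "ennreal (8 * 2 ^ CARD('n) * r\<^sup>2) = ennreal (4 * r\<^sup>2 * 2 ^ CARD('n)) * 2"
      using ennreal_mult[of "4 * r\<^sup>2 * 2 ^ CARD('n)" 2] by (simp add: mult_ac)
    show "(\<integral>\<^sup>+X. \<integral>\<^sup>+Y. indicator (ball c r) X * indicator (ball c r) Y *
          ennreal ((cmod (u X - g X - (u Y - g Y)))\<^sup>2) \<partial>lborel \<partial>lborel)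
        \<le> ennreal (8 * 2 ^ CARD('n) * r\<^sup>2) * emeasure lborel (ball c r) * (\<integral>\<^sup>+Z. indicator (ball c r) Z * ennreal ((norm (H Z))\<^sup>2) \<partial>lborel)"
      unfolding c2 using poincare_pair[OF closed ne thin_\<Gamma> wH H0 HK r, of c] by (simp only: mult_ac)
  qed (use E h0 en in \<open>auto\<close>)
  interpret w: poincare_function_zero_trace \<Gamma> \<tau> d C N "\<lambda>X. u X - g X" "\<lambda>X. ennreal ((norm (H X))\<^sup>2)" "8 * 2 ^ CARD('n)" E
    by unfold_locales (rule tr[OF w.set_integrable_ball])
  show ?thesis
  proof (rule that)
    show "0 \<le> w.hardy_const * 2 powr (N - d)" using w.hardy_const_nonneg by simp
  qed (use w.hardy in blast)
qed

end


theorem theorem1p13: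
  fixes \<Gamma> :: "(real ^ 'n::finite) set"
    and \<sigma> :: "(real ^ 'n) measure"
    and A :: "real ^ 'n \<Rightarrow> complex ^ 'n ^ 'n"
    and u :: "real ^ 'n \<Rightarrow> complex"
    and d q :: real
  assumes "0 < d" and "d < real CARD('n) - 1"
    and "ahlfors_regular_measure d \<Gamma> \<sigma>"
    and "1 < q"
    and "q_elliptic q d \<Gamma> A"
    and "energy_solution d \<Gamma> \<sigma> A u"
  shows "(2 \<le> q \<longrightarrow>
            (\<integral>\<^sup>+X. ennreal (q_energy_density q \<Gamma> u X) \<partial>weighted_measure d \<Gamma>) < \<infinity>) \<and>
         (q < 2 \<longrightarrow>
            (\<exists>x r. 0 < r \<and>
               (\<integral>\<^sup>+X\<in>- ball x r. ennreal (q_energy_density q \<Gamma> u X) \<partial>weighted_measure d \<Gamma>) < \<infinity>))"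
proof -
  obtain C where "ahlfors \<Gamma> (distr \<sigma> borel (\<lambda>x. x)) d C (real CARD('n))"
    using ahlfors_of_regular_measure[OF assms(3,1,2)] .
  then interpret ahlfors \<Gamma> "distr \<sigma> borel (\<lambda>x. x)" d C "real CARD('n)" .
  have sets: "sets \<sigma> = sets (restrict_space borel \<Gamma>)"
    using assms(3) by (simp add: ahlfors_regular_measure_def)
  have W: "u \<in> W_space d \<Gamma>" and ws: "weak_solution d \<Gamma> A u"
    using assms(6) by (auto simp: energy_solution_def)
  obtain g where g: "g \<in> test_functions UNIV" and tr: "AE x in \<sigma>. has_trace \<Gamma> u x (g x)"
    using assms(6) by (auto simp: energy_solution_def)
  have lu: "locally_integrable (- \<Gamma>) u" and exG: "\<exists>G. has_weak_grad (- \<Gamma>) u G"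
    and finG: "(\<integral>\<^sup>+X. ennreal ((norm (weak_grad (- \<Gamma>) u X))\<^sup>2) \<partial>weighted_measure d \<Gamma>) < \<infinity>"
    using W by (auto simp: W_space_def)
  \<comment> \<open>The representative chosen by \<open>weak_grad\<close> is a weak gradient because
    \<open>W_space\<close> asserts that one exists.\<close>
  have wG: "has_weak_grad (- \<Gamma>) u (weak_grad (- \<Gamma>) u)"
    unfolding weak_grad_def using exG by (rule someI_ex)
  obtain v G where vG: "wgrad (- \<Gamma>) v G"
    and vu: "AE X in lborel. X \<notin> \<Gamma> \<longrightarrow> u X = v X" and Gu: "AE X in lborel. X \<notin> \<Gamma> \<longrightarrow> weak_grad (- \<Gamma>) u X = G X"
    and v0: "\<forall>X\<in>\<Gamma>. v X = 0" 
    by (rule borel_weak_gradient[OF lu wG])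
  note v_meas[measurable] = wgradD(1)[OF vG] and G_meas[measurable] = wgradD(2)[OF vG]
  obtain a where A: "A \<in> borel_measurable (lebesgue_on (- \<Gamma>))" and a: "a > 0"
    and ell: "\<And>X \<xi>. X \<notin> \<Gamma> \<Longrightarrow> Re (cdot (A X *v \<xi>) (vec_cnj \<xi>)) \<ge> weight d \<Gamma> X * (norm \<xi>)\<^sup>2 / a"
      "\<And>X \<xi> \<zeta>. X \<notin> \<Gamma> \<Longrightarrow> cmod (cdot (A X *v \<xi>) (vec_cnj \<zeta>)) \<le> a * weight d \<Gamma> X * norm \<xi> * norm \<zeta>"
    using assms(5) unfolding q_elliptic_def elliptic_def by fastforce
  obtain c where c: "c > 0" and qell: "AE X in lebesgue_on (- \<Gamma>). \<forall>\<xi>.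
        Re (cdot (normalized_matrix d \<Gamma> A X *v \<xi>) (vec_cnj (J_map q \<xi>))) \<ge> c * (norm \<xi>)\<^sup>2"
    using assms(5) unfolding q_elliptic_def by blast
  have S: "- \<Gamma> \<inter> space lebesgue \<in> sets lebesgue" using sets_\<Gamma> by auto
  have qell': "AE X in lborel. X \<notin> \<Gamma> \<longrightarrow> (\<forall>\<xi>.
        Re (cdot (normalized_matrix d \<Gamma> A X *v \<xi>) (vec_cnj (J_map q \<xi>))) \<ge> c * (norm \<xi>)\<^sup>2)"
    using qell unfolding AE_restrict_space_iff[OF S] AE_completion_iff by simp
  note nmat = normalized_matrix_bounds[of _ a A, OF _ a ell]
  obtain V where V[measurable]: "V \<in> borel_measurable borel"
    and VG: "AE X in lborel. X \<notin> \<Gamma> \<longrightarrow> normalized_matrix d \<Gamma> A X *v G X = V X"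
    using borel_flux[OF A G_meas] .
  have Vu: "AE X in lborel. X \<notin> \<Gamma> \<longrightarrow> normalized_matrix d \<Gamma> A X *v weak_grad (- \<Gamma>) u X = V X"
    using VG Gu by eventually_elim simp
  have "(\<integral>\<^sup>+X. ennreal ((norm (weak_grad (- \<Gamma>) u X))\<^sup>2) \<partial>weighted_measure d \<Gamma>) = (\<integral>\<^sup>+X. ennreal ((norm (G X))\<^sup>2) \<partial>\<nu>)"
  proof (rule nn_integral_weighted_measure)
    show "(\<lambda>X. ennreal ((norm (weak_grad (- \<Gamma>) u X))\<^sup>2)) \<in> borel_measurable (lebesgue_on (- \<Gamma>))"
      using measurable_on_complement_of_AE[OF G_meas Gu] by measurable
    show "AE X in lborel. X \<notin> \<Gamma> \<longrightarrow> ennreal ((norm (weak_grad (- \<Gamma>) u X))\<^sup>2) = ennreal ((norm (G X))\<^sup>2)"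
      using Gu by eventually_elim simp
  qed measurable
  with finG have G2: "(\<integral>\<^sup>+X. ennreal ((norm (G X))\<^sup>2) \<partial>\<nu>) < \<infinity>" by (simp only:)
  have "(\<integral>\<^sup>+X. ennreal ((norm (V X))\<^sup>2) \<partial>\<nu>) \<le> (\<integral>\<^sup>+X. ennreal (a\<^sup>2) * ennreal ((norm (G X))\<^sup>2) \<partial>\<nu>)"
  proof (rule nn_integral_mono_AE)
    show "AE X in \<nu>. ennreal ((norm (V X))\<^sup>2) \<le> ennreal (a\<^sup>2) * ennreal ((norm (G X))\<^sup>2)"
      unfolding AE_\<nu>_iff using VG
    proof eventually_elim
      case (elim X)
      show ?case
      proof
        assume X: "X \<notin> \<Gamma>"
        have "norm (V X) \<le> a * norm (G X)" using nmat(2)[OF X, of "G X"] elim X by simp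
        then have "(norm (V X))\<^sup>2 \<le> (a * norm (G X))\<^sup>2" by (rule power_mono) simp
        then show "ennreal ((norm (V X))\<^sup>2) \<le> ennreal (a\<^sup>2) * ennreal ((norm (G X))\<^sup>2)"
          by (simp add: ennreal_mult[symmetric] power_mult_distrib ennreal_leI)
      qed
    qed
  qed
  also have "\<dots> < \<infinity>" using G2 by (simp add: nn_integral_cmult ennreal_mult_less_top)
  finally have V2: "(\<integral>\<^sup>+X. ennreal ((norm (V X))\<^sup>2) \<partial>\<nu>) < \<infinity>" .
  obtain K0 where K0: "0 \<le> K0" and hardy: "\<forall>R>0. (\<integral>\<^sup>+X. indicator {X. 0 < infdist X \<Gamma> \<and> infdist X \<Gamma> < R} X *
      (ennreal (weight d \<Gamma> X) * ennreal ((cmod (v X - g X))\<^sup>2)) \<partial>lborel) \<le> ennreal (K0 * R\<^sup>2)"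
    using hardy_difference[OF vG G2 g
        trace_difference[OF sets refl tr smooth_fun_continuous[OF test_functionsD(1)[OF g]] lu v_meas vu v0[rule_format]]] .
  obtain x0 where x0: "x0 \<in> \<Gamma>" using ne by blast
  interpret energy_data \<Gamma> "distr \<sigma> borel (\<lambda>x. x)" d C "real CARD('n)" v g G V K0 x0
    by unfold_locales
      (use vG V V2 G2 weak_form_lborel[OF ws V Vu measurable_on_complement_of_AE[OF V Vu]] g K0 hardy x0 in auto)
  \<comment> \<open>The interpolated form is coercive with the worse of the two constants; the
    factor \<open>q\<close> comes from writing \<open>(q - 1) Re \<xi> + i Im \<xi>\<close> in terms
    of \<open>J_map q\<close>.\<close>
  define b where "b = min (1 / a) (q * c)"
  have b: "b > 0" using a c assms(4) by (simp add: b_def)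
  have bell: "AE X in \<nu>. \<forall>k. 0 < k \<longrightarrow> k \<le> 1 \<longrightarrow> b * (reg_weight q k ((cmod (v X))\<^sup>2) * (norm (G X))\<^sup>2)
      \<le> Re (cdot (V X) (\<chi> i. reg_power_deriv q k (v X) (G X $ i)))"
    unfolding AE_\<nu>_iff using VG qell'
  proof eventually_elim
    case (elim X)
    show ?case
    proof (intro impI allI)
      fix k :: real assume X: "X \<notin> \<Gamma>" and k: "0 < k" "k \<le> 1"
      have "b * (reg_weight q k ((cmod (v X))\<^sup>2) * (norm (G X))\<^sup>2)
          \<le> Re (cdot (normalized_matrix d \<Gamma> A X *v G X) (\<chi> i. reg_power_deriv q k (v X) (G X $ i)))"
        unfolding b_def by (rule reg_power_elliptic[OF nmat(1)[OF X] _ k]) (use elim(2) X assms(4) in auto)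
      then show "b * (reg_weight q k ((cmod (v X))\<^sup>2) * (norm (G X))\<^sup>2)
          \<le> Re (cdot (V X) (\<chi> i. reg_power_deriv q k (v X) (G X $ i)))"
        using elim(1) X by simp
    qed
  qed
  have q_meas[measurable]: "q_density q \<in> borel_measurable borel"
    unfolding q_density_def[abs_def] by measurable
  \<comment> \<open>The truth of \<open>u X = 0\<close> may differ between \<open>u\<close> and
    \<open>v\<close> only on a null set off \<Gamma>, so the convention at zeros is respected by the
    change of representative.\<close>
  have qu: "AE X in lborel. X \<notin> \<Gamma> \<longrightarrow> q_energy_density q \<Gamma> u X = q_density q X"
    using vu Gu by eventually_elim (simp add: q_energy_density_def q_density_def)
  have [measurable]: "q_energy_density q \<Gamma> u \<in> borel_measurable (lebesgue_on (- \<Gamma>))"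
    by (rule measurable_on_complement_of_AE[OF q_meas qu])
  show ?thesis
  proof (intro conjI impI)
    assume "2 \<le> q"
    then have "(\<integral>\<^sup>+X. ennreal (q_density q X) \<partial>\<nu>) < \<infinity>" by (rule q_energy_finite_ge_2[OF b _ bell])
    moreover have "(\<integral>\<^sup>+X. ennreal (q_energy_density q \<Gamma> u X) \<partial>weighted_measure d \<Gamma>) = (\<integral>\<^sup>+X. ennreal (q_density q X) \<partial>\<nu>)"
      by (rule nn_integral_weighted_measure) (measurable, use qu in \<open>eventually_elim, simp\<close>)
    ultimately show "(\<integral>\<^sup>+X. ennreal (q_energy_density q \<Gamma> u X) \<partial>weighted_measure d \<Gamma>) < \<infinity>" by simp
  next
    assume "q < 2"
    then obtain r where r: "0 < r" and fin: "(\<integral>\<^sup>+X. indicator (- ball 0 r) X * ennreal (q_density q X) \<partial>\<nu>) < \<infinity>"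
      using q_energy_finite_less_2[OF b assms(4) _ bell] by metis
    have [measurable]: "ball (0::real^'n) r \<in> sets borel" by simp
    have i: "(\<lambda>X. indicator (- ball 0 r) X :: ennreal) \<in> borel_measurable (lebesgue_on (- \<Gamma>))"
      by (intro measurable_restrict_space1 borel_imp_lebesgue_measurable) measurable
    have "(\<integral>\<^sup>+X. ennreal (q_energy_density q \<Gamma> u X) * indicator (- ball 0 r) X \<partial>weighted_measure d \<Gamma>)
        = (\<integral>\<^sup>+X. indicator (- ball 0 r) X * ennreal (q_density q X) \<partial>\<nu>)"
    proof (rule nn_integral_weighted_measure)
      show "(\<lambda>X. ennreal (q_energy_density q \<Gamma> u X) * indicator (- ball 0 r) X) \<in> borel_measurable (lebesgue_on (- \<Gamma>))"
        using i by measurable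
      show "AE X in lborel. X \<notin> \<Gamma> \<longrightarrow> ennreal (q_energy_density q \<Gamma> u X) * indicator (- ball 0 r) X =
          indicator (- ball 0 r) X * ennreal (q_density q X)"
        using qu by eventually_elim (simp add: mult.commute)
    qed measurable
    with fin show "\<exists>x r. 0 < r \<and> (\<integral>\<^sup>+X\<in>- ball x r. ennreal (q_energy_density q \<Gamma> u X) \<partial>weighted_measure d \<Gamma>) < \<infinity>"
      using r by (intro exI[of _ 0] exI[of _ r]) simp
  qed
qed

end
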